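(* Let $\mathcal F_{\mathbb R}$ be a germ of singular real analytic foliation at $(\mathbb R^2,0)$ of real generalized curve type. Then there exists a strict real logarithmic model for $\mathcal F_{\mathbb R}$.
   Context: **Foliations.** $\mathcal F_{\mathbb R}$ is defined by a germ of real analytic $1$-form $P\,dx+Q\,dy$ at $(\mathbb R^2,0)$, with $P,Q$ relatively prime non-units in the ring of germs of real analytic functions. A sequence of real quadratic blow-ups $\pi=\pi_{\mathbb R}:(\tilde M_{\mathbb R},\mathcal D)\to(\mathbb R^2,0)$ is a finite composition $\pi=\sigma_1\circ\cdots\circ\sigma_n$ of real point blow-ups $\sigma_j$, the first centred at $0$, each next one centred at a point $q_{j-1}$ of the exceptional divisor $\mathcal D_{j-1}=(\sigma_1\circ\cdots\circ\sigma_{j-1})^{-1}(0)$ already obtained; $\pi_j=\sigma_1\circ\cdots\circ\sigma_j$. It is a (minimal) real reduction of singularities of $\mathcal F_{\mathbb R}$ if it is minimal such that the strict transform $\tilde{\mathcal F}_{\mathbb R}$ has finitely many singularities over $\mathcal D$, all simple (linear part non-nilpotent, real eigenvalues with ratio outside $\mathbb Q_+$), $\tilde{\mathcal F}_{\mathbb R}$ has no singularities nor tangencies on non-invariant components of $\mathcal D$, and no two non-invariant components meet. $\mathcal F_{\mathbb R}$ is of real generalized curve type if $\tilde{\mathcal F}_{\mathbb R}$ has no real algebraic saddle-nodes (simple singularities with one zero eigenvalue). **Real q-dicritical triplets.** Branches are irreducible one-dimensional real analytic germs of curves; $\nu_p(S)$ is the multiplicity; an upper star denotes strict transform for curves. A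 transform $\pi^*B$ is transverse to $\mathcal D$ if smooth and transverse to $\mathcal D$ at a trace point (regular point of $\mathcal D$); $D^\pi(B)$ is then the component met. $\pi$ realizes $\varepsilon(\mathcal S)$ if the $\pi^*B$, $B\in\mathcal S$, are disjoint and transverse to $\mathcal D$; it realizes $\kappa(\mathcal D^* )$, for a union of components $\mathcal D^*$ of the divisor of some sequence of real blow-ups, if it produces (up to isomorphism, further blow-ups, or blow-downs not collapsing them) all the components in $\mathcal D^*$ and no two of them meet. A real q-dicritical triplet $(\Delta^\aleph_{\mathbb R},\Sigma^\aleph_{\mathbb R},\Upsilon^\aleph_{\mathbb R})$ framed on $\pi_{\mathbb R}$ consists of: decompositions $\mathcal D_j=\mathcal D_j^\delta\cup\mathcal D_j^\iota$ (dicritical/non-dicritical components) with no common components, compatible with strict transforms, with no two components of $\mathcal D_n^\delta$ meeting; a finite set of real branches $\mathcal S_0^{\aleph}=\mathcal S_0^\delta\sqcup\mathcal S_0^\iota$, with strict transforms $\mathcal S_j$, such that $\pi_{\mathbb R}$ realizes $\varepsilon(\mathcal S_0^\aleph)$, $S\in\mathcal S_0^\delta$ iff $D^\pi(S)\subset\mathcal D_n^\delta$, and $\pi_{\mathbb R}$ is minimal realizing simultaneously $\kappa(\mathcal D_n^\delta)$ and $\varepsilon(\mathcal S_0^\aleph)$; real numbers $I_p(S)$ for local branches $S$ at $p\in\mathcal D_j$ of $\mathcal Z_j=\mathcal S_j\cup\mathcal D_j^\iota$, all $0\le j\le n$, such that $I$ decreases by $\nu_p(S)^2$ under blow-up at $p$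 and is unchanged by blow-ups at other points, $I_p(S)=0$ at regular points of $\mathcal Z_j$, and at singular points of $\mathcal Z_n$ with branches $S_1,S_2$ one has $I_p(S_i)\in\mathbb R^*\setminus\mathbb Q_+$, $I_p(S_2)=1/I_p(S_1)$. Its duplet is $\mathcal{DD}^\aleph_{\mathbb R}=(\Delta^\aleph_{\mathbb R},\Sigma^\aleph_{\mathbb R})$. A real q-dicritical triplet $\mathcal T^\aleph_{\mathbb R}(\mathcal F_{\mathbb R})$ associated with $\mathcal F_{\mathbb R}$ is one framed on the real reduction of singularities of $\mathcal F_{\mathbb R}$, with dicritical components the non-invariant ones, with separatrices all isolated separatrices of $\mathcal F_{\mathbb R}$ (invariant real branches whose lift meets an invariant component) together with a finite number of dicritical separatrices (invariant real branches whose lift meets a non-invariant component), and with the Camacho–Sad indices of $\mathcal F_{\mathbb R}$ and its strict transforms as indices. **Real logarithmic forms.** $\eta_{\mathbb R}=\sum_{i=1}^r\lambda_i\,df_i/f_i+\alpha$ with $f_i$ irreducible real analytic germs, $\lambda_i\in\mathbb R^*$, $\alpha$ a germ of closed real analytic $1$-form. Its real poles are the $\{f_i=0\}$ that are one-dimensional. Let $\mathcal L_{\mathbb R}$ be the foliation it defines. $\eta_{\mathbb R}$ is $1$-faithful if $\nu_0(f\eta_{\mathbb R})=\nu_0(f)-1$, $f=\prod f_i$ ($\nu_0$ = order), and real faithful if it is $1$-faithful along the real reduction of singularities of $\mathcal L_{\mathbb R}$ (at centres where its transform has poles). The real q-dicritical triplet of $\eta_{\mathbb R}$ is based on the real reduction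 of singularities of $\mathcal L_{\mathbb R}$, with separatrices all real poles of $\eta_{\mathbb R}$ and all isolated separatrices of $\mathcal L_{\mathbb R}$, and indices the Camacho–Sad indices $\Upsilon^\aleph_{\mathbb R}(\eta_{\mathbb R})$ of $\mathcal L_{\mathbb R}$; its duplet is $\mathcal{DD}^\aleph_{\mathbb R}(\eta_{\mathbb R})$. **Strict model.** $\eta_{\mathbb R}$ is a strict real logarithmic model for a real q-dicritical triplet $\mathcal T^\aleph_{\mathbb R}$ if: its set of real poles is $\mathcal S_0^\aleph$; $\mathcal{DD}^\aleph_{\mathbb R}(\eta_{\mathbb R})=\mathcal{DD}^\aleph_{\mathbb R}$; $\eta_{\mathbb R}$ is real faithful; and the indices of separatrices in $\mathcal S_0^\aleph$ for $\Upsilon^\aleph_{\mathbb R}$ and $\Upsilon^\aleph_{\mathbb R}(\eta_{\mathbb R})$ coincide. $\eta_{\mathbb R}$ is a strict real logarithmic model for $\mathcal F_{\mathbb R}$ if it is a strict real logarithmic model for some real q-dicritical triplet $\mathcal T^\aleph_{\mathbb R}(\mathcal F_{\mathbb R})$ associated with $\mathcal F_{\mathbb R}$.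
   Formalization: In triplets associated with the foliation, I_p(S)=0 at regular points is required only for Z_n, not every Z_j, and minimality for κ and ε is taken among blow-ups reducing the foliation; literally d(x(x²+y²))=0 and d(y²+x⁴)=0 would have no associated triplet. *)

theory Defs
  imports "HOL-Analysis.Analysis" "HOL-Computational_Algebra.Computational_Algebra"
begin

section \<open>Germs of real analytic functions at the origin of the plane\<close>

text \<open>
  The ring of germs of real analytic functions at \<open>(\<real>\<^sup>2, 0)\<close> is the ring of convergent power
  series in \<open>x, y\<close>. Inside \<open>real fps fps\<close> the outer variable is \<open>x\<close> and the inner one is \<open>y\<close>, so
  \<open>fps_nth (fps_nth a i) j\<close> is the coefficient of \<open>x^i * y^j\<close>. Convergence near the origin is
  expressed by the geometric (Cauchy) bound on the coefficients.
\<close>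

definition convergent2 :: "real fps fps \<Rightarrow> bool" where
  "convergent2 a \<longleftrightarrow> (\<exists>C R. 0 < R \<and> (\<forall>i j. \<bar>fps_nth (fps_nth a i) j\<bar> \<le> C * R ^ (i + j)))"

lemma convergent2I:
  assumes "0 < R" "\<And>i j. \<bar>fps_nth (fps_nth a i) j\<bar> \<le> C * R ^ (i + j)"
  shows "convergent2 a"
  using assms unfolding convergent2_def by blast

lemma convergent2E:
  assumes "convergent2 a"
  obtains C R where "1 \<le> R" "1 \<le> C" "\<And>i j. \<bar>fps_nth (fps_nth a i) j\<bar> \<le> C * R ^ (i + j)"
proof -
  obtain C R where R: "0 < R" and b: "\<And>i j. \<bar>fps_nth (fps_nth a i) j\<bar> \<le> C * R ^ (i + j)"
    using assms unfolding convergent2_def by blast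
  have "\<bar>fps_nth (fps_nth a i) j\<bar> \<le> max 1 C * max 1 R ^ (i + j)" for i j
  proof -
    have "C * R ^ (i + j) \<le> max 1 C * max 1 R ^ (i + j)"
      using R by (intro mult_mono power_mono) auto
    with b[of i j] show ?thesis by linarith
  qed
  then show ?thesis using that[of "max 1 R" "max 1 C"] by simp
qed

lemma convergent2_finite_support:
  assumes "\<And>i j. i > N \<or> j > N \<Longrightarrow> fps_nth (fps_nth a i) j = 0"
  shows "convergent2 a"
proof (rule convergent2I[of 1])
  fix i j
  let ?C = "\<Sum>i\<le>N. \<Sum>j\<le>N. \<bar>fps_nth (fps_nth a i) j\<bar>"
  have nn: "0 \<le> ?C" by (intro sum_nonneg) auto
  show "\<bar>fps_nth (fps_nth a i) j\<bar> \<le> ?C * 1 ^ (i + j)"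
  proof (cases "i \<le> N \<and> j \<le> N")
    case True
    have "\<bar>fps_nth (fps_nth a i) j\<bar> \<le> (\<Sum>j\<le>N. \<bar>fps_nth (fps_nth a i) j\<bar>)"
      using True by (intro member_le_sum) auto
    also have "\<dots> \<le> ?C"
      using True by (intro member_le_sum[of i _ "\<lambda>i. \<Sum>j\<le>N. \<bar>fps_nth (fps_nth a i) j\<bar>"] sum_nonneg) auto
    finally show ?thesis by simp
  next
    case False
    then have "fps_nth (fps_nth a i) j = 0" using assms by (meson not_le)
    with nn show ?thesis by simp
  qed
qed simp

lemma convergent2_add:
  assumes "convergent2 a" "convergent2 b"
  shows "convergent2 (a + b)"
proof -
  obtain C R where 1: "1 \<le> R" "1 \<le> C" "\<And>i j. \<bar>fps_nth (fps_nth a i) j\<bar> \<le> C * R ^ (i + j)"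
    using assms(1) by (rule convergent2E) blast
  obtain D S where 2: "1 \<le> S" "1 \<le> D" "\<And>i j. \<bar>fps_nth (fps_nth b i) j\<bar> \<le> D * S ^ (i + j)"
    using assms(2) by (rule convergent2E) blast
  show ?thesis
  proof (rule convergent2I[of "max R S" _ "C + D"])
    fix i j
    have "C * R ^ (i + j) \<le> C * max R S ^ (i + j)" "D * S ^ (i + j) \<le> D * max R S ^ (i + j)"
      using 1 2 by (auto intro!: mult_left_mono power_mono)
    with 1(3)[of i j] 2(3)[of i j]
    show "\<bar>fps_nth (fps_nth (a + b) i) j\<bar> \<le> (C + D) * max R S ^ (i + j)"
      by (simp add: distrib_right)
  qed (use 1 in auto)
qed

lemma convergent2_uminus: "convergent2 a \<Longrightarrow> convergent2 (- a)"
  by (simp add: convergent2_def)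

lemma convergent2_diff: "convergent2 a \<Longrightarrow> convergent2 b \<Longrightarrow> convergent2 (a - b)"
  using convergent2_add[of a "- b"] by (simp add: convergent2_uminus)

lemma Suc_le_two_power: "real (Suc n) \<le> 2 ^ n"
  by (induction n) auto

lemma convergent2_mult:
  assumes "convergent2 a" "convergent2 b"
  shows "convergent2 (a * b)"
proof -
  obtain C R where 1: "1 \<le> R" "1 \<le> C" "\<And>i j. \<bar>fps_nth (fps_nth a i) j\<bar> \<le> C * R ^ (i + j)"
    using assms(1) by (rule convergent2E) blast
  obtain D S where 2: "1 \<le> S" "1 \<le> D" "\<And>i j. \<bar>fps_nth (fps_nth b i) j\<bar> \<le> D * S ^ (i + j)"
    using assms(2) by (rule convergent2E) blast
  define M where "M = max R S"
  have M: "1 \<le> M" "R \<le> M" "S \<le> M" using 1 by (auto simp: M_def)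
  show ?thesis
  proof (rule convergent2I[of "2 * M" _ "C * D"])
    fix i j
    have t: "\<bar>fps_nth (fps_nth a k) l * fps_nth (fps_nth b (i - k)) (j - l)\<bar> \<le> C * D * M ^ (i + j)"
      if "k \<le> i" "l \<le> j" for k l
    proof -
      have "\<bar>fps_nth (fps_nth a k) l\<bar> \<le> C * M ^ (k + l)"
        using 1(3)[of k l] 1 M power_mono[of R M "k + l"]
        by (smt (verit) mult_left_mono)
      moreover have "\<bar>fps_nth (fps_nth b (i - k)) (j - l)\<bar> \<le> D * M ^ (i - k + (j - l))"
        using 2(3)[of "i - k" "j - l"] 2 M power_mono[of S M "i - k + (j - l)"]
        by (smt (verit) mult_left_mono)
      ultimately have "\<bar>fps_nth (fps_nth a k) l * fps_nth (fps_nth b (i - k)) (j - l)\<bar>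
          \<le> (C * M ^ (k + l)) * (D * M ^ (i - k + (j - l)))"
        unfolding abs_mult using 1 2 M by (intro mult_mono) auto
      also have "\<dots> = C * D * M ^ ((k + l) + (i - k + (j - l)))"
        by (simp add: power_add)
      also have "(k + l) + (i - k + (j - l)) = i + j" using that by simp
      finally show ?thesis .
    qed
    have "fps_nth (fps_nth (a * b) i) j =
        (\<Sum>k=0..i. \<Sum>l=0..j. fps_nth (fps_nth a k) l * fps_nth (fps_nth b (i - k)) (j - l))"
      by (simp add: fps_mult_nth fps_sum_nth)
    also have "\<bar>\<dots>\<bar> \<le> (\<Sum>k=0..i. \<Sum>l=0..j. C * D * M ^ (i + j))"
      by (rule order.trans[OF sum_abs] sum_mono order.trans[OF sum_abs] t | simp)+
    also have "\<dots> = C * D * M ^ (i + j) * (real (Suc i) * real (Suc j))"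
      by (simp add: algebra_simps)
    also have "\<dots> \<le> C * D * M ^ (i + j) * (2 ^ i * 2 ^ j)"
      using 1 2 M by (intro mult_left_mono mult_mono Suc_le_two_power) auto
    also have "\<dots> = C * D * (2 * M) ^ (i + j)"
      by (simp add: power_add power_mult_distrib algebra_simps)
    finally show "\<bar>fps_nth (fps_nth (a * b) i) j\<bar> \<le> C * D * (2 * M) ^ (i + j)" .
  qed (use M in auto)
qed

typedef germ = "{a. convergent2 a}"
proof
  show "0 \<in> {a. convergent2 a}"
    by (auto intro: convergent2_finite_support[of 0])
qed

setup_lifting type_definition_germ

instantiation germ :: idom
begin

lift_definition zero_germ :: germ is 0
  by (auto intro: convergent2_finite_support[of 0])
lift_definition one_germ :: germ is 1
  by (rule convergent2_finite_support[of 0]) auto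
lift_definition plus_germ :: "germ \<Rightarrow> germ \<Rightarrow> germ" is "(+)"
  by (rule convergent2_add)
lift_definition uminus_germ :: "germ \<Rightarrow> germ" is uminus
  by (rule convergent2_uminus)
lift_definition minus_germ :: "germ \<Rightarrow> germ \<Rightarrow> germ" is "(-)"
  by (rule convergent2_diff)
lift_definition times_germ :: "germ \<Rightarrow> germ \<Rightarrow> germ" is "(*)"
  by (rule convergent2_mult)

instance
  by standard (transfer; simp add: algebra_simps)+

end

text \<open>Exact division, needed only so that \<^const>\<open>coprime\<close> is available.\<close>

instantiation germ :: idom_divide
begin

definition divide_germ :: "germ \<Rightarrow> germ \<Rightarrow> germ" where
  "divide_germ a b = (if b \<noteq> 0 \<and> b dvd a then (THE c. a = c * b) else 0)"

instance
  by standard (auto simp: divide_germ_def)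

end

instance germ :: algebraic_semidom ..

lift_definition germ_coeff :: "germ \<Rightarrow> nat \<Rightarrow> nat \<Rightarrow> real" is "\<lambda>a i j. fps_nth (fps_nth a i) j" .

lift_definition germ_const :: "real \<Rightarrow> germ" is "\<lambda>c. fps_const (fps_const c)"
  by (rule convergent2_finite_support[of 0]) auto

lift_definition germ_X :: germ is fps_X
  by (rule convergent2_finite_support[of 1]) auto

lift_definition germ_Y :: germ is "fps_const fps_X"
  by (rule convergent2_finite_support[of 1]) auto

lift_definition germ_dx :: "germ \<Rightarrow> germ" is fps_deriv
proof -
  fix a assume "convergent2 a"
  then obtain C R where 1: "1 \<le> R" "1 \<le> C" "\<And>i j. \<bar>fps_nth (fps_nth a i) j\<bar> \<le> C * R ^ (i + j)"
    by (rule convergent2E) blast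
  show "convergent2 (fps_deriv a)"
  proof (rule convergent2I[of "2 * R" _ "C * R"])
    fix i j
    have "fps_nth (fps_nth (fps_deriv a) i) j
        = fps_nth (fps_const (real (Suc i)) * fps_nth a (Suc i)) j"
      unfolding fps_of_nat by simp
    then have "fps_nth (fps_nth (fps_deriv a) i) j = real (Suc i) * fps_nth (fps_nth a (Suc i)) j"
      by (simp only: fps_mult_left_const_nth)
    also have "\<bar>\<dots>\<bar> \<le> 2 ^ i * (C * R ^ (Suc i + j))"
      unfolding abs_mult using 1 1(3)[of "Suc i" j] Suc_le_two_power[of i] by (intro mult_mono) auto
    also have "\<dots> \<le> 2 ^ (i + j) * (C * R ^ (Suc i + j))"
      using 1 by (intro mult_right_mono power_increasing) auto
    also have "\<dots> = C * R * (2 * R) ^ (i + j)"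
      by (simp add: power_mult_distrib algebra_simps)
    finally show "\<bar>fps_nth (fps_nth (fps_deriv a) i) j\<bar> \<le> C * R * (2 * R) ^ (i + j)" .
  qed (use 1 in auto)
qed

lift_definition germ_dy :: "germ \<Rightarrow> germ" is "\<lambda>a. Abs_fps (\<lambda>i. fps_deriv (fps_nth a i))"
proof -
  fix a assume "convergent2 a"
  then obtain C R where 1: "1 \<le> R" "1 \<le> C" "\<And>i j. \<bar>fps_nth (fps_nth a i) j\<bar> \<le> C * R ^ (i + j)"
    by (rule convergent2E) blast
  show "convergent2 (Abs_fps (\<lambda>i. fps_deriv (fps_nth a i)))"
  proof (rule convergent2I[of "2 * R" _ "C * R"])
    fix i j
    have "fps_nth (fps_nth (Abs_fps (\<lambda>i. fps_deriv (fps_nth a i))) i) j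
        = real (Suc j) * fps_nth (fps_nth a i) (Suc j)"
      by simp
    also have "\<bar>\<dots>\<bar> \<le> 2 ^ j * (C * R ^ (i + Suc j))"
      unfolding abs_mult using 1 1(3)[of i "Suc j"] Suc_le_two_power[of j] by (intro mult_mono) auto
    also have "\<dots> \<le> 2 ^ (i + j) * (C * R ^ (i + Suc j))"
      using 1 by (intro mult_right_mono power_increasing) auto
    also have "\<dots> = C * R * (2 * R) ^ (i + j)"
      by (simp add: power_mult_distrib algebra_simps)
    finally show "\<bar>fps_nth (fps_nth (Abs_fps (\<lambda>i. fps_deriv (fps_nth a i))) i) j\<bar>
        \<le> C * R * (2 * R) ^ (i + j)" .
  qed (use 1 in auto)
qed

definition germ_eval :: "germ \<Rightarrow> real \<times> real \<Rightarrow> real" where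
  "germ_eval f = (\<lambda>(x, y). \<Sum>\<^sub>\<infinity>(i, j)\<in>UNIV. germ_coeff f i j * x ^ i * y ^ j)"

text \<open>The value at the origin.\<close>
abbreviation germ_at0 :: "germ \<Rightarrow> real" where
  "germ_at0 f \<equiv> germ_coeff f 0 0"

text \<open>The order \<open>\<nu>\<^sub>0\<close>; the order of the zero germ is \<open>\<infinity>\<close>.\<close>
definition germ_ord :: "germ \<Rightarrow> enat" where
  "germ_ord f = Inf {enat (i + j) |i j. germ_coeff f i j \<noteq> 0}"


section \<open>Real point blow-ups and infinitely near points\<close>

text \<open>
  The exceptional divisor of the blow-up of a point with local coordinates \<open>(x, y)\<close> is the set of
  directions at this point: \<open>Slope c\<close> is the line \<open>y = c * x\<close> and \<open>Vertical\<close> is the line \<open>x = 0\<close>.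
  Each of its points gets standard coordinates, centred at this point, in which the blow-up map is
  \<open>(x, y) \<mapsto> (x, x * (y + c))\<close> for \<open>Slope c\<close> and \<open>(x, y) \<mapsto> (x * y, y)\<close> for \<open>Vertical\<close>.
  Thus every point infinitely near to the origin is a list of directions, with
  \<open>[]\<close> the origin, and the germ of the blown-up surface at this point is identified with
  \<open>(\<real>\<^sup>2, 0)\<close>. Blow-ups at other points do not affect the germ of the surface at a point.
\<close>

datatype direction = Slope real | Vertical

type_synonym point = "direction list"

lemma abs_nth_linear_power:
  "\<bar>fps_nth ((fps_X + fps_const (c::real)) ^ m) k\<bar> \<le> (1 + \<bar>c\<bar>) ^ m"
proof (induction m arbitrary: k)
  case 0
  then show ?case by (cases k) auto
next
  case (Suc m)
  let ?g = "(fps_X + fps_const c) ^ m"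
  have "fps_nth ((fps_X + fps_const c) ^ Suc m) k =
      (if k = 0 then 0 else fps_nth ?g (k - 1)) + c * fps_nth ?g k"
    by (simp add: distrib_right)
  also have "\<bar>\<dots>\<bar> \<le> (1 + \<bar>c\<bar>) ^ m + \<bar>c\<bar> * (1 + \<bar>c\<bar>) ^ m"
  proof -
    have "\<bar>if k = 0 then 0 else fps_nth ?g (k - 1)\<bar> \<le> (1 + \<bar>c\<bar>) ^ m"
      using Suc.IH[of "k - 1"] by auto
    moreover have "\<bar>c * fps_nth ?g k\<bar> \<le> \<bar>c\<bar> * (1 + \<bar>c\<bar>) ^ m"
      unfolding abs_mult using Suc.IH[of k] by (intro mult_left_mono) auto
    ultimately show ?thesis by linarith
  qed
  finally show ?case by (simp add: algebra_simps)
qed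

text \<open>
  The pullback \<open>f(x, x * (y + c))\<close>: the coefficient of \<open>x^n\<close> is
  \<open>\<Sum>j\<le>n. a\<^bsub>n-j,j\<^esub> * (y + c)^j\<close>, where \<open>f = \<Sum>i j. a\<^bsub>i,j\<^esub> * x^i * y^j\<close>.
\<close>
lift_definition pull_slope :: "real \<Rightarrow> germ \<Rightarrow> germ" is
  "\<lambda>c a. Abs_fps (\<lambda>n. \<Sum>j\<le>n. fps_const (fps_nth (fps_nth a (n - j)) j) * (fps_X + fps_const c) ^ j)"
proof -
  fix c :: real and a assume "convergent2 a"
  then obtain C R where 1: "1 \<le> R" "1 \<le> C" "\<And>i j. \<bar>fps_nth (fps_nth a i) j\<bar> \<le> C * R ^ (i + j)"
    by (rule convergent2E) blast
  let ?b = "Abs_fps (\<lambda>n. \<Sum>j\<le>n. fps_const (fps_nth (fps_nth a (n - j)) j) * (fps_X + fps_const c) ^ j)"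
  define K where "K = 1 + \<bar>c\<bar>"
  have K: "1 \<le> K" by (simp add: K_def)
  have RK: "1 \<le> R * K" using mult_mono[OF 1(1) K] 1 by simp
  show "convergent2 ?b"
  proof (rule convergent2I[of "2 * (R * K)" _ C])
    fix n k
    have "fps_nth (fps_nth ?b n) k =
        (\<Sum>j\<le>n. fps_nth (fps_nth a (n - j)) j * fps_nth ((fps_X + fps_const c) ^ j) k)"
      by (simp add: fps_sum_nth)
    also have "\<bar>\<dots>\<bar> \<le> (\<Sum>j\<le>n. C * R ^ n * K ^ n)"
    proof (rule order.trans[OF sum_abs], rule sum_mono)
      fix j assume "j \<in> {..n}"
      then have j: "j \<le> n" by simp
      have "\<bar>fps_nth (fps_nth a (n - j)) j\<bar> \<le> C * R ^ n" using 1(3)[of "n - j" j] j by simp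
      moreover have "\<bar>fps_nth ((fps_X + fps_const c) ^ j) k\<bar> \<le> K ^ n"
        using abs_nth_linear_power[of c j k] power_increasing[OF j K] unfolding K_def by linarith
      ultimately show "\<bar>fps_nth (fps_nth a (n - j)) j * fps_nth ((fps_X + fps_const c) ^ j) k\<bar>
          \<le> C * R ^ n * K ^ n"
        unfolding abs_mult using 1 by (intro mult_mono) auto
    qed
    also have "\<dots> = real (Suc n) * (C * (R * K) ^ n)"
      by (simp add: power_mult_distrib)
    also have "\<dots> \<le> 2 ^ n * (C * (R * K) ^ n)"
      using 1 K by (intro mult_right_mono Suc_le_two_power) auto
    also have "\<dots> = C * (2 * (R * K)) ^ n" by (simp add: power_mult_distrib)
    also have "\<dots> \<le> C * (2 * (R * K)) ^ (n + k)"
      using 1 RK by (intro mult_left_mono power_increasing) auto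
    finally show "\<bar>fps_nth (fps_nth ?b n) k\<bar> \<le> C * (2 * (R * K)) ^ (n + k)" .
  qed (use RK in auto)
qed

text \<open>The pullback \<open>f(x * y, y)\<close>.\<close>
lift_definition pull_vertical :: "germ \<Rightarrow> germ" is
  "\<lambda>a. Abs_fps (\<lambda>i. fps_X ^ i * fps_nth a i)"
proof -
  fix a assume "convergent2 a"
  then obtain C R where 1: "1 \<le> R" "1 \<le> C" "\<And>i j. \<bar>fps_nth (fps_nth a i) j\<bar> \<le> C * R ^ (i + j)"
    by (rule convergent2E) blast
  show "convergent2 (Abs_fps (\<lambda>i. fps_X ^ i * fps_nth a i))"
  proof (rule convergent2I[of R _ C])
    fix i j
    show "\<bar>fps_nth (fps_nth (Abs_fps (\<lambda>i. fps_X ^ i * fps_nth a i)) i) j\<bar> \<le> C * R ^ (i + j)"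
    proof (cases "j < i")
      case True
      then show ?thesis using 1 by (simp add: fps_X_power_mult_nth)
    next
      case False
      then have "\<bar>fps_nth (fps_nth a i) (j - i)\<bar> \<le> C * R ^ j" using 1(3)[of i "j - i"] by simp
      also have "\<dots> \<le> C * R ^ (i + j)" using 1 by (intro mult_left_mono power_increasing) auto
      finally show ?thesis using False by (simp add: fps_X_power_mult_nth)
    qed
  qed (use 1 in auto)
qed

fun pull1 :: "direction \<Rightarrow> germ \<Rightarrow> germ" where
  "pull1 (Slope c) f = pull_slope c f"
| "pull1 Vertical f = pull_vertical f"

text \<open>
  Pullback of germs by the germ at \<open>p\<close> of the composition \<open>\<pi>\<^sub>p\<close> of blow-ups; the first element of
  the list is the direction of the first blow-up.
\<close>
fun pull :: "point \<Rightarrow> germ \<Rightarrow> germ" where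
  "pull [] f = f"
| "pull (d # p) f = pull p (pull1 d f)"

text \<open>
  The points of the exceptional divisor obtained after blowing up, in order, the points of a list.
  Before any blow-up it consists of the origin.
\<close>
definition divisor :: "point list \<Rightarrow> point set" where
  "divisor \<pi> = (if \<pi> = [] then {[]} else {q @ [d] |q d. q \<in> set \<pi>} - set \<pi>)"

definition blowup_seq :: "point list \<Rightarrow> bool" where
  "blowup_seq \<pi> \<longleftrightarrow> \<pi> \<noteq> [] \<and> (\<forall>j<length \<pi>. \<pi> ! j \<in> divisor (take j \<pi>))"

text \<open>
  A component of the divisor (together with its strict transforms by further blow-ups) is named by
  the point whose blow-up creates it. \<open>component_at q p e\<close>: the component created at \<open>q\<close> passes
  through \<open>p\<close>, where it has the local equation \<open>e = 0\<close>.
\<close>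
inductive component_at :: "point \<Rightarrow> point \<Rightarrow> germ \<Rightarrow> bool" where
  "component_at q (q @ [Slope c]) germ_X"
| "component_at q (q @ [Vertical]) germ_Y"
| "component_at q p germ_X \<Longrightarrow> component_at q (p @ [Vertical]) germ_X"
| "component_at q p germ_Y \<Longrightarrow> component_at q (p @ [Slope 0]) germ_Y"

definition no_two_meet :: "point list \<Rightarrow> point set \<Rightarrow> bool" where
  "no_two_meet \<pi> C \<longleftrightarrow>
     (\<forall>p\<in>divisor \<pi>. \<forall>q\<in>C. \<forall>q'\<in>C. \<forall>e e'. component_at q p e \<and> component_at q' p e' \<longrightarrow> q = q')"

text \<open>
  \<open>\<pi>\<close> is minimal with property \<open>P\<close>: no sequence with this property blows up only a proper part
  of the points blown up by \<open>\<pi>\<close>. The order of independent blow-ups is immaterial.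
\<close>
definition minimal_seq :: "(point list \<Rightarrow> bool) \<Rightarrow> point list \<Rightarrow> bool" where
  "minimal_seq P \<pi> \<longleftrightarrow> blowup_seq \<pi> \<and> P \<pi> \<and> \<not> (\<exists>\<rho>. blowup_seq \<rho> \<and> P \<rho> \<and> set \<rho> \<subset> set \<pi>)"


section \<open>Branches\<close>

text \<open>
  A branch is represented by the principal ideal of its equation. For an irreducible \<open>f\<close> the germ
  of \<open>{f = 0}\<close> has dimension one iff the origin is not isolated in it.
\<close>

type_synonym curve = "germ set"

definition curve_of :: "germ \<Rightarrow> curve" where
  "curve_of f = {g. f dvd g}"

definition one_dimensional :: "germ \<Rightarrow> bool" where
  "one_dimensional f \<longleftrightarrow> (\<exists>\<^sub>F z in at (0, 0). germ_eval f z = 0)"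

definition branch :: "curve \<Rightarrow> bool" where
  "branch S \<longleftrightarrow> (\<exists>f. irreducible f \<and> one_dimensional f \<and> S = curve_of f)"

definition curve_mult :: "curve \<Rightarrow> nat" where
  "curve_mult S = the_enat (INF f\<in>S. germ_ord f)"

definition transverse :: "curve \<Rightarrow> curve \<Rightarrow> bool" where
  "transverse S S' \<longleftrightarrow> (\<exists>f g. S = curve_of f \<and> S' = curve_of g \<and>
     germ_at0 (germ_dx f * germ_dy g - germ_dy f * germ_dx g) \<noteq> 0)"

text \<open>
  \<open>T\<close> is the strict transform of the branch \<open>S\<close> at \<open>p\<close>: \<open>\<pi>\<^sub>p\<close> maps \<open>T\<close> into \<open>S\<close>, and \<open>T\<close> is not
  contained in the exceptional divisor \<open>\<pi>\<^sub>p\<^sup>-\<^sup>1(0)\<close>.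
\<close>
definition strict_branch :: "point \<Rightarrow> curve \<Rightarrow> curve \<Rightarrow> bool" where
  "strict_branch p S T \<longleftrightarrow> branch T \<and> pull p ` S \<subseteq> T \<and> \<not> (pull p germ_X \<in> T \<and> pull p germ_Y \<in> T)"

text \<open>The strict transform of \<open>S\<close> on the final surface of \<open>\<pi>\<close> meets the component named \<open>q\<close>.\<close>
definition meets_component :: "point list \<Rightarrow> curve \<Rightarrow> point \<Rightarrow> bool" where
  "meets_component \<pi> S q \<longleftrightarrow>
     q \<in> set \<pi> \<and> (\<exists>p\<in>divisor \<pi>. \<exists>T e. strict_branch p S T \<and> component_at q p e)"

definition realizes_eps :: "point list \<Rightarrow> curve set \<Rightarrow> bool" where
  "realizes_eps \<pi> \<S> \<longleftrightarrow> (\<exists>tr. inj_on tr \<S> \<and>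
     (\<forall>S\<in>\<S>. tr S \<in> divisor \<pi> \<and> (\<exists>!q. \<exists>e. component_at q (tr S) e) \<and>
       (\<exists>T. strict_branch (tr S) S T \<and> curve_mult T = 1 \<and>
         (\<forall>q e. component_at q (tr S) e \<longrightarrow> transverse T (curve_of e)))))"

definition realizes_kappa :: "point list \<Rightarrow> point set \<Rightarrow> bool" where
  "realizes_kappa \<pi> C \<longleftrightarrow> C \<subseteq> set \<pi> \<and> no_two_meet \<pi> C"


section \<open>Foliations\<close>

text \<open>The pair \<open>(P, Q)\<close> stands for the 1-form \<open>P dx + Q dy\<close>.\<close>

type_synonym form = "germ \<times> germ"

definition scale_form :: "germ \<Rightarrow> form \<Rightarrow> form" where
  "scale_form h \<omega> = (h * fst \<omega>, h * snd \<omega>)"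

definition foliation :: "form \<Rightarrow> bool" where
  "foliation \<omega> \<longleftrightarrow> coprime (fst \<omega>) (snd \<omega>) \<and> \<not> is_unit (fst \<omega>) \<and> \<not> is_unit (snd \<omega>)"

definition pull_form :: "point \<Rightarrow> form \<Rightarrow> form" where
  "pull_form p \<omega> =
     (pull p (fst \<omega>) * germ_dx (pull p germ_X) + pull p (snd \<omega>) * germ_dx (pull p germ_Y),
      pull p (fst \<omega>) * germ_dy (pull p germ_X) + pull p (snd \<omega>) * germ_dy (pull p germ_Y))"

text \<open>
  The strict transform of the foliation at \<open>p\<close>. It is defined up to multiplication by a unit, which
  does not affect any of the notions below.
\<close>
definition strict_form :: "form \<Rightarrow> point \<Rightarrow> form" where
  "strict_form \<omega> p = (SOME \<omega>'. coprime (fst \<omega>') (snd \<omega>') \<and>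
     (\<exists>h. h \<noteq> 0 \<and> pull_form p \<omega> = scale_form h \<omega>'))"

text \<open>The coefficient of \<open>\<omega> \<and> df\<close>.\<close>
definition wedge_d :: "form \<Rightarrow> germ \<Rightarrow> germ" where
  "wedge_d \<omega> f = fst \<omega> * germ_dy f - snd \<omega> * germ_dx f"

definition invariant_curve :: "form \<Rightarrow> curve \<Rightarrow> bool" where
  "invariant_curve \<omega> S \<longleftrightarrow> (\<exists>f. S = curve_of f \<and> f dvd wedge_d \<omega> f)"

definition singular_form :: "form \<Rightarrow> bool" where
  "singular_form \<omega> \<longleftrightarrow> germ_at0 (fst \<omega>) = 0 \<and> germ_at0 (snd \<omega>) = 0"

text \<open>
  \<open>lin_eigenvalues \<omega> l m\<close>: the linear part at the origin of the vector field \<open>Q \<partial>x - P \<partial>y\<close> dual to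
  \<open>P dx + Q dy\<close> has the real eigenvalues \<open>l, m\<close>, counted with multiplicity.
\<close>
definition lin_eigenvalues :: "form \<Rightarrow> real \<Rightarrow> real \<Rightarrow> bool" where
  "lin_eigenvalues \<omega> l m \<longleftrightarrow>
     (let a = germ_at0 (germ_dx (snd \<omega>)); b = germ_at0 (germ_dy (snd \<omega>));
          c = - germ_at0 (germ_dx (fst \<omega>)); d = - germ_at0 (germ_dy (fst \<omega>))
      in l + m = a + d \<and> l * m = a * d - b * c)"

definition pos_rat :: "real \<Rightarrow> bool" where
  "pos_rat x \<longleftrightarrow> x \<in> \<rat> \<and> 0 < x"

text \<open>Non-nilpotent means that one of the eigenvalues, here \<open>l\<close>, is non-zero.\<close>
definition simple_sing :: "form \<Rightarrow> bool" where
  "simple_sing \<omega> \<longleftrightarrow> singular_form \<omega> \<and>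
     (\<exists>l m. lin_eigenvalues \<omega> l m \<and> l \<noteq> 0 \<and> \<not> pos_rat (m / l))"

definition saddle_node :: "form \<Rightarrow> bool" where
  "saddle_node \<omega> \<longleftrightarrow> simple_sing \<omega> \<and> (\<exists>l. lin_eigenvalues \<omega> l 0)"

definition invariant_component :: "form \<Rightarrow> point list \<Rightarrow> point \<Rightarrow> bool" where
  "invariant_component \<omega> \<pi> q \<longleftrightarrow>
     (\<forall>p\<in>divisor \<pi>. \<forall>e. component_at q p e \<longrightarrow> invariant_curve (strict_form \<omega> p) (curve_of e))"

definition noninvariant_components :: "form \<Rightarrow> point list \<Rightarrow> point set" where
  "noninvariant_components \<omega> \<pi> = {q \<in> set \<pi>. \<not> invariant_component \<omega> \<pi> q}"

text \<open>
  The third condition says that \<open>\<omega>' \<and> de\<close> does not vanish at the points of a non-invariant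
  component \<open>{e = 0}\<close>, that is, the foliation is neither singular there nor tangent to it.
\<close>
definition reduces :: "form \<Rightarrow> point list \<Rightarrow> bool" where
  "reduces \<omega> \<pi> \<longleftrightarrow>
     finite {p \<in> divisor \<pi>. singular_form (strict_form \<omega> p)} \<and>
     (\<forall>p\<in>divisor \<pi>. singular_form (strict_form \<omega> p) \<longrightarrow> simple_sing (strict_form \<omega> p)) \<and>
     (\<forall>q\<in>noninvariant_components \<omega> \<pi>. \<forall>p\<in>divisor \<pi>. \<forall>e.
        component_at q p e \<longrightarrow> germ_at0 (wedge_d (strict_form \<omega> p) e) \<noteq> 0) \<and>
     no_two_meet \<pi> (noninvariant_components \<omega> \<pi>)"

definition real_reduction :: "form \<Rightarrow> point list \<Rightarrow> bool" where
  "real_reduction \<omega> \<pi> \<longleftrightarrow> minimal_seq (reduces \<omega>) \<pi>"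

definition real_generalized_curve :: "form \<Rightarrow> bool" where
  "real_generalized_curve \<omega> \<longleftrightarrow>
     (\<exists>\<pi>. real_reduction \<omega> \<pi> \<and> (\<forall>p\<in>divisor \<pi>. \<not> saddle_node (strict_form \<omega> p)))"

definition separatrix :: "form \<Rightarrow> curve \<Rightarrow> bool" where
  "separatrix \<omega> S \<longleftrightarrow> branch S \<and> invariant_curve \<omega> S"

definition isolated_separatrices :: "form \<Rightarrow> point list \<Rightarrow> curve set" where
  "isolated_separatrices \<omega> \<pi> =
     {S. separatrix \<omega> S \<and> (\<exists>q\<in>set \<pi> - noninvariant_components \<omega> \<pi>. meets_component \<pi> S q)}"

definition dicritical_separatrices :: "form \<Rightarrow> point list \<Rightarrow> curve set" where
  "dicritical_separatrices \<omega> \<pi> =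
     {S. separatrix \<omega> S \<and> (\<exists>q\<in>noninvariant_components \<omega> \<pi>. meets_component \<pi> S q)}"


section \<open>Camacho--Sad indices\<close>

text \<open>
  \<open>f(X(t), Y(t))\<close> for \<open>X(0) = Y(0) = 0\<close>; then \<open>X^i * Y^j\<close> contributes to the coefficient of \<open>t^n\<close>
  only if \<open>i + j \<le> n\<close>.
\<close>
definition germ_along :: "germ \<Rightarrow> real fps \<Rightarrow> real fps \<Rightarrow> real fps" where
  "germ_along f X Y = Abs_fps (\<lambda>n. \<Sum>i\<le>n. \<Sum>j\<le>n. germ_coeff f i j * fps_nth (X ^ i * Y ^ j) n)"

text \<open>
  A primitive (generically injective over the complex numbers) real analytic parametrization
  \<open>t \<mapsto> (X(t), Y(t))\<close> of a branch. Injectivity on real points would not be enough, because of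
  \<open>t \<mapsto> t^3\<close>.
\<close>
definition primitive_param :: "curve \<Rightarrow> real fps \<Rightarrow> real fps \<Rightarrow> bool" where
  "primitive_param S X Y \<longleftrightarrow>
     fps_conv_radius X > 0 \<and> fps_conv_radius Y > 0 \<and> fps_nth X 0 = 0 \<and> fps_nth Y 0 = 0 \<and>
     (X \<noteq> 0 \<or> Y \<noteq> 0) \<and> (\<forall>f\<in>S. germ_along f X Y = 0) \<and>
     \<not> (\<exists>U V s. subdegree s \<ge> 2 \<and> X = fps_compose U s \<and> Y = fps_compose V s)"

text \<open>
  If \<open>S = {f = 0}\<close> is invariant by \<open>\<omega>\<close>, write \<open>g \<omega> = h df + f \<eta>\<close> with \<open>g, h\<close> prime to \<open>f\<close>. The index
  is minus the residue of \<open>\<eta>/h\<close> along \<open>S\<close>, the standard definition also for singular \<open>S\<close>.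
\<close>
definition cs_index :: "form \<Rightarrow> curve \<Rightarrow> real" where
  "cs_index \<omega> S = (THE v. \<exists>f g h A B X Y.
     irreducible f \<and> S = curve_of f \<and> \<not> f dvd g \<and> \<not> f dvd h \<and>
     g * fst \<omega> = h * germ_dx f + f * A \<and> g * snd \<omega> = h * germ_dy f + f * B \<and>
     primitive_param S X Y \<and>
     v = - fls_residue
       (fps_to_fls (germ_along A X Y * fps_deriv X + germ_along B X Y * fps_deriv Y)
        / fps_to_fls (germ_along h X Y)))"


section \<open>Real q-dicritical triplets\<close>

text \<open>
  The decompositions at level \<open>j\<close> are determined by the set \<open>dic\<close> of dicritical components:
  \<open>\<D>\<^sub>j\<^sup>\<delta>\<close> consists of the components in \<open>dic\<close> among the first \<open>j\<close> ones, and \<open>\<D>\<^sub>j\<^sup>\<iota>\<close> of the others.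
  \<open>ind T j p S\<close> is the index \<open>I\<^sub>p(S)\<close> at level \<open>j\<close>; it is relevant only if \<open>S\<close> is a local branch
  of \<open>\<Z>\<^sub>j\<close> at \<open>p \<in> \<D>\<^sub>j\<close>.
\<close>

record triplet =
  centres :: "point list"
  dic :: "point set"
  sep_dic :: "curve set"
  sep_iso :: "curve set"
  ind :: "nat \<Rightarrow> point \<Rightarrow> curve \<Rightarrow> real"

definition seps :: "triplet \<Rightarrow> curve set" where
  "seps T = sep_dic T \<union> sep_iso T"

definition local_branches :: "triplet \<Rightarrow> nat \<Rightarrow> point \<Rightarrow> curve set" where
  "local_branches T j p =
     {S. \<exists>B\<in>seps T. strict_branch p B S} \<union>
     {curve_of e |q e. q \<in> set (take j (centres T)) - dic T \<and> component_at q p e}"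

definition index_rules :: "triplet \<Rightarrow> bool" where
  "index_rules T \<longleftrightarrow>
     (let \<pi> = centres T; n = length \<pi> in
       (\<forall>j<n. \<forall>S\<in>local_branches T j (\<pi> ! j). \<forall>d S'. strict_branch [d] S S' \<longrightarrow>
          ind T (Suc j) (\<pi> ! j @ [d]) S' = ind T j (\<pi> ! j) S - real (curve_mult S) ^ 2) \<and>
       (\<forall>j<n. \<forall>p\<in>divisor (take j \<pi>). p \<noteq> \<pi> ! j \<longrightarrow>
          (\<forall>S\<in>local_branches T j p. ind T (Suc j) p S = ind T j p S)) \<and>
       (\<forall>p\<in>divisor \<pi>. \<forall>S. local_branches T n p = {S} \<and> curve_mult S = 1 \<longrightarrow> ind T n p S = 0) \<and>
       (\<forall>p\<in>divisor \<pi>. \<forall>S\<^sub>1\<in>local_branches T n p. \<forall>S\<^sub>2\<in>local_branches T n p. S\<^sub>1 \<noteq> S\<^sub>2 \<longrightarrow>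
          ind T n p S\<^sub>1 \<noteq> 0 \<and> \<not> pos_rat (ind T n p S\<^sub>1) \<and> ind T n p S\<^sub>2 = 1 / ind T n p S\<^sub>1))"

text \<open>
  Two points need care over the real numbers, where non-real separatrices are invisible to the
  triplet but still influence the foliation.
  The sequence is minimal with the realization properties among the sequences satisfying \<open>A\<close>;
  for \<open>A = (\<lambda>_. True)\<close> this is absolute minimality. For the triplets of a foliation, \<open>A\<close> is the
  property of reducing its singularities: the real reduction of \<open>d(y\<^sup>2 + x^4) = 0\<close> needs two
  blow-ups, although this foliation has neither real separatrices nor dicritical components.
  The vanishing of the index at regular points of \<open>\<Z>\<^sub>j\<close> is required on the final surface: the
  Camacho--Sad index at the origin of the only real separatrix \<open>{x = 0}\<close> of
  \<open>d(x * (x\<^sup>2 + y\<^sup>2)) = 0\<close> is \<open>-2\<close>.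
\<close>
definition real_qd_triplet :: "(point list \<Rightarrow> bool) \<Rightarrow> triplet \<Rightarrow> bool" where
  "real_qd_triplet A T \<longleftrightarrow>
     blowup_seq (centres T) \<and>
     dic T \<subseteq> set (centres T) \<and> no_two_meet (centres T) (dic T) \<and>
     finite (seps T) \<and> (\<forall>S\<in>seps T. branch S) \<and> sep_dic T \<inter> sep_iso T = {} \<and>
     realizes_eps (centres T) (seps T) \<and>
     (\<forall>S\<in>seps T. S \<in> sep_dic T \<longleftrightarrow> (\<exists>q\<in>dic T. meets_component (centres T) S q)) \<and>
     minimal_seq (\<lambda>\<rho>. A \<rho> \<and> realizes_kappa \<rho> (dic T) \<and> realizes_eps \<rho> (seps T)) (centres T) \<and>
     index_rules T"

definition associated_triplet :: "form \<Rightarrow> triplet \<Rightarrow> bool" where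
  "associated_triplet \<omega> T \<longleftrightarrow>
     real_qd_triplet (reduces \<omega>) T \<and>
     real_reduction \<omega> (centres T) \<and>
     dic T = noninvariant_components \<omega> (centres T) \<and>
     isolated_separatrices \<omega> (centres T) \<subseteq> seps T \<and>
     seps T \<subseteq> isolated_separatrices \<omega> (centres T) \<union> dicritical_separatrices \<omega> (centres T) \<and>
     (\<forall>j\<le>length (centres T). \<forall>p\<in>divisor (take j (centres T)). \<forall>S\<in>local_branches T j p.
        ind T j p S = cs_index (strict_form \<omega> p) S)"


section \<open>Real logarithmic forms and models\<close>

text \<open>The form \<open>\<Sum>i<r. \<lambda>\<^sub>i df\<^sub>i/f\<^sub>i + \<alpha>\<close>.\<close>

record log_form =
  npoles :: nat
  res :: "nat \<Rightarrow> real"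
  pole :: "nat \<Rightarrow> germ"
  reg :: form

definition real_log_form :: "log_form \<Rightarrow> bool" where
  "real_log_form \<eta> \<longleftrightarrow> 1 \<le> npoles \<eta> \<and>
     (\<forall>i<npoles \<eta>. res \<eta> i \<noteq> 0 \<and> irreducible (pole \<eta> i)) \<and>
     (\<forall>i<npoles \<eta>. \<forall>j<npoles \<eta>. i \<noteq> j \<longrightarrow> \<not> pole \<eta> i dvd pole \<eta> j) \<and>
     germ_dy (fst (reg \<eta>)) = germ_dx (snd (reg \<eta>))"

definition log_den :: "log_form \<Rightarrow> germ" where
  "log_den \<eta> = (\<Prod>i<npoles \<eta>. pole \<eta> i)"

text \<open>The analytic form \<open>f \<eta>\<close>, with \<open>f\<close> the product of the poles.\<close>
definition log_num :: "log_form \<Rightarrow> form" where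
  "log_num \<eta> =
     ((\<Sum>i<npoles \<eta>. germ_const (res \<eta> i) * (\<Prod>j\<in>{..<npoles \<eta>} - {i}. pole \<eta> j) * germ_dx (pole \<eta> i))
        + log_den \<eta> * fst (reg \<eta>),
      (\<Sum>i<npoles \<eta>. germ_const (res \<eta> i) * (\<Prod>j\<in>{..<npoles \<eta>} - {i}. pole \<eta> j) * germ_dy (pole \<eta> i))
        + log_den \<eta> * snd (reg \<eta>))"

definition real_poles :: "log_form \<Rightarrow> curve set" where
  "real_poles \<eta> = {curve_of (pole \<eta> i) |i. i < npoles \<eta> \<and> one_dimensional (pole \<eta> i)}"

definition log_foliation :: "log_form \<Rightarrow> form \<Rightarrow> bool" where
  "log_foliation \<eta> \<omega> \<longleftrightarrow> foliation \<omega> \<and> (\<exists>h. h \<noteq> 0 \<and> log_num \<eta> = scale_form h \<omega>)"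

definition one_faithful :: "log_form \<Rightarrow> bool" where
  "one_faithful \<eta> \<longleftrightarrow>
     min (germ_ord (fst (log_num \<eta>))) (germ_ord (snd (log_num \<eta>))) + 1 = germ_ord (log_den \<eta>)"

text \<open>\<open>\<eta>' = \<pi>\<^sub>p\<^sup>* \<eta>\<close> as meromorphic forms, with denominators cleared.\<close>
definition log_transform :: "point \<Rightarrow> log_form \<Rightarrow> log_form \<Rightarrow> bool" where
  "log_transform p \<eta> \<eta>' \<longleftrightarrow>
     scale_form (pull p (log_den \<eta>)) (log_num \<eta>') = scale_form (log_den \<eta>') (pull_form p (log_num \<eta>))"

text \<open>
  A transform without poles is not a \<^const>\<open>real_log_form\<close>, so the condition concerns exactly the
  centres where the transform has poles.
\<close>
definition faithful_along :: "log_form \<Rightarrow> point list \<Rightarrow> bool" where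
  "faithful_along \<eta> \<pi> \<longleftrightarrow>
     (\<forall>p\<in>set \<pi>. \<forall>\<eta>'. real_log_form \<eta>' \<and> log_transform p \<eta> \<eta>' \<longrightarrow> one_faithful \<eta>')"

text \<open>
  The duplet of \<open>\<eta>\<close>, whose foliation is given by \<open>\<omega>\<close>, based on \<open>\<pi>\<close> (the real reduction is unique
  only up to the order of the blow-ups), with dicritical components \<open>C\<close> and separatrices
  \<open>Sd\<close> (dicritical) and \<open>Si\<close> (isolated).
\<close>
definition log_duplet ::
  "log_form \<Rightarrow> form \<Rightarrow> point list \<Rightarrow> point set \<Rightarrow> curve set \<Rightarrow> curve set \<Rightarrow> bool" where
  "log_duplet \<eta> \<omega> \<pi> C Sd Si \<longleftrightarrow>
     real_reduction \<omega> \<pi> \<and> C = noninvariant_components \<omega> \<pi> \<and>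
     (let \<S> = real_poles \<eta> \<union> isolated_separatrices \<omega> \<pi> in
        Sd = {S\<in>\<S>. \<exists>q\<in>C. meets_component \<pi> S q} \<and> Si = \<S> - Sd)"

definition strict_log_model :: "log_form \<Rightarrow> triplet \<Rightarrow> bool" where
  "strict_log_model \<eta> T \<longleftrightarrow>
     real_log_form \<eta> \<and> real_poles \<eta> = seps T \<and>
     (\<exists>\<omega>. log_foliation \<eta> \<omega> \<and>
        log_duplet \<eta> \<omega> (centres T) (dic T) (sep_dic T) (sep_iso T) \<and>
        faithful_along \<eta> (centres T) \<and>
        (\<forall>S\<in>seps T. ind T 0 [] S = cs_index \<omega> S))"

definition strict_log_model_of_foliation :: "log_form \<Rightarrow> form \<Rightarrow> bool" where
  "strict_log_model_of_foliation \<eta> \<omega> \<longleftrightarrow> (\<exists>T. associated_triplet \<omega> T \<and> strict_log_model \<eta> T)"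

end

(*
  The model is a closed form eta = sum_i w_i df_i/f_i whose residues are prescribed along the final
  divisor of the reduction: 1 along every invariant component and 0 along every dicritical one.
  At a simple singularity lying on a single component, the isolated separatrix gets the weight
  -1/CS, where CS is its index at that point, so that eta has the same index there; regular points
  of invariant components and corners then have the required normal form for free.
  On a dicritical component the restriction of the transform of eta must not vanish, while its
  residues at the centres and corners are forced. Choosing dicritical separatrices of weight -1
  interlaced with these points, all on one affine line, makes the restriction
  sum_a 1/(c - a) - sum_b 1/(c - b), which has no real zero.
  The residues along the components are corrected by poles without real points: for each centre q,
  take a germ whose strict transform at q is x^2 + y^2 up to a unit. It leaves the divisor after the
  blow-up of q, so the weights of these germs are determined by a triangular linear system. A second
  family, with strict transforms x^2 + 2 y^2 and weight 1, forces every centre to be blown up, since a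
  simple singularity has no such invariant curve; this gives minimality of the reduction.
*)
theory Submission
 imports Defs
begin

section \<open>The ring of germs\<close>

text \<open>On a dicritical component the residues have to balance: the residue of eta along it,
  zero by choice, is forced by the residues of the restriction at its points. Each centre or corner
  contributes 1 minus the residue of the other component through it. One more pole of weight -1 than
  there are such points on the affine line, and weight +1 at infinity when nothing else lies there,
  make the sum right. The same count lets the poles alternate beginning and ending with weight -1,
  as the absence of real zeros requires.

  Indices are matched at the final points only. They then agree at the origin because the index of
  an invariant branch drops by the square of its multiplicity under a blow-up, for every foliation,
  so a difference of two indices is preserved.

  The obstacle is to move freely between a curve at an infinitely near point and its image at the
  origin. Images are built algebraically from Weierstrass polynomials, and irreducible germs are
  shown to be prime, so that branches are compared by divisibility. Evaluation of germs only serves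
  to decide which curves have real points.\<close>

abbreviation gX where "gX \<equiv> germ_X"
abbreviation gY where "gY \<equiv> germ_Y"
abbreviation cst where "cst \<equiv> germ_const"
abbreviation Dx where "Dx \<equiv> germ_dx"
abbreviation Dy where "Dy \<equiv> germ_dy"
abbreviation crv where "crv \<equiv> curve_of"
abbreviation stf where "stf \<equiv> strict_form"
abbreviation plf where "plf \<equiv> pull_form"
abbreviation scl where "scl \<equiv> scale_form"
abbreviation wdg where "wdg \<equiv> wedge_d"
abbreviation psl where "psl \<equiv> pull_slope"
abbreviation pvt where "pvt \<equiv> pull_vertical"
abbreviation csi where "csi \<equiv> cs_index"
abbreviation cpt where "cpt \<equiv> component_at"
abbreviation sng where "sng \<equiv> singular_form"
abbreviation smp where "smp \<equiv> simple_sing"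
abbreviation evl where "evl \<equiv> germ_eval"
abbreviation fD where "fD \<equiv> fps_deriv"
abbreviation cf where "cf \<equiv> fps_nth"
abbreviation rad where "rad \<equiv> fps_conv_radius"
abbreviation sdg where "sdg \<equiv> subdegree"
abbreviation prm where "prm \<equiv> prime_elem"
abbreviation Sl where "Sl == Slope"
abbreviation Vt where "Vt == Vertical"
abbreviation (input) iff (infixr "<->" 25) where "A <-> B == (A::bool) = B"
lemmas alg = algebra_simps
abbreviation gc :: "germ => nat => nat => real" where "gc \<equiv> germ_coeff"

lemma germ_eqI: "(!!i j. gc f i j = gc g i j) ==> f = g"
 by transfer (auto simp: fps_eq_iff)

lemma gc_0 [simp]: "gc 0 i j = 0" by transfer simp
lemma gc_1: "gc 1 i j = (if i = 0 & j = 0 then 1 else 0)" by transfer simp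
lemma gc_add [simp]: "gc (f + g) i j = gc f i j + gc g i j" by transfer simp
lemma gc_uminus [simp]: "gc (- f) i j = - gc f i j" by transfer simp
lemma gc_diff [simp]: "gc (f - g) i j = gc f i j - gc g i j" by transfer simp
lemma gc_mult: "gc (f * g) i j = (\<Sum>k=0..i. \<Sum>l=0..j. gc f k l * gc g (i - k) (j - l))"
 by transfer (simp add: fps_mult_nth fps_sum_nth)
lemma gc_sum [simp]: "gc (sum F A) i j = (\<Sum>a\<in>A. gc (F a) i j)"
 by (induction A rule: infinite_finite_induct) auto
lemma gc_const: "gc (cst c) i j = (if i = 0 & j = 0 then c else 0)"
 by transfer (auto)
lemma gc_const_mult [simp]: "gc (cst c * f) i j = c * gc f i j"
 by transfer simp
lemma gc_X_mult: "gc (gX * f) i j = (if i = 0 then 0 else gc f (i - 1) j)"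
 by transfer simp
lemma gc_Y_mult: "gc (gY * f) i j = (if j = 0 then 0 else gc f i (j - 1))"
 by transfer simp
lemma gc_X: "gc gX i j = (if i = 1 & j = 0 then 1 else 0)"
 by transfer (auto)
lemma gc_Y: "gc gY i j = (if i = 0 & j = 1 then 1 else 0)"
 by transfer (auto)
lemma gc_dx: "gc (Dx f) i j = real (Suc i) * gc f (Suc i) j"
proof (transfer)
 fix f :: "real fps fps" and i j
 have "cf (cf (fD f) i) j = cf (fps_const (real (Suc i)) * cf f (Suc i)) j"
  unfolding fps_of_nat by simp
 thus "cf (cf (fD f) i) j = real (Suc i) * cf (cf f (Suc i)) j"
  by simp
qed
lemma gc_dy: "gc (Dy f) i j = real (Suc j) * gc f i (Suc j)"
 by transfer simp

lemma germ_const_hom [simp]: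
 "cst 0 = 0" "cst 1 = 1"
 "cst (a + b) = cst a + cst b"
 "cst (a - b) = cst a - cst b"
 "cst (- a) = - cst a"
 by (auto intro!: germ_eqI simp: gc_const gc_1)
lemma germ_const_mult: "cst (a * b) = cst a * cst b"
 by (auto intro!: germ_eqI simp: gc_const)
lemma germ_const_sum: "cst (sum f A) = (\<Sum>i\<in>A. cst (f i))"
 by (induction A rule: infinite_finite_induct) auto
lemma germ_const_eq_0 [simp]: "cst a = 0 <-> a = 0"
proof
 assume "cst a = 0"
 hence "gc (cst a) 0 0 = 0" by simp
 thus "a = 0" by (simp add: gc_const)
qed simp

lemma at0_mult [simp]: "gc (f * g) 0 0 = gc f 0 0 * gc g 0 0" by (simp add: gc_mult)
lemma at0_1 [simp]: "gc 1 0 0 = 1" by (simp add: gc_1)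
lemma at0_power [simp]: "gc (f ^ n) 0 0 = gc f 0 0 ^ n" by (induction n) auto
lemma at0_XY [simp]: "gc gX 0 0 = 0" "gc gY 0 0 = 0" by (auto simp: gc_X gc_Y)
lemma at0_const [simp]: "gc (cst c) 0 0 = c" by (simp add: gc_const)
lemma XY_neq_0 [simp]: "gX ~= 0" "gY ~= 0"
 using gc_X[of 1 0] gc_Y[of 0 1] by auto

lemma germ_bound:
 obtains C R where "1 \<le> R" "1 \<le> C" "!!i j. \<bar>gc f i j\<bar> \<le> C * R ^ (i + j)"
proof -
 have "\<exists>C R. 1 \<le> R & 1 \<le> C & (\<forall>i j. \<bar>gc f i j\<bar> \<le> C * R ^ (i + j))"
  by transfer (metis convergent2E)
 thus ?thesis using that by blast
qed

section \<open>Germs given by their coefficients\<close>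

definition mk_germ :: "(nat => nat => real) => germ" where
 "mk_germ c = Abs_germ (Abs_fps (%i. Abs_fps (c i)))"

lemma gc_mk_germ:
 assumes "0 < R" "!!i j. \<bar>c i j\<bar> \<le> C * R ^ (i + j)"
 shows "gc (mk_germ c) i j = c i j"
proof -
 have "convergent2 (Abs_fps (%i. Abs_fps (c i)))"
  by (rule convergent2I[of R _ C]) (use assms in auto)
 hence "Rep_germ (mk_germ c) = Abs_fps (%i. Abs_fps (c i))"
  unfolding mk_germ_def by (simp add: Abs_germ_inverse)
 thus ?thesis by (simp add: germ_coeff.rep_eq)
qed

text \<open>Coefficients dominated by those of a shifted germ inherit its geometric bound; the shift
  is absorbed in the constant as \<open>R ^ (a + b)\<close>. The shifts, truncations and
  restrictions below fall under this case.\<close>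

lemma gc_mk_germ_dom:
 assumes "!!i j. \<bar>c i j\<bar> \<le> \<bar>gc f (i + a) (j + b)\<bar>"
 shows "gc (mk_germ c) i j = c i j"
proof -
 obtain C R where *: "1 \<le> R" "1 \<le> C" "!!i j. \<bar>gc f i j\<bar> \<le> C * R ^ (i + j)"
  by (rule germ_bound[of f]) blast
 show ?thesis
 proof (rule gc_mk_germ[of R _ "C * R ^ (a + b)"])
  fix i j
  have "\<bar>c i j\<bar> \<le> C * R ^ ((i + a) + (j + b))" using assms *(3) order_trans by blast
  thus "\<bar>c i j\<bar> \<le> C * R ^ (a + b) * R ^ (i + j)" by (simp add: power_add alg)
 qed (use * in auto)
qed

definition shx :: "nat => germ => germ" where "shx k f = mk_germ (%i j. gc f (i + k) j)"
definition shy :: "nat => germ => germ" where "shy k f = mk_germ (%i j. gc f i (j + k))"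
definition row0 :: "germ => germ" where "row0 f = mk_germ (%i j. if i = 0 then gc f i j else 0)"
text \<open>The coefficient of y^k as a germ in x alone, for reading a germ as a series in y over
  germs in x.\<close>

definition ycoef :: "nat => germ => germ" where
 "ycoef k f = mk_germ (%i j. if j = 0 then gc f i k else 0)"
definition ytrunc :: "nat => germ => germ" where
 "ytrunc k f = mk_germ (%i j. if j < k then gc f i j else 0)"
text \<open>Pull-back by the exchange of coordinates. It transfers statements about the axis x = 0
  and slopes to y = 0 and the vertical direction.\<close>

definition swp :: "germ => germ" where
 "swp f = mk_germ (%i j. gc f j i)"

lemma gc_shx [simp]: "gc (shx k f) i j = gc f (i + k) j"
 unfolding shx_def by (rule gc_mk_germ_dom[of _ f k 0]) auto
lemma gc_shy [simp]: "gc (shy k f) i j = gc f i (j + k)"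
 unfolding shy_def by (rule gc_mk_germ_dom[of _ f 0 k]) auto
lemma gc_row0: "gc (row0 f) i j = (if i = 0 then gc f i j else 0)"
 unfolding row0_def by (rule gc_mk_germ_dom[of _ f 0 0]) auto
lemma gc_ycoef: "gc (ycoef k f) i j = (if j = 0 then gc f i k else 0)"
proof -
 have "\<bar>if j = 0 then gc f i k else 0\<bar> \<le> \<bar>gc f (i + 0) (j + k)\<bar>" for i j by auto
 from gc_mk_germ_dom[OF this] show ?thesis unfolding ycoef_def by simp
qed
lemma gc_ytrunc: "gc (ytrunc k f) i j = (if j < k then gc f i j else 0)"
 unfolding ytrunc_def by (rule gc_mk_germ_dom[of _ f 0 0]) auto
lemma gc_swap [simp]: "gc (swp f) i j = gc f j i"
proof -
 obtain C R where *: "1 \<le> R" "1 \<le> C" "!!i j. \<bar>gc f i j\<bar> \<le> C * R ^ (i + j)"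
  by (rule germ_bound[of f]) blast
 show ?thesis unfolding swp_def
  by (rule gc_mk_germ[of R _ C]) (use * in auto, metis add.commute)
qed

lemma swap_hom [simp]:
 "swp 0 = 0" "swp 1 = 1" "swp (f + g) = swp f + swp g"
 "swp (f - g) = swp f - swp g" "swp (- f) = - swp f"
 "swp (cst c) = cst c" "swp gX = gY" "swp gY = gX"
 "swp (swp f) = f"
 by (rule germ_eqI; simp add: gc_1 gc_const gc_X gc_Y)+
lemma swap_mult [simp]: "swp (f * g) = swp f * swp g"
proof (rule germ_eqI)
 fix i j
 show "gc (swp (f * g)) i j = gc (swp f * swp g) i j"
  unfolding gc_swap gc_mult by (rule sum.swap)
qed
lemma swap_power [simp]: "swp (f ^ n) = swp f ^ n" by (induction n) auto
lemma swap_eq_iff [simp]: "swp f = swp g <-> f = g" by (metis swap_hom(9))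
lemma swap_eq_0_iff [simp]: "swp f = 0 <-> f = 0" by (metis swap_hom(1,9))
lemma swap_dvd_iff [simp]: "swp f dvd swp g <-> f dvd g"
 by (metis dvd_def swap_hom(9) swap_mult)
lemma swap_unit_iff [simp]: "is_unit (swp f) <-> is_unit f"
 by (metis swap_dvd_iff swap_hom(2))
lemma swap_dx: "swp (Dx f) = Dy (swp f)"
 and swap_dy: "swp (Dy f) = Dx (swp f)"
 by (rule germ_eqI; simp add: gc_dx gc_dy)+

text \<open>This is the inductive step of the vanishing principles below, formal and
  analytic.\<close>

lemma germ_decomp: "f = cst (gc f 0 0) + gX * shx 1 f + gY * shy 1 (row0 f)"
 by (rule germ_eqI) (auto simp: gc_const gc_X_mult gc_Y_mult gc_row0)

lemma X_dvd_iff: "gX dvd f <-> (\<forall>j. gc f 0 j = 0)"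
proof
 assume "\<forall>j. gc f 0 j = 0"
 hence "f = gX * shx 1 f" by (intro germ_eqI) (simp add: gc_X_mult)
 thus "gX dvd f" by (rule dvdI)
qed (auto simp: gc_X_mult elim!: dvdE)
lemma Y_dvd_iff: "gY dvd f <-> (\<forall>i. gc f i 0 = 0)"
 using swap_dvd_iff[of gX "swp f"] X_dvd_iff[of "swp f"] by simp

lemma dx_simps [simp]:
 "Dx 0 = 0" "Dx 1 = 0" "Dx (cst c) = 0" "Dx gX = 1" "Dx gY = 0"
 "Dx (f + g) = Dx f + Dx g" "Dx (f - g) = Dx f - Dx g"
 "Dx (- f) = - Dx f"
 by (rule germ_eqI; simp add: gc_dx gc_1 gc_const gc_X gc_Y alg)+
lemma dx_mult: "Dx (f * g) = Dx f * g + f * Dx g"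
 by transfer simp
lemma dy_simps [simp]:
 "Dy 0 = 0" "Dy 1 = 0" "Dy (cst c) = 0" "Dy gX = 0" "Dy gY = 1"
 "Dy (f + g) = Dy f + Dy g" "Dy (f - g) = Dy f - Dy g"
 "Dy (- f) = - Dy f"
 by (rule germ_eqI; simp add: gc_dy gc_1 gc_const gc_X gc_Y alg)+
lemma dy_mult: "Dy (f * g) = Dy f * g + f * Dy g"
proof -
 have "swp (Dy (f * g)) = swp (Dy f * g + f * Dy g)"
  by (simp add: swap_dy dx_mult)
 thus ?thesis by (simp only: swap_eq_iff)
qed

section \<open>Pull-backs as ring homomorphisms\<close>

definition row :: "germ => nat => real fps" where "row f n = cf (Rep_germ f) n"

lemma row_nth: "cf (row f n) k = gc f n k" by (simp add: row_def germ_coeff.rep_eq)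
lemma row_mult: "row (f * g) n = (\<Sum>k=0..n. row f k * row g (n - k))"
 by (simp add: row_def times_germ.rep_eq fps_mult_nth)
lemma row_add: "row (f + g) n = row f n + row g n" by (simp add: row_def plus_germ.rep_eq)
lemma germ_row_eqI: "(!!n. row f n = row g n) ==> f = g"
 by (rule germ_eqI) (metis row_nth)

lemma row_pull_slope:
 "row (psl c f) n = (\<Sum>j\<le>n. fps_const (gc f (n - j) j) * (fps_X + fps_const c) ^ j)"
 by (simp add: row_def pull_slope.rep_eq germ_coeff.rep_eq)
lemma row_pull_vertical: "row (pvt f) n = fps_X ^ n * row f n"
 by (simp add: row_def pull_vertical.rep_eq)

lemma fps_const_sum': "fps_const (sum f A) = (\<Sum>i\<in>A. fps_const (f i))"
 by (induction A rule: infinite_finite_induct) (auto simp flip: fps_const_add)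

lemma pull_slope_mult: "psl c (f * g) = psl c f * psl c g"
proof (rule germ_row_eqI)
 fix n
 define T where "T = fps_X + fps_const c"
 define t where "t k l k' l' = fps_const (gc f k l * gc g k' l') * T ^ (l + l')" for k l k' l'
 have "row (psl c (f * g)) n = (\<Sum>j\<le>n. \<Sum>k=0..n-j. \<Sum>l=0..j. t k l (n - j - k) (j - l))"
  unfolding row_pull_slope gc_mult T_def[symmetric]
  by (intro sum.cong refl)
   (simp add: t_def sum_distrib_right fps_const_sum')
 also have "\<dots> = (\<Sum>(j, k, l)\<in>(SIGMA j:{..n}. {0..n-j} \<times> {0..j}). t k l (n - j - k) (j - l))"
  by (simp add: sum.Sigma)
 \<comment> \<open>Regroup by the degree m = k + l of the monomial of f: a monomial of degree m is
   pulled back into the coefficient of x^m.\<close>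
 also have "\<dots> = (\<Sum>(m, j, l)\<in>(SIGMA m:{0..n}. {..m} \<times> {..n-m}). t (m - j) j (n - m - l) l)"
  by (rule sum.reindex_bij_witness[where j = "%(j, k, l). (k + l, l, j - l)"
     and i = "%(m, j, l). (j + l, m - j, j)"]) (auto simp: alg)
 also have "\<dots> = (\<Sum>m=0..n. \<Sum>j\<le>m. \<Sum>l\<le>n-m. t (m - j) j (n - m - l) l)"
  by (simp add: sum.Sigma)
 also have "\<dots> = row (psl c f * psl c g) n"
  unfolding row_mult row_pull_slope T_def[symmetric]
  by (intro sum.cong refl)
   (simp add: t_def sum_product power_add alg flip: fps_const_mult)
 finally show "row (psl c (f * g)) n = row (psl c f * psl c g) n" .
qed

lemma pull_slope_hom [simp]:
 "psl c 0 = 0" "psl c 1 = 1" "psl c (f + g) = psl c f + psl c g"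
 "psl c (cst a) = cst a" "psl c gX = gX"
 "psl c gY = gX * (gY + cst c)"
proof -
 show a: "psl c (cst a) = cst a" for a
 proof (rule germ_row_eqI)
  fix n
  have "row (psl c (cst a)) n = (\<Sum>j\<le>n. if j = 0 then fps_const (if n = 0 then a else 0) else 0)"
   unfolding row_pull_slope by (intro sum.cong) (auto simp: gc_const)
  thus "row (psl c (cst a)) n = row (cst a) n"
   by (auto simp: fps_eq_iff row_nth gc_const)
 qed
 show "psl c 0 = 0" "psl c 1 = 1" using a[of 0] a[of 1] by auto
 show "psl c (f + g) = psl c f + psl c g"
  by (rule germ_row_eqI)
   (simp add: row_add row_pull_slope sum.distrib alg flip: fps_const_add)
 show "psl c gX = gX"
 proof (rule germ_row_eqI)
  fix n
  have "row (psl c gX) n = (\<Sum>j\<le>n. if j = 0 then fps_const (if n = 1 then 1 else 0) else 0)"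
   unfolding row_pull_slope by (intro sum.cong) (auto simp: gc_X)
  thus "row (psl c gX) n = row gX n"
   by (auto simp: fps_eq_iff row_nth gc_X)
 qed
 show "psl c gY = gX * (gY + cst c)"
 proof (rule germ_row_eqI)
  fix n
  have "row (psl c gY) n = (\<Sum>j\<le>n. if j = 1 then (if n = 1 then fps_X + fps_const c else 0) else 0)"
   unfolding row_pull_slope by (intro sum.cong) (auto simp: gc_Y)
  thus "row (psl c gY) n = row (gX * (gY + cst c)) n"
   by (auto simp: fps_eq_iff row_nth gc_X_mult gc_Y gc_const)
 qed
qed

lemma pull_vertical_mult: "pvt (f * g) = pvt f * pvt g"
proof (rule germ_row_eqI)
 fix n
 show "row (pvt (f * g)) n = row (pvt f * pvt g) n"
  unfolding row_pull_vertical row_mult sum_distrib_left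
 proof (intro sum.cong refl)
  fix k assume "k : {0..n}"
  hence "fps_X ^ n = (fps_X ^ k * fps_X ^ (n - k) :: real fps)" by (simp flip: power_add)
  thus "fps_X ^ n * (row f k * row g (n - k)) = fps_X ^ k * row f k * (fps_X ^ (n - k) * row g (n - k))"
   by simp
 qed
qed

lemma gc_pull_vertical: "gc (pvt f) i j = (if j < i then 0 else gc f i (j - i))"
 by (simp add: row_nth[symmetric] row_pull_vertical fps_X_power_mult_nth)

lemma pull_vertical_hom [simp]:
 "pvt 0 = 0" "pvt 1 = 1" "pvt (f + g) = pvt f + pvt g"
 "pvt (cst a) = cst a" "pvt gX = gX * gY"
 "pvt gY = gY"
 by (rule germ_eqI; force simp: gc_pull_vertical gc_1 gc_const gc_X gc_Y gc_X_mult)+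

text \<open>By \<open>germ_decomp\<close> the value D f is a combination of values of D with factors
  u and v, so it lies in every step of the filtration \<open>Ord\<close>. Applied to the difference
  of two sides, this proves identities between operations on germs without touching coefficients.
  The target is abstract because it will be the ring of germs or that of power series.\<close>

lemma germ_zeroI:
 fixes D :: "germ => 'r::comm_ring_1" and Ord :: "nat => 'r => bool"
 assumes add: "!!f g. D (f + g) = D f + D g" and const: "!!c. D (cst c) = 0"
  and X: "!!f. D (gX * f) = u * D f" and Y: "!!f. D (gY * f) = v * D f"
  and O0: "!!a. Ord 0 a" and Oadd: "!!n a b. Ord n a ==> Ord n b ==> Ord n (a + b)"
  and Ou: "!!n a. Ord n a ==> Ord (Suc n) (u * a)" and Ov: "!!n a. Ord n a ==> Ord (Suc n) (v * a)"
  and sep: "!!a. (!!n. Ord n a) ==> a = 0"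
 shows "D f = 0"
proof (rule sep)
 fix n show "Ord n (D f)"
 proof (induction n arbitrary: f)
  case (Suc n)
  have "D f = u * D (shx 1 f) + v * D (shy 1 (row0 f))"
   by (subst germ_decomp) (simp add: add const X Y)
  thus ?case using Suc Oadd Ou Ov by metis
 qed (rule O0)
qed

text \<open>Membership in the n-th power of the maximal ideal.\<close>

definition ogeq :: "nat => germ => bool" where
 "ogeq n f <-> (\<forall>i j. i + j < n --> gc f i j = 0)"

lemma ogeq_mult: "ogeq n f ==> ogeq m g ==> ogeq (n + m) (f * g)"
 unfolding ogeq_def gc_mult
proof (intro allI impI sum.neutral ballI)
 fix i j k l
 assume a: "\<forall>i j. i + j < n --> gc f i j = 0" "\<forall>i j. i + j < m --> gc g i j = 0"
  and "i + j < n + m" "k : {0..i}" "l : {0..j}"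
 hence "k + l < n \<or> (i - k) + (j - l) < m" by auto
 with a show "gc f k l * gc g (i - k) (j - l) = 0" by auto
qed
lemma ogeq_0: "ogeq 0 f" by (simp add: ogeq_def)
lemma ogeq_1: "ogeq (Suc 0) f <-> gc f 0 0 = 0" by (simp add: ogeq_def)
lemma ogeq_add: "ogeq n f ==> ogeq n g ==> ogeq n (f + g)" by (simp add: ogeq_def)

lemma germ_zeroI':
 assumes "!!f g. D (f + g) = D f + D g" "!!c. D (cst c) = 0"
  and "!!f. D (gX * f) = u * D f" "!!f. D (gY * f) = v * D f"
  and "gc u 0 0 = 0" "gc v 0 0 = 0"
 shows "D f = (0 :: germ)"
proof -
 have mult: "ogeq (Suc n) (w * a)" if "gc w 0 0 = 0" "ogeq n a" for n a w
  using ogeq_mult[of "Suc 0" w n a] that by (simp add: ogeq_1)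
 have sep: "a = 0" if "!!n. ogeq n a" for a
  by (rule germ_eqI) (use that[unfolded ogeq_def] in \<open>metis gc_0 lessI\<close>)
 show ?thesis
  by (rule germ_zeroI[where Ord = ogeq and u = u and v = v])
   (use assms mult sep in \<open>auto simp: ogeq_0 ogeq_add\<close>)
qed

lemma pull_vertical_swap: "pvt f = swp (psl 0 (swp f))"
proof -
 have "pvt f - swp (psl 0 (swp f)) = 0"
  by (rule germ_zeroI'[where u = "gX * gY" and v = gY])
   (auto simp: pull_vertical_mult pull_slope_mult alg)
 thus ?thesis by simp
qed

lemma pull1_hom [simp]:
 "pull1 d 0 = 0" "pull1 d 1 = 1" "pull1 d (f + g) = pull1 d f + pull1 d g"
 "pull1 d (f * g) = pull1 d f * pull1 d g" "pull1 d (cst c) = cst c"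
 by (cases d; simp add: pull_slope_mult pull_vertical_mult)+

lemma pull_hom [simp]:
 "pull p 0 = 0" "pull p 1 = 1" "pull p (f + g) = pull p f + pull p g"
 "pull p (f * g) = pull p f * pull p g" "pull p (cst c) = cst c"
 by (induction p arbitrary: f g c) auto
lemma pull_uminus [simp]: "pull p (- f) = - pull p f"
 using pull_hom(3)[of p f "- f"] by (simp add: eq_neg_iff_add_eq_0 add.commute)
lemma pull_diff [simp]: "pull p (f - g) = pull p f - pull p g"
 using pull_hom(3)[of p f "- g"] by simp
lemma pull_power [simp]: "pull p (f ^ n) = pull p f ^ n" by (induction n) auto
lemma pull_sum: "pull p (sum F A) = (\<Sum>a\<in>A. pull p (F a))"
 by (induction A rule: infinite_finite_induct) auto
lemma pull_prod: "pull p (prod F A) = (\<Prod>a\<in>A. pull p (F a))"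
 by (induction A rule: infinite_finite_induct) auto
lemma pull_dvd: "f dvd g ==> pull p f dvd pull p g" by auto
lemma pull_append: "pull (p @ q) f = pull q (pull p f)"
 by (induction p arbitrary: f) auto
lemma pull_1_eq: "pull [d] f = pull1 d f" by simp

lemma at0_pull_slope [simp]: "gc (psl c f) 0 0 = gc f 0 0"
 using row_pull_slope[of c f 0] by (simp flip: row_nth)
lemma at0_pull1 [simp]: "gc (pull1 d f) 0 0 = gc f 0 0"
 by (cases d) (auto simp: pull_vertical_swap)
lemma at0_pull [simp]: "gc (pull p f) 0 0 = gc f 0 0"
 by (induction p arbitrary: f) auto

text \<open>The defect of each rule kills constants, and multiplying its argument by a coordinate
  multiplies it by the pulled back coordinate; so \<open>germ_zeroI'\<close> applies.\<close>

lemma chain_rule: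
 "Dx (pull p f) = pull p (Dx f) * Dx (pull p gX) + pull p (Dy f) * Dx (pull p gY)"
 "Dy (pull p f) = pull p (Dx f) * Dy (pull p gX) + pull p (Dy f) * Dy (pull p gY)"
proof -
 have "Dx (pull p f) - (pull p (Dx f) * Dx (pull p gX) + pull p (Dy f) * Dx (pull p gY)) = 0"
  by (rule germ_zeroI'[where u = "pull p gX" and v = "pull p gY"])
   (auto simp: dx_mult dy_mult alg)
 moreover have "Dy (pull p f) - (pull p (Dx f) * Dy (pull p gX) + pull p (Dy f) * Dy (pull p gY)) = 0"
  by (rule germ_zeroI'[where u = "pull p gX" and v = "pull p gY"])
   (auto simp: dx_mult dy_mult alg)
 ultimately show
  "Dx (pull p f) = pull p (Dx f) * Dx (pull p gX) + pull p (Dy f) * Dx (pull p gY)"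
  "Dy (pull p f) = pull p (Dx f) * Dy (pull p gX) + pull p (Dy f) * Dy (pull p gY)"
  by auto
qed

lemma pull_form_scale: "plf p (scl h om) = scl (pull p h) (plf p om)"
 by (simp add: pull_form_def scale_form_def alg)
lemma pull_form_append: "plf (p @ q) om = plf q (plf p om)"
 using chain_rule[of q "pull p gX"] chain_rule[of q "pull p gY"]
 by (simp add: pull_form_def pull_append alg)
lemma pull_form_Nil [simp]: "plf [] om = om"
 by (simp add: pull_form_def)

definition jac :: "point => germ" where
 "jac p = Dx (pull p gX) * Dy (pull p gY) - Dx (pull p gY) * Dy (pull p gX)"

lemma wedge_pull: "wdg (plf p om) (pull p f) = pull p (wdg om f) * jac p"
 unfolding wedge_d_def pull_form_def jac_def chain_rule[of p f] by (simp add: alg)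

lemma wedge_mult: "wdg om (f * g) = f * wdg om g + g * wdg om f"
 by (simp add: wedge_d_def dx_mult dy_mult alg)
lemma wedge_scale: "wdg (scl h om) f = h * wdg om f"
 by (simp add: wedge_d_def scale_form_def alg)

section \<open>Order and strict transform under one blow-up\<close>

definition vord :: "germ => nat" where
 "vord f = (LEAST n. \<exists>i j. i + j = n & gc f i j ~= 0)"

lemma vord_props:
 assumes "f ~= 0"
 shows "\<exists>i j. i + j = vord f & gc f i j ~= 0" "i + j < vord f ==> gc f i j = 0"
proof -
 have "\<exists>n i j. i + j = n & gc f i j ~= 0" using assms germ_eqI[of f 0] by auto
 thus "\<exists>i j. i + j = vord f & gc f i j ~= 0"
  unfolding vord_def by (rule LeastI_ex)
 show "gc f i j = 0" if "i + j < vord f"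
  using not_less_Least[OF that[unfolded vord_def]] by blast
qed

lemma vord_eqI: "(!!i j. i + j < n ==> gc f i j = 0) ==> i + j = n ==> gc f i j ~= 0 ==> vord f = n"
 unfolding vord_def by (rule Least_equality) (auto simp: not_less intro: ccontr leI)

lemma vord_swap [simp]: "vord (swp f) = vord f"
 by (simp add: vord_def) (metis add.commute)

lemma germ_ord_eq: "germ_ord f = (if f = 0 then \<infinity> else enat (vord f))"
proof (cases "f = 0")
 case False
 have "germ_ord f = enat (vord f)" unfolding germ_ord_def
 proof (rule antisym)
  show "Inf {enat (i + j) |i j. gc f i j ~= 0} \<le> enat (vord f)"
  proof (rule Inf_lower)
   obtain i j where "i + j = vord f" "gc f i j ~= 0" using vord_props(1)[OF False] by blast
   thus "enat (vord f) : {enat (i + j) |i j. gc f i j ~= 0}"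
    by (metis (mono_tags, lifting) mem_Collect_eq)
  qed
  show "enat (vord f) \<le> Inf {enat (i + j) |i j. gc f i j ~= 0}"
   using vord_props(2)[OF False] by (intro Inf_greatest) (auto simp: not_less intro: leI)
 qed
 with False show ?thesis by simp
qed (simp add: germ_ord_def top_enat_def)

lemma nth_linear_power:
 "cf ((fps_X + fps_const (c::real)) ^ m) k = (if k > m then 0 else of_nat (m choose k) * c ^ (m - k))"
proof (induction m arbitrary: k)
 case (Suc m)
 have "c * c ^ (m - Suc j) = c ^ (m - j)" if "j < m" for j
  using that by (metis Suc_diff_Suc power_Suc)
 thus ?case
  by (cases k) (auto simp: Suc alg)
qed (auto simp: not_less)

text \<open>The coefficient of x^n is the homogeneous part of degree n evaluated at (1, y + c). Its
  highest exponent J in y + c cannot cancel.\<close>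

lemma row_pull_slope_eq_0:
 "row (psl c f) n = 0 <-> (\<forall>j\<le>n. gc f (n - j) j = 0)"
proof
 assume 0: "row (psl c f) n = 0"
 show "\<forall>j\<le>n. gc f (n - j) j = 0"
 proof (rule ccontr)
  assume "~ (\<forall>j\<le>n. gc f (n - j) j = 0)"
  hence ne: "{j. j \<le> n & gc f (n - j) j ~= 0} ~= {}" by auto
  define J where "J = Max {j. j \<le> n & gc f (n - j) j ~= 0}"
  have fin: "finite {j. j \<le> n & gc f (n - j) j ~= 0}" by simp
  have J: "J \<le> n" "gc f (n - J) J ~= 0" using Max_in[OF fin ne] by (auto simp: J_def)
  have big: "gc f (n - j) j = 0" if "j > J" "j \<le> n" for j
   using Max_ge[OF fin, of j] that by (fastforce simp: J_def)
  have "cf (row (psl c f) n) J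
   = (\<Sum>j\<le>n. gc f (n - j) j * cf ((fps_X + fps_const c) ^ j) J)"
   by (simp add: row_pull_slope fps_sum_nth)
  also have "\<dots> = (\<Sum>j\<le>n. if j = J then gc f (n - J) J else 0)"
   by (intro sum.cong refl) (auto simp: nth_linear_power big)
  finally show False using 0 J by simp
 qed
qed (simp add: row_pull_slope)

lemma X_power_dvd_iff: "gX ^ n dvd f <-> (\<forall>i<n. \<forall>j. gc f i j = 0)"
proof (induction n arbitrary: f)
 case (Suc n)
 show ?case
 proof
  assume "gX ^ Suc n dvd f"
  then obtain g where g: "f = gX * g" "gX ^ n dvd g"
   by auto
  show "\<forall>i<Suc n. \<forall>j. gc f i j = 0"
   using Suc[of g] g by (auto simp: gc_X_mult)
 next
  assume *: "\<forall>i<Suc n. \<forall>j. gc f i j = 0"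
  hence "f = gX * shx 1 f" by (intro germ_eqI) (auto simp: gc_X_mult)
  moreover have "gX ^ n dvd shx 1 f" using * by (subst Suc) auto
  ultimately show "gX ^ Suc n dvd f" by auto
 qed
qed auto

lemma gc_X_power_mult: "gc (gX ^ n * f) i j = (if i < n then 0 else gc f (i - n) j)"
 by (induction n arbitrary: i) (auto simp: mult.assoc gc_X_mult)
lemma X_power_shx: "gX ^ n dvd f ==> f = gX ^ n * shx n f"
 by (rule germ_eqI) (auto simp: gc_X_power_mult)

text \<open>Restriction to x = 0 is the row of index 0, a multiplicative map into a domain whose
  kernel is generated by x.\<close>

lemma prime_X: "prm gX"
proof (rule prime_elemI)
 show "~ gX dvd 1" by (auto simp: X_dvd_iff gc_1)
 fix a b assume "gX dvd a * b"
 hence "row (a * b) 0 = 0"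
  by (auto simp: X_dvd_iff row_nth[symmetric] fps_eq_iff)
 hence "row a 0 = 0 \<or> row b 0 = 0" by (simp add: row_mult)
 thus "gX dvd a \<or> gX dvd b" by (auto simp: X_dvd_iff row_nth[symmetric])
qed simp
lemma prime_Y: "prm gY"
proof (rule prime_elemI)
 show "~ gY dvd 1" by (auto simp: Y_dvd_iff gc_1)
 fix a b assume "gY dvd a * b"
 hence "gX dvd swp a * swp b"
  by (metis swap_dvd_iff swap_hom(8) swap_mult)
 hence "gX dvd swp a \<or> gX dvd swp b"
  using prime_X prime_elem_dvd_mult_iff by blast
 thus "gY dvd a \<or> gY dvd b" by (metis swap_dvd_iff swap_hom(7,9))
qed simp

lemma prime_power_mult_eq:
 fixes q :: "'a::algebraic_semidom"
 assumes "prm q" "q ^ n * a = q ^ m * b" "~ q dvd a" "~ q dvd b"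
 shows "n = m & a = b"
proof -
 have le: "n \<le> m" if "q ^ n * a = q ^ m * b" "~ q dvd b" for n m and a b :: 'a
 proof (rule ccontr)
  assume "~ n \<le> m"
  then obtain k where k: "n = m + Suc k" using less_iff_Suc_add by (metis add_Suc_right not_le)
  have "q ^ m * (q * (q ^ k * a)) = q ^ m * b"
   using that(1) k by (simp add: power_add mult.assoc mult.left_commute)
  moreover have "q ^ m ~= 0" using assms(1) by simp
  ultimately have "q * (q ^ k * a) = b" by auto
  thus False using that by auto
 qed
 have "n = m" using le[of n a m b] le[of m b n a] assms by auto
 moreover have "q ^ m ~= 0" using assms(1) by simp
 ultimately show ?thesis using assms(2) by auto
qed

lemma pull_slope_factor:
 assumes "f ~= 0"
 shows "psl c f = gX ^ vord f * shx (vord f) (psl c f)"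
  "~ gX dvd shx (vord f) (psl c f)"
proof -
 have "row (psl c f) i = 0" if "i < vord f" for i
  unfolding row_pull_slope_eq_0 using vord_props(2)[OF assms] that by auto
 hence "gX ^ vord f dvd psl c f"
  unfolding X_power_dvd_iff by (simp flip: row_nth)
 thus "psl c f = gX ^ vord f * shx (vord f) (psl c f)"
  by (rule X_power_shx)
 have "row (psl c f) (vord f) ~= 0"
  unfolding row_pull_slope_eq_0 using vord_props(1)[OF assms] by (metis diff_add_inverse2 le_add2)
 thus "~ gX dvd shx (vord f) (psl c f)"
  by (auto simp: X_dvd_iff fps_eq_iff row_nth)
qed

lemma pull_slope_eq_0 [simp]: "psl c f = 0 <-> f = 0"
proof
 assume 0: "psl c f = 0"
 show "f = 0"
 proof (rule ccontr)
  assume "f ~= 0"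
  from pull_slope_factor(2)[OF this, of c] show False
   by (auto simp: 0 X_dvd_iff)
 qed
qed simp
lemma pull1_eq_0 [simp]: "pull1 d f = 0 <-> f = 0"
 by (cases d) (auto simp: pull_vertical_swap)
lemma pull_eq_0 [simp]: "pull p f = 0 <-> f = 0"
 by (induction p arbitrary: f) auto
lemma pull_eq_iff [simp]: "pull p f = pull p g <-> f = g"
 using pull_eq_0[of p "f - g"] by simp

text \<open>Local equation of the new exceptional divisor. Below it, \<open>st1\<close> is the
  strict transform of an equation: the pull-back divided by the exact power of the exceptional
  equation.\<close>

fun ex :: "direction => germ" where
 "ex (Sl c) = gX" | "ex Vt = gY"

fun st1 :: "direction => germ => germ" where
 "st1 (Sl c) f = shx (vord f) (psl c f)"
| "st1 Vt f = swp (shx (vord f) (psl 0 (swp f)))"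

lemma prime_ex: "prm (ex d)" by (cases d) (auto simp: prime_X prime_Y)

lemma pull1_factor:
 assumes "f ~= 0"
 shows "pull1 d f = ex d ^ vord f * st1 d f" "~ ex d dvd st1 d f"
proof -
 have "pull1 d f = ex d ^ vord f * st1 d f & ~ ex d dvd st1 d f"
 proof (cases d)
  case (Slope c)
  thus ?thesis using pull_slope_factor[OF assms, of c] by auto
 next
  case Vertical
  have "swp f ~= 0" using assms by simp
  from pull_slope_factor[OF this, of 0] Vertical show ?thesis
   by (auto simp: pull_vertical_swap) (metis swap_hom(7) swap_mult swap_power, metis swap_dvd_iff swap_hom(8) swap_hom(9))
 qed
 thus "pull1 d f = ex d ^ vord f * st1 d f" "~ ex d dvd st1 d f" by auto
qed

text \<open>Any factorization of the pull-back with a cofactor not divisible by the exceptional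
  equation yields order and strict transform at once. This is how both are computed later.\<close>

lemma pull1_factor_unique:
 assumes "pull1 d f = ex d ^ n * g" "~ ex d dvd g"
 shows "vord f = n" "st1 d f = g"
proof -
 have "f ~= 0"
 proof
  assume "f = 0"
  with assms(1) have "g = 0" using prime_ex[of d] by simp
  with assms(2) show False by simp
 qed
 note f = pull1_factor[OF this, of d]
 have "ex d ^ vord f * st1 d f = ex d ^ n * g" using f(1) assms(1) by metis
 from prime_power_mult_eq[OF prime_ex this f(2) assms(2)]
 show "vord f = n" "st1 d f = g" by blast+
qed

text \<open>Multiply the two factorizations: the exceptional equation is prime, so it does not
  divide the product of the strict transforms.\<close>

lemma vord_mult: "f ~= 0 ==> g ~= 0 ==> vord (f * g) = vord f + vord g"
 and st1_mult: "f ~= 0 ==> g ~= 0 ==> st1 d (f * g) = st1 d f * st1 d g"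
proof -
 assume fg: "f ~= 0" "g ~= 0"
 have *: "pull1 d (f * g) = ex d ^ (vord f + vord g) * (st1 d f * st1 d g)" for d
  using pull1_factor(1)[OF fg(1), of d] pull1_factor(1)[OF fg(2), of d]
  by (simp add: power_add)
 have **: "~ ex d dvd st1 d f * st1 d g" for d
  using pull1_factor(2)[OF fg(1), of d] pull1_factor(2)[OF fg(2), of d] prime_ex
  by (simp add: prime_elem_dvd_mult_iff)
 show "vord (f * g) = vord f + vord g" "st1 d (f * g) = st1 d f * st1 d g"
  using pull1_factor_unique[OF * **] by auto
qed

lemma st1_neq_0 [simp]: "f ~= 0 ==> st1 d f ~= 0"
 using pull1_factor(2)[of f d] by auto

section \<open>Weierstrass division\<close>

definition psum :: "real => nat => real fps => real" where
 "psum s n a = (\<Sum>j<n. \<bar>cf a j\<bar> * s ^ j)"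

text \<open>The weighted l1 norm of radius s is at most M, phrased with partial sums so that no
  convergence has to be carried along.\<close>

definition bnd :: "real => real fps => real => bool" where
 "bnd s a M <-> (\<forall>n. psum s n a \<le> M)"

lemma psum_nonneg: "0 \<le> s ==> 0 \<le> psum s n a"
 unfolding psum_def by (intro sum_nonneg) auto

lemma psum_add: "0 \<le> s ==> psum s n (a + b) \<le> psum s n a + psum s n b"
 unfolding psum_def sum.distrib[symmetric]
 by (intro sum_mono) (metis abs_triangle_ineq distrib_right fps_add_nth mult_right_mono zero_le_power)

lemma psum_uminus [simp]: "psum s n (- a) = psum s n a"
 by (simp add: psum_def)

lemma psum_mult:
 assumes "0 \<le> s" shows "psum s n (a * b) \<le> psum s n a * psum s n b"
proof -
 define t where "t i k = (\<bar>cf a i\<bar> * s ^ i) * (\<bar>cf b k\<bar> * s ^ k)" for i k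
 have "psum s n (a * b) \<le> (\<Sum>j<n. \<Sum>i\<le>j. t i (j - i))"
  unfolding psum_def
 proof (rule sum_mono)
  fix j
  have "\<bar>cf (a * b) j\<bar> * s ^ j \<le> (\<Sum>i=0..j. \<bar>cf a i * cf b (j - i)\<bar>) * s ^ j"
   unfolding fps_mult_nth using assms by (intro mult_right_mono sum_abs) auto
  also have "\<dots> = (\<Sum>i\<le>j. t i (j - i))"
   unfolding sum_distrib_right atLeast0AtMost
   by (intro sum.cong refl) (simp add: t_def abs_mult flip: power_add)
  finally show "\<bar>cf (a * b) j\<bar> * s ^ j \<le> (\<Sum>i\<le>j. t i (j - i))" .
 qed
 also have "\<dots> = (\<Sum>(i, k)\<in>{(i, k). i + k < n}. t i k)"
  by (rule sum.triangle_reindex[symmetric])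
 also have "\<dots> \<le> (\<Sum>(i, k)\<in>{..<n} \<times> {..<n}. t i k)"
  using assms by (intro sum_mono2) (auto simp: t_def)
 also have "\<dots> = psum s n a * psum s n b"
  by (simp add: psum_def t_def sum_product sum.cartesian_product)
 finally show ?thesis .
qed

lemma bnd_nonneg: "bnd s a M ==> 0 \<le> M"
 unfolding bnd_def by (metis lessThan_0 psum_def sum.empty)
lemma bnd_add: "0 \<le> s ==> bnd s a M ==> bnd s b N ==> bnd s (a + b) (M + N)"
 unfolding bnd_def by (meson add_mono order_trans psum_add)
lemma bnd_uminus [simp]: "bnd s (- a) M <-> bnd s a M"
 unfolding bnd_def by simp
lemma bnd_diff: "0 \<le> s ==> bnd s a M ==> bnd s b N ==> bnd s (a - b) (M + N)"
 using bnd_add[of s a M "- b" N] by simp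
lemma bnd_mult: "0 \<le> s ==> bnd s a M ==> bnd s b N ==> bnd s (a * b) (M * N)"
 unfolding bnd_def by (meson mult_mono order_trans psum_mult psum_nonneg)
lemma bnd_mono: "bnd s a M ==> M \<le> N ==> bnd s a N"
 unfolding bnd_def by (meson order_trans)
lemma bnd_0: "bnd s 0 0" by (simp add: bnd_def psum_def)
lemma bnd_sum:
 assumes "0 \<le> s" "!!i. i : A ==> bnd s (F i) (M i)"
 shows "bnd s (sum F A) (sum M A)"
 using assms(2) by (induction A rule: infinite_finite_induct) (auto simp: bnd_0 bnd_add assms(1))
lemma bnd_nth:
 assumes "0 \<le> s" "bnd s a M" shows "\<bar>cf a j\<bar> * s ^ j \<le> M"
proof -
 have "\<bar>cf a j\<bar> * s ^ j \<le> psum s (Suc j) a"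
  unfolding psum_def using assms(1) by (intro member_le_sum) auto
 also have "\<dots> \<le> M" using assms(2) unfolding bnd_def by blast
 finally show ?thesis .
qed

lemma bnd_shift:
 assumes "0 < s" "bnd s a M" shows "bnd s (fps_shift k a) (M / s ^ k)"
 unfolding bnd_def
proof
 fix n
 have "psum s n (fps_shift k a) * s ^ k = (\<Sum>j<n. \<bar>cf a (j + k)\<bar> * s ^ (j + k))"
  by (simp add: psum_def sum_distrib_right power_add mult.assoc)
 also have "\<dots> = (\<Sum>j\<in>{k..<n+k}. \<bar>cf a j\<bar> * s ^ j)"
  by (rule sum.reindex_bij_witness[where i = "%j. j - k" and j = "%j. j + k"]) auto
 also have "\<dots> \<le> psum s (n + k) a"
  unfolding psum_def using assms(1) by (intro sum_mono2) auto
 also have "\<dots> \<le> M" using assms(2) by (simp add: bnd_def)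
 finally show "psum s n (fps_shift k a) \<le> M / s ^ k"
  using assms(1) by (simp add: field_simps)
qed

lemma geometric_psum:
 assumes "0 \<le> z" "z \<le> 1 / (2::real)" shows "(\<Sum>j<n. z ^ j) \<le> 2"
proof -
 have "(\<Sum>j<n. z ^ j) \<le> (\<Sum>j<n. (1 / 2) ^ j)" using assms by (intro sum_mono power_mono) auto
 also have "\<dots> = 2 - 2 * (1 / 2) ^ n" by (induction n) (auto)
 finally moreover have "0 \<le> (1 / 2 :: real) ^ n" by simp
 ultimately show ?thesis by linarith
qed

text \<open>For radii up to 1/(2R) the geometric series in y is at most 2, so the norm of row i is
  controlled by R^i alone. The factor 2 is put into C.\<close>

lemma germ_bnd:
 obtains C R where "1 \<le> R" "1 \<le> C"
  "!!s i. 0 < s ==> s \<le> 1 / (2 * R) ==> bnd s (row f i) (C * R ^ i)"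
  "!!i j. \<bar>gc f i j\<bar> \<le> C * R ^ (i + j)"
proof -
 obtain C R where CR: "1 \<le> R" "1 \<le> C" "!!i j. \<bar>gc f i j\<bar> \<le> C * R ^ (i + j)"
  by (rule germ_bound[of f]) blast
 show ?thesis
 proof (rule that[of R "2 * C"])
  fix s :: real and i assume s: "0 < s" "s \<le> 1 / (2 * R)"
  show "bnd s (row f i) (2 * C * R ^ i)" unfolding bnd_def
  proof
   fix n
   have "psum s n (row f i) \<le> (\<Sum>j<n. C * R ^ i * (R * s) ^ j)"
    unfolding psum_def
   proof (rule sum_mono)
    fix j
    have "\<bar>cf (row f i) j\<bar> * s ^ j \<le> C * R ^ (i + j) * s ^ j"
     using CR(3)[of i j] s by (intro mult_right_mono) (auto simp: row_nth)
    thus "\<bar>cf (row f i) j\<bar> * s ^ j \<le> C * R ^ i * (R * s) ^ j"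
     by (simp add: power_add power_mult_distrib)
   qed
   also have "\<dots> \<le> C * R ^ i * 2"
    unfolding sum_distrib_left[symmetric] using s CR
    by (intro mult_left_mono geometric_psum) (auto simp: field_simps)
   finally show "psum s n (row f i) \<le> 2 * C * R ^ i" by simp
  qed
 next
  fix i j
  show "\<bar>gc f i j\<bar> \<le> 2 * C * R ^ (i + j)"
  using CR(3)[of i j] by auto
 qed (use CR in auto)
qed

lemma mk_germ_bnd:
 assumes "0 < s" "0 < R" "!!i. bnd s (q i) (C * R ^ i)"
 shows "row (mk_germ (%i j. cf (q i) j)) i = q i"
proof -
 have C: "0 \<le> C" using bnd_nonneg[OF assms(3)[of 0]] by simp
 have "gc (mk_germ (%i j. cf (q i) j)) i j = cf (q i) j" for i j
 proof (rule gc_mk_germ[of "max R (1 / s)" _ C])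
  fix i j
  have "\<bar>cf (q i) j\<bar> \<le> C * R ^ i * (1 / s) ^ j"
   using bnd_nth[OF _ assms(3)[of i], of j] assms(1) by (simp add: field_simps)
  also have "\<dots> \<le> C * (max R (1 / s)) ^ i * (max R (1 / s)) ^ j"
   using C assms by (intro mult_mono power_mono) auto
  finally show "\<bar>cf (q i) j\<bar> \<le> C * max R (1 / s) ^ (i + j)"
   by (simp add: power_add)
 qed (use assms in auto)
 thus ?thesis by (simp add: fps_eq_iff row_nth)
qed

text \<open>Row by row solution of a convolution equation. With L the multiplication by the inverse
  of the first row it inverts a germ; with L the shift by k it performs Weierstrass
  division.\<close>

function qrec :: "(real fps => real fps) => (nat => real fps) => (nat => real fps) => nat => real fps" where
 "qrec L F H n = L (F n - (\<Sum>l<n. H (n - l) * qrec L F H l))"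
 by pat_completeness auto
termination by (relation "Wellfounded.measure (%(L, F, H, n). n)") auto
declare qrec.simps [simp del]

text \<open>The growth rate z = 1 + K C is the one for which (z - 1)(1 + z + ... + z^(n-1)) = z^n -
  1 reproduces the induction hypothesis without loss.\<close>

lemma bnd_qrec:
 assumes "0 < s" "0 < K" "0 < C" "0 < R"
  and L: "!!a M. bnd s a M ==> bnd s (L a) (K * M)"
  and F: "!!i. bnd s (F i) (C * R ^ i)" and H: "!!i. bnd s (H i) (C * R ^ i)"
 shows "bnd s (qrec L F H n) (K * C * (R * (1 + K * C)) ^ n)"
proof (induction n rule: less_induct)
 case (less n)
 define z where "z = 1 + K * C"
 have "bnd s (F n - (\<Sum>l<n. H (n - l) * qrec L F H l))
  (C * R ^ n + (\<Sum>l<n. C * R ^ (n - l) * (K * C * (R * z) ^ l)))"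
  using assms(1) less F H unfolding z_def by (intro bnd_diff bnd_sum bnd_mult) auto
 hence "bnd s (qrec L F H n) (K * (C * R ^ n + (\<Sum>l<n. C * R ^ (n - l) * (K * C * (R * z) ^ l))))"
  by (subst qrec.simps) (rule L)
 also have "(\<Sum>l<n. C * R ^ (n - l) * (K * C * (R * z) ^ l)) = (\<Sum>l<n. C * R ^ n * ((z - 1) * z ^ l))"
 proof (intro sum.cong refl)
  fix l assume "l : {..<n}"
  hence "R ^ n = R ^ (n - l) * R ^ l" by (simp flip: power_add)
  thus "C * R ^ (n - l) * (K * C * (R * z) ^ l) = C * R ^ n * ((z - 1) * z ^ l)"
   by (simp add: z_def power_mult_distrib)
 qed
 also have "\<dots> = C * R ^ n * (z ^ n - 1)"
  unfolding sum_distrib_left[symmetric] by (simp only: power_diff_1_eq)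
 also have "K * (C * R ^ n + C * R ^ n * (z ^ n - 1)) = K * C * (R * z) ^ n"
  by (simp add: alg)
 finally show ?case by (simp add: z_def)
qed

text \<open>Write a = 1 - h. At radius at most 1/(4CR) the norm of h is at most 1/2, and 1/a = 1 +
  h/a bounds the norm of 1/a by 1 plus half of itself. Partial sums are finite, so this can be
  solved.\<close>

lemma bnd_inverse_small:
 assumes "!!j. \<bar>cf a j\<bar> \<le> C * R ^ j" "1 \<le> R" "1 \<le> C" "cf a 0 = 1" "0 < s" "s \<le> 1 / (4 * C * R)"
 shows "bnd s (inverse a) 2"
 unfolding bnd_def
proof
 fix n
 define h where "h = 1 - a"
 have h: "cf h 0 = 0" "cf h (Suc j) = - cf a (Suc j)" for j
  using assms(4) by (auto simp: h_def)
 have Rs: "R * s \<le> 1 / (4 * C)" using assms by (simp add: field_simps)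
 have "1 / (4 * C) \<le> 1 / 2" using assms(3) by simp
 hence Rs2: "R * s \<le> 1 / 2" using Rs by simp
 have ph: "psum s n h \<le> 1 / 2"
 proof (cases n)
  case (Suc m)
  have "psum s n h = (\<Sum>j<m. \<bar>cf a (Suc j)\<bar> * s ^ Suc j)"
   unfolding psum_def Suc sum.lessThan_Suc_shift by (simp add: h)
  also have "\<dots> \<le> (\<Sum>j<m. C * (R * s) * (R * s) ^ j)"
  proof (rule sum_mono)
   fix j
   have "\<bar>cf a (Suc j)\<bar> * s ^ Suc j \<le> C * R ^ Suc j * s ^ Suc j"
    using assms(1)[of "Suc j"] assms(5) by simp
   thus "\<bar>cf a (Suc j)\<bar> * s ^ Suc j \<le> C * (R * s) * (R * s) ^ j"
    by (simp add: alg)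
  qed
  also have "\<dots> \<le> C * (R * s) * 2"
   unfolding sum_distrib_left[symmetric] using assms Rs2
   by (intro mult_left_mono geometric_psum) auto
  also have "\<dots> \<le> C * (1 / (4 * C)) * 2" using Rs assms(3) by (intro mult_right_mono mult_left_mono) auto
  also have "\<dots> = 1 / 2" using assms(3) by simp
  finally show ?thesis .
 qed (simp add: psum_def)
 have "inverse a * a = 1" using assms(4) by auto
 hence "inverse a = 1 + h * inverse a" by (simp add: h_def alg)
 hence "psum s n (inverse a) \<le> psum s n 1 + psum s n (h * inverse a)"
  by (metis psum_add assms(5) less_imp_le)
 also have "psum s n 1 \<le> 1"
 proof -
  have "psum s n 1 = (\<Sum>j<n. if j = 0 then 1 else 0)" unfolding psum_def by (intro sum.cong) auto
  thus ?thesis by simp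
 qed
 also have "psum s n (h * inverse a) \<le> psum s n h * psum s n (inverse a)"
  using psum_mult assms(5) by simp
 also have "\<dots> \<le> 1 / 2 * psum s n (inverse a)"
  using ph psum_nonneg[of s n "inverse a"] assms(5) by (intro mult_right_mono) auto
 finally show "psum s n (inverse a) \<le> 2" by simp
qed

lemma is_unit_at0_1: assumes "gc f 0 0 = 1" shows "is_unit f"
proof -
 obtain C R where CR: "1 \<le> R" "1 \<le> C"
  "!!s i. 0 < s ==> s \<le> 1 / (2 * R) ==> bnd s (row f i) (C * R ^ i)"
  "!!i j. \<bar>gc f i j\<bar> \<le> C * R ^ (i + j)"
  by (rule germ_bnd[of f]) blast
 define s where "s = 1 / (4 * C * R)"
 have s: "0 < s" "s \<le> 1 / (2 * R)" using CR(1,2) by (auto simp: s_def field_simps)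
 have inv: "bnd s (inverse (row f 0)) 2"
  by (rule bnd_inverse_small[of _ C R]) (use CR(4)[of 0] CR(1,2) s assms in \<open>auto simp: row_nth s_def\<close>)
 define q where "q = qrec (%a. inverse (row f 0) * a) (row 1) (row f)"
 have one: "bnd s (row 1 i) (C * R ^ i)" for i
 proof -
  have "psum s n (row 1 i) = (\<Sum>j<n. if j = 0 then (if i = 0 then 1 else 0) else 0)" for n
   unfolding psum_def by (intro sum.cong) (auto simp: row_nth gc_1)
  hence "psum s n (row 1 i) \<le> 1" for n by auto
  moreover have "1 * 1 \<le> C * R ^ i" using CR(1,2) by (intro mult_mono) auto
  ultimately show ?thesis unfolding bnd_def by (metis mult_1 order_trans)
 qed
 have "bnd s (q n) (2 * C * (R * (1 + 2 * C)) ^ n)" for n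
  unfolding q_def
  by (rule bnd_qrec) (use s CR(1,2) CR(3)[OF s] one inv in \<open>auto intro!: bnd_mult\<close>)
 hence rq: "row (mk_germ (%i j. cf (q i) j)) i = q i" for i
  using s CR(1,2) by (intro mk_germ_bnd[where R = "R * (1 + 2 * C)"]) auto
 have "f * mk_germ (%i j. cf (q i) j) = 1"
 proof (rule germ_row_eqI)
  fix n
  have i: "row f 0 * inverse (row f 0) = 1"
   using inverse_mult_eq_1[of "row f 0"] assms by (simp add: row_nth mult.commute)
  have "row (f * mk_germ (%i j. cf (q i) j)) n = (\<Sum>k=0..n. row f k * q (n - k))"
   by (simp add: row_mult rq)
  also have "\<dots> = (\<Sum>l\<le>n. row f (n - l) * q l)"
   by (rule sum.reindex_bij_witness[where i = "%l. n - l" and j = "%l. n - l"]) auto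
  also have "\<dots> = row f 0 * q n + (\<Sum>l<n. row f (n - l) * q l)"
   by (simp flip: lessThan_Suc_atMost)
  also have "row f 0 * q n = row 1 n - (\<Sum>l<n. row f (n - l) * q l)"
   unfolding q_def by (subst qrec.simps) (use i in \<open>simp flip: mult.assoc\<close>)
  finally show "row (f * mk_germ (%i j. cf (q i) j)) n = row 1 n" by simp
 qed
 thus ?thesis by (metis dvdI)
qed

lemma is_unit_iff: "is_unit f <-> gc f 0 0 ~= 0"
proof
 assume "is_unit f"
 then obtain g where "1 = f * g" by auto
 hence "gc f 0 0 * gc g 0 0 = 1" by (metis at0_mult at0_1)
 thus "gc f 0 0 ~= 0" by auto
next
 assume "gc f 0 0 ~= 0"
 hence "is_unit (cst (1 / gc f 0 0) * f)" by (intro is_unit_at0_1) simp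
 thus "is_unit f" by (rule dvd_mult_right)
qed

text \<open>Polynomials in y of degree below k over germs in x. Its companion \<open>yreg\<close> is
  regularity of order k in y.\<close>

definition ylow :: "nat => germ => bool" where
 "ylow k r <-> (\<forall>i j. k \<le> j --> gc r i j = 0)"
definition yreg :: "nat => germ => bool" where
 "yreg k g <-> (\<forall>j<k. gc g 0 j = 0) & gc g 0 k ~= 0"

lemma gc_Y_power_mult: "gc (gY ^ n * f) i j = (if j < n then 0 else gc f i (j - n))"
 by (induction n arbitrary: j) (auto simp: mult.assoc gc_Y_mult)

text \<open>Discarding the first k coefficients of a row inverts multiplication by y^k modulo
  \<open>ylow k\<close>. Since h has no row of index 0, its contribution to row i involves only
  earlier rows of the quotient.\<close>

lemma weierstrass_division_monic:
 assumes "gX dvd h"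
 shows "\<exists>q r. f = q * (gY ^ k + h) + r & ylow k r"
proof -
 obtain C R where CR: "1 \<le> R" "1 \<le> C"
  "!!s i. 0 < s ==> s \<le> 1 / (2 * R) ==> bnd s (row f i) (C * R ^ i)"
  by (rule germ_bnd[of f]) blast
 obtain C' R' where CR': "1 \<le> R'" "1 \<le> C'"
  "!!s i. 0 < s ==> s \<le> 1 / (2 * R') ==> bnd s (row h i) (C' * R' ^ i)"
  by (rule germ_bnd[of h]) blast
 define D S where "D = max C C'" and "S = max R R'"
 define s where "s = 1 / (2 * S)"
 have S: "1 \<le> S" "1 \<le> D" "0 < s" using CR' by (auto simp: S_def D_def s_def)
 have sR: "s \<le> 1 / (2 * R)" "s \<le> 1 / (2 * R')"
  unfolding s_def using CR(1) CR'(1) by (auto simp: S_def intro!: divide_left_mono)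
 have le: "C * R ^ i \<le> D * S ^ i" "C' * R' ^ i \<le> D * S ^ i" for i
  using CR(1,2) CR'(1,2) by (auto simp: D_def S_def intro!: mult_mono power_mono)
 have bF: "bnd s (row f i) (D * S ^ i)" "bnd s (row h i) (D * S ^ i)" for i
  using bnd_mono[OF CR(3)[OF S(3) sR(1)] le(1)] bnd_mono[OF CR'(3)[OF S(3) sR(2)] le(2)] by auto
 define K where "K = 1 / s ^ k"
 have K: "0 < K" using S by (simp add: K_def)
 define q where "q = qrec (fps_shift k) (row f) (row h)"
 have "bnd s (q n) (K * D * (S * (1 + K * D)) ^ n)" for n
  unfolding q_def
  by (rule bnd_qrec) (use S K bF bnd_shift[of s _ _ k] in \<open>auto simp: K_def\<close>)
 hence rq: "row (mk_germ (%i j. cf (q i) j)) i = q i" for i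
  using S K by (intro mk_germ_bnd[where R = "S * (1 + K * D)"]) (auto simp: add_pos_pos)
 define Q where "Q = mk_germ (%i j. cf (q i) j)"
 define r where "r = f - Q * (gY ^ k + h)"
 have h0: "row h 0 = 0" using assms by (simp add: X_dvd_iff fps_eq_iff row_nth)
 have "ylow k r" unfolding ylow_def
 proof (intro allI impI)
  fix i j assume "k \<le> j"
  have rh: "row (Q * h) i = (\<Sum>l<i. row h (i - l) * q l)"
  proof -
   have "row (Q * h) i = (\<Sum>l\<le>i. q l * row h (i - l))"
    by (simp add: row_mult Q_def rq atLeast0AtMost)
   thus ?thesis by (simp add: h0 mult.commute flip: lessThan_Suc_atMost)
  qed
  have "gc (f - Q * h) i j = cf (row f i - (\<Sum>l<i. row h (i - l) * q l)) j"
   by (simp add: row_nth flip: rh)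
  also have "\<dots> = cf (fps_shift k (row f i - (\<Sum>l<i. row h (i - l) * q l))) (j - k)"
   using \<open>k \<le> j\<close> by simp
  also have "\<dots> = cf (q i) (j - k)" unfolding q_def by (subst (2) qrec.simps) simp
  also have "\<dots> = gc (gY ^ k * Q) i j"
   using \<open>k \<le> j\<close> rq[of i, folded Q_def] by (simp add: gc_Y_power_mult flip: row_nth[of Q])
  finally show "gc r i j = 0" by (simp add: r_def alg)
 qed
 thus ?thesis by (intro exI[of _ Q] exI[of _ r]) (simp add: r_def)
qed

text \<open>With v the inverse of the unit \<open>shy k g\<close>, the product g v is y^k plus a
  multiple of x, which is the monic case.\<close>

theorem weierstrass_division:
 assumes "yreg k g" obtains q r where "f = q * g + r" "ylow k r"
proof -
 have "is_unit (shy k g)" using assms by (simp add: is_unit_iff yreg_def)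
 then obtain v where v: "1 = shy k g * v" by auto
 have g: "g = ytrunc k g + gY ^ k * shy k g"
  by (rule germ_eqI) (auto simp: gc_ytrunc gc_Y_power_mult)
 have "gX dvd ytrunc k g" using assms by (auto simp: X_dvd_iff gc_ytrunc yreg_def)
 then obtain q r where qr: "f = q * (gY ^ k + ytrunc k g * v) + r" "ylow k r"
  using weierstrass_division_monic[of "ytrunc k g * v" f k] by auto
 have "g * v = ytrunc k g * v + gY ^ k * (shy k g * v)"
  by (subst g) (simp add: alg)
 hence "gY ^ k + ytrunc k g * v = g * v" by (simp flip: v)
 with qr have "f = (q * v) * g + r" by simp
 thus ?thesis using qr(2) that by blast
qed

text \<open>The lowest nonzero row of q is multiplied by the row of index 0 of g, which starts in
  degree k; so q g has a nonzero coefficient in degree at least k.\<close>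

lemma weierstrass_unique:
 assumes "yreg k g" "ylow k (q * g)" shows "q = 0"
proof (rule ccontr)
 assume "q ~= 0"
 hence ex: "\<exists>i. row q i ~= 0" using germ_row_eqI[of q 0] by (auto simp: fps_eq_iff row_nth)
 define i where "i = (LEAST i. row q i ~= 0)"
 have i: "row q i ~= 0" and less: "!!l. l < i ==> row q l = 0"
  using LeastI_ex[OF ex] not_less_Least by (auto simp: i_def)
 have "row (q * g) i = (\<Sum>l\<le>i. row q l * row g (i - l))" by (simp add: row_mult atLeast0AtMost)
 hence ri: "row (q * g) i = row q i * row g 0" by (simp add: less flip: lessThan_Suc_atMost)
 have g0: "row g 0 ~= 0" "sdg (row g 0) = k"
  using assms(1) by (auto simp: yreg_def fps_eq_iff row_nth intro!: subdegreeI)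
 hence "row (q * g) i ~= 0" "k \<le> sdg (row (q * g) i)" using i by (auto simp: ri)
 thus False
  using assms(2) nth_subdegree_nonzero[of "row (q * g) i"] by (simp add: ylow_def row_nth)
qed

definition wpoly :: "nat => germ => bool" where
 "wpoly k W <-> yreg k W & ylow k (W - gY ^ k)"

text \<open>Divide y^k by g. On x = 0 the coefficient of y^k shows that the quotient has nonzero
  constant term.\<close>

theorem weierstrass_preparation:
 assumes "yreg k g" obtains u where "is_unit u" "wpoly k (u * g)"
proof -
 obtain q r where qr: "gY ^ k = q * g + r" "ylow k r" by (rule weierstrass_division[OF assms])
 have z0: "gc (q * g) 0 j = (\<Sum>l\<le>j. gc g 0 l * gc q 0 (j - l))" for j
  unfolding mult.commute[of q g] gc_mult by (simp add: atLeast0AtMost)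
 have z: "gc (q * g) 0 j = 0" if "j < k" for j
  unfolding z0 using assms that by (auto simp: yreg_def intro!: sum.neutral)
 have "(\<Sum>l\<le>k. gc g 0 l * gc q 0 (k - l)) = (\<Sum>l\<le>k. if l = k then gc g 0 k * gc q 0 0 else 0)"
  using assms by (intro sum.cong) (auto simp: yreg_def)
 hence zk: "gc (q * g) 0 k = gc q 0 0 * gc g 0 k" unfolding z0 by simp
 have yk: "gc (gY ^ k) i j = (if i = 0 & j = k then 1 else 0)" for i j
  using gc_Y_power_mult[of k 1 i j] by (auto simp: gc_1)
 have e: "gc (q * g) i j + gc r i j = (if i = 0 & j = k then 1 else 0)" for i j
  using arg_cong[OF qr(1), of "%f. gc f i j"] by (simp add: yk)
 have "gc q 0 0 * gc g 0 k = 1" using e[of 0 k] zk qr(2) by (simp add: ylow_def)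
 hence "is_unit q" by (auto simp: is_unit_iff)
 moreover have "yreg k (q * g)" using z zk \<open>gc q 0 0 * gc g 0 k = 1\<close> by (simp add: yreg_def)
 moreover have "q * g - gY ^ k = - r" by (simp add: qr(1))
 hence "ylow k (q * g - gY ^ k)" using qr(2) by (simp add: ylow_def)
 ultimately show ?thesis using that by (auto simp: wpoly_def)
qed

section \<open>Irreducible germs are prime\<close>

lemma ylow_mono: "ylow k r ==> k \<le> l ==> ylow l r" by (simp add: ylow_def)

definition xonly :: "germ => bool" where "xonly l <-> (\<forall>i j. 0 < j --> gc l i j = 0)"

lemma xonly_ycoef: "xonly (ycoef k f)" by (simp add: xonly_def gc_ycoef)

lemma gc_xonly_mult:
 assumes "xonly l" shows "gc (l * a) i j = (\<Sum>k=0..i. gc l k 0 * gc a (i - k) j)"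
 unfolding gc_mult
proof (intro sum.cong refl)
 fix k
 have "(\<Sum>m=0..j. gc l k m * gc a (i - k) (j - m)) = (\<Sum>m=0..j. if m = 0 then gc l k 0 * gc a (i - k) j else 0)"
  using assms by (intro sum.cong) (auto simp: xonly_def)
 thus "(\<Sum>m=0..j. gc l k m * gc a (i - k) (j - m)) = gc l k 0 * gc a (i - k) j" by simp
qed

text \<open>The leading coefficient \<open>ycoef d c\<close> is a germ in x, hence, when nonzero, a
  power of x times a unit by \<open>xonly_factor\<close>. The price of dividing by a non-monic
  polynomial is thus a power of x.\<close>

lemma pseudo_division:
 assumes "ylow (Suc d) c"
 shows "ylow e a ==> \<exists>m u r. ycoef d c ^ m * a = u * c + r & ylow d r"
proof (induction e arbitrary: a)
 case 0
 hence "ylow d a" by (simp add: ylow_def)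
 thus ?case by (intro exI[of _ 0] exI[of _ 0] exI[of _ a]) simp
next
 case (Suc e)
 show ?case
 proof (cases "Suc e \<le> d")
  case True
  hence "ylow d a" using Suc.prems ylow_mono by blast
  thus ?thesis by (intro exI[of _ 0] exI[of _ 0] exI[of _ a]) simp
 next
  case False
  hence de: "d \<le> e" by simp
  define l b where "l = ycoef d c" and "b = ycoef e a"
  define a' where "a' = l * a - b * (gY ^ (e - d) * c)"
  have "ylow e a'" unfolding ylow_def
  proof (intro allI impI)
   fix i j assume j: "e \<le> j"
   have 1: "gc (l * a) i j = (\<Sum>k=0..i. gc c k d * gc a (i - k) j)"
    unfolding l_def gc_xonly_mult[OF xonly_ycoef] by (simp add: gc_ycoef)
   have 2: "gc (b * (gY ^ (e - d) * c)) i j = (\<Sum>k=0..i. gc a k e * gc c (i - k) (j - (e - d)))"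
   proof -
    have "~ j < e - d" using j by simp
    thus ?thesis
     unfolding b_def gc_xonly_mult[OF xonly_ycoef] by (simp add: gc_ycoef gc_Y_power_mult)
   qed
   show "gc a' i j = 0"
   proof (cases "j = e")
    case True
    have "(\<Sum>k=0..i. gc c k d * gc a (i - k) e) = (\<Sum>k=0..i. gc a k e * gc c (i - k) d)"
     by (rule sum.reindex_bij_witness[where i = "%k. i - k" and j = "%k. i - k"]) auto
    thus ?thesis using 1 2 True de by (simp add: a'_def)
   next
    case False
    thus ?thesis using 1 2 j de Suc.prems assms by (simp add: a'_def ylow_def)
   qed
  qed
  from Suc.IH[OF this] obtain m u r where
   mur: "l ^ m * a' = u * c + r" "ylow d r" by (auto simp: l_def)
  have "l ^ Suc m * a = (u + l ^ m * b * gY ^ (e - d)) * c + r"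
   using mur(1) by (simp add: a'_def alg)
  with mur(2) show ?thesis unfolding l_def by blast
 qed
qed

lemma xonly_factor:
 assumes "xonly l" "l ~= 0" shows "\<exists>N v. l = gX ^ N * v & is_unit v"
proof -
 have ex: "\<exists>i. gc l i 0 ~= 0" using assms germ_eqI[of l 0] by (metis gc_0 neq0_conv xonly_def)
 define N where "N = (LEAST i. gc l i 0 ~= 0)"
 have N: "gc l N 0 ~= 0" "!!i. i < N ==> gc l i 0 = 0"
  using LeastI_ex[OF ex] not_less_Least by (auto simp: N_def)
 have "gX ^ N dvd l" unfolding X_power_dvd_iff using N assms(1) by (metis neq0_conv xonly_def)
 hence "l = gX ^ N * shx N l" by (rule X_power_shx)
 moreover have "is_unit (shx N l)" using N by (simp add: is_unit_iff)
 ultimately show ?thesis by blast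
qed

lemma X_strip:
 assumes "r ~= 0" shows "\<exists>t r'. r = gX ^ t * r' & ~ gX dvd r' & (\<forall>k. ylow k r --> ylow k r')"
proof -
 have ex: "\<exists>i j. gc r i j ~= 0" using assms germ_eqI[of r 0] by auto
 define N where "N = (LEAST i. \<exists>j. gc r i j ~= 0)"
 have N: "\<exists>j. gc r N j ~= 0" "!!i j. i < N ==> gc r i j = 0"
  using LeastI_ex[OF ex] not_less_Least by (auto simp: N_def)
 have "gX ^ N dvd r" unfolding X_power_dvd_iff using N by blast
 hence "r = gX ^ N * shx N r" by (rule X_power_shx)
 moreover have "~ gX dvd shx N r" using N by (simp add: X_dvd_iff)
 moreover have "ylow k r --> ylow k (shx N r)" for k by (simp add: ylow_def)
 ultimately show ?thesis by blast
qed

lemma prime_power_dvd_cancel: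
 fixes q :: "'a::algebraic_semidom"
 assumes "prm q" "~ q dvd c" shows "q ^ n dvd u * c ==> q ^ n dvd u"
proof (induction n arbitrary: u)
 case (Suc n)
 have "q dvd u * c" using Suc.prems by auto
 then obtain u' where u': "u = q * u'" using assms by (auto simp: prime_elem_dvd_mult_iff)
 have "q ~= 0" using assms by simp
 hence "q ^ n dvd u' * c" using Suc.prems by (simp add: u' mult.assoc)
 from Suc.IH[OF this] show ?case by (simp add: u' mult_dvd_mono)
qed simp

lemma yreg_exists:
 assumes "~ gX dvd g" obtains k where "yreg k g"
proof -
 have ex: "\<exists>j. gc g 0 j ~= 0" using assms by (auto simp: X_dvd_iff)
 have "yreg (LEAST j. gc g 0 j ~= 0) g"
  unfolding yreg_def using LeastI_ex[OF ex] not_less_Least by blast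
 thus ?thesis by (rule that)
qed

lemma wpoly_dvd_X: "wpoly k W ==> ~ gX dvd W"
 by (auto simp: wpoly_def yreg_def X_dvd_iff)

lemma Y_power_coeff: "gc (gY ^ k) i j = (if i = 0 & j = k then 1 else 0)"
 using gc_Y_power_mult[of k 1 i j] by (auto simp: gc_1)

lemma wpoly_coeff: "wpoly k W ==> k \<le> j ==> gc W i j = (if i = 0 & j = k then 1 else 0)"
 unfolding wpoly_def ylow_def by (auto simp: Y_power_coeff)

text \<open>Among the polynomials c in y, not divisible by x, such that f divides c b, take one of
  least degree. Pseudo-division makes it divide every polynomial z with f dividing z b, in
  particular the Weierstrass polynomial of f and the remainder of a modulo f. So c divides f: if c
  is a unit then f divides b, otherwise f divides c and hence a.\<close>

lemma irreducible_prime_germ: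
 assumes "irreducible (f :: germ)" shows "prm f"
proof (cases "gX dvd f")
 case True
 then obtain u where u: "f = gX * u" by blast
 hence "is_unit u" using assms prime_X by (metis irreducible_def prime_elem_not_unit)
 hence "f dvd z <-> gX dvd z" for z by (simp add: u mult_unit_dvd_iff)
 thus ?thesis using prime_X assms by (simp add: prime_elem_def irreducible_def)
next
 case False
 then obtain k where k: "yreg k f" by (rule yreg_exists)
 obtain w where w: "is_unit w" "wpoly k (w * f)" by (rule weierstrass_preparation[OF k])
 define W where "W = w * f"
 have W: "f dvd W" "W dvd f" "wpoly k W" using w by (auto simp: W_def)
 have Xf: "f dvd gX ^ t * z ==> f dvd z" for t z
 proof -
  assume "f dvd gX ^ t * z"
  then obtain y where y: "gX ^ t * z = y * f" by (metis dvdE mult.commute)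
  have "gX ^ t dvd y"
   by (rule prime_power_dvd_cancel[OF prime_X False]) (simp flip: y)
  then obtain y' where "y = gX ^ t * y'" by blast
  with y have "gX ^ t * z = gX ^ t * (y' * f)" by simp
  thus "f dvd z" by simp
 qed
 show ?thesis
 proof (rule prime_elemI)
  show "f ~= 0" "~ f dvd 1" using assms by (auto simp: irreducible_def)
  fix a b assume ab: "f dvd a * b"
  show "f dvd a \<or> f dvd b"
  proof (rule ccontr)
   assume neg: "~ (f dvd a \<or> f dvd b)"
   define good where "good d c <-> ~ gX dvd c & f dvd c * b & ylow (Suc d) c" for d c
   have "good k W" unfolding good_def
    using W wpoly_dvd_X[OF W(3)] wpoly_coeff[OF W(3)] by (auto simp: ylow_def)
   hence ex: "\<exists>d c. good d c" by blast
   define d where "d = (LEAST d. \<exists>c. good d c)"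
   obtain c where c: "good d c" using LeastI_ex[OF ex] by (auto simp: d_def)
   have min: "~ good e z" if "e < d" for e z using not_less_Least that by (auto simp: d_def)
   have c0: "c ~= 0" using c by (auto simp: good_def)
   have l0: "ycoef d c ~= 0"
   proof
    assume "ycoef d c = 0"
    hence "gc c i d = 0" for i by (metis gc_0 gc_ycoef)
    moreover have "ylow (Suc d) c" using c by (simp add: good_def)
    ultimately have yl: "ylow d c" unfolding ylow_def by (metis le_antisym not_less_eq_eq)
    show False
    proof (cases d)
     case 0
     hence "c = 0" using yl by (auto simp: ylow_def intro!: germ_eqI)
     thus False using c0 by simp
    next
     case (Suc e)
     hence "good e c" using yl c by (simp add: good_def)
     thus False using min Suc by blast
    qed
   qed
   obtain N v where Nv: "ycoef d c = gX ^ N * v" "is_unit v"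
    using xonly_factor[OF xonly_ycoef l0] by blast
   \<comment> \<open>A nonzero remainder, stripped of its power of x, would be a candidate of
     smaller degree. The power of x lost in the pseudo-division is cancelled because x does not
     divide c.\<close>
   have key: "c dvd z" if z: "f dvd z * b" "ylow e z" for z e
   proof -
    obtain m u r where mur: "ycoef d c ^ m * z = u * c + r" "ylow d r"
     using pseudo_division[of d c e z] c z(2) by (auto simp: good_def)
    have "r * b = ycoef d c ^ m * (z * b) - u * (c * b)" using mur(1) by (simp add: alg)
    hence rb: "f dvd r * b" using z(1) c by (auto simp: good_def intro: dvd_diff)
    have "r = 0"
    proof (rule ccontr)
     assume "r ~= 0"
     then obtain t r' where r': "r = gX ^ t * r'" "~ gX dvd r'" "ylow d r'"
      using X_strip mur(2) by blast
     have "f dvd gX ^ t * (r' * b)" using rb unfolding r'(1) mult.assoc .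
     hence "f dvd r' * b" by (rule Xf)
     moreover have "d ~= 0"
     proof
      assume "d = 0"
      hence "gX dvd r'" using r'(3) by (simp add: ylow_def X_dvd_iff)
      thus False using r'(2) by simp
     qed
     ultimately have "good (d - 1) r'" using r' by (simp add: good_def)
     thus False using min \<open>d ~= 0\<close> by auto
    qed
    hence uc: "gX ^ (N * m) * (v ^ m * z) = u * c"
     using mur(1) by (simp add: Nv power_mult_distrib power_mult mult.assoc)
    hence "gX ^ (N * m) dvd u"
     using prime_power_dvd_cancel[OF prime_X, of c] c by (metis dvd_triv_left good_def)
    then obtain u' where "u = gX ^ (N * m) * u'" by blast
    with uc have "gX ^ (N * m) * (v ^ m * z) = gX ^ (N * m) * (u' * c)" by simp
    hence "c dvd v ^ m * z" by simp
    moreover have "is_unit (v ^ m)" using Nv by (simp add: is_unit_power_iff)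
    ultimately show "c dvd z" by (simp add: dvd_mult_unit_iff')
   qed
   have "c dvd W" by (rule key[of _ "Suc k"]) (use W wpoly_coeff[OF W(3)] in \<open>auto simp: ylow_def\<close>)
   hence "c dvd f" using W dvd_trans by blast
   hence "is_unit c \<or> f dvd c" using assms irreducibleD' by blast
   moreover have "~ is_unit c"
   proof
    assume "is_unit c"
    hence "f dvd b" using c by (simp add: good_def dvd_mult_unit_iff')
    thus False using neg by simp
   qed
   ultimately have fc: "f dvd c" by simp
   obtain q r where qr: "a = q * f + r" "ylow k r" by (rule weierstrass_division[OF k])
   have "r * b = a * b - f * (q * b)" by (simp add: qr alg)
   hence "f dvd r * b" using ab by simp
   hence "f dvd r" using key[OF _ qr(2)] fc dvd_trans by blast
   hence "f dvd a" by (simp add: qr)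
   thus False using neg by simp
  qed
 qed
qed

lemma vord_unit_iff: "f ~= 0 ==> is_unit f <-> vord f = 0"
 using vord_props[of f] unfolding is_unit_iff by (metis add_is_0 gr0I)

lemma irreducible_factor:
 assumes "f ~= 0" "~ is_unit f" shows "\<exists>p. irreducible p & p dvd (f::germ)"
 using assms
proof (induction "vord f" arbitrary: f rule: less_induct)
 case less
 show ?case
 proof (cases "irreducible f")
  case False
  then obtain a b where ab: "f = a * b" "~ is_unit a" "~ is_unit b"
   using less.prems by (auto simp: irreducible_def)
  hence ne: "a ~= 0" "b ~= 0" using less.prems by auto
  have "vord a < vord f" using vord_mult[OF ne] vord_unit_iff[OF ne(2)] ab by simp
  thus ?thesis using less.hyps[of a] ne ab by auto
 qed auto
qed

text \<open>Splitting off a common non-unit lowers the order, so the descent stops.\<close>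

lemma coprime_reduction:
 assumes "P ~= 0 \<or> Q ~= (0 :: germ)"
 obtains h P' Q' where "h ~= 0" "P = h * P'" "Q = h * Q'" "coprime P' Q'"
proof -
 have *: "\<exists>h P' Q'. h ~= 0 & P = h * P' & Q = h * Q' & coprime P' Q'" if "P ~= 0" for P Q :: germ
  using that
 proof (induction "vord P" arbitrary: P Q rule: less_induct)
  case less
  show ?case
  proof (cases "coprime P Q")
   case False
   then obtain d where d: "d dvd P" "d dvd Q" "~ is_unit d" by (auto simp: coprime_def)
   then obtain a b where ab: "P = d * a" "Q = d * b" by blast
   hence ne: "d ~= 0" "a ~= 0" using less.prems by auto
   have "vord a < vord P" using vord_mult[OF ne] vord_unit_iff[OF ne(1)] ab d by simp
   from less.hyps[OF this ne(2), of b] obtain h P' Q' where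
    "h ~= 0" "a = h * P'" "b = h * Q'" "coprime P' Q'" by blast
   thus ?thesis using ne ab by (intro exI[of _ "d * h"] exI[of _ P'] exI[of _ Q']) (simp)
  qed (intro exI[of _ 1] exI[of _ P] exI[of _ Q], simp)
 qed
 show ?thesis
 proof (cases "P = 0")
  case True
  then obtain h P' Q' where "h ~= 0" "Q = h * P'" "P = h * Q'" "coprime P' Q'"
   using *[of Q P] assms by blast
  thus ?thesis using that[of h Q' P'] by (simp add: coprime_commute)
 next
  case False
  thus ?thesis using *[of P Q] that by blast
 qed
qed

lemma coprime_dvd_aux:
 fixes h :: germ
 assumes "h ~= 0" "h dvd k * P" "h dvd k * Q" "coprime P Q"
 shows "h dvd k"
 using assms
proof (induction "vord h" arbitrary: h k rule: less_induct)
 case less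
 show ?case
 proof (cases "is_unit h")
  case False
  then obtain p where p: "irreducible p" "p dvd h" using irreducible_factor less.prems by blast
  then obtain h' where h': "h = p * h'" by blast
  have pp: "prm p" using p irreducible_prime_germ by blast
  have "~ (p dvd P & p dvd Q)" using less.prems(4) p(1) by (auto simp: coprime_def irreducible_def)
  moreover have "p dvd k * P" "p dvd k * Q" using p(2) less.prems dvd_trans by blast+
  ultimately have "p dvd k" using pp by (auto simp: prime_elem_dvd_mult_iff)
  then obtain k' where k': "k = p * k'" by blast
  have ne: "p ~= 0" "h' ~= 0" using h' less.prems by auto
  have "vord h' < vord h" using vord_mult[OF ne] vord_unit_iff[OF ne(1)] h' p(1) by (auto simp: irreducible_def)
  moreover have "h' dvd k' * P" "h' dvd k' * Q" using less.prems by (auto simp: h' k')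
  ultimately have "h' dvd k'" using less.hyps ne less.prems by blast
  thus ?thesis by (simp add: h' k')
 qed (simp add: unit_imp_dvd)
qed

text \<open>This makes the choice in \<open>strict_form\<close> harmless: each of h and h' divides
  the other, by coprimality of the opposite pair.\<close>

lemma coprime_form_unique:
 fixes h h' :: germ
 assumes "h ~= 0" "h' ~= 0" "h * P = h' * P'" "h * Q = h' * Q'" "coprime P Q" "coprime P' Q'"
 obtains u where "is_unit u" "P' = u * P" "Q' = u * Q"
proof -
 have 1: "h dvd h'" using coprime_dvd_aux[of h h' P' Q'] assms by (metis dvd_triv_left)
 have 2: "h' dvd h" using coprime_dvd_aux[of h' h P Q] assms by simp
 from 2 obtain u where u: "h = h' * u" by blast
 from 1 obtain w where w: "h' = h * w" by blast
 have "h' * (u * w) = h' * 1" using u w by (metis mult.assoc mult.right_neutral)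
 hence "u * w = 1" using assms by simp
 hence "is_unit u" by (metis dvdI)
 moreover have "P' = u * P" "Q' = u * Q" using assms u by auto
 ultimately show ?thesis by (rule that)
qed

section \<open>Infinitely near points and strict transforms\<close>

lemma ylow_expand: "ylow k r ==> r = (\<Sum>j<k. ycoef j r * gY ^ j)"
proof (rule germ_eqI)
 fix i j assume k: "ylow k r"
 have "gc (\<Sum>j<k. ycoef j r * gY ^ j) i j = (\<Sum>m<k. if m = j then gc r i j else 0)"
  unfolding gc_sum by (intro sum.cong refl) (auto simp: mult.commute[of "ycoef _ _"] gc_Y_power_mult gc_ycoef)
 also have "\<dots> = gc r i j" using k by (auto simp: ylow_def)
 finally show "gc r i j = gc (\<Sum>j<k. ycoef j r * gY ^ j) i j" by simp
qed

lemma gc_pull_slope: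
 "gc (psl c f) n i = (\<Sum>j\<le>n. gc f (n - j) j * cf ((fps_X + fps_const c) ^ j) i)"
 by (simp add: row_nth[symmetric] row_pull_slope fps_sum_nth)

lemma gc_pull_slope_0: "gc (psl c f) 0 i = (if i = 0 then gc f 0 0 else 0)"
 by (simp add: gc_pull_slope)

lemma pull_slope_xonly: "xonly l ==> psl c l = l"
proof (rule germ_eqI)
 fix i j assume "xonly l"
 hence "gc (psl c l) i j = (\<Sum>m\<le>i. if m = 0 then (if j = 0 then gc l i 0 else 0) else 0)"
  unfolding gc_pull_slope by (intro sum.cong) (auto simp: xonly_def)
 thus "gc (psl c l) i j = gc l i j" using \<open>xonly l\<close> by (auto simp: xonly_def)
qed

lemma ylow_pull_slope: "ylow k r ==> ylow k (psl c r)"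
 unfolding ylow_def gc_pull_slope
 by (auto intro!: sum.neutral simp: nth_linear_power)

text \<open>For a Weierstrass polynomial W this is x^k W(x, y/x - c), the image of W = 0 under the
  blow-up in the direction of slope c. No negative power of x is left because W has degree k in
  y.\<close>

definition pushpoly :: "nat => real => germ => germ" where
 "pushpoly k c W = (gY - cst c * gX) ^ k +
  (\<Sum>j<k. ycoef j W * gX ^ (k - j) * (gY - cst c * gX) ^ j)"

lemma wpoly_expand:
 assumes "wpoly k W"
 shows "W = gY ^ k + (\<Sum>j<k. ycoef j W * gY ^ j)"
proof -
 have "W - gY ^ k = (\<Sum>j<k. ycoef j (W - gY ^ k) * gY ^ j)"
  by (rule ylow_expand) (use assms in \<open>simp add: wpoly_def\<close>)
 also have "\<dots> = (\<Sum>j<k. ycoef j W * gY ^ j)"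
 proof (intro sum.cong refl)
  fix j assume "j : {..<k}"
  hence "ycoef j (W - gY ^ k) = ycoef j W"
   by (intro germ_eqI) (auto simp: gc_ycoef Y_power_coeff)
  thus "ycoef j (W - gY ^ k) * gY ^ j = ycoef j W * gY ^ j" by simp
 qed
 finally show ?thesis by (simp add: alg)
qed

lemma ycoef_wpoly_0: "wpoly k W ==> j < k ==> gc (ycoef j W) 0 i = 0"
 by (auto simp: gc_ycoef wpoly_def yreg_def)

lemma pull_slope_pushpoly:
 assumes "wpoly k W"
 shows "psl c' (pushpoly k c W) = gX ^ k *
  ((gY + cst (c' - c)) ^ k + (\<Sum>j<k. ycoef j W * (gY + cst (c' - c)) ^ j))"
proof -
 define T where "T = gY + cst (c' - c)"
 have h: "pull [Sl c'] (gY - cst c * gX) = gX * T"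
  by (simp only: pull_diff pull_hom) (simp add: T_def alg)
 have "pull [Sl c'] (pushpoly k c W) = (gX * T) ^ k + (\<Sum>j<k. ycoef j W * gX ^ (k - j) * (gX * T) ^ j)"
  unfolding pushpoly_def pull_hom pull_sum pull_power h
  by (simp add: pull_slope_xonly xonly_ycoef)
 also have "\<dots> = gX ^ k * (T ^ k + (\<Sum>j<k. ycoef j W * T ^ j))"
 proof -
  have "ycoef j W * gX ^ (k - j) * (gX * T) ^ j = gX ^ k * (ycoef j W * T ^ j)" if "j < k" for j
  proof -
   have "gX ^ k = gX ^ (k - j) * gX ^ j" using that by (simp flip: power_add)
   thus ?thesis by (simp add: alg)
  qed
  hence "(\<Sum>j<k. ycoef j W * gX ^ (k - j) * (gX * T) ^ j) = (\<Sum>j<k. gX ^ k * (ycoef j W * T ^ j))"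
   by (intro sum.cong refl) simp
  thus ?thesis unfolding distrib_left sum_distrib_left power_mult_distrib[of _ _ k] by simp
 qed
 finally show ?thesis by (simp add: T_def)
qed

lemma pull_vertical_pushpoly:
 assumes "wpoly k W"
 shows "pvt (pushpoly k c W) = gY ^ k *
  ((1 - cst c * gX) ^ k + (\<Sum>j<k. pvt (ycoef j W) * gX ^ (k - j) * (1 - cst c * gX) ^ j))"
proof -
 define T where "T = 1 - cst c * gX"
 have h: "pull [Vt] (gY - cst c * gX) = gY * T"
  by (simp only: pull_diff pull_hom) (simp add: T_def alg)
 have "pull [Vt] (pushpoly k c W) = (gY * T) ^ k + (\<Sum>j<k. pvt (ycoef j W) * (gX * gY) ^ (k - j) * (gY * T) ^ j)"
  unfolding pushpoly_def pull_hom pull_sum pull_power h by simp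
 also have "\<dots> = gY ^ k * (T ^ k + (\<Sum>j<k. pvt (ycoef j W) * gX ^ (k - j) * T ^ j))"
 proof -
  have "pvt (ycoef j W) * (gX * gY) ^ (k - j) * (gY * T) ^ j
   = gY ^ k * (pvt (ycoef j W) * gX ^ (k - j) * T ^ j)" if "j < k" for j
  proof -
   have "gY ^ k = gY ^ (k - j) * gY ^ j" using that by (simp flip: power_add)
   thus ?thesis by (simp add: alg)
  qed
  hence "(\<Sum>j<k. pvt (ycoef j W) * (gX * gY) ^ (k - j) * (gY * T) ^ j)
   = (\<Sum>j<k. gY ^ k * (pvt (ycoef j W) * gX ^ (k - j) * T ^ j))"
   by (intro sum.cong refl) simp
  thus ?thesis unfolding distrib_left sum_distrib_left power_mult_distrib[of _ _ k] by simp
 qed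
 finally show ?thesis by (simp add: T_def)
qed

lemma pull_slope_swap_pushpoly:
 assumes "wpoly k W"
 shows "psl c (swp (pushpoly k 0 W)) = gX ^ k *
  (1 + (\<Sum>j<k. psl c (swp (ycoef j W)) * (gY + cst c) ^ (k - j)))"
proof -
 have swap_sum: "swp (sum F A) = (\<Sum>a\<in>A. swp (F a))" for F :: "nat => germ" and A
  by (induction A rule: infinite_finite_induct) auto
 define T where "T = gY + cst c"
 have "pull [Sl c] (swp (pushpoly k 0 W)) = gX ^ k + (\<Sum>j<k. psl c (swp (ycoef j W)) * (gX * T) ^ (k - j) * gX ^ j)"
  unfolding pushpoly_def swap_hom swap_sum pull_hom pull_sum
  by (simp add: T_def)
 also have "\<dots> = gX ^ k * (1 + (\<Sum>j<k. psl c (swp (ycoef j W)) * T ^ (k - j)))"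
 proof -
  have "psl c (swp (ycoef j W)) * (gX * T) ^ (k - j) * gX ^ j
   = gX ^ k * (psl c (swp (ycoef j W)) * T ^ (k - j))" if "j < k" for j
  proof -
   have "gX ^ k = gX ^ (k - j) * gX ^ j" using that by (simp flip: power_add)
   thus ?thesis by (simp add: alg)
  qed
  hence "(\<Sum>j<k. psl c (swp (ycoef j W)) * (gX * T) ^ (k - j) * gX ^ j)
   = (\<Sum>j<k. gX ^ k * (psl c (swp (ycoef j W)) * T ^ (k - j)))"
   by (intro sum.cong refl) simp
  thus ?thesis unfolding distrib_left sum_distrib_left by simp
 qed
 finally show ?thesis by (simp add: T_def)
qed

lemma gc_row0_sum_mult:
 assumes "!!j i. j < k ==> gc (w j) 0 i = 0"
 shows "gc (A + (\<Sum>j<k. w j * B j)) 0 i = gc A 0 i"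
proof -
 have "gc (w j * B j) 0 i = 0" if "j < k" for j
  unfolding gc_mult using assms[OF that] by simp
 thus ?thesis by simp
qed

lemma at0_not_ex_dvd: "gc f 0 0 ~= 0 ==> ~ ex d dvd f"
 by (cases d) (auto)

text \<open>The intersection number of g with the exceptional divisor is k.\<close>

definition exreg :: "direction => nat => germ => bool" where
 "exreg d k g <-> (case d of Sl c => yreg k g | Vt => yreg k (swp g))"

lemma yreg_unit:
 assumes "is_unit w" "yreg k h" shows "yreg k (w * h)"
proof -
 have r: "row (w * h) 0 = row h 0 * row w 0" by (simp add: row_mult)
 have "row h 0 ~= 0" "sdg (row h 0) = k"
  using assms(2) by (auto simp: yreg_def row_nth fps_eq_iff intro!: subdegreeI)
 moreover have "row w 0 ~= 0" "sdg (row w 0) = 0"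
  using assms(1) by (auto simp: is_unit_iff row_nth fps_eq_iff)
 ultimately have "row (w * h) 0 ~= 0" "sdg (row (w * h) 0) = k" by (auto simp: r)
 thus ?thesis unfolding yreg_def row_nth[symmetric]
  by auto
qed

lemma exreg_unit: "is_unit w ==> exreg d k h ==> exreg d k (w * h)"
 by (cases d) (auto simp: exreg_def yreg_unit)

text \<open>
 \<open>push1 d k g f\<close>: the irreducible components of \<open>f\<close> are all tangent to the direction \<open>d\<close>, where
 \<open>f\<close> has the strict transform \<open>g\<close>; the last condition describes the initial form of \<open>f\<close>, which
 is a multiple of the \<open>k\<close>-th power of a linear form.
\<close>
definition push1 :: "direction => nat => germ => germ => bool" where
 "push1 d k g f <-> exreg d k g & f ~= 0 & vord f = k & st1 d f = g & (\<forall>d'. d' ~= d --> is_unit (st1 d' f)) &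
  (\<forall>a. g dvd pull1 d a <-> f dvd a) &
  (\<forall>c. Sl c ~= d --> (\<exists>v. v ~= 0 & (\<forall>i. gc (st1 (Sl c) f) 0 i =
    v * (case d of Sl c' => gc ((gY + cst (c - c')) ^ k) 0 i | Vt => gc 1 0 i))))"

lemma st1_eqI: "pull1 d f = ex d ^ k * g ==> ~ ex d dvd g ==> st1 d f = g & vord f = k"
 using pull1_factor_unique by blast

text \<open>Divide a by the pushed polynomial. Pulling back keeps the remainder of degree below k in
  y; it is divisible by W, so uniqueness of Weierstrass division kills it.\<close>

lemma pushpoly_dvd:
 assumes W: "wpoly k W"
 shows "W dvd psl c a <-> pushpoly k c W dvd a"
proof -
 let ?f = "pushpoly k c W"
 have pf: "psl c ?f = gX ^ k * W"
  using pull_slope_pushpoly[OF W, of c c] wpoly_expand[OF W] by simp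
 have "gc ?f 0 j = gc (gY ^ k) 0 j" for j
 proof -
  have "gc ?f 0 j = gc ((gY - cst c * gX) ^ k) 0 j"
   unfolding pushpoly_def using gc_row0_sum_mult[of k "%j. ycoef j W"] ycoef_wpoly_0[OF W]
   by (simp add: mult.assoc)
  also have "gX dvd (gY - cst c * gX) ^ k - gY ^ k"
  proof -
   have "(gY - cst c * gX) - gY dvd (gY - cst c * gX) ^ k - gY ^ k"
    by (simp add: power_diff_sumr2)
   moreover have "gX dvd (gY - cst c * gX) - gY" by simp
   ultimately show ?thesis by auto
  qed
  hence "gc ((gY - cst c * gX) ^ k) 0 j = gc (gY ^ k) 0 j"
   by (simp add: X_dvd_iff)
  finally show ?thesis .
 qed
 hence reg: "yreg k ?f" by (simp add: yreg_def Y_power_coeff)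
 have Wreg: "yreg k W" using W by (simp add: wpoly_def)
 show ?thesis
 proof
  assume "?f dvd a"
  hence "pull1 (Sl c) ?f dvd pull1 (Sl c) a" by (auto elim!: dvdE simp: pull_slope_mult)
  thus "W dvd psl c a" by (simp add: pf dvd_mult_right)
 next
  assume Wa: "W dvd psl c a"
  obtain q r where qr: "a = q * ?f + r" "ylow k r" by (rule weierstrass_division[OF reg])
  have "psl c a = psl c q * gX ^ k * W + psl c r"
   by (simp add: qr(1) pull_slope_mult pf)
  hence "W dvd psl c r" using Wa by simp
  then obtain q' where q': "psl c r = q' * W" by (metis dvdE mult.commute)
  hence "q' = 0" using weierstrass_unique[OF Wreg] ylow_pull_slope[OF qr(2), of c] by simp
  hence "r = 0" using q' by simp
  thus "?f dvd a" using qr by simp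
 qed
qed


lemma push1_slope:
 assumes W: "wpoly k W"
 shows "push1 (Sl c) k W (pushpoly k c W)"
proof -
 let ?f = "pushpoly k c W"
 have pf: "pull1 (Sl c) ?f = ex (Sl c) ^ k * W"
  using pull_slope_pushpoly[OF W, of c c] wpoly_expand[OF W] by simp
 have W0: "W ~= 0" "~ gX dvd W" using wpoly_dvd_X[OF W] by auto
 have 1: "st1 (Sl c) ?f = W & vord ?f = k"
  by (rule st1_eqI[OF pf]) (use W0 in simp)
 have f0: "?f ~= 0" using pf W0 by auto
 have 2: "is_unit (st1 (Sl c') ?f) & (\<forall>i. gc (st1 (Sl c') ?f) 0 i = gc ((gY + cst (c' - c)) ^ k) 0 i)"
  if "c' ~= c" for c'
 proof -
  define T M where "T = gY + cst (c' - c)" and "M = T ^ k + (\<Sum>j<k. ycoef j W * T ^ j)"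
  have M: "gc M 0 i = gc (T ^ k) 0 i" for i
   unfolding M_def by (rule gc_row0_sum_mult) (use ycoef_wpoly_0[OF W] in auto)
  have "gc M 0 0 ~= 0" using that by (simp add: M T_def)
  moreover have "pull1 (Sl c') ?f = ex (Sl c') ^ k * M"
   using pull_slope_pushpoly[OF W, of c' c] by (simp add: M_def T_def)
  ultimately have "st1 (Sl c') ?f = M" using st1_eqI at0_not_ex_dvd by blast
  thus ?thesis using M \<open>gc M 0 0 ~= 0\<close> by (simp add: is_unit_iff T_def)
 qed
 have 3: "is_unit (st1 Vt ?f)"
 proof -
  define T M where "T = 1 - cst c * gX"
   and "M = T ^ k + (\<Sum>j<k. pvt (ycoef j W) * gX ^ (k - j) * T ^ j)"
  have M1: "gc M 0 0 = 1"
  proof -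
   have "gc (pull1 Vt (ycoef j W)) 0 0 = 0" if "j < k" for j
    using ycoef_wpoly_0[OF W that] by (simp only: at0_pull1)
   thus ?thesis by (simp add: M_def T_def)
  qed
  hence "gc M 0 0 ~= 0" by simp
  moreover have "pull1 Vt ?f = ex Vt ^ k * M"
   using pull_vertical_pushpoly[OF W, of c] by (simp add: M_def T_def)
  ultimately have "st1 Vt ?f = M" using st1_eqI at0_not_ex_dvd by blast
  thus ?thesis using M1 by (simp add: is_unit_iff)
 qed
 have 4: "!!a. W dvd pull1 (Sl c) a <-> ?f dvd a" using pushpoly_dvd[OF W] by simp
 have 5: "exreg (Sl c) k W" using W by (simp add: exreg_def wpoly_def)
 show ?thesis unfolding push1_def
 proof (intro conjI allI impI)
  show "is_unit (st1 d' ?f)" if "d' ~= Sl c" for d'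
   using 2 3 that by (cases d') auto
  show "\<exists>v. v ~= 0 & (\<forall>i. gc (st1 (Sl c') ?f) 0 i = v * (case Sl c of Sl c'' =>
    gc ((gY + cst (c' - c'')) ^ k) 0 i | Vt => gc 1 0 i))" if "Sl c' ~= Sl c" for c'
   using 2[of c'] that by auto
 qed (use 1 4 5 f0 in auto)
qed

lemma push1_vertical:
 assumes W: "wpoly k W"
 shows "push1 Vt k (swp W) (swp (pushpoly k 0 W))"
proof -
 let ?f = "swp (pushpoly k 0 W)"
 have pf: "pull1 Vt ?f = ex Vt ^ k * swp W"
  using pull_slope_pushpoly[OF W, of 0 0] wpoly_expand[OF W] by (simp add: pull_vertical_swap)
 have W0: "W ~= 0" "~ gY dvd swp W"
  using wpoly_dvd_X[OF W] by (auto simp flip: swap_dvd_iff[of gY])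
 have 1: "st1 Vt ?f = swp W & vord ?f = k"
  by (rule st1_eqI[OF pf]) (use W0 in simp)
 have f0: "?f ~= 0" using pf W0 by auto
 have 2: "is_unit (st1 (Sl c) ?f) & (\<forall>i. gc (st1 (Sl c) ?f) 0 i = gc 1 0 i)" for c
 proof -
  define T M where "T = gY + cst c"
   and "M = 1 + (\<Sum>j<k. psl c (swp (ycoef j W)) * T ^ (k - j))"
  have M: "gc M 0 i = gc 1 0 i" for i
   unfolding M_def by (rule gc_row0_sum_mult)
    (auto simp: gc_pull_slope_0 ycoef_wpoly_0[OF W])
  hence "gc M 0 0 ~= 0" by simp
  moreover have "pull1 (Sl c) ?f = ex (Sl c) ^ k * M"
   using pull_slope_swap_pushpoly[OF W, of c] by (simp add: M_def T_def)
  ultimately have "st1 (Sl c) ?f = M" using st1_eqI at0_not_ex_dvd by blast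
  thus ?thesis using M \<open>gc M 0 0 ~= 0\<close> by (simp add: is_unit_iff)
 qed
 have 4: "swp W dvd pull1 Vt a <-> ?f dvd a" for a
  using pushpoly_dvd[OF W, of 0 "swp a"] swap_dvd_iff[of "pushpoly k 0 W" "swp a"] by (simp add: pull_vertical_swap)
 have 5: "exreg Vt k (swp W)" using W by (simp add: exreg_def wpoly_def)
 show ?thesis unfolding push1_def
 proof (intro conjI allI impI)
  show "is_unit (st1 d' ?f)" if "d' ~= Vt" for d'
   using 2 that by (cases d') auto
  show "\<exists>v. v ~= 0 & (\<forall>i. gc (st1 (Sl c') ?f) 0 i = v * (case Vt of Sl c'' =>
    gc ((gY + cst (c' - c'')) ^ k) 0 i | Vt => gc 1 0 i))" for c'
   using 2[of c'] by auto
 qed (use 1 4 5 f0 in auto)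
qed

lemma push1_exists:
 assumes "~ ex d dvd g"
 obtains k f u where "is_unit u" "push1 d k (u * g) f"
proof (cases d)
 case (Slope c)
 then obtain k where k: "yreg k g" using assms yreg_exists by auto
 obtain u where "is_unit u" "wpoly k (u * g)" by (rule weierstrass_preparation[OF k])
 thus ?thesis
  using that[of u k "pushpoly k c (u * g)"] push1_slope[of k "u * g" c] Slope by simp
next
 case Vertical
 have "~ gX dvd swp g" using assms Vertical
  by (auto simp flip: swap_dvd_iff[of gY])
 then obtain k where k: "yreg k (swp g)" using yreg_exists by auto
 obtain u where u: "is_unit u" "wpoly k (u * swp g)" by (rule weierstrass_preparation[OF k])
 show ?thesis
  using that[of "swp u" k "swp (pushpoly k 0 (u * swp g))"] push1_vertical[OF u(2)] u Vertical by simp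
qed

text \<open>\<open>g\<close> does not vanish along the whole fibre over the origin.\<close>
definition nonexc :: "point => germ => bool" where
 "nonexc p g <-> ~ (g dvd pull p gX & g dvd pull p gY)"

fun st :: "point => germ => germ" where
 "st [] f = f" | "st (d # p) f = st p (st1 d f)"

text \<open>Here f is an equation at the origin of the image of the curve g at p, built from the
  last blow-up back to the first.\<close>

fun pushes :: "point => germ => germ => bool" where
 "pushes [] g f <-> g = f"
| "pushes (d # p) g f <-> (\<exists>h k. pushes p g h & push1 d k h f)"

lemma pushes_dvd: "pushes p g f ==> g dvd pull p a <-> f dvd a"
proof (induction p arbitrary: f a)
 case (Cons d p)
 thus ?case by (auto simp: push1_def)
qed auto

lemma pull1_ex_dvd: "ex d dvd pull1 d gX" "ex d dvd pull1 d gY"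
 by (cases d; simp)+

lemma nonexc_Cons:
 assumes "prm g" "nonexc (d # p) g"
 shows "nonexc p g" "~ g dvd pull p (ex d)"
proof -
 show *: "~ g dvd pull p (ex d)"
 proof
  assume "g dvd pull p (ex d)"
  hence "g dvd pull (d # p) gX" "g dvd pull (d # p) gY"
   using pull_dvd[OF pull1_ex_dvd(1)] pull_dvd[OF pull1_ex_dvd(2)] dvd_trans
   by (metis pull.simps(2))+
  thus False using assms(2) by (simp add: nonexc_def)
 qed
 thus "nonexc p g" by (cases d) (auto simp: nonexc_def)
qed

lemma push1_unit:
 assumes "push1 d k g f" "is_unit u"
 shows "push1 d k (pull1 d u * g) (u * f)"
proof -
 have u0: "u ~= 0" "f ~= 0" using assms by (auto simp: push1_def)
 have un: "is_unit (pull1 d' u)" for d' using assms(2) by (simp add: is_unit_iff)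
 have st: "st1 d' u = pull1 d' u & vord u = 0" for d'
  by (rule st1_eqI) (use un[of d'] in \<open>auto simp: is_unit_iff at0_not_ex_dvd simp del: at0_pull1\<close>)
 have r0: "gc (pull1 (Sl c) u * h) 0 i = gc u 0 0 * gc h 0 i" for c h i
 proof -
  have "gc (pull1 (Sl c) u * h) 0 i = (\<Sum>l=0..i. gc (psl c u) 0 l * gc h 0 (i - l))"
   unfolding gc_mult by simp
  also have "\<dots> = (\<Sum>l=0..i. if l = 0 then gc u 0 0 * gc h 0 i else 0)"
   by (intro sum.cong) (auto simp: gc_pull_slope_0)
  finally show ?thesis by simp
 qed
 have u00: "gc u 0 0 ~= 0" using assms(2) by (simp add: is_unit_iff)
 show ?thesis unfolding push1_def
 proof (intro conjI allI impI)
  show "exreg d k (pull1 d u * g)" using assms un[of d] by (simp add: push1_def exreg_unit)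
  show "u * f ~= 0" using u0 by simp
  show "vord (u * f) = k" using vord_mult[OF u0] assms st by (simp add: push1_def)
  show "st1 d (u * f) = pull1 d u * g" using st1_mult[OF u0] assms st by (simp add: push1_def)
  show "is_unit (st1 d' (u * f))" if "d' ~= d" for d'
   using st1_mult[OF u0, of d'] assms st[of d'] un[of d'] that by (simp add: push1_def is_unit_mult_iff)
  show "pull1 d u * g dvd pull1 d a <-> u * f dvd a" for a
   using assms un[of d] by (simp add: push1_def mult_unit_dvd_iff')
  fix c assume "Sl c ~= d"
  then obtain v where v: "v ~= 0" "!!i. gc (st1 (Sl c) f) 0 i =
    v * (case d of Sl c' => gc ((gY + cst (c - c')) ^ k) 0 i | Vt => gc 1 0 i)"
   using assms(1) unfolding push1_def by blast
  have "gc (st1 (Sl c) (u * f)) 0 i = (gc u 0 0 * v) *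
    (case d of Sl c' => gc ((gY + cst (c - c')) ^ k) 0 i | Vt => gc 1 0 i)" for i
   using st[of "Sl c"] v(2)[of i] r0[of c "st1 (Sl c) f" i]
   by (simp add: st1_mult[OF u0] del: st1.simps pull1.simps)
  thus "\<exists>v. v ~= 0 & (\<forall>i. gc (st1 (Sl c) (u * f)) 0 i = v *
    (case d of Sl c' => gc ((gY + cst (c - c')) ^ k) 0 i | Vt => gc 1 0 i))"
   using v(1) u00 by (intro exI[of _ "gc u 0 0 * v"]) simp
 qed
qed


lemma pushes_unit: "pushes p g f ==> is_unit u ==> pushes p (pull p u * g) (u * f)"
proof (induction p arbitrary: f u)
 case (Cons d p)
 then obtain h k where h: "pushes p g h" "push1 d k h f" by auto
 have "is_unit (pull1 d u)" using Cons.prems(2) by (simp add: is_unit_iff)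
 hence "pushes p (pull p (pull1 d u) * g) (pull1 d u * h)" using Cons.IH h by blast
 moreover have "push1 d k (pull1 d u * h) (u * f)" using push1_unit h Cons.prems by blast
 ultimately show ?case by auto
qed simp

text \<open>The ideal of f is the contraction of the ideal of g, and contractions of prime ideals
  are prime.\<close>

lemma pushes_prime:
 assumes "prm g" "pushes p g f" shows "prm f"
proof (rule prime_elemI)
 note * = pushes_dvd[OF assms(2)]
 show "f ~= 0" using assms by (cases p) (auto simp: push1_def simp del: st1.simps pull1.simps)
 show "~ f dvd 1" using *[of 1] assms by simp
 show "f dvd a \<or> f dvd b" if "f dvd a * b" for a b
  using that assms(1) by (simp add: prime_elem_dvd_mult_iff flip: *)
qed

text \<open>Each step normalizes by Weierstrass preparation at a lower level, and
  \<open>pushes_unit\<close> lifts that unit to the last point; hence the unit on g. Since the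
  intermediate curve is prime, it could be divisible by the exceptional equation only if g were
  exceptional.\<close>

lemma pushes_exists:
 assumes "prm g" "nonexc p g"
 shows "\<exists>u f. is_unit u & pushes p (u * g) f"
 using assms
proof (induction p)
 case Nil
 show ?case by (intro exI[of _ 1] exI[of _ g]) simp
next
 case (Cons d p)
 obtain u h where h: "is_unit u" "pushes p (u * g) h"
  using Cons.IH[OF Cons.prems(1) nonexc_Cons(1)[OF Cons.prems]] by blast
 have ug: "prm (u * g)" using h Cons.prems by (simp add: prime_elem_mult_unit_left)
 have "~ ex d dvd h"
 proof
  assume "ex d dvd h"
  then obtain w where w: "h = ex d * w" by blast
  have "irreducible h" using pushes_prime[OF ug h(2)] by (rule prime_elem_imp_irreducible)
  hence "is_unit (ex d) \<or> is_unit w" using w by (auto simp: irreducible_def)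
  hence "is_unit w" using prime_elem_not_unit[OF prime_ex] by blast
  hence "h dvd ex d" by (simp add: w)
  hence "u * g dvd pull p (ex d)" using pushes_dvd[OF h(2)] by simp
  thus False using nonexc_Cons(2)[OF Cons.prems] by auto
 qed
 then obtain k f u' where f: "is_unit u'" "push1 d k (u' * h) f" by (rule push1_exists)
 have "pushes p (pull p u' * (u * g)) (u' * h)" by (rule pushes_unit[OF h(2) f(1)])
 hence "pushes (d # p) ((pull p u' * u) * g) f" using f by (auto simp: mult.assoc)
 moreover have "is_unit (pull p u' * u)" using h f by (simp add: is_unit_iff)
 ultimately show ?case by blast
qed

lemma st_append: "st (p @ q) f = st q (st p f)"
 by (induction p arbitrary: f) auto
lemma st_neq_0 [simp]: "f ~= 0 ==> st p f ~= 0"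
 by (induction p arbitrary: f) (auto)
lemma st_mult: "f ~= 0 ==> g ~= 0 ==> st p (f * g) = st p f * st p g"
 by (induction p arbitrary: f g) (auto simp: st1_mult simp del: st1.simps)
lemma unit_neq_0 [simp]: "is_unit f ==> f ~= (0::germ)" by auto
lemma vord_unit [simp]: "is_unit f ==> vord f = 0"
 using vord_unit_iff[of f] unit_neq_0[of f] by blast
lemma st1_unit: "is_unit u ==> st1 d u = pull1 d u"
 using st1_eqI[of d u 0 "pull1 d u"] at0_not_ex_dvd[of "pull1 d u" d] by (simp add: is_unit_iff)
lemma pull_unit [simp]: "is_unit (pull p u) <-> is_unit u"
 by (simp add: is_unit_iff)
lemma pull1_unit [simp]: "is_unit (pull1 d u) <-> is_unit u"
 by (simp add: is_unit_iff)
lemma pull_sv_unit [simp]: "is_unit (psl c u) <-> is_unit u" "is_unit (pvt u) <-> is_unit u"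
 using pull1_unit[of "Sl c" u] pull1_unit[of Vertical u] unfolding pull1.simps .
lemma st_unit: "is_unit u ==> st p u = pull p u"
 by (induction p arbitrary: u) (auto simp: st1_unit simp del: st1.simps)

lemma pushes_st: "pushes (p @ r) g f ==> pushes r g (st p f)"
 by (induction p arbitrary: f) (auto simp: push1_def simp del: st1.simps)

lemma pushes_st_eq: "pushes p g f ==> st p f = g"
 using pushes_st[of p "[]" g f] by simp

text \<open>Where q first leaves p, the image has no tangent in the direction of q. Its strict
  transform there is a unit and remains one.\<close>

lemma pushes_st_other:
 "pushes p g f ==> \<nexists>r. p = q @ r ==> \<nexists>r. q = p @ r ==> is_unit (st q f)"
proof (induction p arbitrary: f q)
 case (Cons d p)
 then obtain h k where h: "pushes p g h" "push1 d k h f" by auto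
 obtain d' q' where q: "q = d' # q'" using Cons.prems by (cases q) auto
 show ?case
 proof (cases "d' = d")
  case True
  thus ?thesis using Cons q by (auto simp: push1_def simp del: st1.simps)
 next
  case False
  hence "is_unit (st1 d' f)" using h by (auto simp: push1_def simp del: st1.simps)
  thus ?thesis by (simp add: q st_unit del: st1.simps)
 qed
qed simp

lemma vord_X [simp]: "vord gX = 1" by (rule vord_eqI[of _ _ 1 0]) (auto simp: gc_X)
lemma vord_Y [simp]: "vord gY = 1" by (rule vord_eqI[of _ _ 0 1]) (auto simp: gc_Y)
lemma vord_power: "f ~= 0 ==> vord (f ^ n) = n * vord f"
 by (induction n) (auto simp: vord_mult)

subsection \<open>Components of the exceptional divisor\<close>

text \<open>The components with local equations x = 0 and y = 0 at a point. The list is reversed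
  because the last direction decides: a slope creates x = 0 and keeps y = 0 only if it is 0, while
  the vertical direction creates y = 0 and keeps x = 0.\<close>

fun rev_comps :: "point => point option \<times> point option" where
 "rev_comps [] = (None, None)"
| "rev_comps (Sl c # l) = (Some (rev l), if c = 0 then snd (rev_comps l) else None)"
| "rev_comps (Vt # l) = (fst (rev_comps l), Some (rev l))"

definition compX :: "point => point option" where "compX p = fst (rev_comps (rev p))"
definition compY :: "point => point option" where "compY p = snd (rev_comps (rev p))"

lemma comp_simps [simp]:
 "compX [] = None" "compY [] = None"
 "compX (p @ [Sl c]) = Some p" "compY (p @ [Sl c]) = (if c = 0 then compY p else None)"
 "compX (p @ [Vt]) = compX p" "compY (p @ [Vt]) = Some p"
 by (simp_all add: compX_def compY_def)

lemma X_neq_Y [simp]: "gX ~= gY" "gY ~= gX"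
 using gc_X[of 1 0] gc_Y[of 1 0] by auto

lemma component_at_iff:
 "cpt q p e <-> (e = gX & compX p = Some q) \<or> (e = gY & compY p = Some q)"
proof
 show "cpt q p e ==> (e = gX & compX p = Some q) \<or> (e = gY & compY p = Some q)"
  by (induction rule: component_at.induct) auto
 show "(e = gX & compX p = Some q) \<or> (e = gY & compY p = Some q) ==> cpt q p e"
 proof (induction p arbitrary: e rule: rev_induct)
  case (snoc d p)
  thus ?case
   by (cases d) (auto intro: component_at.intros split: if_splits)
 qed simp
qed

text \<open>The multiplicity in the total transform of f of the component created at q;
  \<open>mX\<close> and \<open>mY\<close> are the multiplicities of the axes at p.\<close>

definition mu :: "point => germ => nat" where "mu q f = vord (pull q f)"
definition mX :: "point => germ => nat" where
 "mX p f = (case compX p of None => 0 | Some q => mu q f)"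
definition mY :: "point => germ => nat" where
 "mY p f = (case compY p of None => 0 | Some q => mu q f)"

lemma mu_eq_aux:
 assumes "is_unit u" "f ~= 0" "F = gX ^ a * gY ^ b * u * f"
 shows "vord F = a + b + vord f"
 using assms by (simp add: vord_mult vord_power)

text \<open>By induction over the last blow-up: the new component receives the multiplicities of the
  components through its centre plus the order of the strict transform.\<close>

lemma pull_structure:
 assumes "f ~= 0"
 shows "\<exists>u. is_unit u & pull p f = gX ^ mX p f * gY ^ mY p f * u * st p f"
proof (induction p rule: rev_induct)
 case Nil
 thus ?case by (intro exI[of _ 1]) (simp add: mX_def mY_def)
next
 case (snoc d p)
 then obtain u where u: "is_unit u" "pull p f = gX ^ mX p f * gY ^ mY p f * u * st p f" by blast
 have mu: "mu p f = mX p f + mY p f + vord (st p f)"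
  unfolding mu_def by (rule mu_eq_aux[OF u(1) _ u(2)]) (use assms in simp)
 have s: "pull1 d (st p f) = ex d ^ vord (st p f) * st (p @ [d]) f"
  using pull1_factor(1)[of "st p f" d] assms by (simp add: st_append del: st1.simps)
 have pw: "pull1 d (a ^ n) = pull1 d a ^ n" for a n
  using pull_power[of "[d]" a n] unfolding pull_1_eq .
 have e: "pull (p @ [d]) f = pull1 d gX ^ mX p f * pull1 d gY ^ mY p f * pull1 d u *
   (ex d ^ vord (st p f) * st (p @ [d]) f)"
  unfolding pull_append u(2) by (simp only: pull.simps pull1_hom pw s)
 show ?case
 proof (cases d)
  case Vertical
  have m: "mX (p @ [d]) f = mX p f" "mY (p @ [d]) f = mu p f"
   by (simp_all add: mX_def mY_def Vertical)
  show ?thesis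
   unfolding e m by (intro exI[of _ "pull1 d u"])
    (use u(1) in \<open>simp add: Vertical mu power_add power_mult_distrib\<close>)
 next
  case (Slope c)
  show ?thesis
  proof (cases "c = 0")
   case True
   have m: "mX (p @ [d]) f = mu p f" "mY (p @ [d]) f = mY p f"
    by (simp_all add: mX_def mY_def Slope True)
   show ?thesis
    unfolding e m by (intro exI[of _ "pull1 d u"])
     (use u(1) in \<open>simp add: Slope True mu power_add power_mult_distrib\<close>)
  next
   case False
   have m: "mX (p @ [d]) f = mu p f" "mY (p @ [d]) f = 0"
    by (simp_all add: mX_def mY_def Slope False)
   \<comment> \<open>For a nonzero slope the old component y = 0 does not pass through the new
     point: its equation becomes x times the unit y + c.\<close>
   have "is_unit ((gY + cst c) ^ mY p f * pull1 d u)"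
    using u(1) False by (simp add: is_unit_iff)
   thus ?thesis
    unfolding e m by (intro exI[of _ "(gY + cst c) ^ mY p f * pull1 d u"])
     (simp add: Slope mu power_add power_mult_distrib)
  qed
 qed
qed

lemma mu_eq: "f ~= 0 ==> mu p f = mX p f + mY p f + vord (st p f)"
 using pull_structure[of f p] mu_eq_aux unfolding mu_def by auto

lemma mu_pos: "gc f 0 0 = 0 ==> f ~= 0 ==> 0 < mu q f"
 unfolding mu_def using vord_unit_iff[of "pull q f"] by (simp add: is_unit_iff)

lemma comp_dvd:
 "compX p = Some q ==> gc f 0 0 = 0 ==> gX dvd pull p f"
 "compY p = Some q ==> gc f 0 0 = 0 ==> gY dvd pull p f"
proof -
 have *: "gX ^ mX p f * gY ^ mY p f dvd pull p f" if "f ~= 0"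
  using pull_structure[OF that, of p] by auto
 show "compX p = Some q ==> gc f 0 0 = 0 ==> gX dvd pull p f"
 proof (cases "f = 0")
  case False
  assume "compX p = Some q" "gc f 0 0 = 0"
  hence "0 < mX p f" using mu_pos False by (simp add: mX_def)
  hence "gX dvd gX ^ mX p f" by simp
  thus ?thesis using *[OF False] by auto
 qed simp
 show "compY p = Some q ==> gc f 0 0 = 0 ==> gY dvd pull p f"
 proof (cases "f = 0")
  case False
  assume "compY p = Some q" "gc f 0 0 = 0"
  hence "0 < mY p f" using mu_pos False by (simp add: mY_def)
  hence "gY dvd gY ^ mY p f" by simp
  thus ?thesis using *[OF False] by auto
 qed simp
qed

lemma prime_dvd_imp_dvd:
 assumes "prm p" "prm q" "p dvd (q::germ)" shows "q dvd p"
 using assms prime_elem_imp_irreducible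
 by (metis irreducibleD' prime_elem_not_unit)

lemma nonexc_not_comp:
 assumes "prm g" "nonexc p g"
 shows "compX p = Some q ==> ~ g dvd gX" "compY p = Some q ==> ~ g dvd gY"
 using comp_dvd[of p q gX] comp_dvd[of p q gY] assms(2)
 unfolding nonexc_def by auto

text \<open>One of the germs x, y has a unit as strict transform already after the first blow-up, so
  its pull-back is a monomial in the local components times a unit.\<close>

lemma nonexc_comp:
 assumes "!!q. compX p = Some q ==> ~ g dvd gX" "!!q. compY p = Some q ==> ~ g dvd gY"
  "prm g" "p ~= []"
 shows "nonexc p g"
proof -
 have *: "\<exists>f. is_unit (st p f) & (f = gX \<or> f = gY)" if "p ~= []" for p
 proof -
  obtain d r where r: "p = d # r" using \<open>p ~= []\<close> by (cases p) auto
  show ?thesis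
  proof (cases d)
   case (Slope c)
   have "st1 d gX = 1" using st1_eqI[of d gX 1 1] prime_X Slope by simp
   thus ?thesis using r by (intro exI[of _ gX]) (simp add: st_unit del: st1.simps)
  next
   case Vertical
   have "st1 d gY = 1" using st1_eqI[of d gY 1 1] prime_Y Vertical by simp
   thus ?thesis using r by (intro exI[of _ gY]) (simp add: st_unit del: st1.simps)
  qed
 qed
 then obtain f where f: "is_unit (st p f)" "f = gX \<or> f = gY" using assms(4) by blast
 hence "f ~= 0" by auto
 then obtain u where u: "is_unit u" "pull p f = gX ^ mX p f * gY ^ mY p f * u * st p f"
  using pull_structure by blast
 have "~ g dvd pull p f"
 proof
  assume "g dvd pull p f"
  moreover have "~ g dvd u" "~ g dvd st p f"
   using u(1) f(1) assms(3) by (meson dvd_trans prime_elem_not_unit)+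
  ultimately have "g dvd gX ^ mX p f \<or> g dvd gY ^ mY p f"
   using assms(3) by (simp add: u(2) prime_elem_dvd_mult_iff)
  hence "(g dvd gX & mX p f ~= 0) \<or> (g dvd gY & mY p f ~= 0)"
   using assms(3) prime_elem_dvd_power by (metis power_0 prime_elem_not_unit)
  thus False using assms(1,2) by (auto simp: mX_def mY_def split: option.splits)
 qed
 thus ?thesis using f(2) by (auto simp: nonexc_def)
qed

lemma jac_Cons: "jac (d # p) = pull p (ex d) * jac p"
proof -
 have c: "jac (d # p) = pull p (jac [d]) * jac p"
  unfolding jac_def pull.simps chain_rule[of p "pull1 d gX"] chain_rule[of p "pull1 d gY"]
  by (simp add: alg)
 have "jac [d] = ex d" by (cases d) (auto simp: jac_def dx_mult dy_mult)
 with c show ?thesis by simp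
qed

lemma jac_not_dvd: "prm g ==> nonexc p g ==> ~ g dvd jac p"
proof (induction p)
 case Nil
 thus ?case by (auto simp: jac_def)
next
 case (Cons d p)
 thus ?case using nonexc_Cons[of g d p] by (auto simp: jac_Cons prime_elem_dvd_mult_iff)
qed

lemma monomial_not_dvd:
 assumes "prm g" "nonexc p g" "is_unit u"
 shows "~ g dvd gX ^ mX p f * gY ^ mY p f * u"
proof
 assume "g dvd gX ^ mX p f * gY ^ mY p f * u"
 moreover have "~ g dvd u" using assms by (meson dvd_trans prime_elem_not_unit)
 ultimately have "g dvd gX ^ mX p f \<or> g dvd gY ^ mY p f"
  using assms(1) by (simp add: prime_elem_dvd_mult_iff)
 hence "(g dvd gX & mX p f ~= 0) \<or> (g dvd gY & mY p f ~= 0)"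
  using assms(1) prime_elem_dvd_power by (metis power_0 prime_elem_not_unit)
 thus False using nonexc_not_comp[OF assms(1,2)] by (auto simp: mX_def mY_def split: option.splits)
qed

text \<open>Cramer's rule. Through it a non-exceptional factor of the pulled back form yields a
  common factor of the original coefficients.\<close>

lemma pull_form_jac:
 "pull p (fst om) * jac p = fst (plf p om) * Dy (pull p gY) - snd (plf p om) * Dx (pull p gY)"
 "pull p (snd om) * jac p = snd (plf p om) * Dx (pull p gX) - fst (plf p om) * Dy (pull p gX)"
 by (simp_all add: pull_form_def jac_def alg)

text \<open>The total transform of f is M g. Modulo g, the wedge with M g is M times the wedge with
  g, and g divides neither M, nor the Jacobian, nor the scaling factor h.\<close>

lemma invariant_pushes:
 assumes g: "prm g" "nonexc p g" "pushes p g f"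
  and h: "plf p om = scl h om'" and co: "coprime (fst om) (snd om)"
 shows "f dvd wdg om f <-> g dvd wdg om' g"
proof -
 have f: "prm f" using pushes_prime g by blast
 obtain u where u: "is_unit u" "pull p f = gX ^ mX p f * gY ^ mY p f * u * g"
  using pull_structure[of f p] pushes_st_eq[OF g(3)] f by auto
 define M where "M = gX ^ mX p f * gY ^ mY p f * u"
 have M: "~ g dvd M" unfolding M_def by (rule monomial_not_dvd[OF g(1,2) u(1)])
 have J: "~ g dvd jac p" by (rule jac_not_dvd[OF g(1,2)])
 have gh: "~ g dvd h"
 proof
  assume "g dvd h"
  hence "g dvd pull p (fst om) * jac p" "g dvd pull p (snd om) * jac p"
   unfolding pull_form_jac h by (auto simp: scale_form_def)
  hence "f dvd fst om" "f dvd snd om"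
   using g(1) J pushes_dvd[OF g(3)] by (auto simp: prime_elem_dvd_mult_iff)
  thus False using co f by (auto simp: coprime_def)
 qed
 have "pull p (wdg om f) * jac p = h * (M * wdg om' g + g * wdg om' M)"
  unfolding wedge_pull[symmetric] h wedge_scale u(2) M_def[symmetric] wedge_mult by (simp add: alg)
 hence "g dvd pull p (wdg om f) * jac p <-> g dvd h * (M * wdg om' g + g * wdg om' M)" by simp
 also have "\<dots> <-> g dvd M * wdg om' g + g * wdg om' M" using gh g(1) by (simp add: prime_elem_dvd_mult_iff)
 also have "\<dots> <-> g dvd M * wdg om' g" by (simp add: dvd_add_left_iff)
 also have "\<dots> <-> g dvd wdg om' g" using M g(1) by (simp add: prime_elem_dvd_mult_iff)
 finally show ?thesis using J g(1) pushes_dvd[OF g(3)] by (simp add: prime_elem_dvd_mult_iff)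
qed

subsection \<open>Curves\<close>

lemma mem_curve_of [simp]: "a : crv f <-> f dvd a" by (simp add: curve_of_def)

lemma curve_of_eq_iff: "crv f = crv g <-> f dvd g & g dvd f"
by (metis dvd_refl mem_curve_of set_eqI dvd_trans)

lemma dvd_antisym_unit:
 fixes f g :: germ
 assumes "f dvd g" "g dvd f" obtains u where "is_unit u" "g = u * f"
proof (cases "f = 0")
 case True
 thus ?thesis using assms that[of 1] by auto
next
 case False
 obtain u v where "g = f * u" "f = g * v" using assms by blast
 hence "f * (u * v) = f * 1" by (metis mult.assoc mult.right_neutral)
 hence "u * v = 1" using False by simp
 thus ?thesis using that[of u] \<open>g = f * u\<close> by (metis dvdI mult.commute)
qed

lemma wedge_unit_dvd: "is_unit u ==> f dvd wdg om f <-> u * f dvd wdg om (u * f)"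
 by (simp add: wedge_mult dvd_add_left_iff)

lemma invariant_curve_iff: "invariant_curve om (crv f) <-> f dvd wdg om f"
by (metis wedge_unit_dvd invariant_curve_def curve_of_eq_iff dvd_antisym_unit)

lemma branchE:
 assumes "branch T" obtains g where "prm g" "one_dimensional g" "T = crv g"
 using assms irreducible_prime_germ by (auto simp: branch_def)

lemma nonexc_unit: "is_unit u ==> nonexc p (u * g) <-> nonexc p g"
 by (simp add: nonexc_def mult_unit_dvd_iff')

lemma curve_of_unit: "is_unit u ==> crv (u * g) = crv g"
 by (simp add: curve_of_eq_iff)

text \<open>Push an equation of T down to the origin. The result is prime and divides an equation of
  S, so it is itself an equation of S.\<close>

lemma strict_branch_push:
 assumes "branch S" "strict_branch p S T"
 obtains g f where "prm g" "nonexc p g" "T = crv g" "S = crv f" "pushes p g f"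
proof -
 obtain g where g: "prm g" "T = crv g" using assms by (auto simp: strict_branch_def elim: branchE)
 have ne: "nonexc p g" using assms(2) g by (simp add: strict_branch_def nonexc_def)
 obtain u f where f: "is_unit u" "pushes p (u * g) f" using pushes_exists[OF g(1) ne] by blast
 obtain f' where f': "prm f'" "S = crv f'" using assms by (auto elim: branchE)
 have "f' : S" using f' by simp
 hence "g dvd pull p f'" using assms(2) g(2) by (auto simp: strict_branch_def)
 hence "f dvd f'" using pushes_dvd[OF f(2)] f(1) by (simp add: mult_unit_dvd_iff')
 moreover have "prm f" using pushes_prime[OF _ f(2)] g(1) f(1) by (simp add: prime_elem_mult_unit_left)
 ultimately have "f' dvd f" using f' prime_dvd_imp_dvd by blast
 with \<open>f dvd f'\<close> have "S = crv f" using f' by (simp add: curve_of_eq_iff)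
 moreover have "prm (u * g)" using g f by (simp add: prime_elem_mult_unit_left)
 ultimately show ?thesis using that[of "u * g" f] f g ne by (simp add: nonexc_unit curve_of_unit)
qed

lemma strict_branch_pushes:
 "branch (crv g) ==> nonexc p g ==> pushes p g f ==> strict_branch p (crv f) (crv g)"
 by (auto simp: strict_branch_def nonexc_def pushes_dvd)

lemma strict_branch_pushes_unique:
 assumes "prm g" "nonexc p g" "pushes p g f" "strict_branch p (crv f) T"
 shows "T = crv g"
proof -
 obtain g' where g': "prm g'" "T = crv g'" using assms(4) by (auto simp: strict_branch_def elim: branchE)
 have ne: "nonexc p g'" using assms(4) g' by (simp add: strict_branch_def nonexc_def)
 have "pull p ` crv f \<subseteq> crv g'" using assms(4) g'(2) by (simp add: strict_branch_def)
 moreover have "pull p f : pull p ` crv f" by simp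
 ultimately have "pull p f : crv g'" by blast
 hence d: "g' dvd pull p f" by simp
 have "f ~= 0" using pushes_prime[OF assms(1,3)] by simp
 then obtain u where u: "is_unit u" "pull p f = gX ^ mX p f * gY ^ mY p f * u * g"
  using pull_structure[of f p] pushes_st_eq[OF assms(3)] by auto
 have "g' dvd gX ^ mX p f * gY ^ mY p f * u \<or> g' dvd g"
  using d g'(1) unfolding u(2) by (rule prime_elem_dvd_multD[rotated])
 hence "g' dvd g" using monomial_not_dvd[OF g'(1) ne u(1), of f] by blast
 thus ?thesis using g' assms(1) prime_dvd_imp_dvd by (auto simp: curve_of_eq_iff)
qed

section \<open>Parametrized curves\<close>

abbreviation al :: "germ => real fps => real fps => real fps" where "al \<equiv> germ_along"

lemma fps_conv_radius_pos_iff: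
 fixes f :: "real fps"
 shows "0 < rad f <-> (\<exists>s M. 0 < s & bnd s f M)"
proof
 assume "0 < rad f"
 then obtain r where r: "0 < ereal r" "ereal r < rad f" using ereal_dense2 by blast
 hence r0: "0 < r" by simp
 have "summable (%n. norm (cf f n * r ^ n))"
  using r by (intro abs_summable_in_conv_radius) (auto simp: fps_conv_radius_def)
 hence s: "summable (%n. \<bar>cf f n\<bar> * r ^ n)" using r0 by (simp add: abs_mult)
 have "bnd r f (\<Sum>n. \<bar>cf f n\<bar> * r ^ n)"
  unfolding bnd_def psum_def using r0 s by (intro allI sum_le_suminf) auto
 thus "\<exists>s M. 0 < s & bnd s f M" using r0 by blast
next
 assume "\<exists>s M. 0 < s & bnd s f M"
 then obtain s M where s: "0 < s" "bnd s f M" by blast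
 have "ereal s \<le> conv_radius (cf f)"
 proof (rule conv_radius_geI_ex)
  fix r :: real assume r: "0 < r" "ereal r < ereal s"
  have "summable (%n. cf f n * r ^ n)"
  proof (rule summable_comparison_test')
   show "summable (%n. M * (r / s) ^ n)"
    using r by simp
   fix n :: nat
   have "norm (cf f n * r ^ n) = (\<bar>cf f n\<bar> * s ^ n) * (r / s) ^ n"
    using r by (simp add: abs_mult power_divide)
   also have "\<dots> \<le> M * (r / s) ^ n"
    using r s bnd_nth[of s f M n] by simp
   finally show "norm (cf f n * r ^ n) \<le> M * (r / s) ^ n" .
  qed
  thus "\<exists>z. norm z = r & summable (%n. cf f n * z ^ n)" using r by (intro exI[of _ r]) auto
 qed
 thus "0 < rad f" using s(1) unfolding fps_conv_radius_def
  by (metis ereal_less(2) less_le_trans)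
qed

lemma bnd_smaller:
 assumes "0 < s" "s \<le> r" "bnd r a M" shows "bnd s a M"
 unfolding bnd_def
proof
 fix n
 have "psum s n a \<le> psum r n a" unfolding psum_def
  using assms by (intro sum_mono mult_left_mono power_mono) auto
 also have "\<dots> \<le> M" using assms by (simp add: bnd_def)
 finally show "psum s n a \<le> M" .
qed

lemma fps_conv_radius_pos_mult:
 fixes f g :: "real fps"
 assumes "0 < rad f" "0 < rad g" shows "0 < rad (f * g)"
proof -
 obtain s M where 1: "0 < s" "bnd s f M" using assms(1) by (auto simp: fps_conv_radius_pos_iff)
 obtain r N where 2: "0 < r" "bnd r g N" using assms(2) by (auto simp: fps_conv_radius_pos_iff)
 have "bnd (min s r) (f * g) (M * N)"
  using 1 2 bnd_smaller[of "min s r" s f M] bnd_smaller[of "min s r" r g N] by (intro bnd_mult) auto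
 thus ?thesis unfolding fps_conv_radius_pos_iff using 1 2 by (intro exI[of _ "min s r"] exI[of _ "M * N"]) auto
qed

lemma fps_conv_radius_pos_add:
 fixes f g :: "real fps"
 assumes "0 < rad f" "0 < rad g" shows "0 < rad (f + g)"
 using fps_conv_radius_add[of f g] assms by (meson less_le_trans min_less_iff_conj)

lemma fps_nth_mult_eq_0:
 fixes a b :: "real fps"
 assumes "\<forall>k<n. cf a k = 0" "\<forall>k<m. cf b k = 0" "k < n + m"
 shows "cf (a * b) k = 0"
 unfolding fps_mult_nth
proof (intro sum.neutral ballI)
 fix i assume "i : {0..k}"
 hence "i < n \<or> k - i < m" using assms(3) by auto
 thus "cf a i * cf b (k - i) = 0" using assms by auto
qed

lemma power_nth_0:
 fixes Y :: "real fps"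
 assumes "cf Y 0 = 0" "k < j" shows "cf (Y ^ j) k = 0"
 using assms startsby_zero_power_prefix by (metis)

lemma monomial_nth_0:
 fixes X Y :: "real fps"
 assumes "cf X 0 = 0" "cf Y 0 = 0" "n < i + j"
 shows "cf (X ^ i * Y ^ j) n = 0"
 by (rule fps_nth_mult_eq_0[of i _ j]) (use assms power_nth_0 in auto)

lemma sum_swap3: "(\<Sum>i\<in>A. \<Sum>j\<in>B. \<Sum>k\<in>C. t i j k) = (\<Sum>k\<in>C. \<Sum>i\<in>A. \<Sum>j\<in>B. t i j k)"
proof -
 have "(\<Sum>i\<in>A. \<Sum>j\<in>B. \<Sum>k\<in>C. t i j k) = (\<Sum>i\<in>A. \<Sum>k\<in>C. \<Sum>j\<in>B. t i j k)"
  by (rule sum.cong[OF refl], rule sum.swap)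
 also have "\<dots> = (\<Sum>k\<in>C. \<Sum>i\<in>A. \<Sum>j\<in>B. t i j k)" by (rule sum.swap)
 finally show ?thesis .
qed

context
 fixes X Y :: "real fps"
 assumes X0: "cf X 0 = 0" and Y0: "cf Y 0 = 0"
begin

lemma al_nth:
 assumes "n \<le> N"
 shows "cf (al f X Y) n = (\<Sum>i\<le>N. \<Sum>j\<le>N. gc f i j * cf (X ^ i * Y ^ j) n)"
proof -
 have z: "gc f i j * cf (X ^ i * Y ^ j) n = 0" if "n < i \<or> n < j" for i j
  using monomial_nth_0[OF X0 Y0, of n i j] that by auto
 have "cf (al f X Y) n = (\<Sum>(i, j)\<in>{..n} \<times> {..n}. gc f i j * cf (X ^ i * Y ^ j) n)"
  by (simp add: germ_along_def sum.cartesian_product)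
 also have "\<dots> = (\<Sum>(i, j)\<in>{..N} \<times> {..N}. gc f i j * cf (X ^ i * Y ^ j) n)"
  using assms by (intro sum.mono_neutral_left) (auto intro!: z simp: not_le)
 finally show ?thesis by (simp add: sum.cartesian_product)
qed

lemma al_add [simp]: "al (f + g) X Y = al f X Y + al g X Y"
 by (rule fps_ext) (simp add: germ_along_def distrib_right sum.distrib)
lemma al_const [simp]: "al (cst c) X Y = fps_const c"
proof (rule fps_ext)
 fix n
 have "cf (al (cst c) X Y) n = (\<Sum>i\<le>n. \<Sum>j\<le>n. if i = 0 then (if j = 0 then c * cf 1 n else 0) else 0)"
  unfolding germ_along_def fps_nth_Abs_fps by (intro sum.cong refl) (auto simp: gc_const)
 also have "\<dots> = (\<Sum>i\<le>n. if i = 0 then c * cf 1 n else 0)"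
  by (intro sum.cong refl) auto
 finally show "cf (al (cst c) X Y) n = cf (fps_const c) n" by simp
qed
lemma al_0 [simp]: "al 0 X Y = 0" and al_1 [simp]: "al 1 X Y = 1"
 using al_const[of 0] al_const[of 1] by auto
lemma al_const_mult [simp]: "al (cst c * f) X Y = fps_const c * al f X Y"
 by (rule fps_ext) (simp add: germ_along_def sum_distrib_left mult.assoc)

lemma al_X_mult: "al (gX * f) X Y = X * al f X Y"
proof (rule fps_ext)
 fix n
 \<comment> \<open>The bound Suc n leaves room for the shift of i by one in the next line.\<close>
 have "cf (al (gX * f) X Y) n = (\<Sum>i\<le>Suc n. \<Sum>j\<le>Suc n. gc (gX * f) i j * cf (X ^ i * Y ^ j) n)"
  by (rule al_nth) simp
 also have "\<dots> = (\<Sum>i\<le>n. \<Sum>j\<le>Suc n. gc f i j * cf (X * (X ^ i * Y ^ j)) n)"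
  unfolding sum.atMost_Suc_shift[of _ n] by (simp add: gc_X_mult mult.assoc)
 also have "\<dots> = (\<Sum>i\<le>n. \<Sum>j\<le>n. gc f i j * cf (X * (X ^ i * Y ^ j)) n)"
 proof (rule sum.cong[OF refl])
  fix i
  have "cf (X * (X ^ i * Y ^ Suc n)) n = 0"
   using monomial_nth_0[OF X0 Y0, of n "Suc i" "Suc n"] by (simp add: mult.assoc)
  thus "(\<Sum>j\<le>Suc n. gc f i j * cf (X * (X ^ i * Y ^ j)) n) = (\<Sum>j\<le>n. gc f i j * cf (X * (X ^ i * Y ^ j)) n)"
   by simp
 qed
 also have "\<dots> = (\<Sum>i\<le>n. \<Sum>j\<le>n. \<Sum>k=0..n. cf X k * (gc f i j * cf (X ^ i * Y ^ j) (n - k)))"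
  unfolding fps_mult_nth[of X] sum_distrib_left by (simp add: mult.left_commute)
 also have "\<dots> = (\<Sum>k=0..n. \<Sum>i\<le>n. \<Sum>j\<le>n. cf X k * (gc f i j * cf (X ^ i * Y ^ j) (n - k)))"
  by (rule sum_swap3)
 also have "\<dots> = cf (X * al f X Y) n"
  unfolding fps_mult_nth[of X]
  by (rule sum.cong[OF refl]) (simp only: al_nth[of _ n] sum_distrib_left diff_le_self)
 finally show "cf (al (gX * f) X Y) n = cf (X * al f X Y) n" .
qed

end

lemma al_swap: "al (swp f) X Y = al f Y X"
 by (rule fps_ext) (simp add: germ_along_def mult.commute, rule sum.swap)

lemma al_Y_mult:
 assumes "cf X 0 = 0" "cf Y 0 = 0"
 shows "al (gY * f) X Y = Y * al f X Y"
 using al_X_mult[OF assms(2,1), of "swp f"] al_swap[of "gX * swp f" X Y] al_swap[of f Y X]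
 by simp

lemma germ_zeroI_fps:
 fixes D :: "germ => real fps"
 assumes "!!f g. D (f + g) = D f + D g" "!!c. D (cst c) = 0"
  and "!!f. D (gX * f) = u * D f" "!!f. D (gY * f) = v * D f"
  and "cf u 0 = 0" "cf v 0 = 0"
 shows "D f = 0"
proof -
 have m: "\<forall>k<Suc n. cf (w * a) k = 0" if "cf w 0 = 0" "\<forall>k<n. cf a k = 0" for n w and a :: "real fps"
  using fps_nth_mult_eq_0[of 1 w n a] that by auto
 have sep: "a = 0" if "!!n. \<forall>k<n. cf a k = 0" for a :: "real fps"
  by (rule fps_ext) (use that in \<open>metis fps_zero_nth lessI\<close>)
 show ?thesis
  by (rule germ_zeroI[where Ord = "%n a. \<forall>k<n. cf a k = 0" and u = u and v = v])
   (use assms m sep in auto)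
qed

context
 fixes X Y :: "real fps"
 assumes X0: "cf X 0 = 0" and Y0: "cf Y 0 = 0"
begin

lemma al_mult [simp]: "al (f * g) X Y = al f X Y * al g X Y"
proof -
 have "al (f * g) X Y - al f X Y * al g X Y = 0"
  by (rule germ_zeroI_fps[where u = X and v = Y])
   (simp_all add: X0 Y0 distrib_right al_X_mult[OF X0 Y0] al_Y_mult[OF X0 Y0] right_diff_distrib mult.assoc)
 thus ?thesis by simp
qed

lemma al_X [simp]: "al gX X Y = X" and al_Y [simp]: "al gY X Y = Y"
 using al_X_mult[OF X0 Y0, of 1] al_Y_mult[OF X0 Y0, of 1] by (simp_all add: al_1[OF X0 Y0])
lemma al_uminus [simp]: "al (- f) X Y = - al f X Y"
 using al_const_mult[OF X0 Y0, of "-1" f] by (simp flip: fps_const_neg)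
lemma al_diff [simp]: "al (f - g) X Y = al f X Y - al g X Y"
 using al_add[OF X0 Y0, of f "- g"] by simp
lemma al_power [simp]: "al (f ^ n) X Y = al f X Y ^ n"
 by (induction n) (auto simp: al_1[OF X0 Y0])

lemma al_chain: "fD (al f X Y) = al (Dx f) X Y * fD X + al (Dy f) X Y * fD Y"
proof -
 have "fD (al f X Y) - (al (Dx f) X Y * fD X + al (Dy f) X Y * fD Y) = 0"
  by (rule germ_zeroI_fps[where u = X and v = Y])
   (auto simp: X0 Y0 dx_mult dy_mult alg)
 thus ?thesis by simp
qed

lemma al_nth_0: "cf (al f X Y) 0 = gc f 0 0"
 by (simp add: germ_along_def)

lemma al_compose:
 assumes s: "cf s 0 = 0"
 shows "al f X Y oo s = al f (X oo s) (Y oo s)"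
proof -
 have Xs: "cf (X oo s) 0 = 0" "cf (Y oo s) 0 = 0" using X0 Y0 by auto
 have "(al f X Y oo s) - al f (X oo s) (Y oo s) = 0"
  by (rule germ_zeroI_fps[where u = "X oo s" and v = "Y oo s"])
   (auto simp: X0 Y0 al_X_mult[OF Xs] al_Y_mult[OF Xs] fps_compose_add_distrib fps_compose_mult_distrib[OF s] right_diff_distrib)
 thus ?thesis by simp
qed

end

lemma al_pull_slope:
 assumes "cf X 0 = 0" "cf Y 0 = 0"
 shows "al (psl c f) X Y = al f X (X * (Y + fps_const c))"
proof -
 have z: "cf (X * (Y + fps_const c)) 0 = 0" using assms by simp
 note s = al_add[OF assms] al_const[OF assms] al_mult[OF assms] al_X[OF assms] al_Y[OF assms]
  al_add[OF assms(1) z] al_const[OF assms(1) z] al_X_mult[OF assms(1) z] al_Y_mult[OF assms(1) z]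
 have "al (psl c f) X Y - al f X (X * (Y + fps_const c)) = 0"
  by (rule germ_zeroI_fps[where u = X and v = "X * (Y + fps_const c)"])
   (auto simp: assms pull_slope_mult alg)
 thus ?thesis by simp
qed

lemma al_pull_vertical:
 assumes "cf X 0 = 0" "cf Y 0 = 0"
 shows "al (pvt f) X Y = al f (X * Y) Y"
 using al_pull_slope[OF assms(2,1), of 0 "swp f"]
 by (simp add: pull_vertical_swap al_swap mult.commute)

text \<open>The blow-up map applied to a parametrized curve.\<close>

fun pp :: "direction => real fps \<times> real fps => real fps \<times> real fps" where
 "pp (Sl c) (U, V) = (U, U * (V + fps_const c))"
| "pp Vt (U, V) = (U * V, V)"

lemma al_pull1:
 assumes "cf U 0 = 0" "cf V 0 = 0"
 shows "al (pull1 d f) U V = al f (fst (pp d (U, V))) (snd (pp d (U, V)))"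
 by (cases d) (use assms in \<open>auto simp: al_pull_slope al_pull_vertical\<close>)

lemma pp_nth_0:
 assumes "cf U 0 = 0" "cf V 0 = 0"
 shows "cf (fst (pp d (U, V))) 0 = 0" "cf (snd (pp d (U, V))) 0 = 0"
 by (cases d; use assms in simp)+

text \<open>The series of smaller order among X and Y divides the other; the quotient minus its
  value at 0 is the new coordinate, and that value is the slope.\<close>

lemma param_direction:
 fixes X Y :: "real fps"
 assumes "cf X 0 = 0" "cf Y 0 = 0" "X ~= 0 \<or> Y ~= 0"
 obtains d U V where "cf U 0 = 0" "cf V 0 = 0" "pp d (U, V) = (X, Y)" "al (ex d) U V ~= 0"
proof (cases "Y = 0 \<or> (X ~= 0 & sdg X \<le> sdg Y)")
 case True
 hence X: "X ~= 0" using assms(3) by auto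
 have "X dvd Y" using True by (cases "Y = 0") (auto simp: fps_dvd_iff)
 then obtain Z where Z: "Y = X * Z" by blast
 define V where "V = Z - fps_const (cf Z 0)"
 have V: "cf V 0 = 0" by (simp add: V_def)
 show ?thesis
  by (rule that[of X V "Sl (cf Z 0)"]) (use V assms X Z in \<open>auto simp: V_def\<close>)
next
 case False
 hence Y: "Y ~= 0" by auto
 have "\<exists>Z. X = Y * Z & cf Z 0 = 0"
 proof (cases "X = 0")
  case False2: False
  hence lt: "sdg Y < sdg X" using False by auto
  hence "Y dvd X" using Y False2 by (auto simp: fps_dvd_iff)
  then obtain Z where Z: "X = Y * Z" by blast
  hence "Z ~= 0" using False2 by auto
  hence "sdg Z > 0" using lt Z Y by auto
  thus ?thesis using Z by auto
 qed auto
 then obtain Z where Z: "X = Y * Z" "cf Z 0 = 0" by blast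
 show ?thesis
  by (rule that[of Z Y Vertical]) (use assms Z Y in \<open>auto\<close>)
qed

text \<open>Every formal parametrization of \<open>{f = 0}\<close> factors through \<open>(U, V)\<close>.\<close>
definition gp :: "germ => real fps => real fps => bool" where
 "gp f U V <-> rad U > 0 & rad V > 0 & cf U 0 = 0 & cf V 0 = 0 &
  (\<forall>a. al a U V = 0 <-> f dvd a) &
  (\<forall>X Y. cf X 0 = 0 --> cf Y 0 = 0 --> al f X Y = 0 -->
    (\<exists>s. cf s 0 = 0 & X = U oo s & Y = V oo s)) &
  (U ~= 0 --> yreg (sdg U) f) & (V ~= 0 --> yreg (sdg V) (swp f))"

lemma gp_swap: assumes "gp f U V" shows "gp (swp f) V U"
proof -
 have 1: "al a V U = 0 <-> swp f dvd a" for a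
  using assms al_swap[of "swp a" V U] swap_dvd_iff[of f "swp a"] by (simp add: gp_def)
 have 2: "\<exists>s. cf s 0 = 0 & X = V oo s & Y = U oo s"
  if "cf X 0 = 0" "cf Y 0 = 0" "al (swp f) X Y = 0" for X Y
  using assms that al_swap[of f X Y] unfolding gp_def by metis
 show ?thesis using assms 1 2 by (simp add: gp_def)
qed

lemma gp_unit: assumes "gp f U V" "is_unit u" shows "gp (u * f) U V"
proof -
 have 1: "al (u * f) X Y = 0 <-> al f X Y = 0" if "cf X 0 = 0" "cf Y 0 = 0" for X Y
 proof -
  have "cf (al u X Y) 0 ~= 0" using assms(2) that by (simp add: al_nth_0 is_unit_iff)
  hence "al u X Y ~= 0" by auto
  thus ?thesis using that by simp
 qed
 show ?thesis using assms(1) 1 yreg_unit[OF assms(2), of _ f] yreg_unit[of "swp u" _ "swp f"] assms(2)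
  by (simp add: gp_def mult_unit_dvd_iff')
qed

text \<open>An arc on f = 0 lifts, in its tangent direction, to a zero of the strict transform. That
  transform is a unit except in direction d, so the arc lifts to g = 0 and factors through (U, V).
  The regularity clauses express intersection numbers with the axes as orders of the
  parametrization.\<close>

lemma gp_push1:
 assumes p: "push1 d k g f" and g: "gp g U V" "prm g"
 shows "gp f (fst (pp d (U, V))) (snd (pp d (U, V)))"
proof -
 have UV: "cf U 0 = 0" "cf V 0 = 0" "0 < rad U" "0 < rad V"
  and dv: "!!a. al a U V = 0 <-> g dvd a"
  and fac: "!!X Y. cf X 0 = 0 ==> cf Y 0 = 0 ==> al g X Y = 0 ==>
    \<exists>s. cf s 0 = 0 & X = U oo s & Y = V oo s"
  and ord: "U ~= 0 ==> yreg (sdg U) g" "V ~= 0 ==> yreg (sdg V) (swp g)"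
  using g(1) by (auto simp: gp_def)
 have reg: "exreg d k g" using p by (simp add: push1_def)
 have f: "f ~= 0" "vord f = k" "st1 d f = g" "!!d'. d' ~= d ==> is_unit (st1 d' f)"
  "!!a. g dvd pull1 d a <-> f dvd a" using p by (auto simp: push1_def simp del: st1.simps pull1.simps)
 note pz = pp_nth_0[OF UV(1,2), of d]
 have 1: "0 < rad (fst (pp d (U, V)))" "0 < rad (snd (pp d (U, V)))"
  using UV by (cases d; simp add: fps_conv_radius_pos_mult fps_conv_radius_pos_add)+
 have 2: "al a (fst (pp d (U, V))) (snd (pp d (U, V))) = 0 <-> f dvd a" for a
  using al_pull1[OF UV(1,2), of d a] dv[of "pull1 d a"] f(5)[of a] by metis
 have 3: "\<exists>s. cf s 0 = 0 & X = fst (pp d (U, V)) oo s & Y = snd (pp d (U, V)) oo s"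
  if XY: "cf X 0 = 0" "cf Y 0 = 0" "al f X Y = 0" for X Y
 proof (cases "X = 0 & Y = 0")
  case True
  thus ?thesis using pz by (intro exI[of _ 0]) auto
 next
  case False
  then obtain d' A B where AB: "cf A 0 = 0" "cf B 0 = 0" "pp d' (A, B) = (X, Y)" "al (ex d') A B ~= 0"
   using param_direction[OF XY(1,2)] by metis
  have "0 = al (pull1 d' f) A B" using al_pull1[OF AB(1,2), of d' f] AB(3) XY(3) by simp
  also have "\<dots> = al (ex d') A B ^ k * al (st1 d' f) A B"
   using pull1_factor(1)[OF f(1), of d'] f(2) AB(1,2) by simp
  finally have z: "al (st1 d' f) A B = 0" using AB(4) by simp
  have "d' = d"
  proof (rule ccontr)
   assume "d' ~= d"
   hence "gc (st1 d' f) 0 0 ~= 0" using f(4) by (simp add: is_unit_iff del: st1.simps)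
   thus False using al_nth_0[OF AB(1,2), of "st1 d' f"] z by simp
  qed
  then obtain s where s: "cf s 0 = 0" "A = U oo s" "B = V oo s"
   using fac[OF AB(1,2)] z f(3) by blast
  have "pp d (U oo s, V oo s) = (fst (pp d (U, V)) oo s, snd (pp d (U, V)) oo s)"
   by (cases d) (auto simp: fps_compose_mult_distrib[OF s(1)] fps_compose_add_distrib)
  thus ?thesis using s AB(3) \<open>d' = d\<close> by auto
 qed
 have pf: "pull1 d' f = ex d' ^ k * st1 d' f" for d' using pull1_factor(1)[OF f(1), of d'] f(2) by simp
 \<comment> \<open>The vertical chart leaves the restriction to x = 0 unchanged, and slope 0 the
   restriction to y = 0. So the intersection numbers of f with the axes can be read off its strict
   transforms.\<close>
 have col: "gc (pvt h) 0 j = gc h 0 j" "gc (psl 0 h) j 0 = gc h j 0" for h j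
 proof -
  show "gc (pvt h) 0 j = gc h 0 j" by (simp add: gc_pull_vertical)
  hence "gc (pvt (swp h)) 0 j = gc h j 0" for h
   by (simp add: gc_pull_vertical)
  thus "gc (psl 0 h) j 0 = gc h j 0"
   using pull_vertical_swap[of "swp h"] by (metis gc_swap swap_hom(9))
 qed
 have main: "yreg k f" if "d ~= Vt"
 proof -
  have "gc (gY ^ k * st1 Vt f) 0 j = gc f 0 j" for j
   using pf[of Vertical] col(1)[of f j] by simp
  hence *: "gc f 0 j = (if j < k then 0 else gc (st1 Vt f) 0 (j - k))" for j
   by (metis gc_Y_power_mult)
  have "gc (st1 Vt f) 0 0 ~= 0" using f(4)[OF that[symmetric]] by (simp add: is_unit_iff del: st1.simps)
  thus ?thesis by (simp add: yreg_def *)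
 qed
 have main2: "yreg k (swp f)" if "d ~= Sl 0"
 proof -
  have "gc (gX ^ k * st1 (Sl 0) f) j 0 = gc f j 0" for j
   using pf[of "Sl 0"] col(2)[of f j] by simp
  hence *: "gc f j 0 = (if j < k then 0 else gc (st1 (Sl 0) f) (j - k) 0)" for j
   by (metis gc_X_power_mult)
  have "gc (st1 (Sl 0) f) 0 0 ~= 0" using f(4)[OF that[symmetric]] by (simp add: is_unit_iff del: st1.simps)
  thus ?thesis by (simp add: yreg_def *)
 qed
 have nd: "al (ex d) U V ~= 0"
 proof
  assume "al (ex d) U V = 0"
  hence "g dvd ex d" by (simp add: dv)
  hence "ex d dvd g" using prime_dvd_imp_dvd g(2) prime_ex by blast
  moreover have "~ ex d dvd st1 d f" by (rule pull1_factor(2)[OF f(1)])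
  ultimately show False by (simp add: f(3))
 qed
 have yreg_unique: "m = n" if "yreg m h" "yreg n h" for m n h
  using that unfolding yreg_def by (metis linorder_neqE_nat)
 have 4: "(fst (pp d (U, V)) ~= 0 --> yreg (sdg (fst (pp d (U, V)))) f) &
  (snd (pp d (U, V)) ~= 0 --> yreg (sdg (snd (pp d (U, V)))) (swp f))"
 proof (cases d)
  case (Slope c)
  have U0: "U ~= 0" using nd UV Slope by simp
  have dU: "sdg U = k" using yreg_unique[OF ord(1)[OF U0], of k] reg Slope by (simp add: exreg_def)
  have y1: "yreg k f" using main Slope by simp
  have y2: "yreg (sdg (U * (V + fps_const c))) (swp f)" if "U * (V + fps_const c) ~= 0"
  proof (cases "c = 0")
   case False
   have "cf (V + fps_const c) 0 ~= 0" using False UV by simp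
   hence "V + fps_const c ~= 0" "sdg (V + fps_const c) = 0"
    by (metis fps_zero_nth) (use \<open>cf (V + fps_const c) 0 ~= 0\<close> in \<open>simp\<close>)
   hence "sdg (U * (V + fps_const c)) = k" using U0 dU by simp
   thus ?thesis using main2 Slope False by simp
  next
   case True
   hence V0: "V ~= 0" using that by auto
   have st: "st1 (Sl 0) f = g" using f(3) Slope True by simp
   have "gc (gX ^ k * g) j 0 = gc f j 0" for j
    using pf[of "Sl 0"] col(2)[of f j] st by simp
   hence *: "gc f j 0 = (if j < k then 0 else gc g (j - k) 0)" for j
    by (metis gc_X_power_mult)
   have "sdg (U * (V + fps_const c)) = k + sdg V" using True U0 V0 dU by simp
   thus ?thesis using ord(2)[OF V0] by (auto simp: yreg_def *)
  qed
  show ?thesis using y1 y2 dU Slope by simp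
 next
  case Vertical
  have V0: "V ~= 0" using nd UV Vertical by simp
  have dV: "sdg V = k" using yreg_unique[OF ord(2)[OF V0], of k] reg Vertical by (simp add: exreg_def)
  have y1: "yreg k (swp f)" using main2 Vertical by simp
  have y2: "yreg (sdg (U * V)) f" if "U * V ~= 0"
  proof -
   have U0: "U ~= 0" using that by auto
   have st: "st1 Vt f = g" using f(3) Vertical by simp
   have "gc (gY ^ k * g) 0 j = gc f 0 j" for j
    using pf[of Vertical] col(1)[of f j] st by simp
   hence *: "gc f 0 j = (if j < k then 0 else gc g 0 (j - k))" for j
    by (metis gc_Y_power_mult)
   have "sdg (U * V) = k + sdg U" using U0 V0 dV by simp
   thus ?thesis using ord(1)[OF U0] by (auto simp: yreg_def *)
  qed
  show ?thesis using y1 y2 dV Vertical by simp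
 qed
 show ?thesis unfolding gp_def using 1 2 3 4 pz by blast
qed

fun ppp :: "point => real fps \<times> real fps => real fps \<times> real fps" where
 "ppp [] uv = uv" | "ppp (d # p) uv = pp d (ppp p uv)"

lemma gp_pushes:
 assumes "prm g" "gp g U V"
 shows "pushes p g f ==> gp f (fst (ppp p (U, V))) (snd (ppp p (U, V)))"
proof (induction p arbitrary: f)
 case (Cons d p)
 then obtain h k where h: "pushes p g h" "push1 d k h f" by auto
 have "gp h (fst (ppp p (U, V))) (snd (ppp p (U, V)))" using Cons.IH h(1) by blast
 from gp_push1[OF h(2) this pushes_prime[OF assms(1) h(1)]] show ?case by simp
qed (use assms in auto)

lemma gp_X: "gp gX 0 fps_X"
proof -
 have al0: "al a 0 fps_X = row a 0" for a
 proof -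
  have "al a 0 fps_X - row a 0 = 0"
   by (rule germ_zeroI_fps[where u = 0 and v = fps_X])
    (auto simp: al_X_mult al_Y_mult row_add row_mult alg
     intro!: fps_ext, auto simp: row_nth gc_const gc_X gc_Y)
  thus ?thesis by simp
 qed
 have "al a 0 fps_X = 0 <-> gX dvd a" for a
  by (auto simp: al0 X_dvd_iff fps_eq_iff row_nth)
 moreover have "yreg 1 (swp gX)" by (simp add: yreg_def gc_Y)
 moreover have "\<exists>s. cf s 0 = 0 & X = 0 oo s & Y = fps_X oo s"
  if "cf X 0 = 0" "cf Y 0 = 0" "al gX X Y = 0" for X Y
  using that by auto
 ultimately show ?thesis by (simp add: gp_def)
qed

lemma gp_Y: "gp gY fps_X 0"
 using gp_swap[OF gp_X] by simp

definition xgerm :: "real fps => germ" where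
 "xgerm ph = mk_germ (%i j. if j = 0 then cf ph i else 0)"

lemma gc_xgerm:
 assumes "0 < rad ph"
 shows "gc (xgerm ph) i j = (if j = 0 then cf ph i else 0)"
proof -
 obtain s M where s: "0 < s" "bnd s ph M" using assms by (auto simp: fps_conv_radius_pos_iff)
 have M: "0 \<le> M" using bnd_nonneg[OF s(2)] .
 have b: "\<bar>cf ph i\<bar> \<le> M * (1 / s) ^ i" for i
  using bnd_nth[of s ph M i] s by (simp add: field_simps)
 have "\<bar>if j = 0 then cf ph i else 0\<bar> \<le> M * (1 / s) ^ (i + j)" for i j
  using b[of i] M s(1) by auto
 thus ?thesis unfolding xgerm_def by (intro gc_mk_germ[of "1 / s" _ M]) (use s in auto)
qed

lemma al_xgerm:
 assumes "0 < rad ph" "cf X 0 = 0" "cf Y 0 = 0"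
 shows "al (xgerm ph) X Y = ph oo X"
proof (rule fps_ext)
 fix n
 have "cf (al (xgerm ph) X Y) n = (\<Sum>i\<le>n. \<Sum>j\<le>n. if j = 0 then cf ph i * cf (X ^ i) n else 0)"
  unfolding germ_along_def fps_nth_Abs_fps by (intro sum.cong refl) (auto simp: gc_xgerm[OF assms(1)])
 thus "cf (al (xgerm ph) X Y) n = cf (ph oo X) n"
  by (simp add: fps_compose_nth atLeast0AtMost)
qed

lemma gp_graph:
 assumes "0 < rad ph" "cf ph 0 = 0"
 shows "gp (gY - xgerm ph) fps_X ph"
proof -
 let ?f = "gY - xgerm ph"
 note c = gc_xgerm[OF assms(1)]
 have z: "cf (fps_X :: real fps) 0 = 0" by simp
 have reg: "yreg 1 ?f" using assms by (simp add: yreg_def gc_Y c)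
 have alf: "al ?f X Y = Y - (ph oo X)" if "cf X 0 = 0" "cf Y 0 = 0" for X Y
  using al_xgerm[OF assms(1) that] that by simp
 have 1: "al a fps_X ph = 0 <-> ?f dvd a" for a
 proof
  assume a: "al a fps_X ph = 0"
  obtain q r where qr: "a = q * ?f + r" "ylow 1 r" by (rule weierstrass_division[OF reg])
  have f0: "al ?f fps_X ph = 0" using alf[OF z assms(2)] by simp
  have "al a fps_X ph = al q fps_X ph * al ?f fps_X ph + al r fps_X ph"
   unfolding qr(1) using assms by simp
  hence r0: "al r fps_X ph = 0" using a f0 by simp
  have "gc r i 0 = 0" for i
  proof -
   have "cf (al r fps_X ph) i = (\<Sum>m\<le>i. \<Sum>j\<le>i. if m = i then (if j = 0 then gc r i 0 else 0) else 0)"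
    unfolding germ_along_def fps_nth_Abs_fps using qr(2)
    by (intro sum.cong refl) (auto simp: ylow_def)
   also have "\<dots> = (\<Sum>m\<le>i. if m = i then gc r i 0 else 0)"
    by (intro sum.cong refl) auto
   finally show ?thesis using r0 by simp
  qed
  hence "gc r i j = 0" for i j using qr(2) by (cases j) (auto simp: ylow_def)
  hence "r = 0" by (intro germ_eqI) simp
  thus "?f dvd a" by (simp add: qr(1))
 next
  assume "?f dvd a"
  thus "al a fps_X ph = 0" using alf[OF z assms(2)] assms by auto
 qed
 have 2: "\<exists>s. cf s 0 = 0 & X = fps_X oo s & Y = ph oo s"
  if "cf X 0 = 0" "cf Y 0 = 0" "al ?f X Y = 0" for X Y
  using alf[OF that(1,2)] that by auto
 have 3: "yreg (sdg ph) (swp ?f)" if "ph ~= 0"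
  using that by (auto simp: yreg_def gc_X c intro: nth_less_subdegree_zero)
 show ?thesis unfolding gp_def using 1 2 3 reg assms by simp
qed

section \<open>Existence of separatrices\<close>

text \<open>Taylor approximations of the solution of x y' = m y + G(x, y): its coefficient in degree
  n + 1 is the one of G(x, y) divided by n + 1 - m.\<close>

primrec bb :: "germ => real => nat => real fps" where
 "bb G m 0 = 0"
| "bb G m (Suc n) = bb G m n +
  fps_const (cf (al G fps_X (bb G m n)) (Suc n) / (real (Suc n) - m)) * fps_X ^ Suc n"

lemma bb_nth: "cf (bb G m n) k = (if k \<le> n then cf (bb G m k) k else 0)"
proof (induction n arbitrary: k)
 case (Suc n)
 show ?case
 proof (cases "k = Suc n")
  case False
  thus ?thesis using Suc[of k] by auto
 qed simp
qed simp

lemma power_nth_cong: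
 fixes A B :: "real fps"
 assumes "\<forall>k\<le>n. cf A k = cf B k"
 shows "\<forall>k\<le>n. cf (A ^ j) k = cf (B ^ j) k"
proof (induction j)
 case (Suc j)
 thus ?case using assms by (auto simp: fps_mult_nth intro!: sum.cong)
qed simp

lemma al_cong:
 assumes "\<forall>k\<le>n. cf A k = cf B k" "k \<le> n"
 shows "cf (al a X A) k = cf (al a X B) k"
proof -
 have "cf (X ^ i * A ^ j) k = cf (X ^ i * B ^ j) k" for i j
  using power_nth_cong[OF assms(1), of j] assms(2) by (auto simp: fps_mult_nth intro!: sum.cong)
 thus ?thesis by (simp add: germ_along_def)
qed

text \<open>As G has no term linear in y alone, every occurrence of y comes with another factor
  vanishing at 0; so degree n + 1 sees y only up to degree n.\<close>

lemma al_cong_Suc: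
 assumes G: "gc G 0 1 = 0" and AB: "\<forall>k\<le>n. cf A k = cf B k" "cf A 0 = 0" "cf B 0 = 0"
 shows "cf (al G fps_X A) (Suc n) = cf (al G fps_X B) (Suc n)"
proof -
 define g h where "g = shx 1 G" and "h = shy 1 (row0 G)"
 have h0: "gc h 0 0 = 0" using G by (simp add: h_def gc_row0)
 have z: "cf (fps_X :: real fps) 0 = 0" by simp
 have e: "al G fps_X C = fps_const (gc G 0 0) + fps_X * al g fps_X C + C * al h fps_X C"
  if "cf C 0 = 0" for C
  by (subst germ_decomp[of G]) (use that z in \<open>simp add: g_def h_def\<close>)
 have 1: "cf (fps_X * al g fps_X A) (Suc n) = cf (fps_X * al g fps_X B) (Suc n)"
  using al_cong[OF AB(1), of n g fps_X] by simp
 have 2: "cf ((A - B) * al h fps_X A) (Suc n) = 0"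
  by (rule fps_nth_mult_eq_0[of "Suc n" _ 1])
   (use AB z h0 al_nth_0[OF z AB(2)] in auto)
 have 3: "cf (B * (al h fps_X A - al h fps_X B)) (Suc n) = 0"
  by (rule fps_nth_mult_eq_0[of 1 _ "Suc n"]) (use AB al_cong[OF AB(1)] in auto)
 have "A * al h fps_X A - B * al h fps_X B = (A - B) * al h fps_X A + B * (al h fps_X A - al h fps_X B)"
  by (simp add: alg)
 hence "cf (A * al h fps_X A - B * al h fps_X B) (Suc n) = 0" using 2 3 by simp
 thus ?thesis using 1 e[OF AB(2)] e[OF AB(3)] by simp
qed

lemma psum_power:
 assumes "0 \<le> s" "psum s n a \<le> e" "0 < n"
 shows "psum s n (a ^ j) \<le> e ^ j"
proof (induction j)
 case 0
 have "psum s n 1 = (\<Sum>j<n. if j = 0 then 1 else 0)" unfolding psum_def by (intro sum.cong) auto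
 thus ?case by simp
next
 case (Suc j)
 have "psum s n (a * a ^ j) \<le> psum s n a * psum s n (a ^ j)" by (rule psum_mult[OF assms(1)])
 also have "\<dots> \<le> e * e ^ j"
  using assms Suc psum_nonneg[of s n a] psum_nonneg[of s n "a ^ j"] by (intro mult_mono) auto
 finally show ?case by simp
qed

lemma psum_fps_X: "0 \<le> s ==> psum s n fps_X \<le> s"
proof -
 assume s: "0 \<le> s"
 have "psum s n fps_X = (\<Sum>j<n. if j = 1 then s else 0)" unfolding psum_def by (intro sum.cong) auto
 thus ?thesis using s by simp
qed

lemma psum_sum: "0 \<le> s ==> psum s n (sum F A) \<le> (\<Sum>i\<in>A. psum s n (F i))"
proof (induction A rule: infinite_finite_induct)
 case (insert x A)
 thus ?case using psum_add[of s n "F x" "sum F A"] by auto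
qed (auto simp: psum_def)

lemma psum_cmult: "psum s n (fps_const c * a) = \<bar>c\<bar> * psum s n a"
 by (simp add: psum_def abs_mult sum_distrib_left mult.assoc)

lemma psum_al:
 assumes "0 \<le> s" "psum s (Suc m) A \<le> e" "cf A 0 = 0"
 shows "psum s (Suc m) (al G fps_X A) \<le> (\<Sum>i\<le>m. \<Sum>j\<le>m. \<bar>gc G i j\<bar> * (s ^ i * e ^ j))"
proof -
 define P where "P = (\<Sum>i\<le>m. \<Sum>j\<le>m. fps_const (gc G i j) * (fps_X ^ i * A ^ j))"
 have "cf (al G fps_X A) k = cf P k" if "k \<le> m" for k
  using al_nth[OF _ assms(3) that, of fps_X G] by (simp add: P_def fps_sum_nth)
 hence "psum s (Suc m) (al G fps_X A) = psum s (Suc m) P"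
  unfolding psum_def by simp
 also have "\<dots> \<le> (\<Sum>i\<le>m. \<Sum>j\<le>m. psum s (Suc m) (fps_const (gc G i j) * (fps_X ^ i * A ^ j)))"
  unfolding P_def by (rule order_trans[OF psum_sum[OF assms(1)]], intro sum_mono psum_sum[OF assms(1)])
 also have "\<dots> \<le> (\<Sum>i\<le>m. \<Sum>j\<le>m. \<bar>gc G i j\<bar> * (s ^ i * e ^ j))"
 proof (intro sum_mono)
  fix i j
  have "psum s (Suc m) (fps_X ^ i * A ^ j) \<le> psum s (Suc m) (fps_X ^ i) * psum s (Suc m) (A ^ j)"
   by (rule psum_mult[OF assms(1)])
  also have "\<dots> \<le> s ^ i * e ^ j"
   using psum_power[OF assms(1) psum_fps_X[OF assms(1)]] psum_power[OF assms(1,2)] psum_nonneg[OF assms(1)] assms(1)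
   by (intro mult_mono) auto
  finally show "psum s (Suc m) (fps_const (gc G i j) * (fps_X ^ i * A ^ j)) \<le> \<bar>gc G i j\<bar> * (s ^ i * e ^ j)"
   unfolding psum_cmult by (intro mult_left_mono) auto
 qed
 finally show ?thesis .
qed

text \<open>The terms with i > 0 contain a factor x and give 4 C x; those with i = 0 start at j = 2
  and give 2 C y^2.\<close>

lemma bb_sum_bound:
 fixes x y C :: real
 assumes "0 \<le> x" "x \<le> 1 / 2" "0 \<le> y" "y \<le> 1 / 2" "0 \<le> C"
  and b: "!!i j. b i j \<le> C * (x ^ i * y ^ j)" "b 0 0 = 0" "b 0 1 = 0"
 shows "(\<Sum>i\<le>m. \<Sum>j\<le>m. b i j) \<le> 4 * C * x + 2 * C * y ^ 2"
proof -
 have gy: "(\<Sum>j\<le>m. y ^ j) \<le> 2" for m using geometric_psum[OF assms(3,4), of "Suc m"] by (simp add: lessThan_Suc_atMost)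
 have 0: "(\<Sum>j\<le>m. b 0 j) \<le> 2 * C * y ^ 2"
 proof -
  have "(\<Sum>j\<le>m. b 0 j) \<le> (\<Sum>j\<le>Suc (Suc m). if j < 2 then 0 else C * y ^ j)"
  proof -
   have "(\<Sum>j\<le>m. b 0 j) \<le> (\<Sum>j\<le>m. if j < 2 then 0 else C * y ^ j)"
   proof (rule sum_mono)
    fix j show "b 0 j \<le> (if j < 2 then 0 else C * y ^ j)"
    proof (cases "j < 2")
     case True
     hence "j = 0 \<or> j = 1" by auto
     thus ?thesis using b(2,3) by auto
    qed (use b(1)[of 0 j] in simp)
   qed
   also have "\<dots> \<le> (\<Sum>j\<le>Suc (Suc m). if j < 2 then 0 else C * y ^ j)"
    using assms by simp
   finally show ?thesis .
  qed
  also have "\<dots> = (\<Sum>j\<le>m. C * y ^ (j + 2))"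
   unfolding sum.atMost_Suc_shift[of _ "Suc m"] sum.atMost_Suc_shift[of _ m] by simp
  also have "\<dots> = C * y ^ 2 * (\<Sum>j\<le>m. y ^ j)" 
   unfolding sum_distrib_left by (intro sum.cong) (simp_all add: power2_eq_square)
  also have "\<dots> \<le> C * y ^ 2 * 2" using assms gy by (intro mult_left_mono) auto
  finally show ?thesis by simp
 qed
 have "(\<Sum>i\<le>m. \<Sum>j\<le>m. b i j) = (\<Sum>j\<le>m. b 0 j) + (\<Sum>i<m. \<Sum>j\<le>m. b (Suc i) j)"
  by (rule sum.atMost_shift)
 also have "(\<Sum>i<m. \<Sum>j\<le>m. b (Suc i) j) \<le> (\<Sum>i<m. C * x * x ^ i * 2)"
 proof (rule sum_mono)
  fix i
  have "(\<Sum>j\<le>m. b (Suc i) j) \<le> (\<Sum>j\<le>m. C * (x ^ Suc i * y ^ j))" by (intro sum_mono b(1))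
  also have "\<dots> = C * x * x ^ i * (\<Sum>j\<le>m. y ^ j)" by (simp add: sum_distrib_left mult.assoc)
  also have "\<dots> \<le> C * x * x ^ i * 2" using assms gy by (intro mult_left_mono) auto
  finally show "(\<Sum>j\<le>m. b (Suc i) j) \<le> C * x * x ^ i * 2" .
 qed
 also have "(\<Sum>i<m. C * x * x ^ i * 2) = 2 * C * x * (\<Sum>i<m. x ^ i)" by (simp add: sum_distrib_left mult_ac)
 also have "\<dots> \<le> 2 * C * x * 2" using assms geometric_psum[OF assms(1,2)] by (intro mult_left_mono) auto
 finally show ?thesis using 0 by simp
qed

text \<open>Convergence comes from an induction on partial norms. If the approximation has norm at
  most e, the recursion and the lower bound \<delta> on the divisors n - m bound the next partial
  norm by (4 C R s + 2 C (R e)^2) / \<delta>, and e and s are chosen to make this at most e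
  again.\<close>

theorem briot_bouquet:
 assumes F0: "gc F 0 0 = 0" and res: "!!n. 1 \<le> n ==> gc F 0 1 ~= real n"
 obtains ph where "0 < rad ph" "cf ph 0 = 0" "fps_X * fD ph = al F fps_X ph"
proof -
 define m where "m = gc F 0 1"
 define G where "G = F - cst m * gY"
 have G: "gc G 0 0 = 0" "gc G 0 1 = 0" using F0 by (auto simp: G_def m_def gc_Y)
 define b where "b = bb G m"
 define ph where "ph = Abs_fps (%n. cf (b n) n)"
 have bn: "cf (b n) k = (if k \<le> n then cf ph k else 0)" for n k
  unfolding b_def ph_def by (subst bb_nth) simp
 have ph0: "cf ph 0 = 0" by (simp add: ph_def b_def)
 have agree: "cf (al G fps_X ph) (Suc k) = cf (al G fps_X (b n)) (Suc k)" if "k \<le> n" for k n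
  by (rule al_cong_Suc) (use G ph0 bn that in auto)
 have rec: "(real (Suc n) - m) * cf ph (Suc n) = cf (al G fps_X ph) (Suc n)" for n
 proof -
  have "cf ph (Suc n) = cf (b (Suc n)) (Suc n)" by (simp add: ph_def)
  also have "\<dots> = cf (b n) (Suc n) + cf (al G fps_X (b n)) (Suc n) / (real (Suc n) - m)"
   by (simp add: b_def)
  also have "cf (b n) (Suc n) = 0" by (simp add: bn)
  finally show ?thesis using agree[of n n] res[of "Suc n"] by (simp add: m_def)
 qed
 have z: "cf (fps_X :: real fps) 0 = 0" by simp
 have eq: "fps_X * fD ph = al F fps_X ph"
 proof (rule fps_ext)
  fix n
  have "al F fps_X ph = al G fps_X ph + fps_const m * ph" using ph0 z by (simp add: G_def)
  moreover have "cf (al G fps_X ph) 0 = 0" using al_nth_0[OF z ph0] G by simp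
  ultimately show "cf (fps_X * fD ph) n = cf (al F fps_X ph) n"
   using rec[of "n - 1"] ph0 by (cases n) (auto simp: alg)
 qed
 \<comment> \<open>Beyond |m| + 1 the divisors are at least 1 in absolute value, so only finitely
   many enter the minimum.\<close>
 define N where "N = nat \<lceil>\<bar>m\<bar>\<rceil> + 1"
 define \<delta> where "\<delta> = min 1 (Min ((%n. \<bar>real n - m\<bar>) ` {1..N}))"
 have N: "\<bar>m\<bar> + 1 \<le> real N" unfolding N_def by simp
 have \<delta>: "0 < \<delta>" "!!n. 1 \<le> n ==> \<delta> \<le> \<bar>real n - m\<bar>"
 proof -
  have "0 < \<bar>real n - m\<bar>" if "1 \<le> n" for n using res[OF that] by (simp add: m_def)
  thus "0 < \<delta>" unfolding \<delta>_def by (simp add: N_def)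
  fix n :: nat assume n: "1 \<le> n"
  show "\<delta> \<le> \<bar>real n - m\<bar>"
  proof (cases "n \<le> N")
   case True
   hence "Min ((%n. \<bar>real n - m\<bar>) ` {1..N}) \<le> \<bar>real n - m\<bar>" using n by simp
   thus ?thesis by (simp add: \<delta>_def)
  next
   case False
   hence "1 \<le> \<bar>real n - m\<bar>" using N by simp
   thus ?thesis by (simp add: \<delta>_def)
  qed
 qed
 obtain C R where CR: "1 \<le> R" "1 \<le> C" "!!i j. \<bar>gc G i j\<bar> \<le> C * R ^ (i + j)"
  by (rule germ_bound[of G]) blast
 \<comment> \<open>First e, the size of the solution, makes the quadratic term at most half of
   \<delta> e; then the radius s makes the linear term at most the other half.\<close>
 define e where "e = min (1 / (2 * R)) (\<delta> / (4 * C * R ^ 2))"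
 define s where "s = min (1 / (2 * R)) (\<delta> * e / (8 * C * R))"
 have e: "0 < e" "R * e \<le> 1 / 2" "4 * C * R ^ 2 * e \<le> \<delta>"
 proof -
  show "0 < e" using CR \<delta> by (simp add: e_def)
  have "e \<le> 1 / (2 * R)" "e \<le> \<delta> / (4 * C * R ^ 2)" by (auto simp: e_def)
  thus "R * e \<le> 1 / 2" "4 * C * R ^ 2 * e \<le> \<delta>" using CR by (simp_all add: field_simps)
 qed
 have s: "0 < s" "R * s \<le> 1 / 2" "8 * C * R * s \<le> \<delta> * e"
 proof -
  show "0 < s" using CR \<delta> e by (simp add: s_def)
  have "s \<le> 1 / (2 * R)" "s \<le> \<delta> * e / (8 * C * R)" by (auto simp: s_def)
  thus "R * s \<le> 1 / 2" "8 * C * R * s \<le> \<delta> * e" using CR by (simp_all add: field_simps)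
 qed
 have bound: "psum s n ph \<le> e" for n
 proof (induction n)
  case 0
  thus ?case using e by (simp add: psum_def)
 next
  case (Suc n)
  show ?case
  proof (cases n)
   case 0
   thus ?thesis using e ph0 by (simp add: psum_def)
  next
   case (Suc l)
   have pb: "psum s (Suc n) (b l) \<le> e"
   proof -
    have "psum s (Suc n) (b l) = psum s n ph"
     unfolding psum_def using Suc by (simp add: bn)
    thus ?thesis using Suc.IH by simp
   qed
   have "\<delta> * psum s (Suc n) ph \<le> psum s (Suc n) (al G fps_X (b l))"
    unfolding psum_def sum_distrib_left
   proof (rule sum_mono)
    fix k assume k: "k : {..<Suc n}"
    show "\<delta> * (\<bar>cf ph k\<bar> * s ^ k) \<le> \<bar>cf (al G fps_X (b l)) k\<bar> * s ^ k"
    proof (cases k)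
     case (Suc i)
     hence "i \<le> l" using k \<open>n = Suc l\<close> by simp
     have "\<delta> * \<bar>cf ph (Suc i)\<bar> \<le> \<bar>real (Suc i) - m\<bar> * \<bar>cf ph (Suc i)\<bar>"
      using \<delta>(2)[of "Suc i"] by (intro mult_right_mono) auto
     also have "\<dots> = \<bar>cf (al G fps_X (b l)) (Suc i)\<bar>"
      using rec[of i] agree[OF \<open>i \<le> l\<close>] by (simp only: abs_mult[symmetric])
     finally show ?thesis using s Suc by simp
    qed (use ph0 in simp)
   qed
   also have "\<dots> \<le> (\<Sum>i\<le>n. \<Sum>j\<le>n. \<bar>gc G i j\<bar> * (s ^ i * e ^ j))"
    by (rule psum_al) (use s pb bn ph0 in auto)
   also have "\<dots> \<le> 4 * C * (R * s) + 2 * C * (R * e) ^ 2"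
   proof (rule bb_sum_bound)
    fix i j
    have "\<bar>gc G i j\<bar> * (s ^ i * e ^ j) \<le> C * R ^ (i + j) * (s ^ i * e ^ j)"
     using CR(3)[of i j] s e by simp
    thus "\<bar>gc G i j\<bar> * (s ^ i * e ^ j) \<le> C * ((R * s) ^ i * (R * e) ^ j)"
     by (simp add: power_add power_mult_distrib mult_ac)
   qed (use s e CR G in auto)
   also have "\<dots> \<le> \<delta> * e"
   proof -
    have "4 * C * R ^ 2 * e * e \<le> \<delta> * e" using e by simp
    thus ?thesis using s(3) by (simp add: power2_eq_square alg)
   qed
   finally show ?thesis using \<delta>(1) by simp
  qed
 qed
 hence "0 < rad ph" using s(1) by (auto simp: fps_conv_radius_pos_iff bnd_def)
 thus ?thesis using that ph0 eq by blast
qed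

section \<open>Camacho--Sad indices\<close>

abbreviation fl :: "real fps => real fls" where "fl \<equiv> fps_to_fls"

lemma fls_clear_denominator: "\<exists>n P. (G :: real fls) * fls_X ^ n = fl P"
proof -
 define n where "n = nat (- fls_subdegree G)"
 have "- fls_subdegree G \<le> int n" by (simp add: n_def)
 then obtain P where "G = fls_shift (int n) (fl P)" by (rule fls_as_fps)
 hence "G * fls_X ^ n = fl P"
  unfolding fls_X_power_times_conv_shift by simp
 thus ?thesis by blast
qed

lemma fls_deriv_power_mult: "fls_deriv (a ^ n) * a = of_nat n * a ^ n * fls_deriv (a :: real fls)"
 unfolding fls_deriv_power by (cases n) (simp_all add: mult_ac)

text \<open>A quotient without residue has a Laurent primitive. Multiplied by a power of X it is a
  power series, so the substitution is carried out on power series and divided by the same power of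
  s.\<close>

lemma residue_compose_0:
 assumes D: "D ~= 0" and s: "cf s 0 = 0" "s ~= 0" and r: "fls_residue (fl N / fl D) = 0"
 shows "fls_residue (fl ((N oo s) * fD s) / fl (D oo s)) = 0"
proof -
 have Ds: "D oo s ~= 0" using D s by (simp add: fps_compose_eq_0_iff)
 obtain G where G: "fls_deriv G = fl N / fl D" using fls_residue_nonzero_ex_antiderivative[OF r] by blast
 obtain n P where P: "G * fls_X ^ n = fl P" using fls_clear_denominator by blast
 moreover have "fls_deriv (G * fls_X ^ n) * fl D * fls_X =
   (fls_deriv G * fl D) * fls_X ^ Suc n + of_nat n * (G * fls_X ^ n) * fl D"
  using fls_deriv_power_mult[of fls_X n] by (simp add: alg)
 moreover have "fls_deriv G * fl D = fl N" using G D by simp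
 ultimately have "fl (N * fps_X ^ Suc n + of_nat n * P * D) = fl (fD P * D * fps_X)"
  by (simp add: fls_deriv_fps_to_fls fls_times_fps_to_fls fps_to_fls_power)
 hence e: "N * fps_X ^ Suc n + of_nat n * P * D = fD P * D * fps_X"
  unfolding fps_to_fls_eq_iff .
 have cX: "fps_X ^ Suc n oo s = s ^ Suc n" for n using s(1) by (metis fps_X_fps_compose_startby0 fps_compose_power)
 have cn: "of_nat n oo s = (of_nat n :: real fps)" by simp
 have e2: "(N oo s) * s ^ Suc n + of_nat n * (P oo s) * (D oo s) = (fD P oo s) * (D oo s) * s"
  using arg_cong[OF e, of "%f. f oo s"] s(1)
  by (simp only: fps_compose_add_distrib fps_compose_mult_distrib[OF s(1)] cX cn fps_X_fps_compose_startby0)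
 define Z where "Z = fl (P oo s) / fl s ^ n"
 have s0: "fl s ~= 0" using s by simp
 have Zs: "Z * fl s ^ n = fl (P oo s)" using s0 by (simp add: Z_def)
 have "fls_deriv (Z * fl s ^ n) = fl (fD P oo s) * fl (fD s)"
  unfolding Zs fls_deriv_fps_to_fls fps_compose_deriv[OF s(1)] by (simp add: fls_times_fps_to_fls)
 moreover have "fls_deriv (Z * fl s ^ n) * fl s = fls_deriv Z * fl s ^ Suc n + of_nat n * fl (P oo s) * fl (fD s)"
  using fls_deriv_power_mult[of "fl s" n] unfolding Zs[symmetric]
  by (simp add: fls_deriv_fps_to_fls alg)
 ultimately have d: "fls_deriv Z * fl s ^ Suc n = (fl (fD P oo s) * fl s - of_nat n * fl (P oo s)) * fl (fD s)"
  by (simp add: alg)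
 have e3: "fl (N oo s) * fl s ^ Suc n + of_nat n * fl (P oo s) * fl (D oo s) = fl (fD P oo s) * fl (D oo s) * fl s"
  using arg_cong[OF e2, of fl] by (simp only: fps_to_fls_plus fls_times_fps_to_fls fps_to_fls_power fps_to_fls_of_nat)
 have "fls_deriv Z * fl s ^ Suc n * fl (D oo s) = fl (N oo s) * fl s ^ Suc n * fl (fD s)"
 proof -
  have c: "a * b * c = (a * c) * b" for a b c :: "real fls" by simp
  have "(fl (fD P oo s) * fl s - of_nat n * fl (P oo s)) * fl (D oo s) = fl (N oo s) * fl s ^ Suc n"
   using e3 by (simp add: alg)
  thus ?thesis unfolding d by simp
 qed
 hence "fls_deriv Z * fl (D oo s) = fl (N oo s) * fl (fD s)" using s0 by simp
 hence "fl ((N oo s) * fD s) / fl (D oo s) = fls_deriv Z"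
  using Ds by (simp add: fls_times_fps_to_fls field_simps)
 thus ?thesis by simp
qed

lemma residue_dlog:
 assumes "s ~= 0" shows "fls_residue (fl (fD s) / fl s) = real (sdg s)"
 using fls_residue_deriv_times_inverse_eq_subdegree(1)[of "fl s"]
 by (simp add: divide_inverse fls_deriv_fps_to_fls fls_subdegree_fls_to_fps)

text \<open>Subtracting r dx/x reduces to residue 0. A substitution of order one turns dx/x into
  ds/s, which again has residue 1.\<close>

lemma residue_compose:
 assumes D: "D ~= 0" and s: "cf s 0 = 0" "sdg s = 1"
 shows "fls_residue (fl ((N oo s) * fD s) / fl (D oo s)) = fls_residue (fl N / fl D)"
proof -
 define r where "r = fls_residue (fl N / fl D)"
 have s0: "s ~= 0" using s by auto
 have Ds: "D oo s ~= 0" using D s s0 by (simp add: fps_compose_eq_0_iff)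
 define x :: "real fps" where "x = fps_X"
 have x: "x ~= 0" "sdg x = 1" "fD x = 1" "x oo s = s" using s(1) by (simp_all add: x_def)
 have rX: "fls_residue (fls_const r * (fl (fD x) / fl x)) = r"
  unfolding fls_residue_fls_const_times residue_dlog[OF x(1)] x(2) by simp
 have "fl (N * x - fps_const r * D) / fl (D * x) = fl N / fl D - fls_const r * (fl (fD x) / fl x)"
  using D x by (simp add: fls_times_fps_to_fls field_simps)
 hence "fls_residue (fl (N * x - fps_const r * D) / fl (D * x)) = 0"
  using rX by (simp add: r_def)
 hence "fls_residue (fl (((N * x - fps_const r * D) oo s) * fD s) / fl (D * x oo s)) = 0"
  using D s x(1) by (intro residue_compose_0) auto
 moreover have "fl (((N * x - fps_const r * D) oo s) * fD s) / fl (D * x oo s)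
   = fl ((N oo s) * fD s) / fl (D oo s) - fls_const r * (fl (fD s) / fl s)"
  using s0 Ds by (simp add: fps_compose_mult_distrib[OF s(1)] fps_compose_sub_distrib fls_times_fps_to_fls
   x field_simps)
 moreover have "fls_residue (fls_const r * (fl (fD s) / fl s)) = r"
  unfolding fls_residue_fls_const_times residue_dlog[OF s0] s(2) by simp
 ultimately show ?thesis by (simp add: r_def)
qed

text \<open>The value of the index for one decomposition and one parametrization; \<open>dec\<close>
  collects the conditions on the decomposition in \<open>cs_index\<close>.\<close>

definition csv :: "germ => germ => germ => real fps => real fps => real" where
 "csv A B h X Y = - fls_residue (fl (al A X Y * fD X + al B X Y * fD Y) / fl (al h X Y))"

definition dec :: "form => germ => germ => germ => germ => germ => bool" where
 "dec om f g h A B <-> ~ f dvd g & ~ f dvd h &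
  g * fst om = h * Dx f + f * A & g * snd om = h * Dy f + f * B"

lemma cs_index_alt:
 "csi om S = (THE v. \<exists>f g h A B X Y. irreducible f & S = crv f & dec om f g h A B &
  primitive_param S X Y & v = csv A B h X Y)"
 unfolding cs_index_def dec_def csv_def by simp

text \<open>One of the partial derivatives has a nonzero coefficient in degree one below the order
  of f, so it cannot be a multiple of f.\<close>

lemma not_both_derivatives:
 assumes "f ~= 0" "~ is_unit (f :: germ)"
 shows "~ (f dvd Dx f & f dvd Dy f)"
proof
 assume d: "f dvd Dx f & f dvd Dy f"
 have *: False if k: "f dvd k" "gc k a b ~= 0" "a + b < vord f" for k a b
 proof -
  obtain l where l: "k = f * l" using k(1) by blast
  have ne: "l ~= 0" "k ~= 0" using l k(2) by auto
  hence "vord k = vord f + vord l" using vord_mult l by simp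
  thus False using vord_props(2)[OF ne(2), of a b] k by simp
 qed
 obtain i j where ij: "i + j = vord f" "gc f i j ~= 0" using vord_props(1)[OF assms(1)] by blast
 have "0 < vord f" using assms vord_unit_iff by auto
 then consider a where "i = Suc a" | b where "j = Suc b" using ij by (cases i; cases j) auto
 thus False
 proof cases
  case 1
  thus False using *[of "Dx f" a j] d ij by (simp add: gc_dx)
 next
  case 2
  thus False using *[of "Dy f" i b] d ij by (simp add: gc_dy)
 qed
qed

text \<open>If P f_y - Q f_x = f A, then f_y \<omega> = Q df + f A dx, and symmetrically with f_x.
  The multiplier is a partial derivative not divisible by f.\<close>

lemma dec_exists:
 assumes f: "prm f" and co: "coprime (fst om) (snd om)" and inv: "f dvd wdg om f"
 shows "\<exists>g h A B. dec om f g h A B"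
proof -
 have nu: "f ~= 0" "~ is_unit f" using f by auto
 obtain A where A: "fst om * Dy f - snd om * Dx f = f * A" using inv by (auto simp: wedge_d_def elim: dvdE)
 have nPQ: "~ (f dvd fst om & f dvd snd om)" using co nu by (auto simp: coprime_def)
 show ?thesis
 proof (cases "f dvd Dy f")
  case False
  have "~ f dvd snd om"
  proof
   assume Q: "f dvd snd om"
   have "fst om * Dy f = f * A + snd om * Dx f" using A by (simp add: alg)
   hence "f dvd fst om * Dy f" using Q by simp
   thus False using False Q nPQ f by (simp add: prime_elem_dvd_mult_iff)
  qed
  hence "dec om f (Dy f) (snd om) A 0" using False A by (simp add: dec_def alg)
  thus ?thesis by blast
 next
  case True
  hence nx: "~ f dvd Dx f" using not_both_derivatives[OF nu] by blast
  have "~ f dvd fst om"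
  proof
   assume P: "f dvd fst om"
   have "snd om * Dx f = fst om * Dy f - f * A" using A by (simp add: alg)
   hence "f dvd snd om * Dx f" using P by simp
   thus False using nx P nPQ f by (simp add: prime_elem_dvd_mult_iff)
  qed
  hence "dec om f (Dx f) (fst om) 0 (- A)" using nx A by (simp add: dec_def alg)
  thus ?thesis by blast
 qed
qed

text \<open>Eliminating \<omega> from the two decompositions shows that f divides (g' h - g h' u)
  df, hence the factor g' h - g h' u. Along the curve the two quotients then differ by du/u, which
  has no residue.\<close>

lemma csv_independent:
 assumes f: "prm f" and u: "is_unit u"
  and d: "dec om f g h A B" "dec om (u * f) g' h' A' B'"
  and XY: "cf X 0 = 0" "cf Y 0 = 0" and z: "!!a. al a X Y = 0 <-> f dvd a"
 shows "csv A' B' h' X Y = csv A B h X Y"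
proof -
 have nu: "f ~= 0" "~ is_unit f" using f by auto
 define k0 where "k0 = g' * h - g * h' * u"
 have x: "k0 * Dx f = f * (g * h' * Dx u + g * u * A' - g' * A)"
 proof -
  have "g' * (h * Dx f + f * A) = g' * (g * fst om)" using d(1) by (simp add: dec_def)
  also have "\<dots> = g * (h' * Dx (u * f) + u * f * A')" using d(2) by (simp add: dec_def)
  finally have "g' * (h * Dx f + f * A) = g * (h' * Dx (u * f) + u * f * A')" .
  thus ?thesis by (simp add: k0_def dx_mult alg)
 qed
 have y: "k0 * Dy f = f * (g * h' * Dy u + g * u * B' - g' * B)"
 proof -
  have "g' * (h * Dy f + f * B) = g' * (g * snd om)" using d(1) by (simp add: dec_def)
  also have "\<dots> = g * (h' * Dy (u * f) + u * f * B')" using d(2) by (simp add: dec_def)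
  finally have "g' * (h * Dy f + f * B) = g * (h' * Dy (u * f) + u * f * B')" .
  thus ?thesis by (simp add: k0_def dy_mult alg)
 qed
 have "f dvd k0 * Dx f" "f dvd k0 * Dy f" unfolding x y by auto
 hence "f dvd k0" using not_both_derivatives[OF nu] f by (auto simp: prime_elem_dvd_mult_iff)
 then obtain k where k: "k0 = f * k" by blast
 have x2: "k * Dx f = g * h' * Dx u + g * u * A' - g' * A"
  and y2: "k * Dy f = g * h' * Dy u + g * u * B' - g' * B"
  using x y nu unfolding k by auto
 note s = al_mult[OF XY] al_add[OF XY] al_diff[OF XY]
 define N N' where "N = al A X Y * fD X + al B X Y * fD Y"
  and "N' = al A' X Y * fD X + al B' X Y * fD Y"
 define gg gg' hh hh' uu where "gg = al g X Y" and "gg' = al g' X Y" and "hh = al h X Y"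
  and "hh' = al h' X Y" and "uu = al u X Y"
 have "al f X Y = 0" using z by simp
 hence "0 = al k X Y * fD (al f X Y)" by simp
 also have "\<dots> = al (k * Dx f) X Y * fD X + al (k * Dy f) X Y * fD Y"
  unfolding al_chain[OF XY] s by (simp add: alg)
 also have "\<dots> = gg * hh' * fD uu + gg * uu * N' - gg' * N"
  unfolding x2 y2 s N_def N'_def gg_def gg'_def hh'_def uu_def al_chain[OF XY, of u]
  by (simp add: alg)
 finally have e1: "gg' * N = gg * hh' * fD uu + gg * uu * N'" by simp
 have "al k0 X Y = 0" unfolding z using k by simp
 hence e2: "gg' * hh = gg * hh' * uu" unfolding k0_def s gg_def gg'_def hh_def hh'_def uu_def by simp
 have uf: "u * f dvd a <-> f dvd a" for a using u by auto
 have ne: "gg ~= 0" "gg' ~= 0" "hh ~= 0" "hh' ~= 0" "uu ~= 0"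
 proof -
  show "gg ~= 0" "gg' ~= 0" "hh ~= 0" "hh' ~= 0"
   unfolding gg_def gg'_def hh_def hh'_def z using d by (auto simp: dec_def uf)
  have "cf uu 0 ~= 0" using u by (simp add: uu_def al_nth_0[OF XY] is_unit_iff)
  thus "uu ~= 0" by auto
 qed
 have f1: "fl gg' * fl N = fl gg * fl hh' * fl (fD uu) + fl gg * fl uu * fl N'"
  using arg_cong[OF e1, of fl] by (simp add: fls_times_fps_to_fls)
 have f2: "fl gg' * fl hh = fl gg * fl hh' * fl uu"
  using arg_cong[OF e2, of fl] by (simp add: fls_times_fps_to_fls)
 have fne: "fl gg ~= 0" "fl gg' ~= 0" "fl hh ~= 0" "fl hh' ~= 0" "fl uu ~= 0" using ne by auto
 have "fl N / fl hh = (fl gg' * fl N) / (fl gg' * fl hh)" using fne by simp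
 also have "\<dots> = fl (fD uu) / fl uu + fl N' / fl hh'"
  unfolding f1 f2 using fne by (simp add: divide_simps) (simp add: alg)
 finally have "fls_residue (fl N / fl hh) = fls_residue (fl (fD uu) / fl uu) + fls_residue (fl N' / fl hh')"
  by simp
 also have "fls_residue (fl (fD uu) / fl uu) = 0"
 proof -
  have "cf uu 0 ~= 0" using u by (simp add: uu_def al_nth_0[OF XY] is_unit_iff)
  thus ?thesis using residue_dlog[OF ne(5)] by simp
 qed
 finally show ?thesis unfolding csv_def N_def N'_def hh_def hh'_def by simp
qed

lemma gp_nonzero:
 assumes "prm f" "gp f U V" shows "U ~= 0 \<or> V ~= 0"
proof (rule ccontr)
 assume "~ (U ~= 0 \<or> V ~= 0)"
 hence "f dvd gX" "f dvd gY" using assms(2) unfolding gp_def by auto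
 hence "gX dvd f" using prime_dvd_imp_dvd[OF assms(1) prime_X] by simp
 hence "gX dvd gY" using \<open>f dvd gY\<close> dvd_trans by blast
 thus False using gc_Y[of 0 1] by (simp add: X_dvd_iff)
qed

text \<open>Primitivity excludes substitutions of order at least 2. Conversely, if (U, V) were (U',
  V') composed with s of order at least 2, then (U', V') would factor through (U, V), so (U, V)
  would be itself composed with a series that is 0 or of order at least 2, and would vanish.\<close>

lemma gp_params:
 assumes f: "prm f" and g: "gp f U V"
 shows "primitive_param (crv f) X Y ==> \<exists>s. cf s 0 = 0 & sdg s = 1 & X = U oo s & Y = V oo s"
  and "primitive_param (crv f) U V"
proof -
 have UV: "cf U 0 = 0" "cf V 0 = 0" using g by (auto simp: gp_def)
 have fac: "\<exists>s. cf s 0 = 0 & X = U oo s & Y = V oo s"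
  if "cf X 0 = 0" "cf Y 0 = 0" "al f X Y = 0" for X Y
  using g that by (auto simp: gp_def)
 show "\<exists>s. cf s 0 = 0 & sdg s = 1 & X = U oo s & Y = V oo s" if p: "primitive_param (crv f) X Y"
 proof -
  have XY: "cf X 0 = 0" "cf Y 0 = 0" "al f X Y = 0" "X ~= 0 \<or> Y ~= 0"
   using p by (auto simp: primitive_param_def)
  obtain s where s: "cf s 0 = 0" "X = U oo s" "Y = V oo s" using fac[OF XY(1-3)] by blast
  have "s ~= 0" using s XY(4) UV by auto
  hence "sdg s ~= 0" using s(1) by (auto simp: subdegree_eq_0_iff)
  moreover have "~ sdg s \<ge> 2" using p s unfolding primitive_param_def by blast
  ultimately show ?thesis using s by auto
 qed
 have "~ (\<exists>U' V' s. sdg s \<ge> 2 & U = U' oo s & V = V' oo s)"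
 proof
  assume "\<exists>U' V' s. sdg s \<ge> 2 & U = U' oo s & V = V' oo s"
  then obtain U' V' s where s: "sdg s \<ge> 2" "U = U' oo s" "V = V' oo s" by blast
  have s0: "cf s 0 = 0" "s ~= 0" using s(1) by (auto intro: nth_less_subdegree_zero)
  have UV': "cf U' 0 = 0" "cf V' 0 = 0" using UV s by auto
  have "al f U' V' oo s = al f U V" using al_compose[OF UV' s0(1)] s by simp
  also have "\<dots> = 0" using g by (simp add: gp_def)
  finally have "al f U' V' = 0" using s0 by (simp add: fps_compose_eq_0_iff)
  then obtain r where r: "cf r 0 = 0" "U' = U oo r" "V' = V oo r" using fac[OF UV'] by blast
  have w0: "cf (r oo s) 0 = 0" using r by simp
  have U: "U = U oo (r oo s)" "V = V oo (r oo s)" using s r s0 by (simp_all add: fps_compose_assoc)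
  have "sdg (r oo s) = sdg r * sdg s" by (simp add: s0)
  moreover have "sdg r ~= 0 \<or> r = 0" using r by (auto simp: subdegree_eq_0_iff)
  ultimately have "r = 0 \<or> sdg (r oo s) \<ge> 2" using s(1)
   by (metis One_nat_def le_trans mult_le_mono1 nat_mult_1 not_less_eq_eq le_zero_eq)
  moreover have "W = 0" if "W = W oo (r oo s)" "cf W 0 = 0" "r = 0 \<or> sdg (r oo s) \<ge> 2" for W
  proof (rule ccontr)
   assume W: "W ~= 0"
   show False
   proof (cases "r = 0")
    case True
    hence "W = fps_const (cf W 0)" using that(1) by simp
    thus False using that(2) W by simp
   next
    case False
    have "sdg W = sdg W * sdg (r oo s)" using that(1) w0 by (metis subdegree_fps_compose)
    moreover have "sdg W ~= 0" using that(2) W by (auto simp: subdegree_eq_0_iff)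
    ultimately show False using that(3) by simp
   qed
  qed
  ultimately have "U = 0" "V = 0" using U UV by blast+
  thus False using gp_nonzero[OF f g] by simp
 qed
 thus "primitive_param (crv f) U V"
  using g gp_nonzero[OF f g] by (auto simp: primitive_param_def gp_def)
qed

text \<open>All admissible data in the definition give one value: equations differ by units,
  \<open>csv_independent\<close> covers the change of decomposition, and parametrizations differ by
  a substitution of order one, which preserves residues.\<close>

theorem cs_index_eq:
 assumes f: "prm f" and g: "gp f U V" and d: "dec om f k h A B"
 shows "csi om (crv f) = csv A B h U V"
 unfolding cs_index_alt
proof (rule the_equality)
 have "irreducible f" using f by (rule prime_elem_imp_irreducible)
 thus "\<exists>f' k h' A' B' X Y. irreducible f' & crv f = crv f' & dec om f' k h' A' B' &
   primitive_param (crv f) X Y & csv A B h U V = csv A' B' h' X Y"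
  using gp_params(2)[OF f g] d by blast
next
 fix v
 assume "\<exists>f' k' h' A' B' X Y. irreducible f' & crv f = crv f' & dec om f' k' h' A' B' &
   primitive_param (crv f) X Y & v = csv A' B' h' X Y"
 then obtain f' k' h' A' B' X Y where *: "crv f = crv f'" "dec om f' k' h' A' B'"
   "primitive_param (crv f) X Y" "v = csv A' B' h' X Y" by blast
 obtain u where u: "is_unit u" "f' = u * f" using *(1) by (metis curve_of_eq_iff dvd_antisym_unit)
 obtain s where s: "cf s 0 = 0" "sdg s = 1" "X = U oo s" "Y = V oo s"
  using gp_params(1)[OF f g *(3)] by blast
 have UV: "cf U 0 = 0" "cf V 0 = 0" and z: "!!a. al a U V = 0 <-> f dvd a" using g by (auto simp: gp_def)
 have XY: "cf X 0 = 0" "cf Y 0 = 0" using UV s by auto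
 have s0: "s ~= 0" using s(2) by auto
 have als: "al a X Y = al a U V oo s" for a using al_compose[OF UV s(1)] s by simp
 have z': "al a X Y = 0 <-> f dvd a" for a unfolding als using z s(1) s0 by (simp add: fps_compose_eq_0_iff)
 have "v = csv A B h X Y" using csv_independent[OF f u(1) d _ XY z'] *(2,4) u(2) by simp
 also have "\<dots> = csv A B h U V"
 proof -
  have "~ f dvd h" using d by (simp add: dec_def)
  hence h0: "al h U V ~= 0" by (simp add: z)
  have "al A X Y * fD X + al B X Y * fD Y = ((al A U V * fD U + al B U V * fD V) oo s) * fD s"
   unfolding als unfolding s(3,4) fps_compose_deriv[OF s(1)] fps_compose_add_distrib fps_compose_mult_distrib[OF s(1)]
   by (simp add: alg)
  thus ?thesis unfolding csv_def als[of h] using residue_compose[OF h0 s(1,2)] by simp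
 qed
 finally show "v = csv A B h U V" .
qed

section \<open>Local structure of a foliation at a regular or simple point\<close>

lemma scale_form_simps [simp]: "fst (scl h om) = h * fst om" "snd (scl h om) = h * snd om"
 by (simp_all add: scale_form_def)

lemma jac_neq_0: "jac p ~= 0"
proof (induction p)
 case (Cons d p)
 have "ex d ~= 0" using prime_ex[of d] by simp
 thus ?case using Cons by (simp add: jac_Cons)
qed (simp add: jac_def)

lemma coprime_form_nonzero: "coprime (fst om) (snd om) ==> fst om ~= 0 \<or> snd om ~= (0::germ)"
 by auto

lemma pull_form_nonzero:
 assumes "fst om ~= 0 \<or> snd om ~= 0"
 shows "fst (plf p om) ~= 0 \<or> snd (plf p om) ~= 0"
proof (rule ccontr)
 assume "~ ?thesis"
 hence "pull p (fst om) * jac p = 0" "pull p (snd om) * jac p = 0"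
  unfolding pull_form_jac by auto
 thus False using assms jac_neq_0 by simp
qed

lemma strict_form_props:
 assumes "coprime (fst om) (snd om)"
 shows "coprime (fst (stf om p)) (snd (stf om p))"
  and "\<exists>h. h ~= 0 & plf p om = scl h (stf om p)"
proof -
 have "fst (plf p om) ~= 0 \<or> snd (plf p om) ~= 0"
  using assms coprime_form_nonzero pull_form_nonzero by blast
 then obtain h P Q where h: "h ~= 0" "fst (plf p om) = h * P" "snd (plf p om) = h * Q" "coprime P Q"
  by (rule coprime_reduction)
 hence "coprime (fst (P, Q)) (snd (P, Q)) & (\<exists>h. h ~= 0 & plf p om = scl h (P, Q))"
  by (auto simp: prod_eq_iff)
 hence "coprime (fst (stf om p)) (snd (stf om p)) &
  (\<exists>h. h ~= 0 & plf p om = scl h (stf om p))"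
  unfolding strict_form_def by (rule someI)
 thus "coprime (fst (stf om p)) (snd (stf om p))"
  "\<exists>h. h ~= 0 & plf p om = scl h (stf om p)" by auto
qed

text \<open>The choice in \<open>strict_form\<close> is fixed up to a unit. Factors are allowed on
  both sides because local forms become known only after clearing denominators.\<close>

lemma strict_form_unique:
 assumes co: "coprime (fst om) (snd om)" "coprime (fst om') (snd om')"
  and k: "k ~= 0" "k' ~= 0" "scl k (plf p om) = scl k' om'"
 obtains u where "is_unit u" "stf om p = scl u om'"
proof -
 obtain h where h: "h ~= 0" "plf p om = scl h (stf om p)"
  using strict_form_props[OF co(1)] by blast
 have "k' * fst om' = (k * h) * fst (stf om p)" "k' * snd om' = (k * h) * snd (stf om p)"
  using k(3) h(2) by (auto simp: scale_form_def mult.assoc)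
 moreover have "k * h ~= 0" using k h by simp
 ultimately obtain u where u: "is_unit u" "fst (stf om p) = u * fst om'" "snd (stf om p) = u * snd om'"
  using coprime_form_unique[OF k(2) _ _ _ co(2) strict_form_props(1)[OF co(1)]] by metis
 thus ?thesis by (intro that[of u]) (auto simp: prod_eq_iff)
qed

lemma coprime_scale: "is_unit u ==> coprime (fst (scl u om)) (snd (scl u om)) <-> coprime (fst om) (snd om)"
 by simp

lemma singular_scale: "is_unit u ==> sng (scl u om) <-> sng om"
 by (auto simp: singular_form_def is_unit_iff)

lemma inv_scale: "is_unit u ==> f dvd wdg (scl u om) f <-> f dvd wdg om f"
 by (simp add: wedge_scale dvd_mult_unit_iff')

lemma lin_eigenvalues_alt: "lin_eigenvalues om l m <->
  l + m = gc (snd om) 1 0 - gc (fst om) 0 1 &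
  l * m = gc (snd om) 0 1 * gc (fst om) 1 0 - gc (snd om) 1 0 * gc (fst om) 0 1"
 by (auto simp: lin_eigenvalues_def Let_def gc_dx gc_dy)

lemma gc_mult_lin:
 assumes "gc Q 0 0 = 0"
 shows "gc (u * Q) 1 0 = gc u 0 0 * gc Q 1 0" "gc (u * Q) 0 1 = gc u 0 0 * gc Q 0 1"
 using assms by (simp_all add: gc_mult)

lemma lin_eigenvalues_scale:
 assumes "sng om" "lin_eigenvalues om l m"
 shows "lin_eigenvalues (scl u om) (gc u 0 0 * l) (gc u 0 0 * m)"
proof -
 define c where "c = gc u 0 0"
 have z: "gc (fst om) 0 0 = 0" "gc (snd om) 0 0 = 0" using assms(1) by (auto simp: singular_form_def)
 have 1: "l + m = gc (snd om) 1 0 - gc (fst om) 0 1"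
  and 2: "l * m = gc (snd om) 0 1 * gc (fst om) 1 0 - gc (snd om) 1 0 * gc (fst om) 0 1"
  using assms(2) by (auto simp: lin_eigenvalues_alt)
 have "c * l + c * m = c * (l + m)" "c * l * (c * m) = c * c * (l * m)" by (simp_all add: alg)
 thus ?thesis unfolding lin_eigenvalues_alt scale_form_simps gc_mult_lin[OF z(1)] gc_mult_lin[OF z(2)]
   c_def[symmetric] 1 2 by (simp add: alg)
qed

lemma simple_sing_scale_imp: "is_unit u ==> smp om ==> smp (scl u om)"
proof -
 assume u: "is_unit u" and s: "smp om"
 obtain l m where lm: "lin_eigenvalues om l m" "l ~= 0" "~ pos_rat (m / l)" "sng om"
  using s by (auto simp: simple_sing_def)
 have c: "gc u 0 0 ~= 0" using u by (simp add: is_unit_iff)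
 have "lin_eigenvalues (scl u om) (gc u 0 0 * l) (gc u 0 0 * m)" by (rule lin_eigenvalues_scale[OF lm(4,1)])
 moreover have "gc u 0 0 * l ~= 0" "~ pos_rat ((gc u 0 0 * m) / (gc u 0 0 * l))" using lm c by auto
 ultimately show ?thesis unfolding simple_sing_def using lm(4) singular_scale[OF u] by blast
qed

lemma saddle_node_scale_imp: "is_unit u ==> saddle_node om ==> saddle_node (scl u om)"
 unfolding saddle_node_def using simple_sing_scale_imp lin_eigenvalues_scale
 by (metis mult_zero_right simple_sing_def)

lemma scale_unit_inverse:
 assumes "is_unit u" obtains w where "is_unit w" "!!om. scl w (scl u om) = om"
proof -
 obtain w where w: "1 = u * w" using assms by blast
 have "w * (u * a) = a" for a
 proof -
  have "w * (u * a) = (u * w) * a" by simp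
  thus ?thesis by (simp flip: w)
 qed
 hence "scl w (scl u om) = om" for om by (simp only: scale_form_def fst_conv snd_conv prod.collapse)
 moreover have "is_unit w" using w by (metis dvdI mult.commute)
 ultimately show ?thesis by (intro that[of w])
qed

lemma simple_sing_scale: "is_unit u ==> smp (scl u om) <-> smp om"
 using simple_sing_scale_imp scale_unit_inverse by metis
lemma saddle_node_scale: "is_unit u ==> saddle_node (scl u om) <-> saddle_node om"
 using saddle_node_scale_imp scale_unit_inverse by metis

lemma cs_index_scale:
 assumes f: "prm f" "gp f U V" and co: "coprime (fst om) (snd om)" and inv: "f dvd wdg om f" and u: "is_unit u"
 shows "csi (scl u om) (crv f) = csi om (crv f)"
proof -
 obtain g h A B where d: "dec om f g h A B" using dec_exists[OF f(1) co inv] by blast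
 have d': "dec (scl u om) f g (u * h) (u * A) (u * B)"
 proof -
  have "u * (g * fst om) = u * (h * Dx f + f * A)" "u * (g * snd om) = u * (h * Dy f + f * B)"
   using d by (simp_all add: dec_def)
  hence "g * (u * fst om) = u * h * Dx f + f * (u * A)" "g * (u * snd om) = u * h * Dy f + f * (u * B)"
   by (simp_all add: alg)
  thus ?thesis using d u by (simp add: dec_def dvd_mult_unit_iff')
 qed
 have UV: "cf U 0 = 0" "cf V 0 = 0" using f by (auto simp: gp_def)
 have "cf (al u U V) 0 ~= 0" using u by (simp add: al_nth_0[OF UV] is_unit_iff)
 hence u0: "al u U V ~= 0" by auto
 have "csv (u * A) (u * B) (u * h) U V = csv A B h U V"
  unfolding csv_def al_mult[OF UV] using u0
  by (simp add: fls_times_fps_to_fls mult.assoc flip: distrib_left)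
 thus ?thesis using cs_index_eq[OF f d] cs_index_eq[OF f d'] by simp
qed

subsection \<open>Exchanging the coordinates\<close>

text \<open>Pull-back of a 1-form by the exchange of coordinates. The dual vector field changes its
  sign, and so do the eigenvalues.\<close>

definition sform :: "form => form" where "sform om = (swp (snd om), swp (fst om))"

lemma sform_simps [simp]: "fst (sform om) = swp (snd om)" "snd (sform om) = swp (fst om)"
 by (simp_all add: sform_def)

lemma swap_prime [simp]: "prm (swp f) <-> prm f"
proof -
 have *: "prm f ==> prm (swp f)" for f
 proof (rule prime_elemI)
  assume f: "prm f"
  show "swp f ~= 0" "~ is_unit (swp f)" using f by auto
  show "swp f dvd a \<or> swp f dvd b" if "swp f dvd a * b" for a b
  proof -
   have "f dvd swp a * swp b" using that swap_dvd_iff[of f "swp a * swp b"] by simp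
   hence "f dvd swp a \<or> f dvd swp b" using f by (simp add: prime_elem_dvd_mult_iff)
   thus ?thesis using swap_dvd_iff[of f "swp a"] swap_dvd_iff[of f "swp b"] by simp
  qed
 qed
 show ?thesis using *[of f] *[of "swp f"] by auto
qed

lemma swap_dvd_left: "swp f dvd g <-> f dvd swp g"
 using swap_dvd_iff[of f "swp g"] by simp

lemma sform_coprime [simp]: "coprime (swp a) (swp b) <-> coprime a b"
by (metis coprime_def swap_dvd_left swap_hom(9) swap_unit_iff)

lemma wedge_sform: "wdg (sform om) (swp f) = - swp (wdg om f)"
 by (simp add: wedge_d_def swap_dx swap_dy)

lemma sform_sing: "sng (sform om) <-> sng om" by (auto simp: singular_form_def)

lemma sform_lin: "lin_eigenvalues (sform om) l m <-> lin_eigenvalues om (- l) (- m)"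
 unfolding lin_eigenvalues_alt by auto

lemma sform_sform [simp]: "sform (sform om) = om" by (simp add: sform_def)

lemma sform_simple: "smp (sform om) <-> smp om"
proof -
 have *: "smp (sform om)" if sim: "smp om" for om
 proof -
  obtain l m where "lin_eigenvalues om l m" "l ~= 0" "~ pos_rat (m / l)" "sng om"
   using sim by (auto simp: simple_sing_def)
  hence "lin_eigenvalues (sform om) (- l) (- m)" "- l ~= 0" "~ pos_rat (- m / - l)"
   by (simp_all add: sform_lin)
  thus ?thesis unfolding simple_sing_def sform_sing using \<open>sng om\<close> by blast
 qed
 show ?thesis using *[of om] *[of "sform om"] by auto
qed

lemma sform_saddle: "saddle_node (sform om) <-> saddle_node om"
 unfolding saddle_node_def sform_simple sform_lin by (metis add.inverse_inverse neg_0_equal_iff_equal)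

lemma cs_index_sform:
 assumes f: "prm f" "gp f U V" and co: "coprime (fst om) (snd om)" and inv: "f dvd wdg om f"
 shows "csi (sform om) (crv (swp f)) = csi om (crv f)"
proof -
 obtain g h A B where d: "dec om f g h A B" using dec_exists[OF f(1) co inv] by blast
 have d': "dec (sform om) (swp f) (swp g) (swp h) (swp B) (swp A)"
 proof -
  have "swp (g * fst om) = swp (h * Dx f + f * A)" "swp (g * snd om) = swp (h * Dy f + f * B)"
   using d by (auto simp: dec_def)
  thus ?thesis using d by (simp add: dec_def swap_dx swap_dy)
 qed
 have "csv (swp B) (swp A) (swp h) V U = csv A B h U V"
  by (simp add: csv_def al_swap add.commute)
 thus ?thesis
  using cs_index_eq[OF f d] cs_index_eq[of "swp f" V U, OF _ gp_swap[OF f(2)] d'] f(1) by simp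
qed

subsection \<open>Invariant curves through a point\<close>

lemma inv_along:
 assumes f: "prm f" "gp f U V" and inv: "f dvd wdg om f"
 shows "al (fst om) U V * fD U + al (snd om) U V * fD V = 0"
proof -
 have UV: "cf U 0 = 0" "cf V 0 = 0" and z: "!!a. al a U V = 0 <-> f dvd a" using f(2) by (auto simp: gp_def)
 define P Q fx fy where "P = al (fst om) U V" and "Q = al (snd om) U V" and "fx = al (Dx f) U V" and "fy = al (Dy f) U V"
 have w: "P * fy - Q * fx = 0" using inv unfolding z[symmetric] wedge_d_def by (simp add: UV P_def Q_def fx_def fy_def)
 have "al f U V = 0" using z by simp
 hence c: "fx * fD U + fy * fD V = 0" using al_chain[OF UV, of f] by (simp add: fx_def fy_def)
 have "f ~= 0" "~ is_unit f" using f(1) by auto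
 then consider "fy ~= 0" | "fx ~= 0" using not_both_derivatives z by (auto simp: fx_def fy_def)
 hence "P * fD U + Q * fD V = 0"
 proof cases
  case 1
  have "fy * (P * fD U + Q * fD V) = (P * fy - Q * fx) * fD U + Q * (fx * fD U + fy * fD V)"
   by (simp add: alg)
  thus ?thesis using w c 1 by simp
 next
  case 2
  have "fx * (P * fD U + Q * fD V) = P * (fx * fD U + fy * fD V) - (P * fy - Q * fx) * fD V"
   by (simp add: alg)
  thus ?thesis using w c 2 by simp
 qed
 thus ?thesis by (simp add: P_def Q_def)
qed

text \<open>Restricted to the curve f, the equation of another invariant curve satisfies relations A
  psi' = psi C, in one of which A is a unit. A nonzero psi vanishing at 0 cannot, since psi' has
  smaller order.\<close>

lemma regular_unique:
 assumes reg: "~ sng om" and f: "prm f" "gp f U V" "f dvd wdg om f"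
  and f': "~ is_unit f'" "f' dvd wdg om f'"
 shows "f dvd f'"
proof (rule ccontr)
 assume "~ f dvd f'"
 have UV: "cf U 0 = 0" "cf V 0 = 0" and z: "!!a. al a U V = 0 <-> f dvd a" using f(2) by (auto simp: gp_def)
 define \<psi> where "\<psi> = al f' U V"
 have "\<psi> ~= 0" using \<open>~ f dvd f'\<close> z by (simp add: \<psi>_def)
 have "cf \<psi> 0 = 0" using f'(1) by (simp add: \<psi>_def al_nth_0[OF UV] is_unit_iff)
 hence n: "sdg \<psi> ~= 0" using \<open>\<psi> ~= 0\<close> by (auto simp: subdegree_eq_0_iff)
 obtain c where c: "fst om * Dy f' - snd om * Dx f' = f' * c" using f'(2) by (auto simp: wedge_d_def elim: dvdE)
 define P Q where "P = al (fst om) U V" and "Q = al (snd om) U V"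
 have t: "P * fD U + Q * fD V = 0" using inv_along[OF f] by (simp add: P_def Q_def)
 have c': "P * al (Dy f') U V - Q * al (Dx f') U V = \<psi> * al c U V"
  using arg_cong[OF c, of "%g. al g U V"] by (simp add: UV P_def Q_def \<psi>_def)
 have d: "fD \<psi> = al (Dx f') U V * fD U + al (Dy f') U V * fD V"
  unfolding \<psi>_def by (rule al_chain[OF UV])
 have "Q * fD \<psi> = \<psi> * (- al c U V * fD U)"
 proof -
  have "Q * fD \<psi> = - (P * al (Dy f') U V - Q * al (Dx f') U V) * fD U
    + al (Dy f') U V * (P * fD U + Q * fD V)"
   unfolding d by (simp add: alg)
  thus ?thesis unfolding c' t by simp
 qed
 moreover have "P * fD \<psi> = \<psi> * (al c U V * fD V)"
 proof -
  have "P * fD \<psi> = (P * al (Dy f') U V - Q * al (Dx f') U V) * fD V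
    + al (Dx f') U V * (P * fD U + Q * fD V)"
   unfolding d by (simp add: alg)
  thus ?thesis unfolding c' t by simp
 qed
 moreover have False if "A * fD \<psi> = \<psi> * C" "cf A 0 ~= 0" for A C
 proof -
  obtain m where m: "sdg \<psi> = Suc m" using n by (cases "sdg \<psi>") auto
  have d0: "fD \<psi> ~= 0" and sd: "sdg (fD \<psi>) = m"
  proof -
   have nz: "cf (fD \<psi>) m ~= 0" using \<open>\<psi> ~= 0\<close> m nth_subdegree_nonzero[of \<psi>] by simp
   thus "fD \<psi> ~= 0" by (metis fps_zero_nth)
   show "sdg (fD \<psi>) = m"
    by (rule subdegreeI[OF nz]) (simp add: m nth_less_subdegree_zero)
  qed
  have "A ~= 0" "sdg A = 0" using that(2) by auto
  hence "A * fD \<psi> ~= 0" "sdg (A * fD \<psi>) = m" using d0 sd by auto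
  thus False using that(1) \<open>\<psi> ~= 0\<close> m by simp
 qed
 moreover have "cf P 0 ~= 0 \<or> cf Q 0 ~= 0"
  using reg by (auto simp: P_def Q_def al_nth_0[OF UV] singular_form_def)
 ultimately show False by blast
qed

text \<open>Compare the coefficients in degree ord psi, where each side has a single surviving
  term.\<close>

lemma deriv_coeff_compare:
 fixes A \<psi> C :: "real fps"
 assumes "A * fD \<psi> = \<psi> * C" "cf A 0 = 0" "\<psi> ~= 0" "sdg \<psi> ~= 0"
 shows "cf A 1 * real (sdg \<psi>) = cf C 0"
proof -
 obtain m where m: "sdg \<psi> = Suc m" using assms(4) by (cases "sdg \<psi>") auto
 have z: "cf \<psi> k = 0" if "k < Suc m" for k
  using nth_less_subdegree_zero[of k \<psi>] that unfolding m by blast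
 have "cf (A * fD \<psi>) (Suc m) = (\<Sum>i=0..Suc m. if i = 1 then cf A 1 * (real (Suc m) * cf \<psi> (Suc m)) else 0)"
  unfolding fps_mult_nth
 proof (intro sum.cong refl)
  fix i assume i: "i : {0..Suc m}"
  consider "i = 0" | "i = 1" | "1 < i" by linarith
  thus "cf A i * cf (fD \<psi>) (Suc m - i) = (if i = 1 then cf A 1 * (real (Suc m) * cf \<psi> (Suc m)) else 0)"
  proof cases
   case 3
   hence "cf (fD \<psi>) (Suc m - i) = 0" using z[of "Suc (Suc m - i)"] i by simp
   thus ?thesis by auto
  qed (use assms(2) in auto)
 qed
 hence l: "cf (A * fD \<psi>) (Suc m) = cf A 1 * (real (Suc m) * cf \<psi> (Suc m))" by simp
 have "cf (\<psi> * C) (Suc m) = (\<Sum>i=0..Suc m. if i = Suc m then cf \<psi> (Suc m) * cf C 0 else 0)"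
  unfolding fps_mult_nth by (intro sum.cong refl) (auto simp: z)
 hence "cf (\<psi> * C) (Suc m) = cf \<psi> (Suc m) * cf C 0" by simp
 hence "cf A 1 * (real (Suc m) * cf \<psi> (Suc m)) = cf \<psi> (Suc m) * cf C 0"
  using l assms(1) by metis
 hence e: "cf \<psi> (Suc m) * (cf A 1 * real (Suc m)) = cf \<psi> (Suc m) * cf C 0"
  by simp
 have "cf \<psi> (Suc m) ~= 0" using assms(3) m nth_subdegree_nonzero[of \<psi>] by simp
 from mult_left_cancel[OF this] e show ?thesis unfolding m by blast
qed

lemma residue_simple_pole:
 assumes "cf D 0 = 0" "cf D 1 ~= 0"
 shows "fls_residue (fl N / fl D) = cf N 0 / cf D 1"
proof -
 define E where "E = fps_shift 1 D"
 have E0: "cf E 0 ~= 0" using assms by (simp add: E_def)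
 have D: "D = fps_X * E" by (rule fps_ext) (use assms in \<open>simp add: E_def\<close>)
 have "inverse E * E = 1" using E0 by auto
 hence N: "N = (N * inverse E) * E" by simp
 hence "fl N / fl D = fl (N * inverse E) / fls_X"
  by (subst N) (simp add: D fls_times_fps_to_fls)
 hence "fls_residue (fl N / fl D) = cf (N * inverse E) 0" by simp
 thus ?thesis by (simp add: E_def divide_inverse)
qed

lemma residue_regular:
 assumes "cf D 0 ~= 0"
 shows "fls_residue (fl N / fl D) = 0"
proof -
 have "inverse D * D = 1" using assms by auto
 hence N: "N = (N * inverse D) * D" by simp
 hence "fl N / fl D = fl (N * inverse D)" by (subst N) (simp add: fls_times_fps_to_fls)
 thus ?thesis by simp
qed

lemma dy_xgerm: "0 < rad ph ==> Dy (xgerm ph) = 0"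
 by (rule germ_eqI) (simp add: gc_dy gc_xgerm)

lemma nth_al_0X: "cf (al a 0 fps_X) n = gc a 0 n"
proof -
 have "al a 0 fps_X - row a 0 = 0"
  by (rule germ_zeroI_fps[where u = 0 and v = fps_X])
   (auto simp: al_X_mult al_Y_mult row_add row_mult alg
    intro!: fps_ext, auto simp: row_nth gc_const gc_X gc_Y)
 thus ?thesis by (simp add: row_nth)
qed

lemma graph_prime:
 assumes "0 < rad ph" "cf ph 0 = 0"
 shows "prm (gY - xgerm ph)"
proof (rule prime_elemI)
 have z: "cf (fps_X :: real fps) 0 = 0" by simp
 have *: "gY - xgerm ph dvd a <-> al a fps_X ph = 0" for a
  using gp_graph[OF assms] by (auto simp: gp_def)
 have "gc (gY - xgerm ph) 0 1 = 1" using assms by (simp add: gc_Y gc_xgerm)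
 thus "gY - xgerm ph ~= 0" by auto
 show "~ is_unit (gY - xgerm ph)" using assms by (simp add: *)
 show "gY - xgerm ph dvd a \<or> gY - xgerm ph dvd b" if "gY - xgerm ph dvd a * b" for a b
  using that assms by (simp add: *)
qed

lemma graph_invariant_iff:
 assumes "0 < rad ph" "cf ph 0 = 0"
 shows "gY - xgerm ph dvd wdg om (gY - xgerm ph) <->
  al (fst om) fps_X ph + al (snd om) fps_X ph * fD ph = 0"
proof -
 let ?f = "gY - xgerm ph"
 have z: "cf (fps_X :: real fps) 0 = 0" by simp
 have g: "gp ?f fps_X ph" by (rule gp_graph[OF assms])
 have fy: "Dy ?f = 1" by (simp add: dy_xgerm assms)
 have "al ?f fps_X ph = 0" using g unfolding gp_def by (metis dvd_refl)
 hence "al (Dx ?f) fps_X ph + fD ph = 0"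
  using al_chain[OF z assms(2), of ?f] unfolding fy using assms(2) by simp
 hence fx: "al (Dx ?f) fps_X ph = - fD ph" by (simp add: eq_neg_iff_add_eq_0)
 have "al (wdg om ?f) fps_X ph = al (fst om) fps_X ph + al (snd om) fps_X ph * fD ph"
  unfolding wedge_d_def fy al_diff[OF z assms(2)] al_mult[OF z assms(2)] fx using assms(2) by simp
 moreover have "?f dvd wdg om ?f <-> al (wdg om ?f) fps_X ph = 0" using g unfolding gp_def by metis
 ultimately show ?thesis by simp
qed

text \<open>Dividing by the unit cofactor of x in Q turns \<omega> = 0 into x y' = F(x, y), whose
  linear coefficient in y is the ratio of the eigenvalues; nonresonance is the hypothesis of
  \<open>briot_bouquet\<close>.\<close>

lemma separatrix_exists:
 assumes X: "gX dvd snd om" and a: "gc (snd om) 1 0 ~= 0" and P: "gc (fst om) 0 0 = 0"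
  and res: "!!n. 1 \<le> n ==> - gc (fst om) 0 1 ~= real n * gc (snd om) 1 0"
 obtains ph where "0 < rad ph" "cf ph 0 = 0" "gY - xgerm ph dvd wdg om (gY - xgerm ph)"
proof -
 obtain B where B: "snd om = gX * B" using X by blast
 have B0: "gc B 0 0 = gc (snd om) 1 0" by (simp add: B gc_X_mult)
 hence "is_unit B" using a by (simp add: is_unit_iff)
 then obtain w where w: "1 = B * w" by blast
 have "gc B 0 0 * gc w 0 0 = 1" using w by (metis at0_1 at0_mult)
 hence w0: "gc w 0 0 = 1 / gc (snd om) 1 0" using a by (simp add: B0 field_simps)
 define F where "F = - (fst om * w)"
 have F01: "gc F 0 1 = - gc (fst om) 0 1 / gc (snd om) 1 0"
  using P by (simp add: F_def gc_mult w0)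
 have z: "cf (fps_X :: real fps) 0 = 0" by simp
 obtain ph where ph: "0 < rad ph" "cf ph 0 = 0" "fps_X * fD ph = al F fps_X ph"
 proof (rule briot_bouquet[of F])
  show "gc F 0 0 = 0" using P by (simp add: F_def)
  show "gc F 0 1 ~= real n" if "1 \<le> n" for n
   using res[OF that] a unfolding F01 by (simp add: field_simps)
 qed
 have "al (snd om) fps_X ph * fD ph = al B fps_X ph * (fps_X * fD ph)"
  using z ph(2) by (simp add: B)
 also have "\<dots> = - (al (B * w) fps_X ph * al (fst om) fps_X ph)"
  unfolding ph(3) F_def using z ph(2) by simp
 finally have "al (fst om) fps_X ph + al (snd om) fps_X ph * fD ph = 0"
  using z ph(2) by (simp flip: w)
 thus ?thesis using that ph graph_invariant_iff by blast
qed

text \<open>Multiplying y' = - P/Q by x gives a Briot-Bouquet equation with linear coefficient 0, so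
  the same theorem yields the leaves.\<close>

lemma leaf_exists:
 assumes Q: "gc (snd om) 0 0 ~= 0"
 obtains ph where "0 < rad ph" "cf ph 0 = 0" "gY - xgerm ph dvd wdg om (gY - xgerm ph)"
proof -
 have "is_unit (snd om)" using Q by (simp add: is_unit_iff)
 then obtain w where w: "1 = snd om * w" by blast
 define F where "F = gX * - (fst om * w)"
 have z: "cf (fps_X :: real fps) 0 = 0" by simp
 obtain ph where ph: "0 < rad ph" "cf ph 0 = 0" "fps_X * fD ph = al F fps_X ph"
  by (rule briot_bouquet[of F]) (auto simp: F_def gc_X_mult)
 have "fps_X * fD ph = fps_X * - (al (fst om) fps_X ph * al w fps_X ph)"
  unfolding ph(3) F_def using z ph(2) by simp
 hence d: "fD ph = - (al (fst om) fps_X ph * al w fps_X ph)"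
  unfolding mult_left_cancel[OF fps_X_neq_zero] .
 have "al (snd om) fps_X ph * fD ph = - (al (snd om * w) fps_X ph * al (fst om) fps_X ph)"
  unfolding d using z ph(2) by simp
 hence "al (fst om) fps_X ph + al (snd om) fps_X ph * fD ph = 0"
  using z ph(2) by (simp flip: w)
 thus ?thesis using that ph graph_invariant_iff by blast
qed

lemma pos_rat_inverse: "pos_rat (1 / x) <-> pos_rat x"
 unfolding pos_rat_def by (metis Rats_1 Rats_divide div_by_1 divide_divide_eq_right mult.left_neutral zero_less_divide_1_iff)

text \<open>Invariance of x = 0 makes the linear part triangular, so the eigenvalues are its
  diagonal entries. Positive rationals are closed under inversion, which allows either order of the
  two.\<close>

lemma simple_linear:
 assumes "smp om" "~ saddle_node om" "gX dvd snd om"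
 shows "gc (fst om) 0 0 = 0" "gc (snd om) 1 0 ~= 0" "gc (fst om) 0 1 ~= 0"
  "~ pos_rat (- gc (fst om) 0 1 / gc (snd om) 1 0)"
proof -
 define a d where "a = gc (snd om) 1 0" and "d = - gc (fst om) 0 1"
 obtain l m where lm: "lin_eigenvalues om l m" "l ~= 0" "~ pos_rat (m / l)" "sng om"
  using assms(1) by (auto simp: simple_sing_def)
 show "gc (fst om) 0 0 = 0" using lm(4) by (simp add: singular_form_def)
 have "gc (snd om) 0 1 = 0" using assms(3) by (simp add: X_dvd_iff)
 hence e: "l + m = a + d" "l * m = a * d" using lm(1) by (simp_all add: lin_eigenvalues_alt a_def d_def)
 have m0: "m ~= 0" using lm assms(1,2) by (auto simp: saddle_node_def)
 have "l * l + l * m = l * a + l * d" using e(1) by (metis distrib_left)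
 hence "(l - a) * (l - d) = 0" using e(2) by (simp add: alg)
 then consider "l = a" "m = d" | "l = d" "m = a" using e(1) by auto
 hence "a ~= 0 & d ~= 0 & ~ pos_rat (d / a)"
 proof cases
  case 2
  hence "~ pos_rat (1 / (d / a))" using lm(3) by simp
  thus ?thesis using 2 lm(2) m0 unfolding pos_rat_inverse by simp
 qed (use lm m0 in auto)
 thus "gc (snd om) 1 0 ~= 0" "gc (fst om) 0 1 ~= 0" "~ pos_rat (- gc (fst om) 0 1 / gc (snd om) 1 0)"
  by (auto simp: a_def d_def)
qed

lemma cs_graph:
 assumes X: "gX dvd snd om" and a: "gc (snd om) 1 0 ~= 0"
  and ph: "0 < rad ph" "cf ph 0 = 0" and inv: "gY - xgerm ph dvd wdg om (gY - xgerm ph)"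
 shows "csi om (crv (gY - xgerm ph)) = - gc (fst om) 0 1 / gc (snd om) 1 0"
proof -
 let ?f = "gY - xgerm ph"
 have z: "cf (fps_X :: real fps) 0 = 0" by simp
 have g: "gp ?f fps_X ph" by (rule gp_graph[OF ph])
 have fy: "Dy ?f = 1" by (simp add: dy_xgerm ph)
 obtain B where B: "snd om = gX * B" using X by blast
 obtain A where A: "wdg om ?f = ?f * A" using inv by blast
 have Q: "al (snd om) fps_X ph = fps_X * al B fps_X ph" using z ph(2) by (simp add: B)
 have B0: "gc B 0 0 = gc (snd om) 1 0" by (simp add: B gc_X_mult)
 have Q1: "cf (al (snd om) fps_X ph) 1 = gc (snd om) 1 0"
  unfolding Q by (simp add: al_nth_0[OF z ph(2)] B0)
 hence "al (snd om) fps_X ph ~= 0" using a by auto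
 hence nd: "~ ?f dvd snd om" using g by (simp add: gp_def)
 have "~ ?f dvd 1" using graph_prime[OF ph] by simp
 hence "dec om ?f 1 (snd om) A 0"
  using nd A fy unfolding dec_def wedge_d_def by (simp add: alg)
 hence "csi om (crv ?f) = csv A 0 (snd om) fps_X ph"
  by (rule cs_index_eq[OF graph_prime[OF ph] g])
 also have "\<dots> = - (cf (al A fps_X ph) 0 / gc (snd om) 1 0)"
  unfolding csv_def using residue_simple_pole[of "al (snd om) fps_X ph" "al A fps_X ph"] a Q1 z ph(2)
  by (simp add: Q)
 also have "cf (al A fps_X ph) 0 = gc (?f * A) 0 1"
  using ph by (simp add: al_nth_0[OF z ph(2)] gc_mult gc_Y gc_xgerm)
 also have "\<dots> = gc (fst om) 0 1"
  unfolding A[symmetric] wedge_d_def fy using X by (simp add: gc_mult X_dvd_iff)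
 finally show ?thesis by simp
qed

lemma cs_X:
 assumes X: "gX dvd snd om" and d: "gc (fst om) 0 1 ~= 0" and P: "gc (fst om) 0 0 = 0"
 shows "csi om (crv gX) = - gc (snd om) 1 0 / gc (fst om) 0 1"
proof -
 obtain B where B: "snd om = gX * B" using X by blast
 have "~ gX dvd fst om" using d by (auto simp: X_dvd_iff)
 moreover have "~ gX dvd 1" using prime_X by simp
 ultimately have "dec om gX 1 (fst om) 0 B" using B by (simp add: dec_def)
 hence "csi om (crv gX) = csv 0 B (fst om) 0 fps_X"
  by (rule cs_index_eq[OF prime_X gp_X])
 also have "\<dots> = - (gc B 0 0 / gc (fst om) 0 1)"
  unfolding csv_def using residue_simple_pole[of "al (fst om) 0 fps_X" "al B 0 fps_X"] d P
  by (simp add: nth_al_0X)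
 finally show ?thesis by (simp add: B gc_X_mult)
qed

lemma cs_regular:
 assumes reg: "~ sng om" and f: "prm f" "gp f U V" "f dvd wdg om f"
 shows "csi om (crv f) = 0"
proof -
 have UV: "cf U 0 = 0" "cf V 0 = 0" using f(2) by (auto simp: gp_def)
 have nu: "f ~= 0" "~ is_unit f" using f by auto
 obtain A where A: "fst om * Dy f - snd om * Dx f = f * A" using f(3) by (auto simp: wedge_d_def elim: dvdE)
 have nf: "~ f dvd h" if "gc h 0 0 ~= 0" for h
  using nu(2) that by (metis dvd_trans is_unit_iff)
 consider "gc (snd om) 0 0 ~= 0" | "gc (fst om) 0 0 ~= 0" using reg by (auto simp: singular_form_def)
 thus ?thesis
 proof cases
  case 1
  have "~ f dvd Dy f"
  proof
   assume y: "f dvd Dy f"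
   have "snd om * Dx f = fst om * Dy f - f * A" using A by (simp add: alg)
   hence "f dvd snd om * Dx f" using y by simp
   thus False using nf[OF 1] not_both_derivatives[OF nu] y f(1) by (simp add: prime_elem_dvd_mult_iff)
  qed
  hence "dec om f (Dy f) (snd om) A 0" using nf[OF 1] A by (simp add: dec_def alg)
  hence "csi om (crv f) = csv A 0 (snd om) U V" by (rule cs_index_eq[OF f(1,2)])
  also have "\<dots> = 0" unfolding csv_def using 1 by (subst residue_regular) (simp_all add: al_nth_0[OF UV])
  finally show ?thesis .
 next
  case 2
  have "~ f dvd Dx f"
  proof
   assume x: "f dvd Dx f"
   have "fst om * Dy f = snd om * Dx f + f * A" using A by (simp add: alg)
   hence "f dvd fst om * Dy f" using x by simp
   thus False using nf[OF 2] not_both_derivatives[OF nu] x f(1) by (simp add: prime_elem_dvd_mult_iff)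
  qed
  hence "dec om f (Dx f) (fst om) 0 (- A)" using nf[OF 2] A by (simp add: dec_def alg)
  hence "csi om (crv f) = csv 0 (- A) (fst om) U V" by (rule cs_index_eq[OF f(1,2)])
  also have "\<dots> = 0" unfolding csv_def using 2 by (subst residue_regular) (simp_all add: al_nth_0[OF UV])
  finally show ?thesis .
 qed
qed

text \<open>Restrict a third invariant f' to the graph and to x = 0. The orders of the two
  restrictions, multiplied by the respective eigenvalues, both equal minus the value of the cofactor
  c at 0. So the ratio of the eigenvalues would be a positive rational.\<close>

lemma simple_unique:
 assumes X: "gX dvd snd om" and a: "gc (snd om) 1 0 ~= 0" and P: "gc (fst om) 0 0 = 0"
  and nr: "~ pos_rat (- gc (fst om) 0 1 / gc (snd om) 1 0)"
  and ph: "0 < rad ph" "cf ph 0 = 0" and inv: "gY - xgerm ph dvd wdg om (gY - xgerm ph)"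
  and f': "~ is_unit f'" "f' dvd wdg om f'"
 shows "gX dvd f' \<or> gY - xgerm ph dvd f'"
proof (rule ccontr)
 assume neg: "~ ?thesis"
 let ?f = "gY - xgerm ph"
 have z: "cf (fps_X :: real fps) 0 = 0" by simp
 have g: "gp ?f fps_X ph" by (rule gp_graph[OF ph])
 obtain c where c: "fst om * Dy f' - snd om * Dx f' = f' * c" using f'(2) by (auto simp: wedge_d_def elim: dvdE)
 define \<psi> th where "\<psi> = al f' fps_X ph" and "th = al f' 0 fps_X"
 have ne: "\<psi> ~= 0" "th ~= 0"
  using neg g by (auto simp: \<psi>_def th_def gp_def X_dvd_iff fps_eq_iff nth_al_0X)
 have f0: "gc f' 0 0 = 0" using f'(1) by (simp add: is_unit_iff)
 have "cf \<psi> 0 = 0" "cf th 0 = 0" using f0 by (auto simp: \<psi>_def th_def al_nth_0[OF z ph(2)] nth_al_0X)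
 hence sd: "sdg \<psi> ~= 0" "sdg th ~= 0" using ne by (auto simp: subdegree_eq_0_iff)
 have Q1: "cf (al (snd om) fps_X ph) 1 = gc (snd om) 1 0" "cf (al (snd om) fps_X ph) 0 = 0"
 proof -
  obtain B where B: "snd om = gX * B" using X by blast
  show "cf (al (snd om) fps_X ph) 1 = gc (snd om) 1 0" "cf (al (snd om) fps_X ph) 0 = 0"
   using z ph(2) by (simp_all add: B al_nth_0[OF z ph(2)] gc_X_mult)
 qed
 have t: "al (fst om) fps_X ph = - (al (snd om) fps_X ph * fD ph)"
  using inv unfolding graph_invariant_iff[OF ph] by (simp add: eq_neg_iff_add_eq_0)
 have "al (fst om * Dy f' - snd om * Dx f') fps_X ph = \<psi> * al c fps_X ph"
  unfolding c using z ph(2) by (simp add: \<psi>_def)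
 hence "- (al (snd om) fps_X ph * fD \<psi>) = \<psi> * al c fps_X ph"
  using z ph(2) unfolding \<psi>_def by (simp add: t al_chain[OF z ph(2)] alg)
 hence "al (snd om) fps_X ph * fD \<psi> = \<psi> * - al c fps_X ph" by (simp add: minus_equation_iff)
 from deriv_coeff_compare[OF this Q1(2) ne(1) sd(1)]
 have 1: "gc (snd om) 1 0 * real (sdg \<psi>) = - gc c 0 0" by (simp add: Q1[unfolded One_nat_def] al_nth_0[OF z ph(2)])
 have z0: "cf (0 :: real fps) 0 = 0" by simp
 have "al (snd om) 0 fps_X = 0" using X by auto
 hence "al (fst om * Dy f' - snd om * Dx f') 0 fps_X = al (fst om) 0 fps_X * fD th"
  unfolding th_def by (simp add: al_chain[OF z0 z])
 hence "al (fst om) 0 fps_X * fD th = th * al c 0 fps_X"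
  unfolding c by (simp add: th_def)
 from deriv_coeff_compare[OF this _ ne(2) sd(2)]
 have 2: "gc (fst om) 0 1 * real (sdg th) = gc c 0 0" using P by (simp add: nth_al_0X)
 have "- gc (fst om) 0 1 / gc (snd om) 1 0 = real (sdg \<psi>) / real (sdg th)"
  using 1 2 a sd by (simp add: field_simps)
 moreover have "pos_rat (real (sdg \<psi>) / real (sdg th))"
  using sd unfolding pos_rat_def by simp
 ultimately show False using nr by simp
qed

text \<open>Invariance forces eigenvalues with ratio \<open>1\<close>.\<close>
lemma definite_not_invariant:
 assumes inv: "g dvd wdg om g" and g: "g = gX ^ 2 + cst c * gY ^ 2" and c: "0 < c"
 shows "sng om & ~ smp om"
proof -
 obtain k where k: "fst om * Dy g - snd om * Dx g = g * k" using inv by (auto simp: wedge_d_def elim: dvdE)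
 have gx: "Dx g = cst 2 * gX" and gy: "Dy g = cst (2 * c) * gY"
  unfolding g by (rule germ_eqI; auto simp: gc_dx gc_dy power2_eq_square gc_X_mult gc_Y_mult gc_X gc_Y)+
 define P Q where "P = fst om" and "Q = snd om"
 have gg: "g * k = gX * (gX * k) + cst c * (gY * (gY * k))"
  unfolding g by (simp add: power2_eq_square alg)
 have e: "2 * c * gc (gY * P) i j - 2 * gc (gX * Q) i j
   = gc (gX * (gX * k)) i j + c * gc (gY * (gY * k)) i j" for i j
 proof -
  have "gc (fst om * Dy g - snd om * Dx g) i j = gc (cst (2 * c) * (gY * P) - cst 2 * (gX * Q)) i j"
   unfolding gx gy P_def Q_def by (simp add: mult_ac del: gc_const_mult)
  thus ?thesis unfolding k gg by simp
 qed
 have P0: "gc P 0 0 = 0" using e[of 0 1] c by (simp add: gc_X_mult gc_Y_mult)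
 have Q0: "gc Q 0 0 = 0" using e[of 1 0] by (simp add: gc_X_mult gc_Y_mult)
 have Q10: "- 2 * gc Q 1 0 = gc k 0 0" using e[of 2 0] by (simp add: gc_X_mult gc_Y_mult)
 have P01: "2 * gc P 0 1 = gc k 0 0" using e[of 0 2] c by (simp add: gc_X_mult gc_Y_mult)
 have P01': "gc P 0 1 = - gc Q 1 0" using P01 Q10 by simp
 have Q01: "gc Q 0 1 = c * gc P 1 0" using e[of 1 1] by (simp add: gc_X_mult gc_Y_mult)
 have "~ smp om"
 proof
  assume "smp om"
  then obtain l m where lm: "lin_eigenvalues om l m" "l ~= 0" "~ pos_rat (m / l)" by (auto simp: simple_sing_def)
  define a b where "a = gc Q 1 0" and "b = gc P 1 0"
  have 1: "l + m = 2 * a" and 2: "l * m = a * a + c * b * b"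
   using lm(1) Q01 P01' by (simp_all add: lin_eigenvalues_alt a_def b_def P_def Q_def)
  have "(l - m) ^ 2 = (l + m) ^ 2 - 4 * (l * m)" by (simp add: power2_eq_square alg)
  also have "\<dots> = - (4 * c * b ^ 2)" unfolding 1 2 by (simp add: power2_eq_square)
  also have "\<dots> \<le> 0" using c by simp
  finally have "l = m" by simp
  thus False using lm by (simp add: pos_rat_def)
 qed
 thus ?thesis using P0 Q0 by (simp add: singular_form_def P_def Q_def)
qed


subsection \<open>Separatrices relative to a component of the divisor\<close>

text \<open>\<open>graph e f\<close>: the smooth curve \<open>{f = 0}\<close> is a graph transverse to the axis \<open>{e = 0}\<close>.\<close>
definition graph :: "germ => germ => bool" where
 "graph e f <-> (\<exists>ph. 0 < rad ph & cf ph 0 = 0 &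
  (e = gX & f = gY - xgerm ph \<or> e = gY & f = swp (gY - xgerm ph)))"

lemma graph_swap: "graph e f ==> graph (swp e) (swp f)"
 by (auto simp: graph_def)

lemma graph_props:
 assumes "graph e f"
 shows "prm f" "\<exists>U V. gp f U V" "vord f = 1" "~ f dvd e" "~ e dvd f"
  "gc (Dx f * Dy e - Dy f * Dx e) 0 0 ~= 0"
proof -
 obtain ph where ph: "0 < rad ph" "cf ph 0 = 0"
  and ef: "e = gX & f = gY - xgerm ph \<or> e = gY & f = swp (gY - xgerm ph)"
  using assms by (auto simp: graph_def)
 let ?g = "gY - xgerm ph"
 have p: "prm ?g" by (rule graph_prime[OF ph])
 have gp: "gp ?g fps_X ph" by (rule gp_graph[OF ph])
 have v: "vord ?g = 1"
  by (rule vord_eqI[of _ _ 0 1]) (use ph in \<open>auto simp: gc_Y gc_xgerm\<close>)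
 have 1: "~ gX dvd ?g" using ph by (auto simp: X_dvd_iff gc_Y gc_xgerm intro!: exI[of _ 1])
 have 2: "~ ?g dvd gX" using prime_dvd_imp_dvd[OF p prime_X] 1 by blast
 show "prm f" using ef p by (auto simp del: swap_hom)
 show "\<exists>U V. gp f U V" using ef gp gp_swap[OF gp] by blast
 show "vord f = 1" using ef v by (auto simp del: swap_hom)
 show "~ f dvd e" using ef 2 swap_dvd_left[of ?g gY] by auto 
 show "~ e dvd f" using ef 1 swap_dvd_iff[of gX ?g] by auto
 have "Dy (swp ?g) = swp (Dx ?g)" "Dx (swp ?g) = swp (Dy ?g)"
  by (simp_all only: swap_dx swap_dy)
 thus "gc (Dx f * Dy e - Dy f * Dx e) 0 0 ~= 0"
  using ef ph by (auto simp: dy_xgerm simp del: swap_hom(3,4,5))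
qed

theorem simple_structure:
 assumes co: "coprime (fst om) (snd om)" and s: "smp om" "~ saddle_node om"
  and e: "e = gX \<or> e = gY" "e dvd wdg om e"
 shows "\<exists>f. graph e f & f dvd wdg om f & csi om (crv f) ~= 0 &
  ~ pos_rat (csi om (crv f)) & csi om (crv e) = 1 / csi om (crv f) &
  (\<forall>f'. ~ is_unit f' & f' dvd wdg om f' --> e dvd f' \<or> f dvd f')"
proof -
 have main: "\<exists>f. graph gX f & f dvd wdg om f & csi om (crv f) ~= 0 &
  ~ pos_rat (csi om (crv f)) & csi om (crv gX) = 1 / csi om (crv f) &
  (\<forall>f'. ~ is_unit f' & f' dvd wdg om f' --> gX dvd f' \<or> f dvd f')"
  if s: "smp om" "~ saddle_node om" and X: "gX dvd wdg om gX" for om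
 proof -
  have Q: "gX dvd snd om" using X by (simp add: wedge_d_def)
  note l = simple_linear[OF s Q]
  have "- gc (fst om) 0 1 ~= real n * gc (snd om) 1 0" if "1 \<le> n" for n
  proof
   assume "- gc (fst om) 0 1 = real n * gc (snd om) 1 0"
   hence "- gc (fst om) 0 1 / gc (snd om) 1 0 = real n" using l(2) by simp
   thus False using l(4) that by (simp add: pos_rat_def)
  qed
  then obtain ph where ph: "0 < rad ph" "cf ph 0 = 0" "gY - xgerm ph dvd wdg om (gY - xgerm ph)"
   using separatrix_exists[OF Q l(2,1)] by blast
  show ?thesis
   using ph cs_graph[OF Q l(2) ph] cs_X[OF Q l(3,1)] l simple_unique[OF Q l(2,1,4) ph]
   by (intro exI[of _ "gY - xgerm ph"]) (auto simp: graph_def)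
 qed
 show ?thesis
 proof (cases "e = gX")
  case True
  thus ?thesis using main[OF s] e by simp
 next
  case False
  hence eY: "e = gY" using e by simp
  have X: "gX dvd wdg (sform om) gX"
   using e(2) wedge_sform[of om gY] swap_dvd_left[of gY "swp (wdg om gY)"] eY by simp
  obtain f where f: "graph gX f" "f dvd wdg (sform om) f" "csi (sform om) (crv f) ~= 0"
   "~ pos_rat (csi (sform om) (crv f))" "csi (sform om) (crv gX) = 1 / csi (sform om) (crv f)"
   "!!f'. ~ is_unit f' ==> f' dvd wdg (sform om) f' ==> gX dvd f' \<or> f dvd f'"
   using main[of "sform om"] X s by (auto simp: sform_simple sform_saddle)
  have co': "coprime (fst (sform om)) (snd (sform om))" using co by (simp add: coprime_commute)
  obtain U V where UV: "gp f U V" using graph_props(2)[OF f(1)] by blast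
  have "csi (sform (sform om)) (crv (swp f)) = csi (sform om) (crv f)"
   by (rule cs_index_sform[OF graph_props(1)[OF f(1)] UV co' f(2)])
  moreover have "csi (sform (sform om)) (crv (swp gX)) = csi (sform om) (crv gX)"
   by (rule cs_index_sform[OF prime_X gp_X co' X])
  moreover have "swp f dvd wdg om (swp f)"
   using f(2) wedge_sform[of "sform om" f] by simp
  moreover have "gY dvd f' \<or> swp f dvd f'" if "~ is_unit f'" "f' dvd wdg om f'" for f'
  proof -
   have "swp f' dvd wdg (sform om) (swp f')" using that(2) by (simp add: wedge_sform)
   hence "gX dvd swp f' \<or> f dvd swp f'" using f(6) that(1) by simp
   thus ?thesis using swap_dvd_left[of f f'] swap_dvd_left[of gX f'] by simp
  qed
  ultimately show ?thesis using f graph_swap[OF f(1)] eY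
   by (intro exI[of _ "swp f"]) simp
 qed
qed

theorem leaf_structure:
 assumes co: "coprime (fst om) (snd om)" and e: "e = gX \<or> e = gY" "gc (wdg om e) 0 0 ~= 0"
 shows "\<exists>f. graph e f & f dvd wdg om f & csi om (crv f) = 0 &
  (\<forall>f'. ~ is_unit f' & f' dvd wdg om f' --> f dvd f')"
proof -
 have reg: "~ sng om" using e by (auto simp: singular_form_def wedge_d_def)
 have "\<exists>f. graph e f & f dvd wdg om f"
 proof (cases "e = gX")
  case True
  hence "gc (snd om) 0 0 ~= 0" using e(2) by (simp add: wedge_d_def)
  thus ?thesis using leaf_exists[of om] True unfolding graph_def by metis
 next
  case False
  hence eY: "e = gY" using e by simp
  hence "gc (snd (sform om)) 0 0 ~= 0" using e(2) by (simp add: wedge_d_def)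
  then obtain ph where ph: "0 < rad ph" "cf ph 0 = 0" "gY - xgerm ph dvd wdg (sform om) (gY - xgerm ph)"
   by (rule leaf_exists)
  have "swp (gY - xgerm ph) dvd wdg om (swp (gY - xgerm ph))"
   using ph(3) wedge_sform[of "sform om" "gY - xgerm ph"] swap_dvd_iff[of "gY - xgerm ph"]
   by simp
  thus ?thesis using ph(1,2) eY unfolding graph_def by blast
 qed
 then obtain f where f: "graph e f" "f dvd wdg om f" by blast
 obtain U V where UV: "gp f U V" using graph_props(2)[OF f(1)] by blast
 note p = graph_props(1)[OF f(1)]
 show ?thesis
  using f cs_regular[OF reg p UV f(2)] regular_unique[OF reg p UV f(2)] by blast
qed

subsection \<open>Blowing up the index\<close>

lemma pushes_nonexc:
 assumes "prm g" "pushes p g f" shows "nonexc p g"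
proof (cases p)
 case Nil
 show ?thesis
 proof (rule ccontr)
  assume "~ nonexc p g"
  hence "g dvd gX" "g dvd gY" by (auto simp: nonexc_def Nil)
  hence "gX dvd gY" using prime_dvd_imp_dvd[OF assms(1) prime_X] dvd_trans by blast
  thus False using gc_Y[of 0 1] by (simp add: X_dvd_iff)
 qed
next
 case (Cons d q)
 then obtain h k where h: "pushes q g h" "push1 d k h f" using assms(2) by auto
 have "f ~= 0" "st1 d f = h" using h(2) by (auto simp: push1_def simp del: st1.simps)
 hence "~ ex d dvd h" using pull1_factor(2)[of f d] by simp
 moreover have "prm h" by (rule pushes_prime[OF assms(1) h(1)])
 ultimately have "~ h dvd ex d" using prime_dvd_imp_dvd prime_ex by blast
 hence "~ g dvd pull q (ex d)" using pushes_dvd[OF h(1)] by simp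
 thus ?thesis by (cases d) (auto simp: nonexc_def Cons)
qed

lemma pull_form_factor_not_dvd:
 assumes g: "prm g" "pushes p g f"
  and h: "plf p om = scl h om'" and co: "coprime (fst om) (snd om)"
 shows "~ g dvd h"
proof
 assume "g dvd h"
 hence "g dvd pull p (fst om) * jac p" "g dvd pull p (snd om) * jac p"
  unfolding pull_form_jac h by auto
 hence "f dvd fst om" "f dvd snd om"
  using g(1) jac_not_dvd[OF g(1) pushes_nonexc[OF g]] pushes_dvd[OF g(2)] by (auto simp: prime_elem_dvd_mult_iff)
 thus False using co pushes_prime[OF g] by (auto simp: coprime_def)
qed

lemma push1_subdegree:
 assumes p: "push1 d k g f" and g: "gp g U V" "prm g"
 shows "al (ex d) U V ~= 0" "sdg (al (ex d) U V) = k"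
proof -
 have UV: "cf U 0 = 0" "cf V 0 = 0" and dv: "!!a. al a U V = 0 <-> g dvd a"
  and ord: "U ~= 0 ==> yreg (sdg U) g" "V ~= 0 ==> yreg (sdg V) (swp g)"
  using g(1) by (auto simp: gp_def)
 have f: "f ~= 0" "st1 d f = g" "exreg d k g" using p by (auto simp: push1_def simp del: st1.simps)
 show nd: "al (ex d) U V ~= 0"
 proof
  assume "al (ex d) U V = 0"
  hence "g dvd ex d" by (simp add: dv)
  hence "ex d dvd g" using prime_dvd_imp_dvd g(2) prime_ex by blast
  thus False using pull1_factor(2)[OF f(1), of d] f(2) by simp
 qed
 have yreg_unique: "m = n" if "yreg m h" "yreg n h" for m n h
  using that unfolding yreg_def by (metis linorder_neqE_nat)
 show "sdg (al (ex d) U V) = k"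
 proof (cases d)
  case (Slope c)
  hence "U ~= 0" using nd UV by simp
  thus ?thesis using yreg_unique[OF ord(1)] f(3) Slope UV by (simp add: exreg_def)
 next
  case Vertical
  hence "V ~= 0" using nd UV by simp
  thus ?thesis using yreg_unique[OF ord(2)] f(3) Vertical UV by (simp add: exreg_def)
 qed
qed

text \<open>The total transform of f is e^k g, so the decomposition of the pull-back acquires the
  logarithmic term k de/e. As e has order k along g, its residue is k^2.\<close>

lemma cs_blowup:
 assumes p: "push1 d k g f" and g: "prm g" "gp g U V"
  and co: "coprime (fst om) (snd om)" and inv: "f dvd wdg om f"
  and m: "plf [d] om = scl m om'"
 shows "csi om' (crv g) = csi om (crv f) - real k ^ 2"
proof -
 have ps: "pushes [d] g f" using p by auto
 have f: "prm f" by (rule pushes_prime[OF g(1) ps])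
 have f': "f ~= 0" "vord f = k" "st1 d f = g" using p by (auto simp: push1_def simp del: st1.simps)
 have UV: "cf U 0 = 0" "cf V 0 = 0" and z: "!!a. al a U V = 0 <-> g dvd a" using g(2) by (auto simp: gp_def)
 define X Y where "X = fst (pp d (U, V))" and "Y = snd (pp d (U, V))"
 have gf: "gp f X Y" unfolding X_def Y_def by (rule gp_push1[OF p g(2,1)])
 have XY: "cf X 0 = 0" "cf Y 0 = 0" using gf by (auto simp: gp_def)
 have alp: "al (pull1 d' a) U V = al a X Y" if "d' = d" for a d'
  using al_pull1[OF UV, of d a] that by (simp add: X_def Y_def)
 obtain G h A B where d: "dec om f G h A B" using dec_exists[OF f co inv] by blast
 define e where "e = ex d"
 define \<alpha> where "\<alpha> = plf [d] (A, B)"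
 have pf: "pull [d] f = e ^ k * g" using pull1_factor(1)[OF f'(1), of d] f'(2,3) by (simp add: e_def)
 have e0: "~ g dvd e ^ k"
 proof -
  have "~ g dvd e" using push1_subdegree(1)[OF p g(2,1)] z by (simp add: e_def)
  thus ?thesis using g(1) by (metis prime_elem_dvd_power)
 qed
 define ek where "ek = e ^ k"
 have gd: "dec om' g (pull [d] G * m) (pull [d] h * ek) (pull [d] h * Dx ek + ek * fst \<alpha>) (pull [d] h * Dy ek + ek * snd \<alpha>)"
  unfolding dec_def
 proof (intro conjI)
  have "~ g dvd m" by (rule pull_form_factor_not_dvd[OF g(1) ps m co])
  thus "~ g dvd pull [d] G * m"
   using d pushes_dvd[OF ps, of G] g(1) by (simp add: dec_def prime_elem_dvd_mult_iff)
  show "~ g dvd pull [d] h * ek"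
   using d pushes_dvd[OF ps, of h] g(1) e0 by (simp add: dec_def prime_elem_dvd_mult_iff ek_def)
  have GP: "pull [d] G * pull [d] (fst om) = pull [d] h * pull [d] (Dx f) + pull [d] f * pull [d] A"
   and GQ: "pull [d] G * pull [d] (snd om) = pull [d] h * pull [d] (Dy f) + pull [d] f * pull [d] B"
   using d unfolding dec_def by (metis pull_hom(3,4))+
  have m1: "m * fst om' = fst (plf [d] om)" "m * snd om' = snd (plf [d] om)" unfolding m by auto
  have dxf: "Dx (pull [d] f) = Dx ek * g + ek * Dx g" "Dy (pull [d] f) = Dy ek * g + ek * Dy g"
   unfolding pf ek_def by (simp_all add: dx_mult dy_mult)
  have key: "pull [d] G * fst (plf [d] om) = pull [d] h * Dx (pull [d] f) + pull [d] f * fst \<alpha>"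
   "pull [d] G * snd (plf [d] om) = pull [d] h * Dy (pull [d] f) + pull [d] f * snd \<alpha>"
  proof -
   define a b c e' where "a = Dx (pull [d] gX)" and "b = Dx (pull [d] gY)"
    and "c = Dy (pull [d] gX)" and "e' = Dy (pull [d] gY)"
   have "pull [d] G * fst (plf [d] om) = (pull [d] G * pull [d] (fst om)) * a + (pull [d] G * pull [d] (snd om)) * b"
    unfolding pull_form_def a_def b_def by (simp add: alg)
   also have "\<dots> = pull [d] h * Dx (pull [d] f) + pull [d] f * fst \<alpha>"
    unfolding GP GQ chain_rule(1)[of "[d]" f] \<alpha>_def pull_form_def a_def b_def by (simp add: alg)
   finally show "pull [d] G * fst (plf [d] om) = pull [d] h * Dx (pull [d] f) + pull [d] f * fst \<alpha>" .
   have "pull [d] G * snd (plf [d] om) = (pull [d] G * pull [d] (fst om)) * c + (pull [d] G * pull [d] (snd om)) * e'"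
    unfolding pull_form_def c_def e'_def by (simp add: alg)
   also have "\<dots> = pull [d] h * Dy (pull [d] f) + pull [d] f * snd \<alpha>"
    unfolding GP GQ chain_rule(2)[of "[d]" f] \<alpha>_def pull_form_def c_def e'_def by (simp add: alg)
   finally show "pull [d] G * snd (plf [d] om) = pull [d] h * Dy (pull [d] f) + pull [d] f * snd \<alpha>" .
  qed
  show "pull [d] G * m * fst om' = pull [d] h * ek * Dx g + g * (pull [d] h * Dx ek + ek * fst \<alpha>)"
   unfolding mult.assoc[of _ m] m1 key dxf unfolding pf ek_def[symmetric] by (simp add: alg)
  show "pull [d] G * m * snd om' = pull [d] h * ek * Dy g + g * (pull [d] h * Dy ek + ek * snd \<alpha>)"
   unfolding mult.assoc[of _ m] m1 key dxf unfolding pf ek_def[symmetric] by (simp add: alg)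
 qed
 have "~ f dvd h" using d by (simp add: dec_def)
 hence h0: "al h X Y ~= 0" using gf by (simp add: gp_def)
 define E where "E = al e U V"
 have E: "E ~= 0" "sdg E = k" using push1_subdegree[OF p g(2,1)] by (simp_all add: E_def e_def)
 define N where "N = al A X Y * fD X + al B X Y * fD Y"
 have alpull: "al (pull [d] a) U V = al a X Y" for a using alp[of d a] by simp
 have N: "al (fst \<alpha>) U V * fD U + al (snd \<alpha>) U V * fD V = N"
 proof -
  have dX: "fD X = al (Dx (pull [d] gX)) U V * fD U + al (Dy (pull [d] gX)) U V * fD V"
   and dY: "fD Y = al (Dx (pull [d] gY)) U V * fD U + al (Dy (pull [d] gY)) U V * fD V"
   using al_chain[OF UV, of "pull [d] gX"] al_chain[OF UV, of "pull [d] gY"] XY by (simp_all add: alpull del: pull.simps)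
  show ?thesis unfolding N_def dX dY \<alpha>_def pull_form_def fst_conv snd_conv al_add[OF UV] al_mult[OF UV] alpull
   by (simp add: alg)
 qed
 define EK where "EK = al ek U V"
 have EK: "EK = E ^ k" "EK ~= 0" using E UV by (simp_all add: EK_def ek_def E_def)
 have dEK: "fD EK * E = of_nat k * EK * fD E"
  unfolding EK(1) by (induction k) (auto simp: alg)
 have dEK2: "al (Dx ek) U V * fD U + al (Dy ek) U V * fD V = fD EK"
  unfolding EK_def al_chain[OF UV] ..
 define H where "H = al h X Y"
 have num: "al (pull [d] h * Dx ek + ek * fst \<alpha>) U V * fD U + al (pull [d] h * Dy ek + ek * snd \<alpha>) U V * fD V
   = H * fD EK + EK * N"
  unfolding al_add[OF UV] al_mult[OF UV] alpull N[symmetric] dEK2[symmetric] EK_def[symmetric] H_def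
  by (simp add: alg)
 have den: "al (pull [d] h * ek) U V = H * EK" unfolding al_mult[OF UV] alpull EK_def H_def ..
 have fne: "fl H ~= 0" "fl EK ~= 0" "fl E ~= 0" using h0 EK E by (auto simp: H_def)
 have fd: "fl (fD EK) * fl E = of_nat k * fl EK * fl (fD E)"
  using arg_cong[OF dEK, of fl] by (simp add: fls_times_fps_to_fls)
 have "fl (H * fD EK + EK * N) / fl (H * EK) = fl (fD EK) / fl EK + fl N / fl H"
  using fne by (simp add: fls_times_fps_to_fls field_simps)
 also have "fl (fD EK) / fl EK = of_nat k * (fl (fD E) / fl E)"
  using fd fne by (simp add: field_simps)
 finally have "fls_residue (fl (H * fD EK + EK * N) / fl (H * EK)) = real k * real k + fls_residue (fl N / fl H)"
  using residue_dlog[OF E(1)] E(2) fls_residue_fls_const_times(1)[of "real k" "fl (fD E) / fl E"]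
  by (simp add: fls_of_nat)
 thus ?thesis
  unfolding cs_index_eq[OF g gd] cs_index_eq[OF f gf d] csv_def num den N_def[symmetric] H_def[symmetric]
  by (simp add: power2_eq_square)
qed

text \<open>Both indices drop by the same square at every blow-up. Hence equality of indices at the
  origin can be checked at the final points.\<close>

lemma cs_difference:
 assumes g: "prm g" "gp g U V"
 shows "pushes p g f ==> coprime (fst om) (snd om) ==> coprime (fst om') (snd om') ==>
  f dvd wdg om f ==> f dvd wdg om' f ==>
  csi (stf om p) (crv g) - csi (stf om' p) (crv g)
   = csi om (crv f) - csi om' (crv f)"
proof (induction p arbitrary: f om om')
 case Nil
 have *: "csi (stf om []) (crv g) = csi om (crv g)"
  if co: "coprime (fst om) (snd om)" "g dvd wdg om g" for om
 proof -
  obtain u where "is_unit u" "stf om [] = scl u om"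
   by (rule strict_form_unique[of om om 1 1 "[]"]) (use co in \<open>auto\<close>)
  thus ?thesis using cs_index_scale[OF g co] by simp
 qed
 thus ?case using Nil by auto
next
 case (Cons d p)
 obtain h k where h: "pushes p g h" "push1 d k h f" using Cons.prems by auto
 have ph: "prm h" by (rule pushes_prime[OF g(1) h(1)])
 have gh: "gp h (fst (ppp p (U, V))) (snd (ppp p (U, V)))" by (rule gp_pushes[OF g h(1)])
 have pf: "pushes [d] h f" using h by auto
 have *: "coprime (fst (stf om [d])) (snd (stf om [d])) & h dvd wdg (stf om [d]) h &
  csi (stf om [d]) (crv h) = csi om (crv f) - real k ^ 2 &
  csi (stf om (d # p)) (crv g) = csi (stf (stf om [d]) p) (crv g)"
  if co: "coprime (fst om) (snd om)" and inv: "f dvd wdg om f" for om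
 proof -
  define om1 where "om1 = stf om [d]"
  obtain m where m: "m ~= 0" "plf [d] om = scl m om1" and c1: "coprime (fst om1) (snd om1)"
   using strict_form_props[OF co, of "[d]"] by (auto simp: om1_def)
  have i1: "h dvd wdg om1 h"
   using invariant_pushes[OF ph pushes_nonexc[OF ph pf] pf m(2) co] inv by simp
  have c2: "csi om1 (crv h) = csi om (crv f) - real k ^ 2"
   by (rule cs_blowup[OF h(2) ph gh co inv m(2)])
  define om2 where "om2 = stf om1 p"
  obtain n where n: "n ~= 0" "plf p om1 = scl n om2" and co2: "coprime (fst om2) (snd om2)"
   using strict_form_props[OF c1, of p] by (auto simp: om2_def)
  have e: "scl 1 (plf (d # p) om) = scl (pull p m * n) om2"
   using pull_form_append[of "[d]" p om] unfolding m(2) pull_form_scale n(2) by (simp add: scale_form_def)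
  have n0: "pull p m * n ~= 0" using m n by simp
  obtain u where u: "is_unit u" "stf om (d # p) = scl u om2"
   by (rule strict_form_unique[OF co co2 one_neq_zero n0 e])
  have i2: "g dvd wdg om2 g"
   using invariant_pushes[OF g(1) pushes_nonexc[OF g(1) h(1)] h(1) n(2) c1] i1 by simp
  show ?thesis using c1 i1 c2 u cs_index_scale[OF g co2 i2 u(1)] by (simp add: om1_def om2_def)
 qed
 note a = *[OF Cons.prems(2,4)] and b = *[OF Cons.prems(3,5)]
 show ?case using Cons.IH[OF h(1), of "stf om [d]" "stf om' [d]"] a b by simp
qed

lemma curve_mult_eq: "f ~= 0 ==> curve_mult (crv f) = vord f"
proof -
 assume f: "f ~= 0"
 have "(INF g\<in>crv f. germ_ord g) = enat (vord f)"
 proof (rule antisym)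
  show "(INF g\<in>crv f. germ_ord g) \<le> enat (vord f)"
   using f by (intro INF_lower2[of f]) (auto simp: germ_ord_eq)
  show "enat (vord f) \<le> (INF g\<in>crv f. germ_ord g)"
  proof (rule INF_greatest)
   fix g assume "g : crv f"
   then obtain a where "g = f * a" by auto
   thus "enat (vord f) \<le> germ_ord g" by (auto simp: germ_ord_eq vord_mult)
  qed
 qed
 thus ?thesis by (simp add: curve_mult_def)
qed

section \<open>Evaluation of germs\<close>

definition gbd :: "real => real => germ => bool" where
 "gbd R C f <-> (\<forall>i j. \<bar>gc f i j\<bar> \<le> C * R ^ (i + j))"

lemma geometric_pair:
 fixes a b C :: real
 assumes "0 \<le> a" "a \<le> 1 / 2" "0 \<le> b" "b \<le> 1 / 2" "0 \<le> C"
 shows "(%(i, j). C * (a ^ i * b ^ j)) summable_on UNIV" "infsum (%(i, j). C * (a ^ i * b ^ j)) UNIV \<le> 4 * C"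
proof -
 have fin: "sum (%(i, j). C * (a ^ i * b ^ j)) F \<le> 4 * C" if "finite F" for F
 proof -
  obtain n where n: "!!i j. (i, j) : F ==> i < n & j < n"
  proof -
   have "finite (fst ` F Un snd ` F)" using \<open>finite F\<close> by auto
   then obtain n where "\<forall>k \<in> fst ` F Un snd ` F. k < n" using finite_nat_set_iff_bounded by blast
   thus ?thesis using that[of n] by force
  qed
  have "sum (%(i, j). C * (a ^ i * b ^ j)) F \<le> sum (%(i, j). C * (a ^ i * b ^ j)) ({..<n} \<times> {..<n})"
   using n assms by (intro sum_mono2) auto
  also have "\<dots> = C * ((\<Sum>i<n. a ^ i) * (\<Sum>j<n. b ^ j))"
   unfolding sum.cartesian_product[symmetric] sum_product by (simp only: sum_distrib_left)
  also have "\<dots> \<le> C * (2 * 2)"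
   using assms by (intro mult_left_mono mult_mono geometric_psum sum_nonneg) auto
  finally show ?thesis by simp
 qed
 show s: "(%(i, j). C * (a ^ i * b ^ j)) summable_on UNIV"
  by (rule nonneg_bdd_above_summable_on) (use assms fin in \<open>auto intro!: bdd_aboveI2[of _ _ "4 * C"]\<close>)
 show "infsum (%(i, j). C * (a ^ i * b ^ j)) UNIV \<le> 4 * C"
  by (rule infsum_le_finite_sums[OF s]) (use fin in auto)
qed

definition small :: "real => real \<times> real => bool" where
 "small R z <-> \<bar>fst z\<bar> * R \<le> 1 / 2 & \<bar>snd z\<bar> * R \<le> 1 / 2"

lemma eval_summable:
 assumes "gbd R C f" "0 < R" "small R (x, y)"
 shows "(%(i, j). gc f i j * x ^ i * y ^ j) summable_on UNIV" "\<bar>evl f (x, y)\<bar> \<le> 4 * C"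
proof -
 have "\<bar>gc f 0 0\<bar> \<le> C" using assms(1)[unfolded gbd_def, rule_format, of 0 0] by simp
 hence C: "0 \<le> C" by simp
 let ?g = "%(i, j). C * ((\<bar>x\<bar> * R) ^ i * (\<bar>y\<bar> * R) ^ j)"
 let ?f = "%(i, j). gc f i j * x ^ i * y ^ j"
 note G = geometric_pair[of "\<bar>x\<bar> * R" "\<bar>y\<bar> * R" C]
 have s: "\<bar>x\<bar> * R \<le> 1 / 2" "\<bar>y\<bar> * R \<le> 1 / 2" "0 \<le> \<bar>x\<bar> * R" "0 \<le> \<bar>y\<bar> * R"
  using assms by (auto simp: small_def)
 have le: "norm (?f z) \<le> ?g z" for z
 proof -
  obtain i j where z: "z = (i, j)" by (cases z)
  have "\<bar>gc f i j\<bar> * (\<bar>x\<bar> ^ i * \<bar>y\<bar> ^ j) \<le> (C * R ^ (i + j)) * (\<bar>x\<bar> ^ i * \<bar>y\<bar> ^ j)"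
   using assms(1) by (intro mult_right_mono) (auto simp: gbd_def)
  thus ?thesis by (simp add: z abs_mult power_abs power_add power_mult_distrib mult_ac)
 qed
 have gabs: "(%z. norm (?g z)) summable_on UNIV"
 proof -
  have "(%z. norm (?g z)) = ?g" using C assms(2) by auto
  thus ?thesis using G(1)[OF s(3,1,4,2) C] by simp
 qed
 have ab: "(%z. norm (?f z)) summable_on UNIV"
 proof (rule Infinite_Sum.abs_summable_on_comparison_test[OF gabs])
  fix z show "norm (?f z) \<le> norm (?g z)" using le[of z] by simp
 qed
 show "?f summable_on UNIV" by (rule abs_summable_summable[OF ab])
 have "norm (infsum ?f UNIV) \<le> infsum (%z. norm (?f z)) UNIV" by (rule norm_infsum_bound[OF ab])
 also have "\<dots> \<le> infsum ?g UNIV" by (rule infsum_mono[OF ab G(1)[OF s(3,1,4,2) C]]) (rule le)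
 also have "\<dots> \<le> 4 * C" by (rule G(2)[OF s(3,1,4,2) C])
 finally show "\<bar>evl f (x, y)\<bar> \<le> 4 * C" by (simp add: germ_eval_def)
qed

lemma eval_add:
 assumes "gbd R C f" "gbd R C' g" "0 < R" "small R (x, y)"
 shows "evl (f + g) (x, y) = evl f (x, y) + evl g (x, y)"
proof -
 have "(%(i, j). gc (f + g) i j * x ^ i * y ^ j) =
  (%z. (case z of (i, j) => gc f i j * x ^ i * y ^ j) + (case z of (i, j) => gc g i j * x ^ i * y ^ j))"
  by (auto simp: alg)
 thus ?thesis
  unfolding germ_eval_def
  using infsum_add[OF eval_summable(1)[OF assms(1,3,4)] eval_summable(1)[OF assms(2,3,4)]] by simp
qed

lemma eval_const_mult: "evl (cst c * f) (x, y) = c * evl f (x, y)"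
proof -
 have "(%(i, j). gc (cst c * f) i j * x ^ i * y ^ j) = (%z. c * (case z of (i, j) => gc f i j * x ^ i * y ^ j))"
  by auto
 moreover have "infsum \<dots> UNIV = c * infsum (%(i, j). gc f i j * x ^ i * y ^ j) UNIV" by (rule infsum_cmult_right')
 ultimately show ?thesis by (simp add: germ_eval_def)
qed

lemma eval_X_mult: "evl (gX * f) (x, y) = x * evl f (x, y)"
proof -
 let ?h = "%z :: nat \<times> nat. (Suc (fst z), snd z)"
 let ?g = "%(i, j). gc (gX * f) i j * x ^ i * y ^ j"
 have "infsum ?g UNIV = infsum ?g (range ?h)"
 proof (rule infsum_cong_neutral)
  fix z :: "nat \<times> nat" assume "z : UNIV - range ?h"
  hence "fst z = 0" by (cases z, cases "fst z") (auto simp: image_def)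
  thus "?g z = 0" by (cases z) (simp add: gc_X_mult)
 qed auto
 also have "\<dots> = infsum (?g \<circ> ?h) UNIV" by (rule infsum_reindex) (auto simp: inj_on_def)
 also have "?g \<circ> ?h = (%z. x * (case z of (i, j) => gc f i j * x ^ i * y ^ j))"
  by (auto simp: gc_X_mult)
 also have "infsum \<dots> UNIV = x * infsum (%(i, j). gc f i j * x ^ i * y ^ j) UNIV" by (rule infsum_cmult_right')
 finally show ?thesis by (simp add: germ_eval_def)
qed

lemma eval_swap: "evl (swp f) (x, y) = evl f (y, x)"
proof -
 have "infsum (%z. (%(i, j). gc f i j * y ^ i * x ^ j) (prod.swap z)) UNIV = infsum (%(i, j). gc f i j * y ^ i * x ^ j) UNIV"
  by (rule infsum_reindex_bij_betw[of prod.swap]) simp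
 moreover have "(%z. (%(i, j). gc f i j * y ^ i * x ^ j) (prod.swap z)) = (%(i, j). gc (swp f) i j * x ^ i * y ^ j)"
  by auto
 ultimately show ?thesis by (simp add: germ_eval_def)
qed

lemma eval_Y_mult: "evl (gY * f) (x, y) = y * evl f (x, y)"
proof -
 have "evl (swp (gX * swp f)) (x, y) = y * evl f (x, y)"
  unfolding eval_swap eval_X_mult by simp
 thus ?thesis by simp
qed

lemma eval_1: "evl 1 (x, y) = 1"
proof -
 have "infsum (%(i, j). gc 1 i j * x ^ i * y ^ j) UNIV = infsum (%(i, j). gc 1 i j * x ^ i * y ^ j) {(0, 0)}"
  by (rule infsum_cong_neutral) (auto simp: gc_1 split: if_splits)
 thus ?thesis by (simp add: germ_eval_def)
qed

lemma eval_const: "evl (cst c) (x, y) = c"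
 using eval_const_mult[of c 1 x y] by (simp add: eval_1)

lemma gbd_add:
 assumes "gbd R C f" "gbd R C' g" shows "gbd R (C + C') (f + g)"
 unfolding gbd_def
proof (intro allI)
 fix i j
 have "\<bar>gc f i j\<bar> \<le> C * R ^ (i + j)" "\<bar>gc g i j\<bar> \<le> C' * R ^ (i + j)" using assms by (auto simp: gbd_def)
 thus "\<bar>gc (f + g) i j\<bar> \<le> (C + C') * R ^ (i + j)" by (simp add: distrib_right)
qed

lemma gbd_mono: "gbd R C f ==> 0 \<le> R ==> R \<le> S ==> gbd S C f"
proof -
 assume a: "gbd R C f" "0 \<le> R" "R \<le> S"
 have "\<bar>gc f 0 0\<bar> \<le> C" using a(1)[unfolded gbd_def, rule_format, of 0 0] by simp
 hence "C * R ^ n \<le> C * S ^ n" for n using a by (intro mult_left_mono power_mono) auto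
 thus ?thesis using a(1) unfolding gbd_def by (meson order_trans)
qed

text \<open>The analytic counterpart of \<open>germ_zeroI\<close>. Each use of
  \<open>germ_decomp\<close> multiplies the bound of the coefficients by R and the value by u or v,
  so iteration gains the factor q = (|u| + |v|) R < 1.\<close>

lemma eval_zero:
 assumes R: "0 < R" and uv: "(\<bar>u\<bar> + \<bar>v\<bar>) * R < 1"
  and add: "!!f g C C'. gbd R C f ==> gbd R C' g ==> D (f + g) = D f + (D g :: real)"
  and const: "!!c. D (cst c) = 0"
  and X: "!!f C. gbd R C f ==> D (gX * f) = u * D f" and Y: "!!f C. gbd R C f ==> D (gY * f) = v * D f"
  and bound: "!!f C. gbd R C f ==> \<bar>D f\<bar> \<le> K * C"
  and f: "gbd R C f"
 shows "D f = 0"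
proof -
 define q where "q = (\<bar>u\<bar> + \<bar>v\<bar>) * R"
 have q: "0 \<le> q" "q < 1" using uv R by (auto simp: q_def)
 have step: "\<bar>D f\<bar> \<le> K * C * q ^ n" if "gbd R C f" for f C n
  using that
 proof (induction n arbitrary: f C)
  case 0
  thus ?case using bound by simp
 next
  case (Suc n)
  define a b where "a = shx 1 f" and "b = shy 1 (row0 f)"
  have C: "\<bar>gc f i j\<bar> \<le> C * R ^ (i + j)" for i j using Suc.prems by (simp add: gbd_def)
  hence C0: "0 \<le> C" using C[of 0 0] by simp
  have a: "gbd R (C * R) a" using C[of "Suc _"] by (auto simp: gbd_def a_def mult.assoc)
  have b: "gbd R (C * R) b" using C[of 0 "Suc _"] C0 R by (auto simp: gbd_def b_def gc_row0 mult.assoc)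
  have c: "gbd R \<bar>gc f 0 0\<bar> (cst (gc f 0 0))" using R by (auto simp: gbd_def gc_const)
  have Xa: "gbd R C (gX * a)"
   using C C0 R by (auto simp: gbd_def gc_X_mult a_def)
  have Yb: "gbd R C (gY * b)"
   using C[of 0 "_ :: nat", simplified] C0 R by (auto simp: gbd_def gc_Y_mult b_def gc_row0)

  have "f = cst (gc f 0 0) + gX * a + gY * b"
   unfolding a_def b_def by (rule germ_decomp)
  hence "D f = D (cst (gc f 0 0) + gX * a + gY * b)" by simp
  also have "\<dots> = u * D a + v * D b"
   using add[OF gbd_add[OF c Xa] Yb] add[OF c Xa] const X[OF a] Y[OF b] by simp
  finally have "\<bar>D f\<bar> \<le> \<bar>u\<bar> * \<bar>D a\<bar> + \<bar>v\<bar> * \<bar>D b\<bar>"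
   by (metis abs_mult abs_triangle_ineq)
  also have "\<dots> \<le> \<bar>u\<bar> * (K * (C * R) * q ^ n) + \<bar>v\<bar> * (K * (C * R) * q ^ n)"
   by (intro add_mono mult_left_mono Suc.IH[OF a] Suc.IH[OF b]) auto
  also have "\<dots> = K * C * q ^ Suc n" by (simp add: q_def alg)
  finally show ?case .
 qed
 have "(%n. K * C * q ^ n) \<longlonglongrightarrow> K * C * 0"
  using q by (intro tendsto_intros LIMSEQ_realpow_zero) auto
 hence "\<bar>D f\<bar> \<le> K * C * 0" by (rule LIMSEQ_le_const) (use step[OF f] in auto)
 thus ?thesis by simp
qed

lemma gbd_exists: obtains R C where "1 \<le> R" "1 \<le> C" "gbd R C f"
 by (rule germ_bound[of f]) (auto simp: gbd_def)

lemma gbd_mult: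
 assumes f: "gbd R C f" and g: "gbd R C' g" and R: "0 < R"
 shows "gbd (2 * R) (C * C') (f * g)"
 unfolding gbd_def
proof (intro allI)
 fix i j
 have C: "0 \<le> C" "0 \<le> C'" using f[unfolded gbd_def, rule_format, of 0 0] g[unfolded gbd_def, rule_format, of 0 0] by auto
 have "\<bar>gc (f * g) i j\<bar> \<le> (\<Sum>k=0..i. \<Sum>l=0..j. C * C' * R ^ (i + j))"
  unfolding gc_mult
 proof (rule order.trans[OF sum_abs], rule sum_mono, rule order.trans[OF sum_abs], rule sum_mono)
  fix k l assume kl: "k : {0..i}" "l : {0..j}"
  have "\<bar>gc f k l * gc g (i - k) (j - l)\<bar> \<le> (C * R ^ (k + l)) * (C' * R ^ (i - k + (j - l)))"
   unfolding abs_mult using f g C R by (intro mult_mono) (auto simp: gbd_def)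
  also have "\<dots> = C * C' * R ^ ((k + l) + (i - k + (j - l)))" by (simp add: power_add)
  also have "(k + l) + (i - k + (j - l)) = i + j" using kl by simp
  finally show "\<bar>gc f k l * gc g (i - k) (j - l)\<bar> \<le> C * C' * R ^ (i + j)" .
 qed
 also have "\<dots> = C * C' * R ^ (i + j) * (real (Suc i) * real (Suc j))" by simp
 also have "\<dots> \<le> C * C' * R ^ (i + j) * (2 ^ i * 2 ^ j)"
  using C R by (intro mult_left_mono mult_mono Suc_le_two_power) auto
 also have "\<dots> = C * C' * (2 * R) ^ (i + j)" by (simp add: power_add)
 finally show "\<bar>gc (f * g) i j\<bar> \<le> C * C' * (2 * R) ^ (i + j)" .
qed

lemma small_mono: "small S z ==> 0 \<le> R ==> R \<le> S ==> small R z"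
 unfolding small_def by (meson abs_ge_zero mult_left_mono order_trans)

lemma eval_mult:
 assumes f: "gbd R C f" and g: "gbd R C' g" and R: "0 < R" and s: "small (4 * R) (x, y)"
 shows "evl (f * g) (x, y) = evl f (x, y) * evl g (x, y)"
proof -
 define D where "D f = evl (f * g) (x, y) - evl f (x, y) * evl g (x, y)" for f
 have s1: "small R (x, y)" and s2: "small (2 * R) (x, y)" using s R by (auto intro: small_mono)
 have C': "0 \<le> C'" using g[unfolded gbd_def, rule_format, of 0 0] by auto
 \<comment> \<open>The constant 20 is 4 + 16, from the value of the product and the product of the
   values.\<close>
 have "D f = 0"
 proof (rule eval_zero[OF R, of x y D "20 * C'", OF _ _ _ _ _ _ f])
  show "(\<bar>x\<bar> + \<bar>y\<bar>) * R < 1" using s by (simp add: small_def alg)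
  show "D (f + h) = D f + D h" if "gbd R A f" "gbd R B h" for f h A B
   unfolding D_def distrib_right eval_add[OF that R s1]
    eval_add[OF gbd_mult[OF that(1) g R] gbd_mult[OF that(2) g R] _ s2, OF mult_pos_pos[OF zero_less_numeral R]]
   by simp
  show "D (cst c) = 0" for c by (simp add: D_def eval_const_mult eval_const)
  show "D (gX * f) = x * D f" for f by (simp add: D_def mult.assoc eval_X_mult right_diff_distrib)
  show "D (gY * f) = y * D f" for f by (simp add: D_def mult.assoc eval_Y_mult right_diff_distrib)
  show "\<bar>D h\<bar> \<le> 20 * C' * B" if "gbd R B h" for h B
  proof -
   have B: "0 \<le> B" using that[unfolded gbd_def, rule_format, of 0 0] by auto
   have "\<bar>evl (h * g) (x, y)\<bar> \<le> 4 * (B * C')" using eval_summable(2)[OF gbd_mult[OF that g R] _ s2] R by simp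
   moreover have "\<bar>evl h (x, y) * evl g (x, y)\<bar> \<le> (4 * B) * (4 * C')"
    unfolding abs_mult using B by (intro mult_mono eval_summable(2)[OF that R s1] eval_summable(2)[OF g R s1]) auto
   ultimately show ?thesis unfolding D_def by (simp add: alg)
  qed
 qed
 thus ?thesis by (simp add: D_def)
qed

lemma gbd_pull_slope:
 assumes f: "gbd R C f" and R: "1 \<le> R"
 shows "gbd (2 * (R * (1 + \<bar>c\<bar>))) C (psl c f)"
 unfolding gbd_def
proof (intro allI)
 fix n k
 define K where "K = 1 + \<bar>c\<bar>"
 have K: "1 \<le> K" by (simp add: K_def)
 have C: "0 \<le> C" using f[unfolded gbd_def, rule_format, of 0 0] by auto
 have RK: "1 \<le> R * K" using mult_mono[OF R K] R by simp
 have "\<bar>gc (psl c f) n k\<bar> \<le> (\<Sum>j\<le>n. C * R ^ n * K ^ n)"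
  unfolding gc_pull_slope
 proof (rule order.trans[OF sum_abs], rule sum_mono)
  fix j assume "j : {..n}"
  hence j: "j \<le> n" by simp
  have "\<bar>gc f (n - j) j\<bar> \<le> C * R ^ n" using f[unfolded gbd_def, rule_format, of "n - j" j] j by simp
  moreover have "\<bar>cf ((fps_X + fps_const c) ^ j) k\<bar> \<le> K ^ n"
   using abs_nth_linear_power[of c j k] power_increasing[OF j K] unfolding K_def by simp
  ultimately show "\<bar>gc f (n - j) j * cf ((fps_X + fps_const c) ^ j) k\<bar> \<le> C * R ^ n * K ^ n"
   unfolding abs_mult by (intro mult_mono) auto
 qed
 also have "\<dots> = real (Suc n) * (C * (R * K) ^ n)" by (simp add: power_mult_distrib)
 also have "\<dots> \<le> 2 ^ n * (C * (R * K) ^ n)" using C R K by (intro mult_right_mono Suc_le_two_power) auto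
 also have "\<dots> = C * (2 * (R * K)) ^ n" by simp
 also have "\<dots> \<le> C * (2 * (R * K)) ^ (n + k)" using C RK by (intro mult_left_mono power_increasing) auto
 finally show "\<bar>gc (psl c f) n k\<bar> \<le> C * (2 * (R * (1 + \<bar>c\<bar>))) ^ (n + k)" by (simp add: K_def)
qed

lemma eval_pull_slope:
 assumes f: "gbd R C f" and R: "1 \<le> R" and s: "small (8 * R * (1 + \<bar>c\<bar>)) (x, y)" and y: "\<bar>y\<bar> \<le> 1"
 shows "evl (psl c f) (x, y) = evl f (x, x * (y + c))"
proof -
 define K where "K = 1 + \<bar>c\<bar>"
 define S where "S = 2 * (R * K)"
 have K: "1 \<le> K" by (simp add: K_def)
 have RK: "R \<le> R * K" using K R by simp
 have S: "0 < S" "R \<le> S" using RK R by (auto simp: S_def)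
 define D where "D f = evl (psl c f) (x, y) - evl f (x, x * (y + c))" for f
 have s1: "small S (x, y)" using s K R by (auto intro: small_mono simp: S_def K_def[symmetric])
 have xS: "\<bar>x\<bar> * (8 * R * K) \<le> 1 / 2" using s by (simp add: small_def K_def)
 have xR: "\<bar>x\<bar> * R \<le> \<bar>x\<bar> * (R * K)" using RK by (intro mult_left_mono) auto
 have yc: "\<bar>y + c\<bar> \<le> K" using y by (simp add: K_def)
 have v: "\<bar>x * (y + c)\<bar> * R \<le> \<bar>x\<bar> * (R * K)"
 proof -
  have "\<bar>x * (y + c)\<bar> * R \<le> (\<bar>x\<bar> * K) * R" unfolding abs_mult using yc R by (intro mult_right_mono mult_left_mono) auto
  thus ?thesis by (simp add: mult_ac)
 qed
 have s2: "small R (x, x * (y + c))" unfolding small_def using v xR xS by simp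
 have D: "gbd S B (psl c h)" if "gbd R B h" for h B
  using gbd_pull_slope[OF that R, of c] by (simp add: S_def K_def)
 have R0: "0 < R" using R by simp
 have "D f = 0"
 proof (rule eval_zero[OF R0, of x "x * (y + c)" D 8, OF _ _ _ _ _ _ f])
  show "(\<bar>x\<bar> + \<bar>x * (y + c)\<bar>) * R < 1" unfolding distrib_right using v xR xS by simp
  show "D (f + h) = D f + D h" if "gbd R A f" "gbd R B h" for f h A B
   unfolding D_def pull_slope_hom eval_add[OF that R0 s2] eval_add[OF D[OF that(1)] D[OF that(2)] S(1) s1] by simp
  show "D (cst c) = 0" for c by (simp add: D_def eval_const)
  show "D (gX * f) = x * D f" for f by (simp add: D_def pull_slope_mult eval_X_mult right_diff_distrib)
  show "D (gY * h) = x * (y + c) * D h" if "gbd R B h" for h B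
  proof -
   have Yb: "gbd S (B * 1) (gY * psl c h)"
   proof -
    have "\<bar>gc (psl c h) i j\<bar> \<le> B * S ^ (i + j)" for i j using D[OF that] by (simp add: gbd_def)
    moreover have "B * S ^ n \<le> B * S ^ Suc n" for n
    proof -
     have "0 \<le> B" using that[unfolded gbd_def, rule_format, of 0 0] by auto
     moreover have "1 \<le> S" using S R by simp
     ultimately show ?thesis by (intro mult_left_mono power_increasing) auto
    qed
    ultimately have "\<bar>gc (psl c h) i (j - 1)\<bar> \<le> B * S ^ (i + j)" if "j ~= 0" for i j
     using that by (cases j) (auto, meson order_trans)
    moreover have "0 \<le> B" using that[unfolded gbd_def, rule_format, of 0 0] by auto
    ultimately show ?thesis using S by (auto simp: gbd_def gc_Y_mult)
   qed
   have cb: "gbd S (\<bar>c\<bar> * B) (cst c * psl c h)"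
    using D[OF that] by (auto simp: gbd_def abs_mult mult.assoc intro!: mult_left_mono)
   have "psl c (gY * h) = gX * (gY * psl c h + cst c * psl c h)"
    by (simp add: pull_slope_mult alg)
   hence "evl (psl c (gY * h)) (x, y) = x * (y * evl (psl c h) (x, y) + c * evl (psl c h) (x, y))"
    by (simp only: eval_X_mult eval_add[OF Yb cb S(1) s1] eval_Y_mult eval_const_mult)
   thus ?thesis by (simp add: D_def eval_Y_mult alg)
  qed
  show "\<bar>D h\<bar> \<le> 8 * B" if "gbd R B h" for h B
   using eval_summable(2)[OF D[OF that] S(1) s1] eval_summable(2)[OF that R0 s2] by (simp add: D_def)
 qed
 thus ?thesis by (simp add: D_def)
qed

lemma eventually_small: "eventually (%z. small R z & \<bar>fst z\<bar> \<le> 1 & \<bar>snd z\<bar> \<le> 1) (nhds (0, 0))"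
proof -
 have "((%z :: real \<times> real. \<bar>fst z\<bar> * R) \<longlongrightarrow> \<bar>fst (0 :: real, 0 :: real)\<bar> * R) (nhds (0, 0))"
  "((%z :: real \<times> real. \<bar>snd z\<bar> * R) \<longlongrightarrow> \<bar>snd (0 :: real, 0 :: real)\<bar> * R) (nhds (0, 0))"
  "((%z :: real \<times> real. \<bar>fst z\<bar>) \<longlongrightarrow> \<bar>fst (0 :: real, 0 :: real)\<bar>) (nhds (0, 0))"
  "((%z :: real \<times> real. \<bar>snd z\<bar>) \<longlongrightarrow> \<bar>snd (0 :: real, 0 :: real)\<bar>) (nhds (0, 0))"
  by (intro tendsto_intros filterlim_ident)+
 from this[THEN order_tendstoD(2), of "1 / 2"] this[THEN order_tendstoD(2), of 1]
 have "eventually (%z :: real \<times> real. \<bar>fst z\<bar> * R < 1 / 2) (nhds (0, 0))" "eventually (%z :: real \<times> real. \<bar>snd z\<bar> * R < 1 / 2) (nhds (0, 0))"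
  "eventually (%z :: real \<times> real. \<bar>fst z\<bar> < 1) (nhds (0, 0))" "eventually (%z :: real \<times> real. \<bar>snd z\<bar> < 1) (nhds (0, 0))"
  by auto
 thus ?thesis by eventually_elim (auto simp: small_def)
qed

lemma eventually_eval_mult:
 "eventually (%z. evl (f * g) z = evl f z * evl g z) (nhds (0, 0))"
proof -
 obtain R C where f: "1 \<le> R" "gbd R C f" by (rule gbd_exists)
 obtain S B where g: "1 \<le> S" "gbd S B g" by (rule gbd_exists)
 define M where "M = max R S"
 have "gbd M C f" "gbd M B g" "0 < M" using f g by (auto intro: gbd_mono simp: M_def)
 thus ?thesis
  by (intro eventually_mono[OF eventually_small[of "4 * M"]]) (auto intro: eval_mult)
qed

lemma eventually_eval_add:
 "eventually (%z. evl (f + g) z = evl f z + evl g z) (nhds (0, 0))"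
proof -
 obtain R C where f: "1 \<le> R" "gbd R C f" by (rule gbd_exists)
 obtain S B where g: "1 \<le> S" "gbd S B g" by (rule gbd_exists)
 define M where "M = max R S"
 have "gbd M C f" "gbd M B g" "0 < M" using f g by (auto intro: gbd_mono simp: M_def)
 thus ?thesis
  by (intro eventually_mono[OF eventually_small[of M]]) (auto intro: eval_add)
qed

fun ptmap :: "direction => real \<times> real => real \<times> real" where
 "ptmap (Sl c) (x, y) = (x, x * (y + c))"
| "ptmap Vt (x, y) = (x * y, y)"

lemma eventually_eval_pull1:
 "eventually (%z. evl (pull1 d f) z = evl f (ptmap d z)) (nhds (0, 0))"
proof (cases d)
 case (Slope c)
 obtain R C where f: "1 \<le> R" "gbd R C f" by (rule gbd_exists)
 show ?thesis
  using f Slope by (intro eventually_mono[OF eventually_small[of "8 * R * (1 + \<bar>c\<bar>)"]]) (auto intro: eval_pull_slope)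
next
 case Vertical
 obtain R C where f: "1 \<le> R" "gbd R C f" by (rule gbd_exists)
 have f': "gbd R C (swp f)" using f(2) unfolding gbd_def gc_swap by (metis add.commute)
 have "evl (pvt f) (x, y) = evl f (x * y, y)" if "small (8 * R) (x, y)" "\<bar>x\<bar> \<le> 1" for x y
 proof -
  have "small (8 * R * (1 + \<bar>0\<bar>)) (y, x)" using that by (simp add: small_def)
  from eval_pull_slope[OF f' f(1) this that(2)] show ?thesis
   by (simp add: pull_vertical_swap eval_swap mult.commute)
 qed
 thus ?thesis
  using eventually_small[of "8 * R"] by (auto simp: Vertical elim!: eventually_mono)
qed

lemma eventually_eval_unit:
 assumes "is_unit u" shows "eventually (%z. evl u z ~= 0) (nhds (0, 0))"
proof -
 obtain w where w: "u * w = 1" using assms by auto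
 show ?thesis
  using eventually_eval_mult[of u w] by eventually_elim (auto simp: w eval_1)
qed


lemma eval_0 [simp]: "evl 0 z = 0"
 using eval_const[of 0 "fst z" "snd z"] by simp

lemma eventually_eval_ex_power:
 "eventually (%z. evl (ex d ^ k * g) z = (case d of Sl c => fst z | Vt => snd z) ^ k * evl g z) (nhds (0, 0))"
proof (intro always_eventually allI)
 fix z :: "real \<times> real"
 obtain x y where z: "z = (x, y)" by (cases z)
 show "evl (ex d ^ k * g) z = (case d of Sl c => fst z | Vt => snd z) ^ k * evl g z"
  by (induction k) (cases d; simp add: z mult.assoc eval_X_mult eval_Y_mult)+
qed

lemma eventually_tendsto:
 "eventually P (nhds l) ==> (f \<longlongrightarrow> l) F ==> eventually (%t. P (f t)) F"
 by (simp add: filterlim_iff)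

section \<open>Real zeros of a germ and of its strict transforms\<close>

lemma one_dim_iff: "one_dimensional f <-> (\<exists>\<^sub>F z in nhds (0, 0). z ~= (0, 0) & evl f z = 0)"
 unfolding one_dimensional_def eventually_at_filter frequently_def by (simp add: imp_conv_disj)

lemma one_dim_swap: "one_dimensional (swp f) <-> one_dimensional f"
proof -
 have imp: "one_dimensional (swp f)" if "one_dimensional f" for f
  unfolding one_dim_iff frequently_def
 proof
  assume "\<forall>\<^sub>F z in nhds (0, 0). ~ (z ~= (0, 0) & evl (swp f) z = 0)"
  moreover have "((%z :: real \<times> real. (snd z, fst z)) \<longlongrightarrow> (0, 0)) (nhds (0, 0))"
   using tendsto_Pair[OF tendsto_snd[OF filterlim_ident] tendsto_fst[OF filterlim_ident], of "(0 :: real, 0 :: real)"] by simp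
  ultimately have "\<forall>\<^sub>F z :: real \<times> real in nhds (0, 0). ~ ((snd z, fst z) ~= (0, 0) & evl (swp f) (snd z, fst z) = 0)"
   by (rule eventually_tendsto)
  hence "\<forall>\<^sub>F z in nhds (0, 0). ~ (z ~= (0, 0) & evl f z = 0)"
   by (rule eventually_mono) (auto simp: eval_swap)
  thus False using that by (simp add: one_dim_iff frequently_def)
 qed
 show ?thesis using imp[of f] imp[of "swp f"] by auto
qed

lemma one_dim_unit:
 assumes "is_unit u" shows "one_dimensional (u * f) <-> one_dimensional f"
proof -
 have "\<forall>\<^sub>F z in nhds (0, 0). evl (u * f) z = 0 <-> evl f z = 0"
  using eventually_eval_mult[of u f] eventually_eval_unit[OF assms] by eventually_elim auto
 hence "(\<exists>\<^sub>F z in nhds (0, 0). z ~= (0, 0) & evl (u * f) z = 0) <-> (\<exists>\<^sub>F z in nhds (0, 0). z ~= (0, 0) & evl f z = 0)"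
  by (intro frequently_cong) (auto elim!: eventually_mono)
 thus ?thesis by (simp add: one_dim_iff)
qed

lemma unit_not_one_dim: "is_unit u ==> ~ one_dimensional u"
 using eventually_eval_unit[of u] by (auto simp: one_dim_iff frequently_def elim!: eventually_mono)

lemma branch_iff:
 assumes f: "prm f" shows "branch (crv f) <-> one_dimensional f"
proof
 assume "branch (crv f)"
 then obtain g where g: "one_dimensional g" "crv f = crv g" by (auto simp: branch_def)
 hence "g dvd f" "f dvd g" by auto
 then obtain u where "is_unit u" "f = u * g" by (rule dvd_antisym_unit)
 thus "one_dimensional f" using g(1) one_dim_unit by simp
qed (use f prime_elem_imp_irreducible in \<open>auto simp: branch_def\<close>)

text \<open>The points (t, phi(t)) with phi(t) = t a(t, 0) are zeros, and they tend to the origin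
  because a is bounded.\<close>

lemma graph_one_dim: assumes "graph e f" shows "one_dimensional f"
proof -
 have main: "one_dimensional (gY - xgerm ph)" if ph: "0 < rad ph" "cf ph 0 = 0" for ph
 proof -
  define a where "a = shx 1 (xgerm ph)"
  have xa: "xgerm ph = gX * a"
   using ph by (intro germ_eqI) (auto simp: gc_X_mult a_def gc_xgerm)
  obtain R C where a: "1 \<le> R" "1 \<le> C" "gbd R C a" by (rule gbd_exists)
  define \<psi> where "\<psi> t = t * evl a (t, 0)" for t
  have ind: "evl a (t, y) = evl a (t, 0)" for t y
   unfolding germ_eval_def by (auto intro!: infsum_cong simp: a_def gc_xgerm[OF ph(1)])
  have b: "\<bar>\<psi> t\<bar> \<le> 4 * C * \<bar>t\<bar>" if "\<bar>t\<bar> * R \<le> 1 / 2" for t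
   using mult_left_mono[OF eval_summable(2)[OF a(3), of t 0], of "\<bar>t\<bar>"] that a
   by (simp add: \<psi>_def abs_mult small_def mult_ac)
  have "\<forall>\<^sub>F t in at (0::real). \<bar>\<psi> t\<bar> \<le> 4 * C * \<bar>t\<bar>"
  proof -
   have "((%t::real. \<bar>t\<bar> * R) \<longlongrightarrow> \<bar>0\<bar> * R) (at 0)" by (intro tendsto_intros)
   from order_tendstoD(2)[OF this, of "1/2"] show ?thesis by (auto elim!: eventually_mono intro!: b)
  qed
  moreover have "((%t::real. 4 * C * \<bar>t\<bar>) \<longlongrightarrow> 4 * C * \<bar>0\<bar>) (at 0)" by (intro tendsto_intros)
  ultimately have "(\<psi> \<longlongrightarrow> 0) (at 0)" by (intro Lim_null_comparison[of \<psi> "%t. 4 * C * \<bar>t\<bar>"]) auto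
  hence lim: "((%t. (t, \<psi> t)) \<longlongrightarrow> (0, 0)) (at 0)" by (intro tendsto_Pair) auto
  have ev: "\<forall>\<^sub>F z in nhds (0, 0). evl (gY - xgerm ph) z = snd z - evl (xgerm ph) z"
  proof -
   have "evl gY (x, y) = y" for x y using eval_Y_mult[of 1 x y] by (simp add: eval_1)
   moreover have m: "gY - xgerm ph = gY + cst (-1) * xgerm ph" by simp
   ultimately show ?thesis
    using eventually_eval_add[of gY "cst (-1) * xgerm ph"]
    unfolding m by (auto elim!: eventually_mono simp: eval_const_mult simp del: germ_const_hom)
  qed
  show ?thesis unfolding one_dim_iff frequently_def
  proof
   assume "\<forall>\<^sub>F z in nhds (0, 0). ~ (z ~= (0, 0) & evl (gY - xgerm ph) z = 0)"
   with ev have "\<forall>\<^sub>F z in nhds (0, 0). z ~= (0, 0) --> snd z - evl (xgerm ph) z ~= 0" by eventually_elim auto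
   hence "\<forall>\<^sub>F t in at 0. (t, \<psi> t) ~= (0, 0) --> \<psi> t - evl (xgerm ph) (t, \<psi> t) ~= 0"
    by (drule_tac eventually_tendsto[OF _ lim]) (simp)
   moreover have "evl (xgerm ph) (t, y) = \<psi> t" for t y
    unfolding xa eval_X_mult \<psi>_def using ind[of t y] by simp
   ultimately have *: "\<forall>\<^sub>F t in at (0::real). t = 0" by (auto elim!: eventually_mono)
   have "\<forall>\<^sub>F t in at (0::real). False"
    using * eventually_neq_at_within[of 0 0 UNIV] by eventually_elim simp
   thus False by simp
  qed
 qed
 show ?thesis using assms main unfolding graph_def by (metis one_dim_swap)
qed

text \<open>On x = 0 the germ is y^k times a unit, so near the origin it has no zero there except
  the origin itself.\<close>

lemma zeros_off_axis:
 assumes "~ gX dvd g" "one_dimensional g"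
 shows "\<exists>\<^sub>F z in nhds (0, 0). fst z ~= 0 & evl g z = 0"
 unfolding frequently_def
proof
 assume ev: "\<forall>\<^sub>F z in nhds (0, 0). ~ (fst z ~= 0 & evl g z = 0)"
 obtain k where k: "yreg k g" using yreg_exists[OF assms(1)] .
 define u where "u = shy k (row0 g)"
 have u: "is_unit u" using k by (simp add: u_def is_unit_iff gc_row0 yreg_def)
 have "row0 g = gY ^ k * u"
  using k by (intro germ_eqI) (auto simp: gc_Y_power_mult u_def gc_row0 yreg_def)
 hence g: "g = gY ^ k * u + gX * shx 1 g"
  by (intro germ_eqI) (auto simp: gc_X_mult gc_row0 simp flip: \<open>row0 g = _\<close>)
 have "\<forall>\<^sub>F z in nhds (0, 0). fst z = 0 & evl g z = 0 --> z = (0, 0)"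
  using eventually_eval_add[of "gY ^ k * u" "gX * shx 1 g"] eventually_eval_unit[OF u] eventually_eval_ex_power[of Vertical k u]
 proof eventually_elim
  case (elim z)
  obtain x y where z: "z = (x, y)" by (cases z)
  show ?case
  proof
   assume a: "fst z = 0 & evl g z = 0"
   have "evl g z = y ^ k * evl u z"
    using elim a by (subst g) (simp add: z eval_X_mult)
   hence "y ^ k = 0" using elim a by simp
   thus "z = (0, 0)" using a z by auto
  qed
 qed
 with ev have "\<forall>\<^sub>F z in nhds (0, 0). ~ (z ~= (0, 0) & evl g z = 0)" by eventually_elim auto
 thus False using assms(2) by (simp add: one_dim_iff frequently_def)
qed

lemma zeros_off_ex:
 assumes "~ ex d dvd g" "one_dimensional g"
 shows "\<exists>\<^sub>F z in nhds (0, 0). ptmap d z ~= (0, 0) & evl g z = 0"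
proof (cases d)
 case (Slope c)
 thus ?thesis using zeros_off_axis[of g] assms by (auto elim!: frequently_elim1)
next
 case Vertical
 have "~ gX dvd swp g" "one_dimensional (swp g)"
  using assms Vertical one_dim_swap swap_dvd_iff[of gY g] by auto
 hence f: "\<exists>\<^sub>F z in nhds (0, 0). fst z ~= 0 & evl (swp g) z = 0" by (rule zeros_off_axis)
 show ?thesis unfolding frequently_def
 proof
  assume "\<forall>\<^sub>F z in nhds (0, 0). ~ (ptmap d z ~= (0, 0) & evl g z = 0)"
  moreover have "((%z :: real \<times> real. (snd z, fst z)) \<longlongrightarrow> (0, 0)) (nhds (0, 0))"
   using tendsto_Pair[OF tendsto_snd[OF filterlim_ident] tendsto_fst[OF filterlim_ident], of "(0 :: real, 0 :: real)"] by simp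
  ultimately have "\<forall>\<^sub>F z :: real \<times> real in nhds (0, 0). ~ (ptmap d (snd z, fst z) ~= (0, 0) & evl g (snd z, fst z) = 0)"
   by (rule eventually_tendsto)
  hence "\<forall>\<^sub>F z in nhds (0, 0). ~ (fst z ~= 0 & evl (swp g) z = 0)"
   by (rule eventually_mono) (auto simp: eval_swap Vertical)
  thus False using f by (simp add: frequently_def)
 qed
qed

lemma eventually_eval_st1:
 assumes "f ~= 0"
 shows "\<forall>\<^sub>F z in nhds (0, 0). evl f (ptmap d z) = (case d of Sl c => fst z | Vt => snd z) ^ vord f * evl (st1 d f) z"
 using eventually_eval_pull1[of d f] eventually_eval_ex_power[of d "vord f" "st1 d f"]
 by eventually_elim (simp add: pull1_factor(1)[OF assms, of d] del: st1.simps pull1.simps)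

lemma tendsto_ptmap: "(ptmap d \<longlongrightarrow> (0, 0)) (nhds (0, 0))"
proof -
 have f: "((%z :: real \<times> real. fst z) \<longlongrightarrow> 0) (nhds (0, 0))" "((%z :: real \<times> real. snd z) \<longlongrightarrow> 0) (nhds (0, 0))"
  using tendsto_fst[OF filterlim_ident, of "(0 :: real, 0 :: real)"] tendsto_snd[OF filterlim_ident, of "(0 :: real, 0 :: real)"] by auto
 show ?thesis
 proof (cases d)
  case (Slope c)
  have "((%z :: real \<times> real. (fst z, fst z * (snd z + c))) \<longlongrightarrow> (0, 0 * (0 + c))) (nhds (0, 0))"
   by (intro tendsto_intros f)
  moreover have "ptmap d = (%z. (fst z, fst z * (snd z + c)))" using Slope by auto
  ultimately show ?thesis by simp
 next
  case Vertical
  have "((%z :: real \<times> real. (fst z * snd z, snd z)) \<longlongrightarrow> (0 * 0, 0)) (nhds (0, 0))"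
   by (intro tendsto_intros f)
  moreover have "ptmap d = (%z. (fst z * snd z, snd z))" using Vertical by auto
  ultimately show ?thesis by simp
 qed
qed

text \<open>Zeros of the strict transform off the exceptional divisor are mapped to points different
  from the origin.\<close>

lemma one_dim_push1:
 assumes "f ~= 0" "one_dimensional (st1 d f)" shows "one_dimensional f"
proof -
 have nd: "~ ex d dvd st1 d f" by (rule pull1_factor(2)[OF assms(1)])
 have "\<exists>\<^sub>F z in nhds (0, 0). ptmap d z ~= (0, 0) & evl (st1 d f) z = 0"
  by (rule zeros_off_ex[OF nd assms(2)])
 hence fr: "\<exists>\<^sub>F z in nhds (0, 0). ptmap d z ~= (0, 0) & evl f (ptmap d z) = 0"
  by (rule frequently_rev_mp) (rule eventually_mono[OF eventually_eval_st1[OF assms(1), of d]], simp)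
 show ?thesis unfolding one_dim_iff frequently_def
 proof
  assume "\<forall>\<^sub>F z in nhds (0, 0). ~ (z ~= (0, 0) & evl f z = 0)"
  hence "\<forall>\<^sub>F z in nhds (0, 0). ~ (ptmap d z ~= (0, 0) & evl f (ptmap d z) = 0)"
   by (rule eventually_tendsto[OF _ tendsto_ptmap])
  thus False using fr by (simp add: frequently_def)
 qed
qed

text \<open>If zeros accumulate inside some cone |y| \<le> M |x|, compactness gives a limit slope c
  and lifted zeros tending to its point. Otherwise the zeros leave every cone, and their lifts tend
  to the vertical point.\<close>

lemma one_dim_strict:
 assumes f: "f ~= 0" "one_dimensional f"
 obtains d where "one_dimensional (st1 d f)"
proof (cases "\<exists>M. \<exists>\<^sub>F z in nhds (0, 0). z ~= (0, 0) & \<bar>snd z\<bar> \<le> M * \<bar>fst z\<bar> & evl f z = 0")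
 case True
 then obtain M where fr: "\<exists>\<^sub>F z in nhds (0, 0). z ~= (0, 0) & \<bar>snd z\<bar> \<le> M * \<bar>fst z\<bar> & evl f z = 0" by blast
 have "\<exists>z. dist z (0, 0) < 1 / real (Suc n) & z ~= (0, 0) & \<bar>snd z\<bar> \<le> M * \<bar>fst z\<bar> & evl f z = 0" for n
 proof (rule ccontr)
  assume "~ ?thesis"
  hence "\<forall>\<^sub>F z in nhds (0, 0). ~ (z ~= (0, 0) & \<bar>snd z\<bar> \<le> M * \<bar>fst z\<bar> & evl f z = 0)"
   unfolding eventually_nhds_metric by (intro exI[of _ "1 / real (Suc n)"]) auto
  thus False using fr by (simp add: frequently_def)
 qed
 then obtain z where z: "!!n. dist (z n) (0, 0) < 1 / real (Suc n)" "!!n. z n ~= (0, 0)"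
  "!!n. \<bar>snd (z n)\<bar> \<le> M * \<bar>fst (z n)\<bar>" "!!n. evl f (z n) = 0" by metis
 have zl: "z \<longlonglongrightarrow> (0, 0)"
 proof (rule metric_LIMSEQ_I)
  fix r :: real assume "0 < r"
  then obtain N where N: "1 / real (Suc N) < r" using nat_approx_posE by blast
  have "dist (z n) (0, 0) < r" if "N \<le> n" for n
  proof -
   have "1 / real (Suc n) \<le> 1 / real (Suc N)" using that by (simp add: frac_le)
   thus ?thesis using z(1)[of n] N by simp
  qed
  thus "\<exists>no. \<forall>n\<ge>no. dist (z n) (0, 0) < r" by blast
 qed
 have x0: "fst (z n) ~= 0" for n using z(2)[of n] z(3)[of n] by (cases "z n") auto
 have "snd (z n) / fst (z n) : {- M..M}" for n
 proof -
  have "\<bar>snd (z n) / fst (z n)\<bar> \<le> M" using z(3)[of n] x0[of n] by (simp add: field_simps)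
  thus ?thesis unfolding abs_le_iff by auto
 qed
 then obtain c r where r: "strict_mono r" and c: "((%n. snd (z n) / fst (z n)) \<circ> r) \<longlonglongrightarrow> c"
  using compact_Icc[of "- M" M, unfolded compact_def, rule_format, of "%n. snd (z n) / fst (z n)"] by blast
 define w where "w n = (fst (z (r n)), snd (z (r n)) / fst (z (r n)) - c)" for n
 have zr: "(%n. z (r n)) \<longlonglongrightarrow> (0, 0)" using LIMSEQ_subseq_LIMSEQ[OF zl r] by (simp add: o_def)
 have wl: "w \<longlonglongrightarrow> (fst (0 :: real, 0 :: real), c - c)"
  unfolding w_def using c by (intro tendsto_intros zr) (simp add: o_def)
 have pw: "ptmap (Sl c) (w n) = z (r n)" for n using x0[of "r n"] by (cases "z (r n)") (simp add: w_def)
 have "one_dimensional (st1 (Sl c) f)" unfolding one_dim_iff frequently_def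
 proof
  assume "\<forall>\<^sub>F z in nhds (0, 0). ~ (z ~= (0, 0) & evl (st1 (Sl c) f) z = 0)"
  with eventually_eval_st1[OF f(1), of "Sl c"]
  have "\<forall>\<^sub>F z in nhds (0, 0). fst z ~= 0 --> evl f (ptmap (Sl c) z) ~= 0"
   by eventually_elim (auto)
  hence "\<forall>\<^sub>F n in sequentially. fst (w n) ~= 0 --> evl f (ptmap (Sl c) (w n)) ~= 0"
   by (rule eventually_tendsto) (use wl in simp)
  hence "\<forall>\<^sub>F n in sequentially. False"
   by (rule eventually_mono) (use x0 z(4) in \<open>simp only: pw, simp add: w_def\<close>)
  thus False by simp
 qed
 thus ?thesis using that by blast
next
 case False
 have "one_dimensional (st1 Vt f)" unfolding one_dim_iff frequently_def
 proof
  assume "\<forall>\<^sub>F z in nhds (0, 0). ~ (z ~= (0, 0) & evl (st1 Vt f) z = 0)"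
  with eventually_eval_st1[OF f(1), of Vertical]
  have "\<forall>\<^sub>F z in nhds (0, 0). snd z ~= 0 --> evl f (ptmap Vt z) ~= 0"
   by eventually_elim (auto)
  then obtain e where e: "0 < e" "!!z. dist z (0, 0) < e ==> snd z ~= 0 ==> evl f (ptmap Vt z) ~= 0"
   unfolding eventually_nhds_metric by blast
  \<comment> \<open>Outside the cone of opening 2/e the lifted coordinate x/y is below e/2; y is
    kept below e/2 as well, so the lift lies in the ball of radius e.\<close>
  have "\<forall>\<^sub>F z in nhds (0, 0). ~ (z ~= (0, 0) & \<bar>snd z\<bar> \<le> (2 / e) * \<bar>fst z\<bar> & evl f z = 0)"
   using False unfolding frequently_def by blast
  moreover have "\<forall>\<^sub>F z :: real \<times> real in nhds (0, 0). dist z (0, 0) < e / 2"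
   unfolding eventually_nhds_metric using e(1) by (intro exI[of _ "e / 2"]) auto
  ultimately have "\<forall>\<^sub>F z in nhds (0, 0). ~ (z ~= (0, 0) & evl f z = 0)"
  proof eventually_elim
   case (elim z)
   obtain x y where z: "z = (x, y)" by (cases z)
   show ?case
   proof
    assume a: "z ~= (0, 0) & evl f z = 0"
    hence xy: "2 / e * \<bar>x\<bar> < \<bar>y\<bar>" using elim(1) z by auto
    have "0 \<le> 2 / e * \<bar>x\<bar>" using e(1) by simp
    with xy have y: "y ~= 0" by auto
    have "\<bar>x / y\<bar> < e / 2" using xy y e(1) by (simp add: field_simps)
    moreover have "\<bar>y\<bar> < e / 2" using elim(2) z dist_snd_le[of z "(0, 0)"] by simp
    moreover have "dist (x / y, y) (0, 0) \<le> \<bar>x / y\<bar> + \<bar>y\<bar>"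
     by (simp add: dist_Pair_Pair dist_real_def sqrt_sum_squares_le_sum_abs del: abs_divide)
    ultimately have "dist (x / y, y) (0, 0) < e" by linarith
    hence "evl f (ptmap Vt (x / y, y)) ~= 0" using e(2) y by (simp del: ptmap.simps)
    thus False using a z y by simp
   qed
  qed
  thus False using f(2) by (simp add: one_dim_iff frequently_def)
 qed
 thus ?thesis using that by blast
qed

lemma push1_one_dim_iff:
 assumes "push1 d k h f" shows "one_dimensional f <-> one_dimensional h"
proof -
 have f: "f ~= 0" "st1 d f = h" "!!d'. d' ~= d ==> is_unit (st1 d' f)" using assms by (auto simp: push1_def simp del: st1.simps)
 show ?thesis
 proof
  assume "one_dimensional f"
  then obtain d' where "one_dimensional (st1 d' f)" using one_dim_strict[OF f(1)] by blast
  thus "one_dimensional h" using f unit_not_one_dim by metis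
 qed (use one_dim_push1[OF f(1), of d] f(2) in simp)
qed

lemma pushes_one_dim_iff: "pushes p g f ==> one_dimensional f <-> one_dimensional g"
 by (induction p arbitrary: f) (auto dest: push1_one_dim_iff)

lemma definite_not_one_dim:
 assumes "0 < c" shows "~ one_dimensional (gX ^ 2 + cst c * gY ^ 2)"
proof -
 have 1: "evl (gX ^ 2) (x, y) = x ^ 2" "evl (gY ^ 2) (x, y) = y ^ 2" for x y
  using eval_X_mult[of "gX * 1" x y] eval_X_mult[of 1 x y] eval_Y_mult[of "gY * 1" x y] eval_Y_mult[of 1 x y]
  by (simp_all add: power2_eq_square eval_1)
 have "\<forall>\<^sub>F z in nhds (0, 0). ~ (z ~= (0, 0) & evl (gX ^ 2 + cst c * gY ^ 2) z = 0)"
  using eventually_eval_add[of "gX ^ 2" "cst c * gY ^ 2"]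
 proof eventually_elim
  case (elim z)
  obtain x y where z: "z = (x, y)" by (cases z)
  have "x ^ 2 + c * y ^ 2 ~= 0" if "x ~= 0 \<or> y ~= 0"
  proof -
   have "0 \<le> x ^ 2" "0 \<le> c * y ^ 2" "0 < x ^ 2 \<or> 0 < c * y ^ 2" using that assms by auto
   thus ?thesis by linarith
  qed
  thus ?case using elim by (auto simp: z 1 eval_const_mult)
 qed
 thus ?thesis by (simp add: one_dim_iff frequently_def)
qed

section \<open>Infinitely near points of a sequence of blow-ups\<close>

lemma blowup_seq_Nil: "blowup_seq bq ==> [] : set bq"
 unfolding blowup_seq_def divisor_def by (metis length_greater_0_conv nth_mem singletonD take0)

lemma blowup_seq_butlast:
 assumes "blowup_seq bq" "p @ [d] : set bq" shows "p : set bq"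
proof -
 obtain j where j: "j < length bq" "bq ! j = p @ [d]" using assms(2) by (metis in_set_conv_nth)
 hence "p @ [d] : divisor (take j bq)" using assms(1) by (auto simp: blowup_seq_def)
 hence "p : set (take j bq)" by (auto simp: divisor_def split: if_splits)
 thus ?thesis by (meson in_set_takeD)
qed

lemma blowup_seq_prefix:
 assumes "blowup_seq bq" shows "p @ r : set bq ==> p : set bq"
proof (induction r rule: rev_induct)
 case (snoc d r)
 thus ?case using blowup_seq_butlast[OF assms, of "p @ r" d] by simp
qed simp

lemma divisor_iff:
 assumes "blowup_seq bq" shows "p : divisor bq <-> (\<exists>q d. p = q @ [d] & q : set bq) & p ~: set bq"
 using assms by (auto simp: divisor_def blowup_seq_def)

text \<open>Induction from the final divisor towards the origin: the lengths of the centres are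
  bounded, and every point created over a centre is a centre or a final point.\<close>

lemma near_induct [consumes 2, case_names final centre]:
 assumes "blowup_seq bq" "p : set bq Un divisor bq"
  and fin: "!!p. p : divisor bq ==> P p" and step: "!!p. p : set bq ==> (!!d. P (p @ [d])) ==> P p"
 shows "P p"
proof -
 define M where "M = Max (length ` set bq)"
 have M: "length q \<le> M" if "q : set bq" for q using that by (simp add: M_def)
 have "P p" if "p : set bq Un divisor bq" for p
  using that
 proof (induction "Suc M - length p" arbitrary: p rule: less_induct)
  case less
  show ?case
  proof (cases "p : set bq")
   case True
   have "P (p @ [d])" for d
   using M[OF True] True divisor_iff[OF assms(1)] less.hyps by auto
   thus ?thesis by (rule step[OF True])
  qed (use less fin in blast)
 qed
 thus ?thesis using assms(2) by simp
qed

lemma comp_prefix: "(compX p = Some q --> (\<exists>d r. p = q @ d # r)) & (compY p = Some q --> (\<exists>d r. p = q @ d # r))"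
proof (induction p rule: rev_induct)
 case (snoc d p)
 show ?case by (cases d) (use snoc in \<open>auto\<close>)
qed simp

lemma comp_centre:
 assumes "blowup_seq bq" "p : set bq Un divisor bq" "compX p = Some q \<or> compY p = Some q"
 shows "q : set bq"
proof -
 obtain d r where p: "p = q @ d # r" using comp_prefix assms(3) by blast
 show ?thesis
 proof (cases "p : set bq")
  case True
  thus ?thesis using blowup_seq_prefix[OF assms(1)] p by blast
 next
  case False
  then obtain q' d' where "p = q' @ [d']" "q' : set bq" using assms divisor_iff by blast
  thus ?thesis using p blowup_seq_prefix[OF assms(1), of q] by (cases r rule: rev_cases) auto
 qed
qed

lemma comp_distinct: "compX p = Some q ==> compY p ~= Some q"
proof (cases p rule: rev_cases)
 case (snoc p' d)
 have ne: "compX p' ~= Some p'" "compY p' ~= Some p'" using comp_prefix[of p' p'] by auto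
 assume "compX p = Some q"
 thus ?thesis using ne by (cases d) (auto simp: snoc)
qed simp

text \<open>Everything strictly above a point arises from its blow-up, and a final point is not
  blown up.\<close>

lemma divisor_not_prefix:
 assumes "blowup_seq bq" "p : divisor bq" "p' : set bq Un divisor bq" "p' = p @ r"
 shows "r = []"
proof (rule ccontr)
 assume "r ~= []"
 then obtain r' d where r: "r = r' @ [d]" by (metis rev_exhaust)
 have "p @ r' : set bq"
 proof (cases "p' : set bq")
  case True
  thus ?thesis using blowup_seq_butlast[OF assms(1), of "p @ r'"] assms(4) r by simp
 next
  case False
  thus ?thesis using assms divisor_iff[OF assms(1)] r by auto
 qed
 thus False using blowup_seq_prefix[OF assms(1)] assms(2) divisor_iff[OF assms(1)] by blast
qed

definition lone :: "point => point => germ => bool" where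
 "lone p q e <-> cpt q p e & (\<forall>q' e'. cpt q' p e' --> q' = q)"

definition corner :: "point => bool" where
 "corner p <-> compX p ~= None & compY p ~= None"

lemma component_at_eq: "cpt q p e ==> cpt q p e' ==> e' = e"
 using comp_distinct by (auto simp: component_at_iff)

lemma component_XY: "cpt q p e ==> e = gX \<or> e = gY"
 by (auto simp: component_at_iff)

lemma prime_component: "cpt q p e ==> prm e"
 using prime_X prime_Y by (auto simp: component_at_iff)

lemma gp_component: "cpt q p e ==> \<exists>U V. gp e U V"
 using gp_X gp_Y by (auto simp: component_at_iff)

lemma lone_snoc: "lone (p @ [d]) q e ==> q = p & e = ex d"
 using comp_prefix[of q q] by (cases d) (auto simp: lone_def component_at_iff split: if_splits)

lemma lone_or_corner:
 assumes "p ~= []" shows "corner p \<or> (\<exists>q e. lone p q e)"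
proof -
 obtain p' d where p: "p = p' @ [d]" using assms by (metis rev_exhaust)
 show ?thesis by (cases d) (auto simp: p corner_def lone_def component_at_iff)
qed

lemma corner_cases:
 assumes "corner p" obtains p' where "p = p' @ [Sl 0] \<or> p = p' @ [Vt]"
proof (cases p rule: rev_cases)
 case Nil
 thus ?thesis using assms by (simp add: corner_def)
next
 case (snoc p' d)
 thus ?thesis using assms that by (cases d) (auto simp: corner_def split: if_splits)
qed

lemma finite_corners:
 assumes "blowup_seq bq" shows "finite {p \<in> divisor bq. corner p}"
proof (rule finite_subset)
 show "{p \<in> divisor bq. corner p} \<subseteq> (%q. q @ [Sl 0]) ` set bq Un (%q. q @ [Vt]) ` set bq"
 using corner_cases divisor_iff[OF assms] by auto
qed simp

text \<open>Finitely many slopes are excluded. The condition \<open>c ~= 0\<close> keeps the point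
  off the corners.\<close>

lemma generic_slope:
 assumes "blowup_seq bq" "q : set bq" "finite C"
 obtains c where "c ~: C" "c ~= 0" "q @ [Sl c] : divisor bq"
proof -
 have "finite ((%c. q @ [Sl c]) -` set bq)" by (rule finite_vimageI) (auto simp: inj_on_def)
 hence "finite (C Un {0} Un (%c. q @ [Sl c]) -` set bq)" using assms(3) by simp
 then obtain c where "c ~: C Un {0} Un (%c. q @ [Sl c]) -` set bq" using ex_new_if_finite[OF infinite_UNIV_char_0] by metis
 thus ?thesis using that[of c] divisor_iff[OF assms(1)] assms(2) by auto
qed

text \<open>A coordinate axis continues as an axis at its next point, with multiplicity 1. This
  links the invariance of a component at the two points.\<close>

lemma push1_axis:
 "\<exists>w. is_unit w & push1 Vt 1 (w * gX) gX"
 "\<exists>w. is_unit w & push1 (Sl 0) 1 (w * gY) gY"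
proof -
 have main: "\<exists>w. is_unit w & push1 d 1 (w * a) a"
  if a: "prm a" "~ ex d dvd a" "pull1 d a = ex d * a" "vord a = 1" for d a
 proof -
  obtain k f u where u: "is_unit u" "push1 d k (u * a) f" using push1_exists[OF a(2)] .
  have pf: "prm f"
   by (rule pushes_prime[of "u * a" "[d]"]) (use u a in \<open>auto simp: prime_elem_mult_unit_left\<close>)
  have "u * a dvd pull1 d a" using u(1) unfolding a(3) by auto
  hence "f dvd a" using u(2) by (simp add: push1_def del: st1.simps pull1.simps)
  moreover have "a dvd f" using prime_dvd_imp_dvd[OF pf a(1)] calculation by simp
  ultimately obtain v where v: "is_unit v" "a = v * f" by (rule dvd_antisym_unit)
  have p: "push1 d k (pull1 d v * (u * a)) a" using push1_unit[OF u(2) v(1)] v(2) by simp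
  hence "k = 1" using a(4) by (simp add: push1_def del: st1.simps pull1.simps)
  with p u v show ?thesis by (intro exI[of _ "pull1 d v * u"]) (simp add: mult.assoc is_unit_mult_iff del: pull1.simps)
 qed
 have "~ gY dvd gX" "~ gX dvd gY" by (auto simp: X_dvd_iff Y_dvd_iff gc_X gc_Y)
 thus "\<exists>w. is_unit w & push1 Vt 1 (w * gX) gX" "\<exists>w. is_unit w & push1 (Sl 0) 1 (w * gY) gY"
  using main[OF prime_X, of Vertical] main[OF prime_Y, of "Sl 0"] by auto
qed

text \<open>Reducing after each blow-up or once at the end gives reduced forms of the same
  pull-back; the unit between them goes into m.\<close>

lemma strict_step:
 assumes "coprime (fst om) (snd om)"
 obtains m where "m ~= 0" "plf [d] (stf om p) = scl m (stf om (p @ [d]))"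
proof -
 obtain h where h: "h ~= 0" "plf p om = scl h (stf om p)" using strict_form_props[OF assms] by blast
 obtain k where k: "k ~= 0" "plf (p @ [d]) om = scl k (stf om (p @ [d]))" using strict_form_props[OF assms] by blast
 define om1 where "om1 = stf om p"
 have c1: "coprime (fst om1) (snd om1)" unfolding om1_def by (rule strict_form_props[OF assms])
 obtain n where n: "n ~= 0" "plf [d] om1 = scl n (stf om1 [d])" using strict_form_props[OF c1] by blast
 have e: "scl k (stf om (p @ [d])) = scl (pull [d] h * n) (stf om1 [d])"
  unfolding k(2)[symmetric] pull_form_append h(2) pull_form_scale om1_def[symmetric] n(2) by (simp add: scale_form_def)
 have n0: "pull [d] h * n ~= 0" using h n by simp
 obtain u where u: "is_unit u" "fst (stf om1 [d]) = u * fst (stf om (p @ [d]))" "snd (stf om1 [d]) = u * snd (stf om (p @ [d]))"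
  by (rule coprime_form_unique[OF k(1) n0 _ _ strict_form_props(1)[OF assms] strict_form_props(1)[OF c1]])
   (use e in \<open>auto simp: prod_eq_iff\<close>)
 show ?thesis
 proof (rule that[of "n * u"])
  show "n * u ~= 0" using n u by auto
  show "plf [d] (stf om p) = scl (n * u) (stf om (p @ [d]))"
   using n(2) u(2,3) by (simp add: om1_def scale_form_def mult.assoc)
 qed
qed

lemma invariant_along:
 assumes "coprime (fst om) (snd om)" "prm g" "pushes p g f"
 shows "f dvd wdg om f <-> g dvd wdg (stf om p) g"
proof -
 obtain h where h: "plf p om = scl h (stf om p)" using strict_form_props[OF assms(1)] by blast
 show ?thesis by (rule invariant_pushes[OF assms(2) pushes_nonexc[OF assms(2,3)] assms(3) h assms(1)])
qed

lemma invariant_step: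
 assumes "coprime (fst om) (snd om)" "prm g" "push1 d k g f"
 shows "f dvd wdg (stf om p) f <-> g dvd wdg (stf om (p @ [d])) g"
proof -
 have ps: "pushes [d] g f" using assms(3) by auto
 obtain m where m: "plf [d] (stf om p) = scl m (stf om (p @ [d]))" using strict_step[OF assms(1)] by blast
 show ?thesis by (rule invariant_pushes[OF assms(2) pushes_nonexc[OF assms(2) ps] ps m strict_form_props(1)[OF assms(1)]])
qed

lemma strict_form_Nil:
 assumes "coprime (fst om) (snd om)" obtains u where "is_unit u" "stf om [] = scl u om"
 by (rule strict_form_unique[of om om 1 1 "[]"]) (use assms in \<open>auto\<close>)

subsection \<open>Separatrices through the final divisor\<close>

text \<open>
 \<open>dc\<close> is the set of dicritical components, and \<open>Si\<close>, \<open>Sd\<close> are the points of the final divisor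
 carrying an isolated, respectively a chosen dicritical separatrix; \<open>g p\<close> is its equation at \<open>p\<close>
 and \<open>f p\<close> its equation at the origin.
\<close>

locale frame =
 fixes bq :: "point list" and dc Si Sd :: "point set" and g f :: "point => germ"
 assumes bs: "blowup_seq bq" and dc: "dc \<subseteq> set bq" "no_two_meet bq dc"
  and fin: "finite Si" "finite Sd" and disj: "Si \<inter> Sd = {}"
  and final: "!!p. p : Si Un Sd ==> p : divisor bq"
  and sep: "!!p. p : Si Un Sd ==> \<exists>q e u. lone p q e & (q : dc <-> p : Sd) & is_unit u & graph e (u * g p)"
  and push: "!!p. p : Si Un Sd ==> pushes p (g p) (f p)"
begin

lemma sep_props:
 assumes "p : Si Un Sd"
 shows "prm (g p)" "\<exists>U V. gp (g p) U V" "vord (g p) = 1" "one_dimensional (g p)" "g p ~= 0"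
  and "!!q e. cpt q p e ==> transverse (crv (g p)) (crv e)"
  and "!!q e. cpt q p e ==> ~ g p dvd e"
  and "!!q e. cpt q p e ==> ~ e dvd g p"
  and "!!q e. cpt q p e ==> q : dc <-> p : Sd"
proof -
 obtain q e u where u: "lone p q e" "q : dc <-> p : Sd" "is_unit u" "graph e (u * g p)" using sep[OF assms] by blast
 note gr = graph_props[OF u(4)]
 obtain w where w: "is_unit w" "w * u = 1" using u(3) by (metis dvd_def mult.commute)
 hence gw: "g p = w * (u * g p)" by simp
 have c: "crv (u * g p) = crv (g p)" by (rule curve_of_unit[OF u(3)])
 show pr: "prm (g p)" using gr(1) u(3) by (simp add: prime_elem_mult_unit_left)
 thus ne: "g p ~= 0" by auto
 show "\<exists>U V. gp (g p) U V" using gr(2) gp_unit[OF _ w(1)] gw by metis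
 show "vord (g p) = 1" using gr(3) vord_mult[of u "g p"] u(3) ne by simp
 show "one_dimensional (g p)" using graph_one_dim[OF u(4)] one_dim_unit[OF u(3)] by simp
 fix q' e' assume e': "cpt q' p e'"
 hence q': "q' = q" "e' = e" using u(1) component_at_eq[of q p e e'] by (auto simp: lone_def)
 show "transverse (crv (g p)) (crv e')"
  unfolding transverse_def by (rule exI[of _ "u * g p"], rule exI[of _ e]) (use gr(6) c q' in auto)
 show "~ g p dvd e'" using gr(4) u(3) q' by auto
 show "~ e' dvd g p" using gr(5) q' by auto
 show "q' : dc <-> p : Sd" using u(2) q' by simp
qed

lemma sep_branch:
 assumes "p : Si Un Sd"
 shows "prm (f p)" "branch (crv (f p))" "f p ~= 0" "branch (crv (g p))"
  "nonexc p (g p)" "strict_branch p (crv (f p)) (crv (g p))"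
proof -
 note g = sep_props[OF assms] and ps = push[OF assms]
 show pf: "prm (f p)" by (rule pushes_prime[OF g(1) ps])
 thus "f p ~= 0" by auto
 show "branch (crv (f p))" using pushes_one_dim_iff[OF ps] g(4) pf by (simp add: branch_iff)
 show bg: "branch (crv (g p))" using g by (simp add: branch_iff)
 show ne: "nonexc p (g p)" by (rule pushes_nonexc[OF g(1) ps])
 show "strict_branch p (crv (f p)) (crv (g p))" by (rule strict_branch_pushes[OF bg ne ps])
qed

lemma same_curve_st_unit:
 assumes "crv a = crv b" "a ~= 0" "b ~= 0" shows "is_unit (st p a) <-> is_unit (st p b)"
proof -
 have "a dvd b" "b dvd a" using assms(1) by auto
 then obtain u where u: "is_unit u" "b = u * a" by (rule dvd_antisym_unit)
 hence "st p b = pull p u * st p a" using assms(2) by (simp add: st_mult st_unit)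
 thus ?thesis using u(1) by (simp add: is_unit_mult_iff)
qed

text \<open>Distinct final points are incomparable as lists, which is the situation of
  \<open>pushes_st_other\<close>.\<close>

lemma st_sep_unit:
 assumes "p : Si Un Sd" "p' : divisor bq" "p' ~= p" shows "is_unit (st p' (f p))"
proof (rule pushes_st_other[OF push[OF assms(1)]])
 show "\<nexists>r. p = p' @ r" using divisor_not_prefix[OF bs assms(2), of p] final[OF assms(1)] assms(3) by auto
 show "\<nexists>r. p' = p @ r" using divisor_not_prefix[OF bs final[OF assms(1)], of p'] assms(2,3) by auto
qed

lemma strict_at_sep:
 assumes p: "p : Si Un Sd" and p': "p' : divisor bq" and T: "strict_branch p' (crv (f p)) T"
 shows "p' = p & T = crv (g p)"
proof -
 obtain h f' where h: "prm h" "nonexc p' h" "T = crv h" "crv (f p) = crv f'" "pushes p' h f'"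
  using strict_branch_push[OF sep_branch(2)[OF p] T] .
 have f': "f' ~= 0" using pushes_prime[OF h(1,5)] by auto
 have "~ is_unit (st p' f')" using pushes_st_eq[OF h(5)] h(1) by simp
 hence e: "p' = p"
  using st_sep_unit[OF p p'] same_curve_st_unit[OF h(4) sep_branch(3)[OF p] f'] by blast
 moreover have "T = crv (g p)"
  by (rule strict_branch_pushes_unique[OF sep_props(1)[OF p] sep_branch(5)[OF p] push[OF p]]) (use T e in simp)
 ultimately show ?thesis by simp
qed

lemma meets_iff:
 assumes p: "p : Si Un Sd"
 shows "meets_component bq (crv (f p)) q <-> (\<exists>e. cpt q p e)"
using strict_at_sep[OF p] comp_centre[OF bs, of p q] final[OF p] sep_branch(6)[OF p] meets_component_def component_at_iff by auto

lemma sep_inj: "inj_on (%p. crv (f p)) (Si Un Sd)"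
proof (rule inj_onI)
 fix p p' assume p: "p : Si Un Sd" "p' : Si Un Sd" "crv (f p) = crv (f p')"
 thus "p = p'" using strict_at_sep[OF p(2) final[OF p(1)]] sep_branch(6)[OF p(1)] by simp
qed

lemma realizes: "realizes_eps bq ((%p. crv (f p)) ` (Si Un Sd))"
proof -
 define tr where "tr = inv_into (Si Un Sd) (%p. crv (f p))"
 have tr: "tr (crv (f p)) = p" if "p : Si Un Sd" for p
  unfolding tr_def using sep_inj that by (rule inv_into_f_f)
 have "tr S : divisor bq & (\<exists>!q. \<exists>e. cpt q (tr S) e) &
   (\<exists>T. strict_branch (tr S) S T & curve_mult T = 1 &
    (\<forall>q e. cpt q (tr S) e --> transverse T (crv e)))"
  if "S : (%p. crv (f p)) ` (Si Un Sd)" for S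
 proof -
  obtain p where p: "p : Si Un Sd" "S = crv (f p)" using \<open>S : _\<close> by blast
  obtain q e where q: "lone p q e" using sep[OF p(1)] by blast
  have "\<exists>!q. \<exists>e. cpt q p e" using q by (auto simp: lone_def)
  moreover have "strict_branch p S (crv (g p)) & curve_mult (crv (g p)) = 1 &
    (\<forall>q e. cpt q p e --> transverse (crv (g p)) (crv e))"
   using sep_branch(6)[OF p(1)] sep_props(3,5,6)[OF p(1)] p(2) by (simp add: curve_mult_eq)
  ultimately show ?thesis using final[OF p(1)] tr[OF p(1)] p(2) by auto
 qed
 note * = this
 have "inj_on tr ((%p. crv (f p)) ` (Si Un Sd))" unfolding tr_def by (rule inj_on_inv_into) simp
 thus ?thesis unfolding realizes_eps_def by (intro exI[of _ tr] conjI ballI *)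
qed

text \<open>What the given foliation and the foliation of the model have in common. The reduction
  property and the description of the separatrices are derived from it once, for both.\<close>

definition adapted :: "form => bool" where
 "adapted th <-> coprime (fst th) (snd th) &
  (\<forall>p\<in>divisor bq. \<forall>q e. cpt q p e -->
    (q ~: dc --> e dvd wdg (stf th p) e) & (q : dc --> gc (wdg (stf th p) e) 0 0 ~= 0)) &
  (\<forall>p\<in>divisor bq. sng (stf th p) -->
    smp (stf th p) & ~ saddle_node (stf th p) & (corner p \<or> p : Si)) &
  (\<forall>p\<in>Si. sng (stf th p)) &
  (\<forall>p\<in>Si Un Sd. g p dvd wdg (stf th p) (g p))"

context
 fixes th assumes ad: "adapted th"
begin

lemma ad_co: "coprime (fst th) (snd th)" "coprime (fst (stf th p)) (snd (stf th p))"
 using ad strict_form_props(1)[of th p] by (auto simp: adapted_def)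

lemma ad_comp:
 assumes "p : divisor bq" "cpt q p e"
 shows "q ~: dc ==> e dvd wdg (stf th p) e" "q : dc ==> gc (wdg (stf th p) e) 0 0 ~= 0"
 using ad assms by (auto simp: adapted_def)

lemma ad_sing:
 assumes "p : divisor bq" "sng (stf th p)"
 shows "smp (stf th p)" "~ saddle_node (stf th p)" "corner p \<or> p : Si"
 using ad assms by (auto simp: adapted_def)

lemma ad_sep: "p : Si Un Sd ==> g p dvd wdg (stf th p) (g p)" "p : Si ==> sng (stf th p)"
 using ad by (auto simp: adapted_def)

lemma ad_noninvariant: "noninvariant_components th bq = dc"
proof
 show "noninvariant_components th bq \<subseteq> dc"
  using ad_comp(1) by (auto simp: noninvariant_components_def invariant_component_def invariant_curve_iff)
 show "dc \<subseteq> noninvariant_components th bq"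
 proof
  fix q assume q: "q : dc"
  hence "q : set bq" using dc by blast
  then obtain c where c: "q @ [Sl c] : divisor bq" using generic_slope[OF bs _ finite.emptyI] by blast
  have "cpt q (q @ [Sl c]) gX" by (rule component_at.intros)
  moreover have "gc (wdg (stf th (q @ [Sl c])) gX) 0 0 ~= 0" by (rule ad_comp(2)[OF c calculation q])
  hence "~ gX dvd wdg (stf th (q @ [Sl c])) gX" by auto
  ultimately show "q : noninvariant_components th bq"
   using c \<open>q : set bq\<close> by (auto simp: noninvariant_components_def invariant_component_def invariant_curve_iff)
 qed
qed

lemma ad_reduces: "reduces th bq"
 unfolding reduces_def ad_noninvariant
proof (intro conjI ballI allI impI)
 show "finite {p \<in> divisor bq. sng (stf th p)}"
  by (rule finite_subset[of _ "{p \<in> divisor bq. corner p} Un Si"]) (use ad_sing(3) finite_corners[OF bs] fin in auto)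
qed (use ad_sing(1) ad_comp(2) dc in auto)

lemma wedge_nonsingular: "gc (wdg om e) 0 0 ~= 0 ==> ~ sng om"
 by (auto simp: wedge_d_def singular_form_def)

lemma ad_regular_branch:
 assumes "p : divisor bq" "~ sng (stf th p)" "cpt q p e" "q ~: dc"
  and "prm h" "h dvd wdg (stf th p) h"
 shows "e dvd h"
proof -
 obtain U V where "gp e U V" using gp_component[OF assms(3)] by blast
 from regular_unique[OF assms(2) prime_component[OF assms(3)] this ad_comp(1)[OF assms(1,3,4)] _ assms(6)]
 show ?thesis using assms(5) by simp
qed

lemma nonexc_component: "nonexc p h ==> prm h ==> cpt q p e ==> ~ h dvd e & ~ e dvd h"
 using nonexc_not_comp[of h p q] prime_dvd_imp_dvd[of e h] prime_component[of q p e]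
 by (auto simp: component_at_iff)

text \<open>The second curve k is the other component at a corner and the separatrix g p elsewhere.
  Being invariant and different from e, it coincides with the transverse graph given by
  \<open>simple_structure\<close>, whose properties it inherits.\<close>

lemma ad_singular_axes:
 assumes p: "p : divisor bq" "sng (stf th p)"
 obtains q e k where "cpt q p e" "q ~: dc" "prm k" "\<exists>U V. gp k U V" "~ e dvd k"
  "k dvd wdg (stf th p) k" "k = g p & p : Si \<or> (\<exists>q'. q' ~: dc & cpt q' p k)"
  "csi (stf th p) (crv k) ~= 0" "~ pos_rat (csi (stf th p) (crv k))"
  "csi (stf th p) (crv e) = 1 / csi (stf th p) (crv k)"
  "!!h. prm h ==> h dvd wdg (stf th p) h ==> crv h = crv e \<or> crv h = crv k"
proof -
 have ndc: "q ~: dc" if "cpt q p e" for q e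
  using ad_comp(2)[OF p(1) that] wedge_nonsingular p(2) by blast
 have "\<exists>q e k0. cpt q p e & prm k0 & k0 dvd wdg (stf th p) k0 & (\<exists>U V. gp k0 U V) &
  ~ e dvd k0 & (k0 = g p & p : Si \<or> (\<exists>q'. q' ~: dc & cpt q' p k0))"
 proof (cases "corner p")
  case True
  then obtain q q' where "compX p = Some q" "compY p = Some q'" by (auto simp: corner_def)
  hence c: "cpt q p gX" "cpt q' p gY" by (auto simp: component_at_iff)
  have "~ gX dvd gY" by (auto simp: X_dvd_iff gc_Y)
  thus ?thesis using c ndc[OF c(2)] ad_comp(1)[OF p(1) c(2)] prime_Y gp_Y by blast
 next
  case False
  hence pS: "p : Si" using ad_sing(3)[OF p] by blast
  obtain q e where c: "cpt q p e" using sep[of p] pS by (auto simp: lone_def)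
  show ?thesis using c ad_sep(1)[of p] sep_props[of p] pS by blast
 qed
 then obtain q e k0 where c: "cpt q p e" and k0: "prm k0" "k0 dvd wdg (stf th p) k0" "\<exists>U V. gp k0 U V" "~ e dvd k0"
  "k0 = g p & p : Si \<or> (\<exists>q'. q' ~: dc & cpt q' p k0)" by blast
 note e = component_XY[OF c] and i = ad_comp(1)[OF p(1) c ndc[OF c]]
 obtain k where k: "graph e k" "k dvd wdg (stf th p) k" "csi (stf th p) (crv k) ~= 0"
  "~ pos_rat (csi (stf th p) (crv k))"
  "csi (stf th p) (crv e) = 1 / csi (stf th p) (crv k)"
  "\<forall>f'. ~ is_unit f' & f' dvd wdg (stf th p) f' --> e dvd f' \<or> k dvd f'"
  using simple_structure[OF ad_co(2) ad_sing(1,2)[OF p] e i] by blast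
 note pk = graph_props[OF k(1)]
 have eq: "crv a = crv b" if "prm a" "prm b" "a dvd b" for a b :: germ
  using that prime_dvd_imp_dvd[OF that] by (simp add: curve_of_eq_iff)
 have kk: "crv k = crv k0"
  using k(6) k0 eq[OF pk(1) k0(1)] by (auto simp: prime_elem_def)
 show ?thesis
 proof (rule that[OF c ndc[OF c] k0(1,3,4,2,5)])
  show "crv h = crv e \<or> crv h = crv k0" if h: "prm h" "h dvd wdg (stf th p) h" for h
  proof -
   have "e dvd h \<or> k dvd h" using k(6) h by simp
   thus ?thesis using eq[OF prime_component[OF c] h(1)] eq[OF pk(1) h(1)] kk by metis
  qed
 qed (use k kk in auto)
qed

text \<open>A branch cannot meet an invariant component at a regular point, where the component is
  the only invariant curve. At a singular point it is one of two invariant curves and not a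
  component, which leaves g p.\<close>

lemma ad_isolated: "isolated_separatrices th bq = (%p. crv (f p)) ` Si"
proof
 show "(%p. crv (f p)) ` Si \<subseteq> isolated_separatrices th bq"
 proof
  fix S assume "S : (%p. crv (f p)) ` Si"
  then obtain p where p: "p : Si" "S = crv (f p)" by blast
  hence pS: "p : Si Un Sd" by simp
  have "f p dvd wdg th (f p)"
   using invariant_along[OF ad_co(1) sep_props(1)[OF pS] push[OF pS]] ad_sep(1)[OF pS] by simp
  hence "separatrix th S" using sep_branch(2)[OF pS] p(2) by (simp add: separatrix_def invariant_curve_iff)
  moreover obtain q e where "lone p q e" "q : dc <-> p : Sd" using sep[OF pS] by blast
  moreover hence "meets_component bq S q" "q : set bq"
   using meets_iff[OF pS] p(2) by (auto simp: lone_def meets_component_def)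
  ultimately show "S : isolated_separatrices th bq"
   using disj p(1) by (auto simp: isolated_separatrices_def ad_noninvariant)
 qed
 show "isolated_separatrices th bq \<subseteq> (%p. crv (f p)) ` Si"
 proof
  fix S assume "S : isolated_separatrices th bq"
  then obtain q where S: "branch S" "invariant_curve th S" "q ~: dc" "meets_component bq S q"
   by (auto simp: isolated_separatrices_def ad_noninvariant separatrix_def)
  then obtain p T e where p: "p : divisor bq" "strict_branch p S T" "cpt q p e" by (auto simp: meets_component_def)
  obtain h f' where h: "prm h" "nonexc p h" "T = crv h" "S = crv f'" "pushes p h f'"
   using strict_branch_push[OF S(1) p(2)] .
  have inv: "h dvd wdg (stf th p) h"
   using invariant_along[OF ad_co(1) h(1,5)] S(2) h(4) by (simp add: invariant_curve_iff)
  have nh: "~ e' dvd h" "~ h dvd e'" if "cpt q' p e'" for q' e'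
   using nonexc_component[OF h(2,1) that] by auto
  have "sng (stf th p)"
   using ad_regular_branch[OF p(1) _ p(3) S(3) h(1) inv] nh[OF p(3)] by blast
  from ad_singular_axes[OF p(1) this] obtain q1 e1 k where k: "cpt q1 p e1" "q1 ~: dc" "k = g p & p : Si \<or> (\<exists>q'. q' ~: dc & cpt q' p k)"
   "crv h = crv e1 \<or> crv h = crv k"
   using inv h(1) by metis
  have kg: "crv h = crv (g p)" "p : Si" using k nh by (auto simp: curve_of_eq_iff)
  hence pS: "p : Si Un Sd" by simp
  have "crv f' = crv (f p)"
   using pushes_dvd[OF h(5)] pushes_dvd[OF push[OF pS]] kg(1) unfolding curve_of_eq_iff by (meson dvd_refl dvd_trans)
  thus "S : (%p. crv (f p)) ` Si" using kg(2) h(4) by blast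
 qed
qed

lemma ad_dicritical: "(%p. crv (f p)) ` Sd \<subseteq> dicritical_separatrices th bq"
proof
 fix S assume "S : (%p. crv (f p)) ` Sd"
 then obtain p where p: "p : Sd" "S = crv (f p)" by blast
 hence pS: "p : Si Un Sd" by simp
 have "f p dvd wdg th (f p)"
  using invariant_along[OF ad_co(1) sep_props(1)[OF pS] push[OF pS]] ad_sep(1)[OF pS] by simp
 hence "separatrix th S" using sep_branch(2)[OF pS] p(2) by (simp add: separatrix_def invariant_curve_iff)
 moreover obtain q e where "lone p q e" "q : dc <-> p : Sd" using sep[OF pS] by blast
 moreover hence "meets_component bq S q" using meets_iff[OF pS] p(2) by (auto simp: lone_def)
 ultimately show "S : dicritical_separatrices th bq" using p(1) by (auto simp: dicritical_separatrices_def ad_noninvariant)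
qed

text \<open>The index rules involve components at the centres as well. There invariance is brought
  down from the next point at which the same axis continues.\<close>

lemma ad_component_invariant:
 assumes "p : set bq Un divisor bq" shows "\<forall>q e. q ~: dc --> cpt q p e --> e dvd wdg (stf th p) e"
 using bs assms
proof (induction rule: near_induct)
 case (final p)
 thus ?case using ad_comp(1) by blast
next
 case (centre p)
 show ?case
 proof (intro allI impI)
  fix q e assume q: "q ~: dc" "cpt q p e"
  show "e dvd wdg (stf th p) e"
  proof (cases "e = gX")
   case True
   hence "cpt q (p @ [Vt]) gX" using q(2) by (auto intro: component_at.intros)
   hence i: "gX dvd wdg (stf th (p @ [Vt])) gX" using centre(2) q(1) by blast
   obtain w where w: "is_unit w" "push1 Vt 1 (w * gX) gX" using push1_axis(1) by blast
   show ?thesis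
    using invariant_step[OF ad_co(1) _ w(2)] wedge_unit_dvd[OF w(1)] i prime_X w(1) True
    by (simp add: prime_elem_mult_unit_left)
  next
   case False
   hence eY: "e = gY" using component_XY[OF q(2)] by simp
   hence "cpt q (p @ [Sl 0]) gY" using q(2) by (auto intro: component_at.intros)
   hence i: "gY dvd wdg (stf th (p @ [Sl 0])) gY" using centre(2) q(1) by blast
   obtain w where w: "is_unit w" "push1 (Sl 0) 1 (w * gY) gY" using push1_axis(2) by blast
   show ?thesis
    using invariant_step[OF ad_co(1) _ w(2)] wedge_unit_dvd[OF w(1)] i prime_Y w(1) eY
    by (simp add: prime_elem_mult_unit_left)
  qed
 qed
qed

text \<open>The index ignores the level because the strict transform at a point is not affected by
  blow-ups elsewhere; the second index rule becomes immediate.\<close>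

definition trip :: triplet where
 "trip = \<lparr>centres = bq, dic = dc, sep_dic = (%p. crv (f p)) ` Sd, sep_iso = (%p. crv (f p)) ` Si,
  ind = (%j p S. csi (stf th p) S)\<rparr>"

lemma seps_trip: "seps trip = (%p. crv (f p)) ` (Si Un Sd)"
 by (auto simp: trip_def seps_def)

lemma st_same_curve:
 assumes "crv a = crv b" "b ~= 0" obtains u where "is_unit u" "a = u * b" "st p a = pull p u * st p b"
proof -
 have "b dvd a" "a dvd b" using assms(1) by auto
 then obtain u where u: "is_unit u" "a = u * b" by (rule dvd_antisym_unit)
 show ?thesis by (rule that[OF u]) (use u assms(2) in \<open>simp add: st_mult st_unit\<close>)
qed

text \<open>Indices at intermediate levels are computed along parametrizations there, obtained as
  images of the one at the final point.\<close>

lemma gp_st_sep: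
 assumes p0: "p0 : Si Un Sd" and p: "p : set bq Un divisor bq" and nu: "~ is_unit (st p (f p0))"
 shows "\<exists>U V. gp (st p (f p0)) U V"
proof -
 have "(\<exists>r. p0 = p @ r) \<or> (\<exists>r. p = p0 @ r)" using pushes_st_other[OF push[OF p0]] nu by blast
 then obtain r where r: "p0 = p @ r" using divisor_not_prefix[OF bs final[OF p0] p] by auto
 obtain U V where "gp (g p0) U V" using sep_props(2)[OF p0] by blast
 moreover have "pushes r (g p0) (st p (f p0))" using pushes_st[of p r] push[OF p0] r by simp
 ultimately show ?thesis using gp_pushes[OF sep_props(1)[OF p0]] by blast
qed

lemma branch_component: "cpt q p e ==> branch (crv e)"
proof -
 have x: "xgerm 0 = 0" using gc_xgerm[of 0] by (intro germ_eqI) auto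
 have "graph gX gY" "graph gY gX"
  unfolding graph_def by (intro exI[of _ 0] conjI; simp add: x)+
 hence "one_dimensional gX" "one_dimensional gY" using graph_one_dim by blast+
 moreover assume "cpt q p e"
 ultimately show ?thesis using branch_iff[OF prime_component] component_XY by blast
qed

lemma st1_component:
 assumes "cpt q p e"
 shows "is_unit (st1 d e) \<or> st1 d e = e"
proof -
 have X: "st1 (Sl c) gX = 1" "st1 Vt gY = 1" for c
  using st1_eqI[of "Sl c" gX 1 1] prime_X
  by auto
 have V: "st1 Vt gX = gX"
  using st1_eqI[of Vertical gX 1 gX] by (simp add: Y_dvd_iff gc_X mult.commute del: st1.simps)
 have S: "st1 (Sl c) gY = gY + cst c" for c
 proof -
  have "gc (gY + cst c) 0 1 ~= 0" by (simp add: gc_Y gc_const)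
  hence "~ gX dvd gY + cst c" by (auto simp: X_dvd_iff)
  thus ?thesis using st1_eqI[of "Sl c" gY 1 "gY + cst c"] by simp
 qed
 have "is_unit (gY + cst c)" if "c ~= 0" for c using that by (simp add: is_unit_iff)
 thus ?thesis using component_XY[OF assms] X V S by (cases d) (auto)
qed

lemma local_branch_cases:
 assumes S: "S : local_branches trip j p" and p: "p : set bq Un divisor bq"
 obtains h where "S = crv h" "branch S" "prm h" "\<exists>U V. gp h U V" "h dvd wdg (stf th p) h"
  "(\<exists>p0 \<in> Si Un Sd. \<exists>u. is_unit u & h = u * st p (f p0)) \<or> (\<exists>q. q ~: dc & cpt q p h)"
proof -
 consider p0 where "p0 : Si Un Sd" "strict_branch p (crv (f p0)) S"
  | q e where "q ~: dc" "cpt q p e" "S = crv e"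
  using S unfolding local_branches_def seps_trip by (auto simp: trip_def)
 thus ?thesis
 proof cases
  case 1
  obtain h f' where h: "prm h" "nonexc p h" "S = crv h" "crv (f p0) = crv f'" "pushes p h f'"
   using strict_branch_push[OF sep_branch(2)[OF 1(1)] 1(2)] .
  obtain u where u: "is_unit u" "f' = u * f p0" "st p f' = pull p u * st p (f p0)"
   using st_same_curve[OF h(4)[symmetric] sep_branch(3)[OF 1(1)]] .
  have hs: "h = pull p u * st p (f p0)" using u(3) pushes_st_eq[OF h(5)] by simp
  have uu: "is_unit (pull p u)" using u(1) by simp
  have nu: "~ is_unit (st p (f p0))" using h(1) hs uu by (auto simp: prime_elem_def)
  have "f p0 dvd wdg th (f p0)"
   using invariant_along[OF ad_co(1) sep_props(1)[OF 1(1)] push[OF 1(1)]] ad_sep(1)[OF 1(1)] by simp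
  hence "f' dvd wdg th f'" using wedge_unit_dvd[OF u(1)] u(2) by simp
  hence inv: "h dvd wdg (stf th p) h" using invariant_along[OF ad_co(1) h(1,5)] by simp
  have gph: "\<exists>U V. gp h U V" using gp_st_sep[OF 1(1) p nu] gp_unit[OF _ uu] hs by metis
  have "branch S" using 1(2) by (simp add: strict_branch_def)
  thus ?thesis using that[OF h(3) _ h(1) gph inv] 1(1) uu hs by blast
 next
  case 2
  have b: "branch S" using branch_component[OF 2(2)] 2(3) by simp
  have i: "e dvd wdg (stf th p) e" using ad_component_invariant[OF p] 2(1,2) by metis
  show ?thesis by (rule that[OF 2(3) b prime_component[OF 2(2)] gp_component[OF 2(2)] i]) (use 2 in metis)
 qed
qed

text \<open>To apply \<open>cs_blowup\<close>, a parametrization of the transformed branch must be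
  at hand: it comes from the final point for a separatrix and from a coordinate axis for a
  component.\<close>

lemma rule_blowup:
 assumes p: "p : set bq" and S: "S : local_branches trip j p" and S': "strict_branch [d] S S'"
 shows "csi (stf th (p @ [d])) S' = csi (stf th p) S - real (curve_mult S) ^ 2"
proof -
 have pN: "p : set bq Un divisor bq" using p by simp
 obtain h where h: "S = crv h" "branch S" "prm h" "h dvd wdg (stf th p) h"
  and c: "(\<exists>p0 \<in> Si Un Sd. \<exists>u. is_unit u & h = u * st p (f p0)) \<or> (\<exists>q. q ~: dc & cpt q p h)"
  using local_branch_cases[OF S pN] by metis
 obtain g' f' where g': "prm g'" "S' = crv g'" "S = crv f'" "pushes [d] g' f'"
  using strict_branch_push[OF h(2) S'] by metis
 then obtain k where k: "push1 d k g' f'" by auto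
 have h0: "h ~= 0" using h(3) by auto
 obtain u where u: "is_unit u" "f' = u * h" "st [d] f' = pull [d] u * st [d] h"
  using st_same_curve[of f' h "[d]"] g'(3) h(1) h0 by auto
 have f0: "f' ~= 0" "st1 d f' = g'" "vord f' = k" using k by (auto simp: push1_def simp del: st1.simps)
 have gs: "g' = pull1 d u * st1 d h" using u(3) f0 by simp
 have uu: "is_unit (pull1 d u)" using u(1) by simp
 have nu: "~ is_unit (st1 d h)" using g'(1) gs uu by (auto simp: prime_elem_def is_unit_mult_iff simp del: st1.simps)
 have "\<exists>U V. gp (st1 d h) U V"
  using c
 proof
  assume "\<exists>p0 \<in> Si Un Sd. \<exists>u. is_unit u & h = u * st p (f p0)"
  then obtain p0 v where v: "p0 : Si Un Sd" "is_unit v" "h = v * st p (f p0)" by blast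
  have s: "st1 d h = pull1 d v * st (p @ [d]) (f p0)"
   using v sep_branch(3)[OF v(1)] by (simp add: st1_mult st1_unit st_append del: st1.simps)
  have pd: "p @ [d] : set bq Un divisor bq" using p divisor_iff[OF bs] by blast
  have "~ is_unit (st (p @ [d]) (f p0))" using nu s v(2) by auto
  then obtain U V where "gp (st (p @ [d]) (f p0)) U V" using gp_st_sep[OF v(1) pd] by blast
  from gp_unit[OF this, of "pull1 d v"] show ?thesis using s v(2) by auto
 next
  assume "\<exists>q. q ~: dc & cpt q p h"
  thus ?thesis using st1_component[of _ p h d] gp_component[of _ p h] nu by metis
 qed
 then obtain U V where "gp (st1 d h) U V" by blast
 from gp_unit[OF this uu] have gg: "gp g' U V" using gs by simp
 obtain m where m: "m ~= 0" "plf [d] (stf th p) = scl m (stf th (p @ [d]))"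
  using strict_step[OF ad_co(1)] .
 have "f' dvd wdg (stf th p) f'" using h(4) wedge_unit_dvd[OF u(1)] u(2) by simp
 from cs_blowup[OF k g'(1) gg ad_co(2) this m(2)]
 show ?thesis using g' f0 by (simp add: curve_mult_eq)
qed

lemma final_singular_branches:
 assumes p: "p : divisor bq" "sng (stf th p)"
 obtains S T where "S ~= T" "local_branches trip (length bq) p = {S, T}" "csi (stf th p) T ~= 0"
  "~ pos_rat (csi (stf th p) T)" "csi (stf th p) S = 1 / csi (stf th p) T"
proof -
 have pN: "p : set bq Un divisor bq" using p by simp
 obtain q e k where k: "cpt q p e" "q ~: dc" "prm k" "\<exists>U V. gp k U V" "~ e dvd k"
  "k dvd wdg (stf th p) k" "k = g p & p : Si \<or> (\<exists>q'. q' ~: dc & cpt q' p k)"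
  "csi (stf th p) (crv k) ~= 0" "~ pos_rat (csi (stf th p) (crv k))"
  "csi (stf th p) (crv e) = 1 / csi (stf th p) (crv k)"
  "!!h. prm h ==> h dvd wdg (stf th p) h ==> crv h = crv e \<or> crv h = crv k"
  by (rule ad_singular_axes[OF p]) blast
 have comp: "crv e' : local_branches trip (length bq) p" if "q' ~: dc" "cpt q' p e'" for q' e'
  using that comp_centre[OF bs pN] by (auto simp: local_branches_def trip_def component_at_iff)
 have "crv k : local_branches trip (length bq) p"
  using k(7)
 proof
  assume a: "k = g p & p : Si"
  hence "strict_branch p (crv (f p)) (crv k)" using sep_branch(6)[of p] by simp
  thus ?thesis unfolding local_branches_def seps_trip using a by blast
 qed (use comp in blast)
 moreover have "local_branches trip (length bq) p \<subseteq> {crv e, crv k}"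
 proof
  fix S assume "S : local_branches trip (length bq) p"
  then obtain h where h: "S = crv h" "prm h" "h dvd wdg (stf th p) h"
   by (rule local_branch_cases[OF _ pN])
  show "S : {crv e, crv k}" using k(11)[OF h(2,3)] h(1) by simp
 qed
 ultimately have "local_branches trip (length bq) p = {crv e, crv k}" using comp[OF k(2,1)] by blast
 moreover have "crv e ~= crv k" using k(5) by auto
 ultimately show ?thesis using that k(8-10) by blast
qed

lemma rule_regular:
 assumes p: "p : divisor bq" "~ sng (stf th p)"
 shows "S : local_branches trip j p ==> csi (stf th p) S = 0"
  "S : local_branches trip j p ==> T : local_branches trip j p ==> S = T"
proof -
 have pN: "p : set bq Un divisor bq" using p by simp
 { fix S assume "S : local_branches trip j p"
  then obtain h U V where h: "S = crv h" "prm h" "gp h U V" "h dvd wdg (stf th p) h"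
   using local_branch_cases[OF _ pN] by metis
  note cs_regular[OF p(2) h(2-4)]
  moreover have "S = T" if T: "T : local_branches trip j p" for T
  proof -
   obtain h' where h': "T = crv h'" "prm h'" "h' dvd wdg (stf th p) h'"
    using local_branch_cases[OF T pN] by metis
   have "h dvd h'" by (rule regular_unique[OF p(2) h(2-4) _ h'(3)]) (use h'(2) in \<open>auto\<close>)
   thus ?thesis using prime_dvd_imp_dvd[OF h(2) h'(2)] h(1) h'(1) by (simp add: curve_of_eq_iff)
  qed
  ultimately have "csi (stf th p) S = 0 & (T : local_branches trip j p --> S = T)" for T
   using h(1) by blast }
 thus "S : local_branches trip j p ==> csi (stf th p) S = 0"
  "S : local_branches trip j p ==> T : local_branches trip j p ==> S = T" by blast+
qed

lemma trip_index_rules: "index_rules trip"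
proof -
 have c: "centres trip = bq" and i: "ind trip = (%j p S. csi (stf th p) S)" by (simp_all add: trip_def)
 have r1: "\<forall>j<length bq. \<forall>S\<in>local_branches trip j (bq ! j). \<forall>d S'. strict_branch [d] S S' -->
   csi (stf th (bq ! j @ [d])) S' = csi (stf th (bq ! j)) S - real (curve_mult S) ^ 2"
  using rule_blowup[OF nth_mem] by blast
 have r3: "csi (stf th p) S = 0"
  if p: "p : divisor bq" and S: "local_branches trip (length bq) p = {S} & curve_mult S = 1" for p S
 proof (cases "sng (stf th p)")
  case True
  obtain S1 T1 where "S1 ~= T1" "local_branches trip (length bq) p = {S1, T1}" by (rule final_singular_branches[OF p True])
  thus ?thesis using S by simp
 next
  case False
  show ?thesis by (rule rule_regular(1)[OF p False, of _ "length bq"]) (use S in simp)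
 qed
 have r4: "csi (stf th p) S\<^sub>1 ~= 0 & ~ pos_rat (csi (stf th p) S\<^sub>1) &
   csi (stf th p) S\<^sub>2 = 1 / csi (stf th p) S\<^sub>1"
  if p: "p : divisor bq" and S: "S\<^sub>1 : local_branches trip (length bq) p" "S\<^sub>2 : local_branches trip (length bq) p" "S\<^sub>1 ~= S\<^sub>2" for p S\<^sub>1 S\<^sub>2
 proof (cases "sng (stf th p)")
  case True
  obtain S1 T1 where a: "S1 ~= T1" "local_branches trip (length bq) p = {S1, T1}" "csi (stf th p) T1 ~= 0"
   "~ pos_rat (csi (stf th p) T1)" "csi (stf th p) S1 = 1 / csi (stf th p) T1"
   by (rule final_singular_branches[OF p True])
  have "S\<^sub>1 = S1 & S\<^sub>2 = T1 \<or> S\<^sub>1 = T1 & S\<^sub>2 = S1" using S a(2) by auto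
  thus ?thesis
  proof (elim disjE conjE)
   assume "S\<^sub>1 = S1" "S\<^sub>2 = T1"
   thus ?thesis using a(3,4) by (simp only: a(5)) (simp add: pos_rat_inverse)
  next
   assume "S\<^sub>1 = T1" "S\<^sub>2 = S1"
   thus ?thesis using a(3,4) by (simp only: a(5)) simp
  qed
 next
  case False
  thus ?thesis using rule_regular(2)[OF p False S(1,2)] S(3) by simp
 qed
 show ?thesis unfolding index_rules_def Let_def c i
  by (intro conjI r1) (use r3 r4 in blast)+
qed

text \<open>Minimality among reductions gives minimality for the conjunction with the realization
  properties, since \<open>bq\<close> has them too.\<close>

lemma trip_associated:
 assumes red: "real_reduction th bq" shows "associated_triplet th trip"
proof -
 have [simp]: "centres trip = bq" "dic trip = dc" "sep_dic trip = (%p. crv (f p)) ` Sd"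
  "sep_iso trip = (%p. crv (f p)) ` Si" "ind trip j p S = csi (stf th p) S" for j p S by (simp_all add: trip_def)
 have m: "S : (%p. crv (f p)) ` Sd <-> (\<exists>q\<in>dc. meets_component bq S q)" if "S : seps trip" for S
 proof -
  obtain p where p: "p : Si Un Sd" "S = crv (f p)" using \<open>S : seps trip\<close> unfolding seps_trip by blast
  have "S : (%p. crv (f p)) ` Sd <-> p : Sd" using p sep_inj by (auto simp: inj_on_def)
  moreover obtain q e where "lone p q e" "q : dc <-> p : Sd" using sep[OF p(1)] by blast
  ultimately show ?thesis using meets_iff[OF p(1)] p(2) by (auto simp: lone_def)
 qed
 have min: "minimal_seq (%\<rho>. reduces th \<rho> & realizes_kappa \<rho> dc & realizes_eps \<rho> (seps trip)) bq"
  using red dc realizes unfolding real_reduction_def minimal_seq_def seps_trip realizes_kappa_def by blast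
 have "real_qd_triplet (reduces th) trip"
  unfolding real_qd_triplet_def
 proof (intro conjI)
  show "finite (seps trip)" "\<forall>S\<in>seps trip. branch S" using fin sep_branch(2) by (auto simp: seps_trip)
  show "sep_dic trip \<inter> sep_iso trip = {}" using disj sep_inj by (auto simp: inj_on_def)
  show "realizes_eps (centres trip) (seps trip)" using realizes by (simp add: seps_trip)
 qed (use bs dc m min trip_index_rules in auto)
 thus ?thesis
  unfolding associated_triplet_def using red ad_noninvariant ad_isolated ad_dicritical by (auto simp: seps_trip)
qed

end

end

subsection \<open>Interlacing poles\<close>

fun altsum :: "real list => real => real" where
 "altsum [] c = 0"
| "altsum (x # xs) c = 1 / (c - x) - altsum xs c"

text \<open>To the left of all points the terms alternate in sign with decreasing absolute
  value.\<close>

lemma altsum_right: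
 "sorted_wrt (<) (x # xs) ==> c < x ==> 1 / (c - x) \<le> altsum (x # xs) c & altsum (x # xs) c < 0"
proof (induction xs arbitrary: x)
 case (Cons y ys)
 hence i: "1 / (c - y) \<le> altsum (y # ys) c" "altsum (y # ys) c < 0" by auto
 have "1 / (c - x) < 1 / (c - y)" using Cons.prems by (simp add: field_simps)
 thus ?case using i by simp
qed simp

text \<open>The dichotomy is what survives the induction. If the tail is negative, the sum exceeds
  1/(c - x); if the tail is at least 1/(c - y), which is larger than 1/(c - x), the sum is negative.
  Neither alternative allows 0.\<close>

lemma altsum_left:
 "sorted_wrt (<) (x # xs) ==> x < c ==> c ~: set xs ==> altsum (x # xs) c < 0 \<or> 1 / (c - x) \<le> altsum (x # xs) c"
proof (induction xs arbitrary: x)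
 case (Cons y ys)
 show ?case
 proof (cases "y < c")
  case True
  hence "altsum (y # ys) c < 0 \<or> 1 / (c - y) \<le> altsum (y # ys) c" using Cons by auto
  moreover have "1 / (c - x) < 1 / (c - y)" using Cons.prems True by (simp add: field_simps)
  ultimately show ?thesis by auto
 next
  case False
  hence "altsum (y # ys) c < 0" using altsum_right[of y ys c] Cons.prems by auto
  thus ?thesis by simp
 qed
qed simp

lemma altsum_nonzero:
 assumes "sorted_wrt (<) (x # xs)" "c ~: set (x # xs)" shows "altsum (x # xs) c ~= 0"
proof (cases "x < c")
 case True
 hence "0 < 1 / (c - x)" by simp
 moreover have "altsum (x # xs) c < 0 \<or> 1 / (c - x) \<le> altsum (x # xs) c"
  by (rule altsum_left[OF assms(1) True]) (use assms(2) in simp)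
 ultimately show ?thesis by linarith
next
 case False
 hence "c < x" using assms(2) by auto
 thus ?thesis using altsum_right[OF assms(1)] by fastforce
qed

text \<open>The next element of B is placed halfway to the following element of the list, or beyond
  its last one; so the merged list alternates and has B at both ends.\<close>

lemma interlace_list:
 "sorted_wrt (<) (b # as) ==> \<exists>B xs. finite B & card B = Suc (length as) & B \<inter> set as = {} & (\<forall>x\<in>B. b \<le> x) &
  sorted_wrt (<) (b # xs) & set (b # xs) = B Un set as &
  (\<forall>c. altsum (b # xs) c = (\<Sum>x\<in>B. 1 / (c - x)) - (\<Sum>a\<in>set as. 1 / (c - a)))"
proof (induction as arbitrary: b)
 case Nil
 show ?case by (rule exI[of _ "{b}"], rule exI[of _ "[]"]) simp
next
 case (Cons a as)
 define b' where "b' = (if as = [] then a + 1 else (a + hd as) / 2)"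
 have ab: "b < a" "a < b'" "sorted_wrt (<) (b' # as)"
  using Cons.prems by (cases as; force simp: b'_def)+
 obtain B xs where B: "finite B" "card B = Suc (length as)" "B \<inter> set as = {}" "\<forall>x\<in>B. b' \<le> x"
  "sorted_wrt (<) (b' # xs)" "set (b' # xs) = B Un set as"
  "\<forall>c. altsum (b' # xs) c = (\<Sum>x\<in>B. 1 / (c - x)) - (\<Sum>a\<in>set as. 1 / (c - a))"
  using Cons.IH[OF ab(3)] by blast
 have n: "b ~: B" "a ~: B" "a ~: set as" "b ~: set as" using B(4) ab by force+
 have lt: "\<forall>x\<in>set (b' # xs). a < x" using B(5) ab(2) by force
 show ?case
 proof (intro exI conjI allI)
  show "finite (insert b B)" "card (insert b B) = Suc (length (a # as))" "insert b B \<inter> set (a # as) = {}"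
   using B n ab(1) by auto
  show "\<forall>x\<in>insert b B. b \<le> x" using B(4) ab by force
  show "sorted_wrt (<) (b # a # b' # xs)" using B(5) ab by force
  show "set (b # a # b' # xs) = insert b B Un set (a # as)" using B(6) by auto
  show "altsum (b # a # b' # xs) c = (\<Sum>x\<in>insert b B. 1 / (c - x)) - (\<Sum>a\<in>set (a # as). 1 / (c - a))" for c
   using B(1,7) n by simp
 qed
qed

lemma interlace:
 fixes A :: "real set"
 assumes "finite A"
 obtains B where "finite B" "card B = Suc (card A)" "A \<inter> B = {}"
  "!!c. c ~: A ==> c ~: B ==> (\<Sum>a\<in>A. 1 / (c - a)) - (\<Sum>b\<in>B. 1 / (c - b)) ~= 0"
proof -
 define as where "as = sorted_list_of_set A"
 have as: "set as = A" "sorted_wrt (<) as" "length as = card A" using assms by (auto simp: as_def)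
 \<comment> \<open>Inserting 0 keeps the minimum defined when A is empty.\<close>
 define b where "b = Min (insert 0 A) - 1"
 have "b < a" if "a : A" for a
 proof -
  have "Min (insert 0 A) \<le> a" by (rule Min_le) (use assms that in auto)
  thus ?thesis unfolding b_def by simp
 qed
 hence s: "sorted_wrt (<) (b # as)" using as by simp
 obtain B xs where B: "finite B" "card B = Suc (length as)" "B \<inter> set as = {}"
  "sorted_wrt (<) (b # xs)" "set (b # xs) = B Un set as"
  "\<forall>c. altsum (b # xs) c = (\<Sum>x\<in>B. 1 / (c - x)) - (\<Sum>a\<in>set as. 1 / (c - a))"
  using interlace_list[OF s] by blast
 show ?thesis
 proof (rule that[of B])
  show "(\<Sum>a\<in>A. 1 / (c - a)) - (\<Sum>b\<in>B. 1 / (c - b)) ~= 0" if "c ~: A" "c ~: B" for c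
  proof -
   have "c ~: set (b # xs)" using B(5) as(1) that by blast
   from altsum_nonzero[OF B(4) this] show ?thesis using B(6)[rule_format, of c] as(1) by simp
  qed
 qed (use B as in auto)
qed

text \<open>Indices are added in order of decreasing length. The new one is the shortest, so its
  unknown does not enter the earlier equations and is determined by its own.\<close>

lemma triangular_system:
 fixes m :: "'a list => 'a list => real"
 assumes "finite Q"
 shows "(\<forall>q\<in>Q. m q q ~= 0) ==> (\<forall>q\<in>Q. \<forall>q'\<in>Q. q ~= q' & length q' \<le> length q --> m q q' = 0) ==>
  \<exists>s. \<forall>q\<in>Q. (\<Sum>q'\<in>Q. s q' * m q q') = a q"
 using assms
proof (induction Q rule: finite_ranking_induct[where f = "%q. - int (length q)"])
 case (insert q0 Q)
 show ?case
 proof (cases "q0 : Q")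
  case True
  thus ?thesis using insert by (simp add: insert_absorb)
 next
  case False
  obtain s where s: "\<forall>q\<in>Q. (\<Sum>q'\<in>Q. s q' * m q q') = a q" using insert by auto
  define t where "t = (a q0 - (\<Sum>q'\<in>Q. s q' * m q0 q')) / m q0 q0"
  define s' where "s' = s(q0 := t)"
  have e: "(\<Sum>q'\<in>insert q0 Q. s' q' * m q q') = t * m q q0 + (\<Sum>q'\<in>Q. s q' * m q q')" for q
   using insert.hyps(1) False by (auto simp: s'_def intro!: sum.cong)
  have "(\<Sum>q'\<in>insert q0 Q. s' q' * m q q') = a q" if "q : insert q0 Q" for q
  proof (cases "q = q0")
   case True
   thus ?thesis using insert.prems(1) by (simp add: e t_def)
  next
   case False
   hence "q : Q" "m q q0 = 0" using that insert.hyps(2) insert.prems(2) by auto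
   thus ?thesis using s by (simp add: e)
  qed
  thus ?thesis by blast
 qed
qed simp

subsection \<open>Definite quadratic germs\<close>

definition qd :: "real => germ" where "qd c = gX ^ 2 + cst c * gY ^ 2"

lemma gc_qd: "gc (qd c) i j = (if i = 2 & j = 0 then 1 else if i = 0 & j = 2 then c else 0)"
 using gc_X_power_mult[of 2 1 i j] gc_Y_power_mult[of 2 1 i j] by (auto simp: qd_def gc_1 split: if_splits)

lemma qd_neq_0 [simp]: "qd c ~= 0"
 using gc_qd[of c 2 0] by auto

lemma vord_qd [simp]: "vord (qd c) = 2"
 by (rule vord_eqI[of _ _ 2 0]) (auto simp: gc_qd)

text \<open>A proper factorization would split the definite form x^2 + c y^2 into real linear forms;
  comparing coefficients exhibits c as minus a square.\<close>

lemma prime_qd: assumes c: "0 < c" shows "prm (qd c)"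
proof (rule irreducible_prime_germ, rule irreducibleI)
 show "qd c ~= 0" by simp
 show "~ is_unit (qd c)" by (simp add: is_unit_iff gc_qd)
 fix a b assume ab: "qd c = a * b"
 show "is_unit a \<or> is_unit b"
 proof (rule ccontr)
  assume "~ ?thesis"
  hence z: "gc a 0 0 = 0" "gc b 0 0 = 0" by (auto simp: is_unit_iff)
  have s: "{0..2::nat} = {0, 1, 2}" "{0..Suc 0} = {0, 1}" by auto
  have "gc a 1 0 * gc b 1 0 = 1" using gc_qd[of c 2 0] z by (simp add: ab gc_mult numeral_2_eq_2)
  moreover have "gc a 0 1 * gc b 0 1 = c" using gc_qd[of c 0 2] z by (simp add: ab gc_mult numeral_2_eq_2)
  moreover have m: "gc a 0 1 * gc b 1 0 + gc a 1 0 * gc b 0 1 = 0" using gc_qd[of c 1 1] z by (simp add: ab gc_mult)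
  moreover have "(gc a 1 0 * gc b 0 1) * (gc a 0 1 * gc b 1 0) = (gc a 1 0 * gc b 1 0) * (gc a 0 1 * gc b 0 1)"
   by simp
  ultimately moreover have "gc a 0 1 * gc b 1 0 = - (gc a 1 0 * gc b 0 1)" by simp
  ultimately have "- ((gc a 1 0 * gc b 0 1) ^ 2) = c" by (simp only: power2_eq_square mult_minus_right)
  thus False using c by auto
 qed
qed

text \<open>A definite form has no real tangent direction.\<close>

lemma st1_qd: assumes c: "0 < c" shows "is_unit (st1 d (qd c))"
proof (cases d)
 case (Slope b)
 define h where "h = 1 + cst c * (gY + cst b) ^ 2"
 have "gc h 0 0 > 0" using c by (simp add: h_def add_pos_nonneg)
 hence h: "is_unit h" by (simp add: is_unit_iff)
 have "pull1 d (qd c) = gX ^ 2 * h"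
  by (simp add: Slope qd_def h_def power2_eq_square alg)
 thus ?thesis using st1_eqI[of d "qd c" 2 h] h Slope at0_not_ex_dvd[of h d] by (simp add: is_unit_iff del: st1.simps pull1.simps)
next
 case Vertical
 define h where "h = gX ^ 2 + cst c"
 have h: "is_unit h" using c by (simp add: h_def is_unit_iff)
 have "pull1 d (qd c) = gY ^ 2 * h"
  by (simp add: Vertical qd_def h_def power2_eq_square alg)
 thus ?thesis using st1_eqI[of d "qd c" 2 h] h Vertical at0_not_ex_dvd[of h d] by (simp add: is_unit_iff del: st1.simps pull1.simps)
qed

text \<open>This tells apart the two families of pairs based at one centre.\<close>

lemma qd_unit_multiple:
 assumes "is_unit u" "qd c = u * qd c'" shows "c = c'"
proof -
 have s: "{0..2::nat} = {0, 1, 2}" by auto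
 have "gc (u * qd c') 2 0 = gc u 0 0" "gc (u * qd c') 0 2 = c' * gc u 0 0" by (simp_all add: gc_mult s gc_qd)
 hence "gc u 0 0 = 1" "c' * gc u 0 0 = c" using gc_qd[of c 2 0] gc_qd[of c 0 2] unfolding assms(2) by auto
 thus ?thesis by simp
qed

lemma pair_exists:
 assumes c: "0 < c" shows "\<exists>f u. is_unit u & pushes q (u * qd c) f"
proof -
 have n: "~ qd c dvd gX" "~ qd c dvd gY"
 proof -
  have "~ qd c dvd a" if "a ~= 0" "vord a = 1" for a
  proof
   assume "qd c dvd a"
   then obtain b where "a = qd c * b" by blast
   thus False using that vord_mult[of "qd c" b] by auto
  qed
  thus "~ qd c dvd gX" "~ qd c dvd gY" by auto
 qed
 have "nonexc q (qd c)"
  by (cases "q = []") (use n prime_qd[OF c] nonexc_comp in \<open>auto simp: nonexc_def\<close>)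
 thus ?thesis using pushes_exists[OF prime_qd[OF c]] by blast
qed

text \<open>Invariance moves up to q, where the curve is a definite form up to a unit. A reduction
  cannot have such a point on its final divisor.\<close>

lemma pair_bad:
 assumes c: "0 < c" and co: "coprime (fst om) (snd om)" and p: "is_unit u" "pushes q (u * qd c) f" and inv: "f dvd wdg om f"
 shows "sng (stf om q) & ~ smp (stf om q)"
proof -
 have "prm (u * qd c)" using p(1) prime_qd[OF c] by (simp add: prime_elem_mult_unit_left)
 hence "u * qd c dvd wdg (stf om q) (u * qd c)" using invariant_along[OF co _ p(2)] inv by simp
 hence "qd c dvd wdg (stf om q) (qd c)" using wedge_unit_dvd[OF p(1)] by simp
 from definite_not_invariant[OF this qd_def c] show ?thesis .
qed

text \<open>As x does not divide the dy-coefficient of the strict transform, the factor m of the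
  pull-back is divisible by x and then by x^2. So the coefficients vanish at q and the linear part
  of \<omega> is a multiple of x dy - y dx: the eigenvalues coincide.\<close>

lemma dicritical_bad:
 assumes co: "coprime (fst om) (snd om)" and ndvd: "~ gX dvd wdg (stf om (q @ [Sl c])) gX"
 shows "sng (stf om q) & ~ smp (stf om q)"
proof -
 define P Q where "P = fst (stf om q)" and "Q = snd (stf om q)"
 define P1 Q1 where "P1 = fst (stf om (q @ [Sl c]))" and "Q1 = snd (stf om (q @ [Sl c]))"
 have nQ: "~ gX dvd Q1" using ndvd by (simp add: wedge_d_def Q1_def)
 obtain m where m: "m ~= 0" "plf [Sl c] (stf om q) = scl m (stf om (q @ [Sl c]))"
  using strict_step[OF co] .
 define t where "t = gY + cst c"
 have e: "psl c P + psl c Q * t = m * P1" "psl c Q * gX = m * Q1"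
  using arg_cong[OF m(2), of fst] arg_cong[OF m(2), of snd]
  by (simp_all add: pull_form_def P_def Q_def P1_def Q1_def t_def dx_mult dy_mult)
 have gct: "gc (a * t) i j = (if j = 0 then 0 else gc a i (j - 1)) + c * gc a i j" for a i j
  by (simp add: t_def distrib_left mult.commute[of _ gY] mult.commute[of _ "cst c"] gc_Y_mult)
 have "gX dvd m * Q1" unfolding e(2)[symmetric] by simp
 hence "gX dvd m" using nQ prime_X by (simp add: prime_elem_dvd_mult_iff)
 hence "gX dvd psl c P + psl c Q * t" unfolding e(1) by simp
 hence r: "gc (psl c P + psl c Q * t) 0 j = 0" for j by (simp add: X_dvd_iff)
 have q0: "gc Q 0 0 = 0" using r[of 1] by (simp add: gct gc_pull_slope_0)
 have p0: "gc P 0 0 = 0" using r[of 0] q0 by simp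
 have XP: "gX dvd psl c P" "gX dvd psl c Q" using p0 q0 by (auto simp: X_dvd_iff gc_pull_slope_0)
 then obtain P2 Q2 where P2: "psl c P = gX * P2" "psl c Q = gX * Q2" by blast
 have "gX ^ 2 dvd m * Q1" unfolding e(2)[symmetric] P2 by (simp add: power2_eq_square)
 hence "gX ^ 2 dvd m" using nQ prime_X prime_power_dvd_cancel[of gX Q1 2 m] by simp
 then obtain n where "m = gX ^ 2 * n" by blast
 hence "gX * (P2 + Q2 * t) = gX * (gX * n * P1)" using e(1) by (simp add: P2 power2_eq_square alg)
 hence "gX dvd P2 + Q2 * t" by simp
 hence r2: "gc (P2 + Q2 * t) 0 j = 0" for j by (simp add: X_dvd_iff)
 have row1: "gc a 0 j = gc b 1 0 * (if j = 0 then 1 else 0) + gc b 0 1 * ((if j = 1 then 1 else 0) + (if j = 0 then c else 0))"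
  if "psl c b = gX * a" for a b j
 proof -
  have "gc a 0 j = gc (psl c b) 1 j" using that by (simp add: gc_X_mult)
  also have "\<dots> = gc b 1 0 * (if j = 0 then 1 else 0) + gc b 0 1 * ((if j = 1 then 1 else 0) + (if j = 0 then c else 0))"
   by (simp add: gc_pull_slope)
  finally show ?thesis .
 qed
 note rP = row1[OF P2(1)] and rQ = row1[OF P2(2)]
 have Q01: "gc Q 0 1 = 0" using r2[of 2] by (simp add: gct rP rQ)
 have PQ: "gc P 0 1 = - gc Q 1 0" using r2[of 1] Q01 by (simp add: gct rP rQ)
 have "gc t 0 0 = c" by (simp add: t_def)
 hence P10: "gc P 1 0 = 0" using r2[of 0] Q01 PQ by (simp add: rP rQ)
 have "~ smp (stf om q)"
 proof
  assume "smp (stf om q)"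
  then obtain l k where l: "l + k = 2 * gc Q 1 0" "l * k = gc Q 1 0 ^ 2" "l ~= 0" "~ pos_rat (k / l)"
   using PQ P10 by (auto simp: simple_sing_def lin_eigenvalues_alt P_def[symmetric] Q_def[symmetric] power2_eq_square)
  have "(l - k) ^ 2 = (l + k) ^ 2 - 4 * (l * k)" by (simp add: power2_eq_square alg)
  hence "l = k" using l(1,2) by simp
  thus False using l(3,4) by (simp add: pos_rat_def)
 qed
 thus ?thesis using p0 q0 by (simp add: singular_form_def P_def Q_def)
qed


section \<open>Logarithmic forms\<close>

text \<open>The sum of w_i d(ph_i)/ph_i multiplied by the product of all ph_i. The index set is
  arbitrary; the poles are numbered only in \<open>fam_log\<close>.\<close>

definition lnum :: "'i set => ('i => real) => ('i => germ) => form" where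
 "lnum I w ph = ((\<Sum>i\<in>I. cst (w i) * (\<Prod>j\<in>I - {i}. ph j) * Dx (ph i)),
        (\<Sum>i\<in>I. cst (w i) * (\<Prod>j\<in>I - {i}. ph j) * Dy (ph i)))"

text \<open>One multiplier z that makes all logarithmic derivatives regular turns the cleared form
  back into a weighted sum.\<close>

lemma lnum_clear:
 assumes "finite I" "!!i. i : I ==> z * d i = ph i * (c i :: germ)"
 shows "z * (\<Sum>i\<in>I. cst (w i) * (\<Prod>j\<in>I - {i}. ph j) * d i) = (\<Prod>j\<in>I. ph j) * (\<Sum>i\<in>I. cst (w i) * c i)"
 unfolding sum_distrib_left
proof (rule sum.cong[OF refl])
 fix i assume i: "i : I"
 have "z * (cst (w i) * (\<Prod>j\<in>I - {i}. ph j) * d i) = cst (w i) * (\<Prod>j\<in>I - {i}. ph j) * (z * d i)" by simp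
 also have "\<dots> = ((\<Prod>j\<in>I - {i}. ph j) * ph i) * (cst (w i) * c i)" unfolding assms(2)[OF i] by simp
 also have "(\<Prod>j\<in>I - {i}. ph j) * ph i = (\<Prod>j\<in>I. ph j)" using prod.remove[OF assms(1) i, of ph] by simp
 finally show "z * (cst (w i) * (\<Prod>j\<in>I - {i}. ph j) * d i) = (\<Prod>j\<in>I. ph j) * (cst (w i) * c i)" .
qed

lemma pull_lnum: "plf p (lnum I w ph) = lnum I w (%i. pull p (ph i))"
proof -
 have a: "pull p (\<Sum>i\<in>I. cst (w i) * (\<Prod>j\<in>I - {i}. ph j) * D i) * a + pull p (\<Sum>i\<in>I. cst (w i) * (\<Prod>j\<in>I - {i}. ph j) * E i) * b
  = (\<Sum>i\<in>I. cst (w i) * (\<Prod>j\<in>I - {i}. pull p (ph j)) * (pull p (D i) * a + pull p (E i) * b))" for D E a b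
  by (simp add: pull_sum pull_prod sum_distrib_right sum.distrib[symmetric] distrib_left mult.assoc)
 show ?thesis unfolding lnum_def pull_form_def fst_conv snd_conv a chain_rule[of p "ph _"] ..
qed

lemma lnum_pole:
 assumes "finite I" "i : I"
 obtains A B where "fst (lnum I w ph) = cst (w i) * (\<Prod>j\<in>I - {i}. ph j) * Dx (ph i) + ph i * A"
  "snd (lnum I w ph) = cst (w i) * (\<Prod>j\<in>I - {i}. ph j) * Dy (ph i) + ph i * B"
proof -
 have s: "\<exists>A. (\<Sum>k\<in>I. cst (w k) * (\<Prod>j\<in>I - {k}. ph j) * D k) = cst (w i) * (\<Prod>j\<in>I - {i}. ph j) * D i + ph i * A" for D
 proof -
  have "ph i dvd cst (w k) * (\<Prod>j\<in>I - {k}. ph j) * D k" if "k : I - {i}" for k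
  proof -
   have "ph i dvd (\<Prod>j\<in>I - {k}. ph j)" by (rule dvd_prodI) (use assms that in auto)
   thus ?thesis by simp
  qed
  hence "ph i dvd (\<Sum>k\<in>I - {i}. cst (w k) * (\<Prod>j\<in>I - {k}. ph j) * D k)" by (rule dvd_sum)
  thus ?thesis unfolding sum.remove[OF assms] by auto
 qed
 show ?thesis
  using that unfolding lnum_def fst_conv snd_conv using s[of "%i. Dx (ph i)"] s[of "%i. Dy (ph i)"] by blast
qed

lemma lnum_invariant:
 assumes "finite I" "i : I" shows "ph i dvd wdg (lnum I w ph) (ph i)"
proof -
 obtain A B where A: "fst (lnum I w ph) = cst (w i) * (\<Prod>j\<in>I - {i}. ph j) * Dx (ph i) + ph i * A"
  and B: "snd (lnum I w ph) = cst (w i) * (\<Prod>j\<in>I - {i}. ph j) * Dy (ph i) + ph i * B"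
  by (rule lnum_pole[OF assms])
 have "wdg (lnum I w ph) (ph i) = ph i * (A * Dy (ph i) - B * Dx (ph i))"
  unfolding wedge_d_def A B by (simp add: alg)
 thus ?thesis by simp
qed

lemma prime_dvd_prod:
 assumes p: "prm (p :: germ)" shows "finite K ==> p dvd (\<Prod>j\<in>K. ph j) ==> \<exists>j\<in>K. p dvd ph j"
proof (induction K rule: finite_induct)
 case empty
 thus ?case using prime_elem_not_unit[OF p] by simp
next
 case (insert k K)
 hence "p dvd ph k \<or> p dvd (\<Prod>j\<in>K. ph j)" using prime_elem_dvd_mult_iff[OF p] by simp
 thus ?case using insert.IH by blast
qed

text \<open>Modulo ph_i only the i-th term survives. Its residue is nonzero, the other poles are not
  divisible by ph_i, and neither are both derivatives of ph_i.\<close>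

lemma lnum_pole_not_dvd:
 assumes I: "finite I" "i : I" and pr: "!!j. j : I ==> prm (ph j)" and n: "!!j. j : I ==> ph i dvd ph j ==> j = i" and w: "w i ~= 0"
  and h: "lnum I w ph = scl h om"
 shows "~ ph i dvd h"
proof
 assume "ph i dvd h"
 hence d: "ph i dvd fst (lnum I w ph)" "ph i dvd snd (lnum I w ph)" unfolding h by auto
 obtain A B where A: "fst (lnum I w ph) = cst (w i) * (\<Prod>j\<in>I - {i}. ph j) * Dx (ph i) + ph i * A"
  and B: "snd (lnum I w ph) = cst (w i) * (\<Prod>j\<in>I - {i}. ph j) * Dy (ph i) + ph i * B"
  by (rule lnum_pole[OF I])
 have pi: "prm (ph i)" using pr I by blast
 hence nu: "~ is_unit (ph i)" "ph i ~= 0" by auto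
 have c: "~ ph i dvd cst (w i)"
 proof
  assume "ph i dvd cst (w i)"
  moreover have "is_unit (cst (w i))" using w by (simp add: is_unit_iff)
  ultimately show False using nu(1) dvd_trans by blast
 qed
 have p: "~ ph i dvd (\<Prod>j\<in>I - {i}. ph j)"
 proof
  assume "ph i dvd (\<Prod>j\<in>I - {i}. ph j)"
  then obtain j where "j : I - {i}" "ph i dvd ph j" using prime_dvd_prod[OF pi, of "I - {i}" ph] I(1) by blast
  thus False using n by blast
 qed
 have "ph i dvd cst (w i) * (\<Prod>j\<in>I - {i}. ph j) * Dx (ph i)" "ph i dvd cst (w i) * (\<Prod>j\<in>I - {i}. ph j) * Dy (ph i)"
  using d unfolding A B by (simp_all add: dvd_add_left_iff)
 hence "ph i dvd Dx (ph i)" "ph i dvd Dy (ph i)" using c p pi by (auto simp: prime_elem_dvd_mult_iff)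
 thus False using not_both_derivatives[OF nu(2,1)] by blast
qed

definition fam_log :: "'i set => ('i => real) => ('i => germ) => (nat => 'i) => log_form" where
 "fam_log I w ph h = \<lparr>npoles = card I, res = (%n. w (h n)), pole = (%n. ph (h n)), reg = (0, 0)\<rparr>"

lemma fam_log_num:
 assumes "bij_betw h {..<card I} I"
 shows "log_num (fam_log I w ph h) = lnum I w ph" "log_den (fam_log I w ph h) = (\<Prod>i\<in>I. ph i)"
proof -
 have p: "(\<Prod>j\<in>{..<card I} - {i}. ph (h j)) = (\<Prod>j\<in>I - {h i}. ph j)" if "i < card I" for i
 proof (rule prod.reindex_bij_betw)
  have "bij_betw h ({..<card I} - {i}) (I - h ` {i})"
   by (rule bij_betw_DiffI[OF assms]) (use that in \<open>auto simp: bij_betw_apply[OF assms]\<close>)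
  thus "bij_betw h ({..<card I} - {i}) (I - {h i})" by simp
 qed
 have s: "(\<Sum>i<card I. cst (w (h i)) * (\<Prod>j\<in>{..<card I} - {i}. ph (h j)) * D (ph (h i))) =
   (\<Sum>i\<in>I. cst (w i) * (\<Prod>j\<in>I - {i}. ph j) * D (ph i))" for D
 using p sum.reindex_bij_betw[OF assms, of "%i. cst (w i) * (\<Prod>j\<in>I - {i}. ph j) * D (ph i)"] by auto
 show "log_num (fam_log I w ph h) = lnum I w ph" unfolding log_num_def lnum_def fam_log_def by (simp add: s)
 show "log_den (fam_log I w ph h) = (\<Prod>i\<in>I. ph i)"
  unfolding log_den_def fam_log_def using prod.reindex_bij_betw[OF assms, of ph] by simp
qed

section \<open>Orders of forms and faithfulness\<close>

definition ford :: "form => enat" where "ford om = min (germ_ord (fst om)) (germ_ord (snd om))"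

lemma ford_scale:
 assumes "h ~= 0" shows "ford (scl h om) = enat (vord h) + ford om"
proof -
 have "germ_ord (h * a) = enat (vord h) + germ_ord a" for a using assms by (simp add: germ_ord_eq vord_mult)
 moreover have "min (k + a) (k + b) = k + min a b" for k a b :: enat
  by (cases "a \<le> b") (auto simp: min_def add_left_mono intro: antisym)
 ultimately show ?thesis by (simp add: ford_def)
qed

text \<open>Orders are additive in the relation defining the transform, so faithfulness does not
  depend on how the transform is written as a quotient.\<close>

lemma one_faithful_transform:
 assumes t: "log_transform p \<eta> \<eta>'" and d: "log_den \<eta> ~= 0" "real_log_form \<eta>'"
  and o: "ford (plf p (log_num \<eta>)) + 1 = enat (vord (pull p (log_den \<eta>)))"
 shows "one_faithful \<eta>'"
proof -
 have d': "log_den \<eta>' ~= 0" using d(2) by (auto simp: log_den_def real_log_form_def)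
 have p0: "pull p (log_den \<eta>) ~= 0" using d(1) by simp
 have "enat (vord (pull p (log_den \<eta>))) + ford (log_num \<eta>') = enat (vord (log_den \<eta>')) + ford (plf p (log_num \<eta>))"
  using arg_cong[OF t[unfolded log_transform_def], of ford] d' p0 by (simp add: ford_scale)
 hence "enat (vord (pull p (log_den \<eta>))) + (ford (log_num \<eta>') + 1) = enat (vord (log_den \<eta>')) + enat (vord (pull p (log_den \<eta>)))"
  using o by (metis add.assoc)
 hence "ford (log_num \<eta>') + 1 = enat (vord (log_den \<eta>'))"
  by (cases "ford (log_num \<eta>')") (auto simp: one_enat_def)
 thus ?thesis using d' by (simp add: one_faithful_def ford_def germ_ord_eq)
qed

lemma germ_ord_ge: "enat n \<le> germ_ord a <-> ogeq n a"
proof (cases "a = 0")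
 case False
 thus ?thesis using vord_props[OF False] by (auto simp: germ_ord_eq ogeq_def) (metis not_le_imp_less)
qed (simp add: germ_ord_eq ogeq_def)

lemma ford_ge: "enat n \<le> ford om <-> ogeq n (fst om) & ogeq n (snd om)"
 by (simp add: ford_def germ_ord_ge)

lemma ogeq_vord: "f ~= 0 ==> ogeq n f <-> n \<le> vord f"
 using germ_ord_ge[of n f] by (simp add: germ_ord_eq)

lemma ogeq_sum: "(!!i. i : I ==> ogeq n (F i)) ==> ogeq n (sum F I)"
 by (induction I rule: infinite_finite_induct) (auto intro: ogeq_add simp: ogeq_def)

text \<open>Differentiating one factor of the product lowers the order by at most one. Faithfulness
  is the opposite inequality.\<close>

lemma ford_lnum:
 assumes I: "finite I" "!!i. i : I ==> ph i ~= 0"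
 shows "enat (vord (\<Prod>i\<in>I. ph i)) \<le> ford (lnum I w ph) + 1"
proof -
 define m where "m = vord (\<Prod>i\<in>I. ph i)"
 have "ogeq (m - 1) (cst (w i) * (\<Prod>j\<in>I - {i}. ph j) * D (ph i))"
  if i: "i : I" and D: "D = Dx \<or> D = Dy" for D i
 proof -
  have p: "(\<Prod>j\<in>I. ph j) = ph i * (\<Prod>j\<in>I - {i}. ph j)" using prod.remove[OF I(1) i] .
  have p0: "(\<Prod>j\<in>I - {i}. ph j) ~= 0" using I by auto
  have mm: "m = vord (ph i) + vord (\<Prod>j\<in>I - {i}. ph j)" using vord_mult[OF I(2)[OF i] p0] by (simp add: m_def p)
  have "ogeq (vord (ph i) - 1) (D (ph i))"
   using vord_props(2)[OF I(2)[OF i]] D by (auto simp: ogeq_def gc_dx gc_dy)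
  moreover have "ogeq (vord (\<Prod>j\<in>I - {i}. ph j)) (cst (w i) * (\<Prod>j\<in>I - {i}. ph j))"
   using vord_props(2)[OF p0] by (auto simp: ogeq_def)
  hence o: "ogeq (vord (\<Prod>j\<in>I - {i}. ph j) + (vord (ph i) - 1)) (cst (w i) * (\<Prod>j\<in>I - {i}. ph j) * D (ph i))"
   by (rule ogeq_mult[OF _ \<open>ogeq (vord (ph i) - 1) (D (ph i))\<close>])
  have "m - 1 \<le> vord (\<Prod>j\<in>I - {i}. ph j) + (vord (ph i) - 1)" using mm by simp
  thus ?thesis using o by (auto simp: ogeq_def)
 qed
 hence "enat (m - 1) \<le> ford (lnum I w ph)" unfolding ford_ge lnum_def by (auto intro!: ogeq_sum)
 moreover have "enat m \<le> enat (m - 1) + 1" by (cases m) (auto simp: one_enat_def)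
 ultimately show ?thesis unfolding m_def[symmetric] by (meson add_right_mono order_trans)
qed

text \<open>
 If the order of \<open>plf\<close> were too large, the pulled back form would vanish to high order along
 the next exceptional divisor, on which neither its residue nor its restriction can vanish.
\<close>
lemma ford_faithful:
 assumes D: "D ~= 0" "enat (vord D) \<le> ford om + 1"
  and z: "gX * fst (plf [Sl c] om) = pull [Sl c] D * (cst \<epsilon> + gX * h1)"
   "snd (plf [Sl c] om) = pull [Sl c] D * h2"
  and ne: "\<epsilon> ~= 0 \<or> gc h2 0 0 ~= 0"
 shows "ford om + 1 = enat (vord D)"
proof (rule ccontr)
 define m where "m = vord D"
 assume "~ ?thesis"
 hence "enat m < ford om + 1" using D(2) by (simp add: m_def)
 hence "enat m \<le> ford om" by (cases "ford om") (auto simp: one_enat_def)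
 hence o: "ogeq m (fst om)" "ogeq m (snd om)" by (simp_all add: ford_ge)
 have dv: "gX ^ m dvd psl c a" if "ogeq m a" for a
 proof (cases "a = 0")
  case False
  hence "m \<le> vord a" using that by (simp add: ogeq_vord)
  hence "gX ^ m dvd gX ^ vord a" by (rule le_imp_power_dvd)
  thus ?thesis using pull_slope_factor(1)[OF False, of c] by (metis dvd_mult2)
 qed simp
 obtain P Q where PQ: "psl c (fst om) = gX ^ m * P" "psl c (snd om) = gX ^ m * Q"
  using dv[OF o(1)] dv[OF o(2)] by blast
 define E where "E = shx m (psl c D)"
 have E: "psl c D = gX ^ m * E" "~ gX dvd E"
  using pull_slope_factor[OF D(1), of c] by (simp_all add: E_def m_def)
 define t where "t = gY + cst c"
 have f: "fst (plf [Sl c] om) = gX ^ m * (P + Q * t)" "snd (plf [Sl c] om) = gX ^ m * (Q * gX)"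
  by (simp_all add: pull_form_def PQ t_def dx_mult dy_mult alg)
 have "gX ^ m * (gX * (P + Q * t)) = gX ^ m * (E * (cst \<epsilon> + gX * h1))"
  using z(1) unfolding f by (simp add: E)
 hence "gX * (P + Q * t) = E * (cst \<epsilon> + gX * h1)" by simp
 hence "gX dvd E * (cst \<epsilon> + gX * h1)" by (metis dvd_triv_left)
 hence "gX dvd cst \<epsilon> + gX * h1" using E(2) prime_X by (simp add: prime_elem_dvd_mult_iff)
 hence e: "\<epsilon> = 0" by (auto simp: X_dvd_iff gc_X_mult dest!: spec[of _ 0])
 have "gX ^ m * (Q * gX) = gX ^ m * (E * h2)" using z(2) unfolding f by (simp add: E)
 hence "Q * gX = E * h2" by simp
 hence "gX dvd E * h2" by (metis dvd_triv_right)
 hence "gX dvd h2" using E(2) prime_X by (simp add: prime_elem_dvd_mult_iff)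
 hence "gc h2 0 0 = 0" by auto
 thus False using ne e by simp
qed

subsection \<open>Normal forms at the final points\<close>

lemma prime_coprime:
 assumes "prm (p :: germ)" "~ p dvd a" shows "coprime p a"
proof (rule coprimeI)
 fix c assume c: "c dvd p" "c dvd a"
 then obtain b where b: "p = c * b" by blast
 have "is_unit c \<or> is_unit b" using irreducibleD[OF prime_elem_imp_irreducible[OF assms(1)] b] .
 moreover have "~ is_unit b"
 proof
  assume "is_unit b"
  hence "p dvd c" unfolding b by simp
  thus False using c(2) assms(2) dvd_trans by blast
 qed
 ultimately show "is_unit c" by blast
qed

lemma simple_singI: "sng om ==> lin_eigenvalues om l m ==> l ~= 0 ==> ~ pos_rat (m / l) ==> smp om"
 by (auto simp: simple_sing_def)

lemma coprime_units: "coprime a b ==> is_unit u ==> is_unit v ==> coprime (a * u) (b * (v :: germ))"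
 by (auto simp: coprime_def dvd_mult_unit_iff)

text \<open>The form x y (dx/x + dy/y) up to regular terms: equal residues give the eigenvalues 1
  and -1, whatever the regular terms are.\<close>

lemma normal_corner:
 defines "Om \<equiv> (%h1 h2. (gY * (1 + gX * h1), gX * (1 + gY * h2)))"
 shows "coprime (fst (Om h1 h2)) (snd (Om h1 h2))" "smp (Om h1 h2)" "~ saddle_node (Om h1 h2)"
  "gX dvd wdg (Om h1 h2) gX" "gY dvd wdg (Om h1 h2) gY"
proof -
 have u: "is_unit (1 + gX * h1)" "is_unit (1 + gY * h2)" by (simp_all add: is_unit_iff)
 have "coprime gY gX"
  by (rule prime_coprime[OF prime_Y]) (auto simp: Y_dvd_iff gc_X)
 thus "coprime (fst (Om h1 h2)) (snd (Om h1 h2))"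
  using u coprime_units by (simp add: Om_def)
 have l: "lin_eigenvalues (Om h1 h2) 1 (- 1)"
  by (simp add: lin_eigenvalues_alt Om_def gc_X_mult gc_Y_mult gc_1)
 have s: "sng (Om h1 h2)" by (simp add: singular_form_def Om_def)
 show "smp (Om h1 h2)"
  by (rule simple_singI[OF s l]) (auto simp: pos_rat_def)
 have "lin_eigenvalues (Om h1 h2) x 0 ==> False" for x
  by (simp add: lin_eigenvalues_alt Om_def gc_X_mult gc_Y_mult gc_1)
 thus "~ saddle_node (Om h1 h2)" by (auto simp: saddle_node_def)
 show "gX dvd wdg (Om h1 h2) gX" "gY dvd wdg (Om h1 h2) gY" by (simp_all add: wedge_d_def Om_def)
qed

text \<open>The form x g (dx/x + r dg/g) up to regular terms. Its eigenvalues are r and -1 up to a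
  common factor, which gives the index -1/r along g.\<close>

lemma normal_isolated:
 assumes g: "graph gX (u * g)" "is_unit u" and l: "r ~= 0" "~ pos_rat (- 1 / r)"
  and Om: "fst Om = g + gX * (cst r * Dx g + g * h1)" "snd Om = gX * (cst r * Dy g + g * h2)"
 shows "coprime (fst Om) (snd Om)" "smp Om" "~ saddle_node Om" "gX dvd wdg Om gX" "g dvd wdg Om g"
  "csi Om (crv g) = - 1 / r"
proof -
 obtain ph where ph: "0 < rad ph" "cf ph 0 = 0" "u * g = gY - xgerm ph" using g(1) by (auto simp: graph_def)
 have u0: "gc u 0 0 ~= 0" using g(2) by (simp add: is_unit_iff)
 have g00: "gc g 0 0 = 0" using arg_cong[OF ph(3), of "%a. gc a 0 0"] u0 ph(1,2) by (simp add: gc_xgerm)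
 have g01: "gc g 0 1 ~= 0" using arg_cong[OF ph(3), of "%a. gc a 0 1"] ph(1,2) g00 gc_mult_lin(2)[OF g00, of u]
  by (auto simp: gc_xgerm gc_Y)
 define v where "v = cst r * Dy g + g * h2"
 have v: "gc v 0 0 = r * gc g 0 1" using g00 by (simp add: v_def gc_dy)
 have uv: "is_unit v" using v g01 l by (simp add: is_unit_iff)
 have P01: "gc (fst Om) 0 1 = gc g 0 1" by (simp add: Om gc_X_mult)
 have Q: "gc (snd Om) 1 0 = r * gc g 0 1" "gc (snd Om) 0 1 = 0" using v by (simp_all add: Om gc_X_mult v_def)
 have P00: "gc (fst Om) 0 0 = 0" "gc (snd Om) 0 0 = 0" using g00 by (simp_all add: Om)
 have XQ: "gX dvd snd Om" by (simp add: Om)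
 thus "gX dvd wdg Om gX" by (simp add: wedge_d_def)
 have nX: "~ gX dvd fst Om" using P01 g01 unfolding X_dvd_iff by metis
 have "coprime (fst Om) gX"
  using prime_coprime[OF prime_X nX] by (simp add: coprime_commute)
 thus "coprime (fst Om) (snd Om)" using uv unfolding Om(2) v_def[symmetric]
  using coprime_units[of "fst Om" gX 1 v] by simp
 have wd: "wdg Om g = g * ((1 + gX * h1) * Dy g - gX * h2 * Dx g)"
  unfolding wedge_d_def Om by (simp add: alg)
 thus gi: "g dvd wdg Om g" by simp
 have lin: "lin_eigenvalues Om (r * gc g 0 1) (- gc g 0 1)"
  by (simp add: lin_eigenvalues_alt P01[simplified] Q[simplified])
 have sf: "sng Om" using P00 by (simp add: singular_form_def)
 show "smp Om" by (rule simple_singI[OF sf lin]) (use l g01 in auto)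
 have "lin_eigenvalues Om x 0 ==> False" for x
  using P01 Q g01 l by (simp add: lin_eigenvalues_alt)
 thus "~ saddle_node Om" by (auto simp: saddle_node_def)
 have Q10: "gc (snd Om) 1 0 ~= 0" using Q(1) g01 l by simp
 have "gY - xgerm ph dvd wdg Om (gY - xgerm ph)" using wedge_unit_dvd[OF g(2), of g Om] gi ph(3) by simp
 from cs_graph[OF XQ Q10 ph(1,2) this] have "csi Om (crv (u * g)) = - 1 / r"
  using P01 Q(1) g01 ph(3) by simp
 thus "csi Om (crv g) = - 1 / r" by (simp add: curve_of_unit[OF g(2)])
qed

lemma normal_isolated_Y:
 assumes g: "graph gY (u * g)" "is_unit u" and l: "r ~= 0" "~ pos_rat (- 1 / r)"
  and Om: "fst Om = gY * (cst r * Dx g + g * h1)" "snd Om = g + gY * (cst r * Dy g + g * h2)"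
 shows "coprime (fst Om) (snd Om)" "smp Om" "~ saddle_node Om" "gY dvd wdg Om gY" "g dvd wdg Om g"
  "csi Om (crv g) = - 1 / r"
proof -
 have gs: "graph gX (swp u * swp g)" "is_unit (swp u)" using graph_swap[OF g(1)] g(2) by auto
 have s: "fst (sform Om) = swp g + gX * (cst r * Dx (swp g) + swp g * swp h2)"
  "snd (sform Om) = gX * (cst r * Dy (swp g) + swp g * swp h1)"
  by (simp_all add: Om swap_dx swap_dy)
 note n = normal_isolated[OF gs l s]
 show co: "coprime (fst Om) (snd Om)" using n(1) by (simp add: coprime_commute)
 show "smp Om" "~ saddle_node Om" using n(2,3) by (simp_all add: sform_simple sform_saddle)
 show "gY dvd wdg Om gY" using n(4) wedge_sform[of Om gY] swap_dvd_iff[of gY "wdg Om gY"] by simp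
 show gi: "g dvd wdg Om g" using n(5) wedge_sform[of Om g] by simp
 have pg: "prm (u * g)" "\<exists>U V. gp (u * g) U V" using graph_props[OF g(1)] by auto
 obtain w where w: "is_unit w" "w * u = 1" using g(2) by (metis dvd_def mult.commute)
 have "w * (u * g) = g" using w by simp
 then obtain U V where gpg: "gp g U V" using pg(2) gp_unit[OF _ w(1)] by metis
 have "prm g" using pg(1) g(2) by (simp add: prime_elem_mult_unit_left)
 from cs_index_sform[OF this gpg co gi] show "csi Om (crv g) = - 1 / r" using n(6) by simp
qed

lemma graph_derivative:
 assumes "graph e (u * g)" "is_unit u"
 shows "gc g 0 0 = 0" "e = gX ==> gc g 0 1 ~= 0" "e = gY ==> gc g 1 0 ~= 0"
proof -
 define a where "a = u * g"
 have u0: "gc u 0 0 ~= 0" using assms(2) by (simp add: is_unit_iff)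
 have gr: "graph e a" using assms(1) by (simp add: a_def)
 have "gc a 0 0 = 0" using gr by (auto simp: graph_def gc_xgerm)
 thus g00: "gc g 0 0 = 0" using u0 by (simp add: a_def)
 note gl = gc_mult_lin[OF g00, of u, folded a_def]
 show "e = gX ==> gc g 0 1 ~= 0" using gr gl(2) by (auto simp: graph_def gc_xgerm gc_Y)
 show "e = gY ==> gc g 1 0 ~= 0" using gr gl(1) by (auto simp: graph_def gc_xgerm gc_X)
qed

subsection \<open>The poles of the model\<close>

definition pairg :: "real => point => germ" where
 "pairg c q = (SOME f. \<exists>u. is_unit u & pushes q (u * qd c) f)"

lemma pairg_pushes: "0 < c ==> \<exists>u. is_unit u & pushes q (u * qd c) (pairg c q)"
 unfolding pairg_def using pair_exists[of c q] by (rule someI_ex)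

text \<open>The intersection number with the axis x = 0; \<open>ie\<close> is the one with the
  exceptional divisor in direction d.\<close>

definition iX :: "germ => nat" where "iX a = sdg (row a 0)"

definition ie :: "direction => germ => nat" where
 "ie d a = (case d of Sl c => iX a | Vt => iX (swp a))"

lemma iX_yreg: "yreg k a ==> iX a = k"
 unfolding iX_def yreg_def by (rule subdegreeI) (auto simp: row_nth)

lemma ie_exreg: "exreg d k a ==> ie d a = k"
 by (cases d) (auto simp: exreg_def ie_def iX_yreg)

lemma iX_unit: "is_unit a ==> iX a = 0" "is_unit a ==> iX (swp a) = 0" "is_unit a ==> ie d a = 0"
proof -
 have *: "iX a = 0" if "is_unit a" for a using that by (intro iX_yreg) (simp add: yreg_def is_unit_iff)
 thus "is_unit a ==> iX a = 0" "is_unit a ==> iX (swp a) = 0" by auto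
 thus "is_unit a ==> ie d a = 0" by (cases d) (simp_all add: ie_def)
qed

text \<open>Noether's formula for the smooth curve x = 0, whose strict transform passes through the
  vertical point.\<close>

lemma iX_vertical:
 assumes "~ gX dvd a" shows "iX a = vord a + iX (st1 Vt a)"
proof -
 have a: "a ~= 0" using assms by auto
 define b where "b = st1 Vt a"
 have pv: "pvt a = gY ^ vord a * b" using pull1_factor(1)[OF a, of Vertical] by (simp add: b_def del: st1.simps)
 have "row a 0 = row (pvt a) 0" by (simp add: row_pull_vertical)
 also have "\<dots> = fps_X ^ vord a * row b 0"
  unfolding pv by (rule fps_ext) (auto simp: row_nth gc_Y_power_mult fps_X_power_mult_nth)
 finally have r: "row a 0 = fps_X ^ vord a * row b 0" .
 have "row a 0 ~= 0" using assms by (auto simp: X_dvd_iff fps_eq_iff row_nth)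
 thus ?thesis unfolding iX_def b_def[symmetric] r by simp
qed

lemma iY_slope:
 assumes "~ gY dvd a" shows "iX (swp a) = vord a + iX (swp (st1 (Sl 0) a))"
proof -
 have "~ gX dvd swp a" using assms swap_dvd_iff[of gY a] by simp
 from iX_vertical[OF this] show ?thesis by simp
qed

lemma st_comp_not_dvd:
 assumes "a ~= 0"
 shows "compX p = Some q ==> ~ gX dvd st p a" "compY p = Some q ==> ~ gY dvd st p a"
proof -
 have "(compX p = Some q --> ~ gX dvd st p a) & (compY p = Some q --> ~ gY dvd st p a)"
 proof (induction p arbitrary: q rule: rev_induct)
  case (snoc d p)
  define b where "b = st p a"
  have b: "b ~= 0" using assms by (simp add: b_def)
  have s: "st (p @ [d]) a = st1 d b" by (simp add: st_append b_def del: st1.simps)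
  note nd = pull1_factor(2)[OF b, of d] and pf = pull1_factor(1)[OF b, of d]
  show ?case
  proof (cases d)
   case (Slope c)
   have "~ gY dvd st1 d b" if c: "c = 0" "compY p = Some q"
   proof
    assume "gY dvd st1 d b"
    hence "gY dvd swp (pvt (swp b))" using pf c Slope by (simp add: pull_vertical_swap del: st1.simps)
    hence "gX dvd pvt (swp b)" using swap_dvd_iff[of gX "pvt (swp b)"] by simp
    hence "gX dvd swp b" by (auto simp: X_dvd_iff gc_pull_vertical)
    hence "gY dvd b" using swap_dvd_iff[of gX "swp b"] by simp
    thus False using snoc.IH[of q] c by (simp add: b_def)
   qed
   thus ?thesis using nd Slope unfolding s by simp
  next
   case Vertical
   have "~ gX dvd st1 d b" if c: "compX p = Some q"
   proof
    assume "gX dvd st1 d b"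
    hence "gX dvd pvt b" using pf Vertical by simp
    hence "gX dvd b" by (auto simp: X_dvd_iff gc_pull_vertical)
    thus False using snoc.IH[of q] c by (simp add: b_def)
   qed
   thus ?thesis using nd Vertical unfolding s by simp
  qed
 qed simp
 thus "compX p = Some q ==> ~ gX dvd st p a" "compY p = Some q ==> ~ gY dvd st p a" by blast+
qed

text \<open>The value at 0 of the logarithmic derivative along x = 0; it turns products into
  sums.\<close>

definition dl :: "germ => real" where "dl a = gc a 0 1 / gc a 0 0"

lemma dl_mult: "gc a 0 0 ~= 0 ==> gc b 0 0 ~= 0 ==> dl (a * b) = dl a + dl b"
proof -
 have s: "{0..Suc 0} = {0, 1}" by auto
 assume "gc a 0 0 ~= 0" "gc b 0 0 ~= 0"
 thus ?thesis by (simp add: dl_def gc_mult field_simps)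
qed

lemma dl_power: "gc a 0 0 ~= 0 ==> dl (a ^ n) = real n * dl a"
 by (induction n) (simp_all add: dl_mult dl_def[of 1] gc_1 alg)

lemma dl_linear: "c ~= 0 ==> dl (gY + cst c) = 1 / c"
 by (simp add: dl_def gc_Y gc_const)

lemma dl_pull_slope: "dl (psl c a) = 0"
 by (simp add: dl_def gc_pull_slope_0)

lemma dl_row: "(!!i. gc a 0 i = v * gc b 0 i) ==> v ~= 0 ==> dl a = dl b"
 by (simp add: dl_def)

lemma log_derivative:
 assumes "is_unit u" obtains h1 h2 where "Dx u = u * h1" "Dy u = u * h2" "gc h2 0 0 = dl u"
proof -
 obtain v where v: "u * v = 1" using assms by auto
 have "gc u 0 0 * gc v 0 0 = 1" using arg_cong[OF v, of "%a. gc a 0 0"] by simp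
 hence g: "gc v 0 0 = 1 / gc u 0 0" using nonzero_eq_divide_eq[of "gc u 0 0" "gc v 0 0" 1] assms by (simp add: is_unit_iff mult.commute)
 have "u * (v * a) = a" for a using v by simp
 thus ?thesis using g by (intro that[of "v * Dx u" "v * Dy u"]) (simp_all add: dl_def gc_dy)
qed

text \<open>The relation between G and H covers both cases occurring below: H = G for the separatrix
  at the point and H = 1 for every other pole.\<close>

lemma clear_dx:
 assumes F: "F = gX ^ a * gY ^ b * u * H" and u: "Dx u = u * h" and H: "G * Dx H = H * k"
 shows "(gX * gY * G) * Dx F = F * (cst (real a) * gY * G + gX * gY * k + gX * gY * G * h)"
proof -
 have p: "gX * Dx (gX ^ n) = cst (real n) * gX ^ n" for n
  by (induction n) (simp_all add: dx_mult alg)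
 have q: "Dx (gY ^ n) = 0" for n by (induction n) (simp_all add: dx_mult)
 define A B where "A = gX ^ a" and "B = gY ^ b"
 have pA: "gX * Dx A = cst (real a) * A" and qB: "Dx B = 0" by (simp_all add: A_def B_def p q)
 have "(gX * gY * G) * Dx F = (gX * Dx A) * (B * u * H * gY * G) + gX * gY * G * (A * B * (u * h) * H) + gX * gY * (A * B * u) * (G * Dx H)"
  unfolding F A_def[symmetric] B_def[symmetric] by (simp add: dx_mult qB u alg)
 also have "\<dots> = F * (cst (real a) * gY * G + gX * gY * k + gX * gY * G * h)"
  unfolding pA H F A_def[symmetric] B_def[symmetric] by (simp add: alg)
 finally show ?thesis .
qed

lemma clear_dy:
 assumes F: "F = gX ^ a * gY ^ b * u * H" and u: "Dy u = u * h" and H: "G * Dy H = H * k"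
 shows "(gX * gY * G) * Dy F = F * (cst (real b) * gX * G + gX * gY * k + gX * gY * G * h)"
proof -
 have p: "gY * Dy (gY ^ n) = cst (real n) * gY ^ n" for n
  by (induction n) (simp_all add: dy_mult alg)
 have q: "Dy (gX ^ n) = 0" for n by (induction n) (simp_all add: dy_mult)
 define A B where "A = gX ^ a" and "B = gY ^ b"
 have pA: "gY * Dy B = cst (real b) * B" and qB: "Dy A = 0" by (simp_all add: A_def B_def p q)
 have "(gX * gY * G) * Dy F = (gY * Dy B) * (A * u * H * gX * G) + gX * gY * G * (A * B * (u * h) * H) + gX * gY * (A * B * u) * (G * Dy H)"
  unfolding F A_def[symmetric] B_def[symmetric] by (simp add: dy_mult qB u alg)
 also have "\<dots> = F * (cst (real b) * gX * G + gX * gY * k + gX * gY * G * h)"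
  unfolding pA H F A_def[symmetric] B_def[symmetric] by (simp add: alg)
 finally show ?thesis .
qed

text \<open>The slopes in \<open>B q\<close> carry weight -1. The vertical point, if nothing else is
  there, carries weight +1 and so has the residue that a centre or corner would have; the
  restriction to the component is then governed by its affine line.\<close>

locale model = frame +
 fixes B :: "point => real set" and ws :: "point => real"
 assumes B: "!!q. q : dc ==> finite (B q) & card (B q) = Suc (card {c. q @ [Sl c] : set bq \<or> corner (q @ [Sl c])}) &
   {c. q @ [Sl c] : set bq \<or> corner (q @ [Sl c])} \<inter> B q = {} &
   (\<forall>c. c ~: {c. q @ [Sl c] : set bq \<or> corner (q @ [Sl c])} --> c ~: B q -->
    (\<Sum>a\<in>{c. q @ [Sl c] : set bq \<or> corner (q @ [Sl c])}. 1 / (c - a)) - (\<Sum>b\<in>B q. 1 / (c - b)) ~= 0)"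
  and Sd_eq: "Sd = {q @ [Sl b] |q b. q : dc & b : B q} Un
   {q @ [Vt] |q. q : dc & q @ [Vt] ~: set bq & ~ corner (q @ [Vt])}"
  and wi: "!!p. p : Si ==> ws p ~= 0 & ~ pos_rat (- 1 / ws p)"
  and wd: "!!p. p : Sd ==> ws p = (if last p = Vt then 1 else - 1)"
begin

definition A :: "point => real set" where "A q = {c. q @ [Sl c] : set bq \<or> corner (q @ [Sl c])}"

lemma AB:
 assumes "q : dc"
 shows "finite (A q)" "finite (B q)" "card (B q) = Suc (card (A q))" "A q \<inter> B q = {}"
  "!!c. c ~: A q ==> c ~: B q ==> (\<Sum>a\<in>A q. 1 / (c - a)) - (\<Sum>b\<in>B q. 1 / (c - b)) ~= 0"
proof -
 have "finite ((%c. q @ [Sl c]) -` set bq)" by (rule finite_vimageI) (auto simp: inj_on_def)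
 hence "finite (insert 0 ((%c. q @ [Sl c]) -` set bq))" by simp
 thus "finite (A q)" by (rule finite_subset[rotated]) (auto simp: A_def corner_def split: if_splits)
qed (use B[OF assms, folded A_def] in auto)

text \<open>Tag 0 marks the separatrices. Tags 1 and 2 mark the two families of pairs and serve at
  the same time as the coefficient c in \<open>qd c\<close>.\<close>

definition idx :: "(nat \<times> point) set" where
 "idx = {0} \<times> (Si Un Sd) Un {1, 2} \<times> (set bq - dc)"

definition pol :: "nat \<times> point => germ" where
 "pol i = (if fst i = 0 then f (snd i) else pairg (real (fst i)) (snd i))"

lemma finite_idx: "finite idx"
 using fin by (auto simp: idx_def)

lemma pair_pushes:
 assumes "i : idx" "fst i ~= 0"
 obtains u where "is_unit u" "pushes (snd i) (u * qd (real (fst i))) (pol i)" "0 < real (fst i)"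
 using assms pairg_pushes[of "real (fst i)" "snd i"] by (auto simp: pol_def)

lemma pol_pushes: "i : idx ==> \<exists>b. pushes (snd i) b (pol i) & prm b"
proof (cases "fst i = 0")
 case True
 assume "i : idx"
 with True have "snd i : Si Un Sd" "pol i = f (snd i)" by (auto simp: idx_def pol_def)
 thus ?thesis using push[of "snd i"] sep_props(1)[of "snd i"] by auto
next
 case False
 assume "i : idx"
 from pair_pushes[OF this False] obtain u where "is_unit u" "pushes (snd i) (u * qd (real (fst i))) (pol i)" "0 < real (fst i)" .
 thus ?thesis using prime_qd by (auto intro!: exI[of _ "u * qd (real (fst i))"] simp: prime_elem_mult_unit_left)
qed

lemma prime_pol: "i : idx ==> prm (pol i)"
 using pol_pushes pushes_prime by blast

lemma pol_neq_0: "i : idx ==> pol i ~= 0"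
 using prime_pol by (auto simp: prime_elem_def)

lemma base_near: "i : idx ==> snd i : set bq Un divisor bq"
 using final by (auto simp: idx_def)

lemma pol_base: assumes "i : idx" shows "~ is_unit (st (snd i) (pol i))"
proof -
 obtain b where "pushes (snd i) b (pol i)" "prm b" using pol_pushes[OF assms] by blast
 thus ?thesis using pushes_st_eq[of "snd i" b "pol i"] by simp
qed

text \<open>Beyond its base point a pole disappears: a pair has no real tangent there, and a
  separatrix is based at a final point, above which nothing is blown up.\<close>

lemma pol_off:
 assumes i: "i : idx" and q: "q : set bq Un divisor bq" and n: "\<nexists>r. snd i = q @ r"
 shows "is_unit (st q (pol i))"
proof (cases "\<exists>r. q = snd i @ r")
 case False
 thus ?thesis using pol_pushes[OF i] pushes_st_other n by blast
next
 case True
 then obtain r where r: "q = snd i @ r" by blast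
 then obtain d r' where r': "r = d # r'" using n by (cases r) auto
 show ?thesis
 proof (cases "fst i = 0")
  case True
  hence "snd i : divisor bq" using i final by (auto simp: idx_def)
  hence "r = []" using divisor_not_prefix[OF bs _ q r] by blast
  thus ?thesis using r' by simp
 next
  case False
  from pair_pushes[OF i False] obtain u where u: "is_unit u" "pushes (snd i) (u * qd (real (fst i))) (pol i)" "0 < real (fst i)" .
  have "st q (pol i) = st r' (st1 d (u * qd (real (fst i))))" using pushes_st_eq[OF u(2)] by (simp add: r r' st_append del: st1.simps)
  also have "\<dots> = st r' (pull1 d u * st1 d (qd (real (fst i))))" using u(1) by (simp add: st1_mult st1_unit del: st1.simps)
  finally show ?thesis using u(1) st1_qd[OF u(3), of d] by (simp add: st_unit is_unit_mult_iff del: st1.simps)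
 qed
qed

lemma pol_through:
 assumes i: "i : idx" and r: "snd i = q @ d # r"
 shows "push1 d (vord (st q (pol i))) (st (q @ [d]) (pol i)) (st q (pol i))"
proof -
 obtain b where "pushes (snd i) b (pol i)" using pol_pushes[OF i] by blast
 hence "pushes (d # r) b (st q (pol i))" using pushes_st[of q "d # r"] r by simp
 then obtain h k where "push1 d k h (st q (pol i))" by auto
 moreover from this have "k = vord (st q (pol i))" "h = st (q @ [d]) (pol i)"
  by (auto simp: push1_def st_append simp del: st1.simps)
 ultimately show ?thesis by simp
qed

definition dirs :: "point => direction set" where "dirs q = Sl ` (A q Un B q) Un {Vt}"

text \<open>A pole through a direction that is not a centre is a separatrix based at that very
  point. It lies on a dicritical component, hence belongs to Sd.\<close>

lemma pol_direction:
 assumes q: "q : dc" and i: "i : idx" and r: "snd i = q @ d # r"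
 shows "d : dirs q"
proof (cases "q @ [d] : set bq")
 case True
 thus ?thesis by (cases d) (auto simp: dirs_def A_def)
next
 case False
 have "q : set bq" using q dc by blast
 hence fd: "q @ [d] : divisor bq" using False divisor_iff[OF bs] by blast
 hence "r = []" using divisor_not_prefix[OF bs fd base_near[OF i], of r] r by simp
 hence p: "snd i = q @ [d]" using r by simp
 hence S: "q @ [d] : Si Un Sd" using i False by (auto simp: idx_def)
 obtain q' e where "lone (q @ [d]) q' e" "q' : dc <-> q @ [d] : Sd" using sep[OF S] by blast
 hence "q @ [d] : Sd" using lone_snoc[of q d q' e] q by simp
 thus ?thesis unfolding Sd_eq by (auto simp: dirs_def)
qed

lemma finite_dirs: "q : dc ==> finite (dirs q)"
 using AB by (auto simp: dirs_def)

lemma not_prefix_snoc: "\<nexists>r. p = q @ d # r ==> \<nexists>r. p = (q @ [d]) @ r"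
 by simp

lemma pol_dc_base: "q : dc ==> i : idx ==> snd i ~= q"
 using dc final divisor_iff[OF bs] by (auto simp: idx_def)

lemma near_snoc: "q : set bq ==> q @ [d] : set bq Un divisor bq"
 using divisor_iff[OF bs] by blast

text \<open>A pole leaves q in at most one direction, where its intersection number with the
  exceptional divisor equals its multiplicity.\<close>

lemma pol_multiplicity:
 assumes q: "q : dc" and i: "i : idx"
 shows "vord (st q (pol i)) = (\<Sum>d\<in>dirs q. ie d (st (q @ [d]) (pol i)))"
proof -
 have qN: "q : set bq" using q dc by blast
 have off: "ie d (st (q @ [d]) (pol i)) = 0" if "\<nexists>r. snd i = q @ d # r" for d
  using pol_off[OF i near_snoc[OF qN] not_prefix_snoc[OF that]] iX_unit(3) by blast
 show ?thesis
 proof (cases "\<exists>d r. snd i = q @ d # r")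
  case True
  then obtain d r where r: "snd i = q @ d # r" by blast
  have "(\<Sum>d'\<in>dirs q. ie d' (st (q @ [d']) (pol i))) = (\<Sum>d'\<in>dirs q. if d' = d then ie d (st (q @ [d]) (pol i)) else 0)"
   using off r by (intro sum.cong) auto
  also have "\<dots> = ie d (st (q @ [d]) (pol i))" using finite_dirs[OF q] pol_direction[OF q i r] by simp
  also have "\<dots> = vord (st q (pol i))" using pol_through[OF i r] by (intro ie_exreg) (auto simp: push1_def simp del: st1.simps)
  finally show ?thesis by simp
 next
  case False
  have "\<nexists>r. snd i = q @ r"
  proof
   assume "\<exists>r. snd i = q @ r"
   then obtain r where "snd i = q @ r" by blast
   thus False using False pol_dc_base[OF q i] by (cases r) auto
  qed
  hence "is_unit (st q (pol i))" using pol_off[OF i] qN by blast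
  thus ?thesis using off False by simp
 qed
qed

text \<open>By the last clause of \<open>push1\<close>, the strict transform of a pole with
  direction a restricts to the divisor near slope c as a constant times (y + c - a)^k; a vertical
  pole restricts to a constant.\<close>

lemma pol_restriction:
 assumes q: "q : dc" and i: "i : idx" and c: "c ~: A q" "c ~: B q"
 shows "dl (st (q @ [Sl c]) (pol i)) = (\<Sum>a\<in>A q Un B q. real (ie (Sl a) (st (q @ [Sl a]) (pol i))) / (c - a))"
proof -
 have qN: "q : set bq" using q dc by blast
 have off: "ie d (st (q @ [d]) (pol i)) = 0" if "\<nexists>r. snd i = q @ d # r" for d
  using pol_off[OF i near_snoc[OF qN] not_prefix_snoc[OF that]] iX_unit(3) by blast
 define T where "T = st q (pol i)"
 have s: "st (q @ [Sl c]) (pol i) = st1 (Sl c) T" by (simp add: T_def st_append del: st1.simps)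
 show ?thesis
 proof (cases "\<exists>d r. snd i = q @ d # r")
  case True
  then obtain d r where r: "snd i = q @ d # r" by blast
  note p1 = pol_through[OF i r, folded T_def]
  have dd: "d ~= Sl c" using pol_direction[OF q i r] c by (auto simp: dirs_def)
  obtain v where v: "v ~= 0" "!!j. gc (st1 (Sl c) T) 0 j = v * (case d of Sl c' => gc ((gY + cst (c - c')) ^ vord T) 0 j | Vt => gc 1 0 j)"
   using p1 dd unfolding push1_def by metis
  show ?thesis
  proof (cases d)
   case (Slope a)
   have a: "a : A q Un B q" using pol_direction[OF q i r] Slope by (auto simp: dirs_def)
   have ca: "c - a ~= 0" using dd Slope by simp
   have "(\<Sum>a'\<in>A q Un B q. real (ie (Sl a') (st (q @ [Sl a']) (pol i))) / (c - a')) =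
    (\<Sum>a'\<in>A q Un B q. if a' = a then real (ie (Sl a) (st (q @ [Sl a]) (pol i))) / (c - a) else 0)"
    using off[of "Sl _"] r Slope by (intro sum.cong) auto
   also have "\<dots> = real (ie (Sl a) (st (q @ [Sl a]) (pol i))) / (c - a)" using AB[OF q] a by simp
   also have "ie (Sl a) (st (q @ [Sl a]) (pol i)) = vord T"
    using p1 Slope by (intro ie_exreg) (auto simp: push1_def simp del: st1.simps)
   also have "real (vord T) / (c - a) = dl ((gY + cst (c - a)) ^ vord T)"
    using ca by (subst dl_power) (simp_all add: dl_linear del: germ_const_hom)
   also have "\<dots> = dl (st1 (Sl c) T)" using v Slope by (intro dl_row[symmetric, where v = v]) auto
   finally show ?thesis using s by simp
  next
   case Vertical
   have "(\<Sum>a\<in>A q Un B q. real (ie (Sl a) (st (q @ [Sl a]) (pol i))) / (c - a)) = 0"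
    using off[of "Sl _"] r Vertical by simp
   moreover have "dl (st1 (Sl c) T) = dl 1" using v Vertical by (intro dl_row[where v = v]) auto
   ultimately show ?thesis using s by (simp add: dl_def[of 1] gc_1)
  qed
 next
  case False
  have "\<nexists>r. snd i = q @ r"
  proof
   assume "\<exists>r. snd i = q @ r"
   then obtain r where "snd i = q @ r" by blast
   thus False using False pol_dc_base[OF q i] by (cases r) auto
  qed
  hence "is_unit T" using pol_off[OF i] qN by (simp add: T_def)
  hence "dl (st1 (Sl c) T) = 0" using st1_unit[of T "Sl c"] by (simp add: dl_pull_slope del: st1.simps)
  thus ?thesis using s off False by simp
 qed
qed

lemma pol_final:
 assumes i: "i : idx" and p: "p : divisor bq" and n: "i ~= (0, p)" shows "is_unit (st p (pol i))"
proof (rule pol_off[OF i])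
 show "\<nexists>r. snd i = p @ r"
 proof
  assume "\<exists>r. snd i = p @ r"
  hence "snd i = p" using divisor_not_prefix[OF bs p base_near[OF i]] by auto
  thus False using n i p divisor_iff[OF bs] by (auto simp: idx_def)
 qed
qed (use p in simp)

end

context model
begin

text \<open>The residue prescribed along a component. A missing component counts as 0, so sums over
  the components at a point have a uniform shape.\<close>

definition eo :: "point option => real" where
 "eo a = (case a of None => 0 | Some q => if q : dc then 0 else 1)"

lemma eo_simps: "eo None = 0" "q : dc ==> eo (Some q) = 0" "q ~: dc ==> eo (Some q) = 1"
 by (simp_all add: eo_def)

text \<open>The unknowns are the weights of the pairs with tag 1. A pair based at q' enters the
  equation at q only if q is a prefix of q', so the system is triangular with nonzero
  diagonal.\<close>

lemma weights_exist:
 "\<exists>wt. (\<forall>p. wt (0, p) = ws p) & (\<forall>p. wt (2, p) = 1) &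
  (\<forall>q\<in>set bq - dc. (\<Sum>i\<in>idx. wt i * real (vord (st q (pol i)))) = eo (Some q) - eo (compX q) - eo (compY q))"
proof -
 let ?Q = "set bq - dc"
 define m where "m q q' = real (vord (st q (pol (1, q'))))" for q q'
 define a where "a q = eo (Some q) - eo (compX q) - eo (compY q) - (\<Sum>p\<in>Si Un Sd. ws p * real (vord (st q (pol (0, p)))))
  - (\<Sum>q'\<in>?Q. real (vord (st q (pol (2, q')))))" for q
 have "\<exists>s. \<forall>q\<in>?Q. (\<Sum>q'\<in>?Q. s q' * m q q') = a q"
 proof (rule triangular_system)
  show "\<forall>q\<in>?Q. m q q ~= 0"
  proof
   fix q assume "q : ?Q"
   hence i: "(1, q) : idx" by (simp add: idx_def)
   hence "vord (st q (pol (1, q))) ~= 0" using pol_base[OF i] vord_unit_iff[of "st q (pol (1, q))"] pol_neq_0[OF i] by simp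
   thus "m q q ~= 0" by (simp add: m_def)
  qed
  show "\<forall>q\<in>?Q. \<forall>q'\<in>?Q. q ~= q' & length q' \<le> length q --> m q q' = 0"
  proof (intro ballI impI)
   fix q q' assume q: "q : ?Q" "q' : ?Q" "q ~= q' & length q' \<le> length q"
   hence i: "(1, q') : idx" by (simp add: idx_def)
   have "is_unit (st q (pol (1, q')))" by (rule pol_off[OF i]) (use q in auto)
   thus "m q q' = 0" by (simp add: m_def)
  qed
 qed simp
 then obtain s where s: "!!q. q : ?Q ==> (\<Sum>q'\<in>?Q. s q' * m q q') = a q" by blast
 define wt where "wt i = (if fst i = 0 then ws (snd i) else if fst i = 1 then s (snd i) else 1)" for i :: "nat \<times> point"
 have sp: "(\<Sum>i\<in>idx. F i) = (\<Sum>p\<in>Si Un Sd. F (0, p)) + ((\<Sum>p\<in>?Q. F (1, p)) + (\<Sum>p\<in>?Q. F (2, p)))" for F :: "nat \<times> point => real"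
 proof -
  have "idx = Pair 0 ` (Si Un Sd) Un (Pair 1 ` ?Q Un Pair 2 ` ?Q)" by (auto simp: idx_def)
  also have "sum F \<dots> = sum F (Pair 0 ` (Si Un Sd)) + (sum F (Pair 1 ` ?Q) + sum F (Pair 2 ` ?Q))"
   by (subst sum.union_disjoint, use fin in auto)+
  finally show ?thesis by (simp add: sum.reindex inj_on_def)
 qed
 show ?thesis
 proof (intro exI[of _ wt] conjI ballI allI)
  fix q assume q: "q : ?Q"
  show "(\<Sum>i\<in>idx. wt i * real (vord (st q (pol i)))) = eo (Some q) - eo (compX q) - eo (compY q)"
   unfolding sp using s[OF q] by (simp add: wt_def m_def a_def)
 qed (simp_all add: wt_def)
qed

definition wt :: "nat \<times> point => real" where
 "wt = (SOME wt. (\<forall>p. wt (0, p) = ws p) & (\<forall>p. wt (2, p) = 1) &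
  (\<forall>q\<in>set bq - dc. (\<Sum>i\<in>idx. wt i * real (vord (st q (pol i)))) = eo (Some q) - eo (compX q) - eo (compY q)))"

lemma wt_simps: "wt (0, p) = ws p" "wt (2, p) = 1"
 and wt_eqn: "q : set bq - dc ==> (\<Sum>i\<in>idx. wt i * real (vord (st q (pol i)))) = eo (Some q) - eo (compX q) - eo (compY q)"
 using someI_ex[OF weights_exist] unfolding wt_def[symmetric] by auto

lemma ws_neq_0: "p : Si Un Sd ==> ws p ~= 0"
 using wi[of p] wd[of p] by (auto split: if_splits)

lemma sep_not_corner: "p : Si Un Sd ==> ~ corner p"
proof
 assume p: "p : Si Un Sd" "corner p"
 obtain q e where l: "lone p q e" using sep[OF p(1)] by blast
 obtain q1 q2 where "compX p = Some q1" "compY p = Some q2" using p(2) by (auto simp: corner_def)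
 thus False using l comp_distinct[of p q1] by (auto simp: lone_def component_at_iff)
qed

lemma residue_at_sep:
 assumes p: "p @ [d] : Si Un Sd"
 shows "(\<Sum>i\<in>idx. wt i * real (ie d (st (p @ [d]) (pol i)))) = ws (p @ [d])"
proof -
 have i0: "(0, p @ [d]) : idx" using p by (simp add: idx_def)
 have "(\<Sum>i\<in>idx. wt i * real (ie d (st (p @ [d]) (pol i)))) =
   (\<Sum>i\<in>idx. if i = (0, p @ [d]) then wt (0, p @ [d]) * real (ie d (st (p @ [d]) (pol (0, p @ [d])))) else 0)"
  using pol_final[OF _ final[OF p]] iX_unit(3) by (intro sum.cong) auto
 also have "\<dots> = ws (p @ [d]) * real (ie d (st (p @ [d]) (f (p @ [d]))))"
  using finite_idx i0 by (simp add: wt_simps pol_def)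
 also have "st (p @ [d]) (f (p @ [d])) = g (p @ [d])" by (rule pushes_st_eq[OF push[OF p]])
 also have "ie d (g (p @ [d])) = 1"
 proof -
  obtain q e u where u: "lone (p @ [d]) q e" "is_unit u" "graph e (u * g (p @ [d]))" using sep[OF p] by blast
  have e: "e = ex d" using lone_snoc[OF u(1)] by simp
  note gd = graph_derivative[OF u(3,2)]
  show ?thesis
   by (rule ie_exreg) (use gd e in \<open>cases d; auto simp: exreg_def yreg_def\<close>)
 qed
 finally show ?thesis by simp
qed

text \<open>
 The residue along a dicritical component at one of its points, with the contribution of the other
 component through this point, does not change under blow-ups of the point.
\<close>
lemma residues:
 assumes "p : set bq Un divisor bq"
 shows "(p : set bq --> (\<Sum>i\<in>idx. wt i * real (vord (st p (pol i)))) = eo (Some p) - eo (compX p) - eo (compY p)) &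
  (p : set bq \<or> corner p -->
   (\<forall>q\<in>dc. compX p = Some q --> (\<Sum>i\<in>idx. wt i * real (iX (st p (pol i)))) + eo (compY p) = 1) &
   (\<forall>q\<in>dc. compY p = Some q --> (\<Sum>i\<in>idx. wt i * real (iX (swp (st p (pol i))))) + eo (compX p) = 1))"
 using bs assms
proof (induction rule: near_induct)
 case (final p)
 have nN: "p ~: set bq" using final divisor_iff[OF bs] by blast
 have "(\<forall>q\<in>dc. compX p = Some q --> (\<Sum>i\<in>idx. wt i * real (iX (st p (pol i)))) + eo (compY p) = 1) &
   (\<forall>q\<in>dc. compY p = Some q --> (\<Sum>i\<in>idx. wt i * real (iX (swp (st p (pol i))))) + eo (compX p) = 1)"
  if c: "corner p"
 proof -
  have u: "is_unit (st p (pol i))" if "i : idx" for i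
   using pol_final[OF that final] sep_not_corner c that by (auto simp: idx_def)
  have s: "(\<Sum>i\<in>idx. wt i * real (iX (st p (pol i)))) = 0" "(\<Sum>i\<in>idx. wt i * real (iX (swp (st p (pol i))))) = 0"
   using iX_unit(1,2)[OF u] by auto
  obtain q1 q2 where q: "compX p = Some q1" "compY p = Some q2" using c by (auto simp: corner_def)
  hence "q1 ~= q2" using comp_distinct[of p q1] by auto
  \<comment> \<open>Dicritical components do not meet, so the other component at the corner is
    invariant and contributes the whole value 1; no pole passes through a corner.\<close>
  hence "q1 ~: dc \<or> q2 ~: dc" using dc(2) final q unfolding no_two_meet_def component_at_iff by metis
  thus ?thesis using s q by (auto simp: eo_def)
 qed
 thus ?case using nN by blast
next
 case (centre p)
 have eqn: "(\<Sum>i\<in>idx. wt i * real (vord (st p (pol i)))) = eo (Some p) - eo (compX p) - eo (compY p)"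
 proof (cases "p : dc")
  case False
  thus ?thesis using wt_eqn centre(1) by blast
 next
  case True
  define r where "r d = (\<Sum>i\<in>idx. wt i * real (ie d (st (p @ [d]) (pol i))))" for d
  note ab = AB[OF True]
  have "(\<Sum>i\<in>idx. wt i * real (vord (st p (pol i)))) = (\<Sum>i\<in>idx. \<Sum>d\<in>dirs p. wt i * real (ie d (st (p @ [d]) (pol i))))"
   by (intro sum.cong) (auto simp: pol_multiplicity[OF True] sum_distrib_left)
  also have "\<dots> = (\<Sum>d\<in>dirs p. r d)" unfolding r_def by (rule sum.swap)
  also have "\<dots> = (\<Sum>a\<in>A p. r (Sl a)) + (\<Sum>b\<in>B p. r (Sl b)) + r Vt"
  proof -
   have "Vt ~: Sl ` (A p Un B p)" by auto
   hence "sum r (dirs p) = sum r (Sl ` (A p Un B p)) + r Vt"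
    unfolding dirs_def using ab by simp
   also have "sum r (Sl ` (A p Un B p)) = (\<Sum>a\<in>A p Un B p. r (Sl a))" by (subst sum.reindex) (auto simp: inj_on_def)
   also have "\<dots> = (\<Sum>a\<in>A p. r (Sl a)) + (\<Sum>b\<in>B p. r (Sl b))" using ab by (intro sum.union_disjoint) auto
   finally show ?thesis .
  qed
  also have "(\<Sum>b\<in>B p. r (Sl b)) = (\<Sum>b\<in>B p. - 1)"
  proof (rule sum.cong[OF refl])
   fix b assume "b : B p"
   hence S: "p @ [Sl b] : Sd" unfolding Sd_eq using True by blast
   thus "r (Sl b) = - 1" unfolding r_def using residue_at_sep[of p "Sl b"] wd[OF S] by simp
  qed
  also have "(\<Sum>a\<in>A p. r (Sl a)) = (\<Sum>a\<in>A p. 1 - eo (compY (p @ [Sl a])))"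
  proof (rule sum.cong[OF refl])
   fix a assume "a : A p"
   hence "p @ [Sl a] : set bq \<or> corner (p @ [Sl a])" by (simp add: A_def)
   thus "r (Sl a) = 1 - eo (compY (p @ [Sl a]))"
    using centre(2)[of "Sl a"] True by (auto simp: r_def ie_def)
  qed
  also have "\<dots> = real (card (A p)) - eo (compY p)"
  proof -
   have "(\<Sum>a\<in>A p. eo (compY (p @ [Sl a]))) = (\<Sum>a\<in>A p. if a = 0 then eo (compY p) else 0)"
    by (intro sum.cong) (auto simp: eo_simps)
   also have "\<dots> = eo (compY p)"
   proof (cases "compY p")
    case (Some q)
    hence "corner (p @ [Sl 0])" by (simp add: corner_def)
    thus ?thesis using ab by (simp add: A_def)
   qed (auto simp: eo_simps intro!: sum.neutral)
   finally show ?thesis by (simp add: sum_subtractf)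
  qed
  also have "r Vt = 1 - eo (compX p)"
  proof (cases "p @ [Vt] : set bq \<or> corner (p @ [Vt])")
   case T: True
   thus ?thesis using centre(2)[of Vertical] True by (auto simp: r_def ie_def)
  next
   case False
   hence S: "p @ [Vt] : Sd" unfolding Sd_eq using True by blast
   moreover have "compX p = None" using False by (cases "compX p") (auto simp: corner_def)
   ultimately show ?thesis unfolding r_def using residue_at_sep[of p Vertical] wd[OF S] by (simp add: eo_simps)
  qed
  \<comment> \<open>The balance is card A - eo(compY) from A, minus card A + 1 from B, plus 1 -
    eo(compX) from the vertical point. Here the count of \<open>B\<close> enters.\<close>
  finally show ?thesis using ab(3) True by (simp add: eo_simps)
 qed
 \<comment> \<open>On an older dicritical axis the sum at p differs from the one at the next point
   of the axis by the order just computed. Since the new component replaces the old second component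
   there, the total stays 1.\<close>
 have X: "(\<Sum>i\<in>idx. wt i * real (iX (st p (pol i)))) + eo (compY p) = 1" if q: "q : dc" "compX p = Some q" for q
 proof -
  have "(\<Sum>i\<in>idx. wt i * real (iX (st p (pol i)))) =
   (\<Sum>i\<in>idx. wt i * real (vord (st p (pol i))) + wt i * real (iX (st (p @ [Vt]) (pol i))))"
   using iX_vertical[OF st_comp_not_dvd(1)[OF pol_neq_0 q(2)]]
   by (intro sum.cong) (auto simp: st_append distrib_left simp del: st1.simps)
  also have "\<dots> = eo (Some p) - eo (compX p) - eo (compY p) + (\<Sum>i\<in>idx. wt i * real (iX (st (p @ [Vt]) (pol i))))"
   by (simp add: sum.distrib eqn)
  finally show ?thesis using centre(2)[of Vertical] q by (auto simp: corner_def eo_simps)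
 qed
 have Y: "(\<Sum>i\<in>idx. wt i * real (iX (swp (st p (pol i))))) + eo (compX p) = 1" if q: "q : dc" "compY p = Some q" for q
 proof -
  have "(\<Sum>i\<in>idx. wt i * real (iX (swp (st p (pol i))))) =
   (\<Sum>i\<in>idx. wt i * real (vord (st p (pol i))) + wt i * real (iX (swp (st (p @ [Sl 0]) (pol i)))))"
   using iY_slope[OF st_comp_not_dvd(2)[OF pol_neq_0 q(2)]]
   by (intro sum.cong) (auto simp: st_append distrib_left simp del: st1.simps)
  also have "\<dots> = eo (Some p) - eo (compX p) - eo (compY p) + (\<Sum>i\<in>idx. wt i * real (iX (swp (st (p @ [Sl 0]) (pol i)))))"
   by (simp add: sum.distrib eqn)
  finally show ?thesis using centre(2)[of "Sl 0"] q by (auto simp: corner_def eo_simps)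
 qed
 show ?case using eqn X Y by blast
qed

text \<open>By \<open>mu_eq\<close> the residue along the component of p is the sum of those along
  the components through p and of the weighted order at p; the former are created at shorter
  points.\<close>

lemma multiplicity_sum:
 "p : set bq ==> (\<Sum>i\<in>idx. wt i * real (mu p (pol i))) = eo (Some p)"
proof (induction p rule: length_induct)
 case (1 p)
 have pn: "p : set bq Un divisor bq" using 1 by simp
 have IH: "(\<Sum>i\<in>idx. wt i * real (mu q (pol i))) = eo (Some q)" if q: "compX p = Some q \<or> compY p = Some q" for q
 proof -
  have "length q < length p" using comp_prefix[of p q] q by auto
  thus ?thesis using 1 comp_centre[OF bs pn q] by blast
 qed
 have X: "(\<Sum>i\<in>idx. wt i * real (mX p (pol i))) = eo (compX p)"
  using IH by (cases "compX p") (simp_all add: mX_def eo_simps)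
 have Y: "(\<Sum>i\<in>idx. wt i * real (mY p (pol i))) = eo (compY p)"
  using IH by (cases "compY p") (simp_all add: mY_def eo_simps)
 have "(\<Sum>i\<in>idx. wt i * real (mu p (pol i))) =
  (\<Sum>i\<in>idx. wt i * real (mX p (pol i)) + wt i * real (mY p (pol i)) + wt i * real (vord (st p (pol i))))"
  by (intro sum.cong) (auto simp: mu_eq[OF pol_neq_0] distrib_left)
 also have "\<dots> = eo (Some p)" using X Y residues[OF pn] 1 by (simp add: sum.distrib)
 finally show ?case .
qed

lemma component_sum:
 assumes "p : set bq Un divisor bq"
 shows "(\<Sum>i\<in>idx. wt i * real (mX p (pol i))) = eo (compX p)" "(\<Sum>i\<in>idx. wt i * real (mY p (pol i))) = eo (compY p)"
 using multiplicity_sum comp_centre[OF bs assms]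
 by (cases "compX p"; cases "compY p"; simp add: mX_def mY_def eo_simps)+

text \<open>After all contributions are collected, the restriction of the model at slope c has the
  coefficient that interlacing keeps away from 0. This is transversality at the points of a
  dicritical component that carry no pole.\<close>

lemma transverse_restriction:
 assumes q: "q : dc" "p = q @ [Sl c]" and p: "p : divisor bq" "p ~: Si Un Sd" "~ corner p"
  and U: "!!i. i : idx ==> is_unit (U i) & pull p (pol i) = gX ^ mX p (pol i) * gY ^ mY p (pol i) * U i"
 shows "(\<Sum>i\<in>idx. wt i * dl (U i)) ~= 0"
proof -
 note ab = AB[OF q(1)]
 have qn: "q : set bq Un divisor bq" and qN: "q : set bq" using q dc by blast+
 have cA: "c ~: A q" using p q divisor_iff[OF bs] by (auto simp: A_def)
 have cB: "c ~: B q" using p(2) q unfolding Sd_eq by blast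
 have c0: "compY q = None" if "c = 0" using p(3) q(2) that by (auto simp: corner_def)
 have cp: "compY p = None" using p(3) q(2) by (auto simp: corner_def)
 have dlU: "dl (U i) = real (mY q (pol i)) * (if c = 0 then 0 else 1 / c) + dl (st p (pol i))" if i: "i : idx" for i
 proof -
  obtain u where u: "is_unit u" "pull q (pol i) = gX ^ mX q (pol i) * gY ^ mY q (pol i) * u * st q (pol i)"
   using pull_structure[OF pol_neq_0[OF i]] by blast
  define T b m where "T = st q (pol i)" and "b = mY q (pol i)" and "m = mX q (pol i) + mY q (pol i) + vord T"
  define t where "t = gY + cst c"
  have T0: "T ~= 0" using pol_neq_0[OF i] by (simp add: T_def)
  have sT: "st p (pol i) = st1 (Sl c) T" by (simp add: q(2) T_def st_append del: st1.simps)
  define V where "V = t ^ b * psl c u * st1 (Sl c) T"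
  have "pull p (pol i) = gX ^ mX q (pol i) * (gX * t) ^ b * psl c u * psl c T"
  proof -
   have pw: "psl c (a ^ n) = psl c a ^ n" for a n by (induction n) (simp_all add: pull_slope_mult)
   show ?thesis unfolding q(2) pull_append u(2) by (simp add: T_def b_def t_def)
  qed
  also have "psl c T = gX ^ vord T * st1 (Sl c) T"
   using pull1_factor(1)[OF T0, of "Sl c"] by simp
  finally have e1: "pull p (pol i) = gX ^ m * V" by (simp add: V_def m_def b_def power_add power_mult_distrib mult_ac del: st1.simps)
  have ne: "i ~= (0, p)" using i p(2) by (auto simp: idx_def)
  have uS: "is_unit (st1 (Sl c) T)" using pol_final[OF i p(1) ne] sT by simp
  have tb: "is_unit (t ^ b)"
  proof (cases "c = 0")
   case True
   thus ?thesis using c0 by (simp add: b_def mY_def)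
  qed (simp add: t_def is_unit_iff)
  have uV: "is_unit V" using tb u(1) uS by (simp add: V_def is_unit_mult_iff del: st1.simps)
  have nX: "~ gX dvd a" if "is_unit a" for a using that at0_not_ex_dvd[of a "Sl c"] by (simp add: is_unit_iff)
  have e2: "pull p (pol i) = gX ^ mX p (pol i) * U i" using U[OF i] cp by (simp add: mY_def)
  have "U i = V" using prime_power_mult_eq[OF prime_X, of "mX p (pol i)" "U i" m V] e1 e2 nX U[OF i] uV by auto
  moreover have "dl V = dl (t ^ b) + 0 + dl (st1 (Sl c) T)"
   unfolding V_def using tb u(1) uS by (subst dl_mult, auto simp: is_unit_iff dl_mult dl_pull_slope simp del: st1.simps)+
  moreover have "dl (t ^ b) = real b * (if c = 0 then 0 else 1 / c)"
  proof (cases "c = 0")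
   case True
   hence "b = 0" using c0 by (simp add: b_def mY_def)
   thus ?thesis by (simp add: dl_def gc_1)
  next
   case False
   thus ?thesis by (simp add: t_def dl_power dl_linear)
  qed
  ultimately show ?thesis by (simp add: sT b_def)
 qed
 define r where "r a = (\<Sum>i\<in>idx. wt i * real (ie (Sl a) (st (q @ [Sl a]) (pol i))))" for a
 have "(\<Sum>i\<in>idx. wt i * dl (U i)) = (\<Sum>i\<in>idx. wt i * real (mY q (pol i)) * (if c = 0 then 0 else 1 / c) +
   (\<Sum>a\<in>A q Un B q. wt i * real (ie (Sl a) (st (q @ [Sl a]) (pol i))) / (c - a)))"
  using pol_restriction[OF q(1) _ cA cB] q(2)
  by (intro sum.cong) (auto simp: dlU distrib_left sum_distrib_left simp del: st1.simps)
 also have "\<dots> = (\<Sum>i\<in>idx. wt i * real (mY q (pol i))) * (if c = 0 then 0 else 1 / c) + (\<Sum>a\<in>A q Un B q. r a / (c - a))"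
  unfolding sum.distrib r_def sum_divide_distrib sum_distrib_right by (subst sum.swap) simp
 also have "(\<Sum>i\<in>idx. wt i * real (mY q (pol i))) = eo (compY q)" by (rule component_sum(2)[OF qn])
 also have "(\<Sum>a\<in>A q Un B q. r a / (c - a)) = (\<Sum>a\<in>A q. r a / (c - a)) + (\<Sum>a\<in>B q. r a / (c - a))"
  using ab by (intro sum.union_disjoint) auto
 also have "(\<Sum>a\<in>B q. r a / (c - a)) = (\<Sum>b\<in>B q. - (1 / (c - b)))"
 proof (rule sum.cong[OF refl])
  fix b assume "b : B q"
  hence S: "q @ [Sl b] : Sd" unfolding Sd_eq using q(1) by blast
  thus "r b / (c - b) = - (1 / (c - b))" unfolding r_def using residue_at_sep[of q "Sl b"] wd[OF S] by simp
 qed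
 also have "(\<Sum>a\<in>A q. r a / (c - a)) = (\<Sum>a\<in>A q. 1 / (c - a) - (if a = 0 then eo (compY q) / c else 0))"
 proof (rule sum.cong[OF refl])
  fix a assume "a : A q"
  hence "q @ [Sl a] : set bq \<or> corner (q @ [Sl a])" by (simp add: A_def)
  hence "r a + eo (compY (q @ [Sl a])) = 1"
   using residues[OF near_snoc[OF qN, of "Sl a"]] q(1) by (auto simp: r_def ie_def)
  hence "r a = 1 - (if a = 0 then eo (compY q) else 0)" by (auto simp: eo_simps split: if_splits)
  thus "r a / (c - a) = 1 / (c - a) - (if a = 0 then eo (compY q) / c else 0)"
   by (auto simp: diff_divide_distrib)
 qed
 \<comment> \<open>If another component passes through slope 0, its residue lowers the one at that
   point. The lost term eo/c is exactly what the factor (y + c)^b of the total transform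
   contributes.\<close>
 also have "\<dots> = (\<Sum>a\<in>A q. 1 / (c - a)) - eo (compY q) * (if c = 0 then 0 else 1 / c)"
 proof -
  have "(\<Sum>a\<in>A q. if a = 0 then eo (compY q) / c else 0) = eo (compY q) * (if c = 0 then 0 else 1 / c)"
  proof (cases "compY q")
   case (Some q')
   hence "corner (q @ [Sl 0])" by (simp add: corner_def)
   thus ?thesis using ab by (auto simp: A_def)
  qed (auto simp: eo_simps intro!: sum.neutral)
  thus ?thesis by (simp add: sum_subtractf)
 qed
 finally have "(\<Sum>i\<in>idx. wt i * dl (U i)) = (\<Sum>a\<in>A q. 1 / (c - a)) - (\<Sum>b\<in>B q. 1 / (c - b))"
  by (simp add: sum_negf)
 thus ?thesis using ab(5)[OF cA cB] by simp
qed

end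

lemma lone_cases:
 assumes "lone p q e"
 shows "e = gX & compX p = Some q & compY p = None \<or> e = gY & compY p = Some q & compX p = None"
proof -
 have c: "cpt q p e" using assms by (simp add: lone_def)
 have "compX p = Some q' ==> q' = q" "compY p = Some q' ==> q' = q" for q'
  using assms unfolding lone_def component_at_iff by blast+
 hence "compX p = None \<or> compY p = None" using comp_distinct[of p q] by (metis option.exhaust)
 thus ?thesis using c unfolding component_at_iff by auto
qed

context model
begin

text \<open>The triangular system may give weight 0 to some pairs, while residues of a logarithmic
  form are nonzero; such poles are dropped.\<close>

definition act :: "(nat \<times> point) set" where "act = {i \<in> idx. wt i ~= 0}"

definition L :: form where "L = lnum act wt pol"

lemma act: "finite act" "act \<subseteq> idx" "i : idx ==> i ~: act ==> wt i = 0"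
 using finite_idx by (auto simp: act_def)

lemma sum_act: "(\<Sum>i\<in>act. wt i * F i) = (\<Sum>i\<in>idx. wt i * F i)"
 using act finite_idx by (intro sum.mono_neutral_left) auto

text \<open>At p the quotient of the pulled back form by the product D of its poles is eo(compX)
  dx/x + eo(compY) dy/y + r dG/G plus a regular part; the multiplier x y G avoids fractions. The
  last clause gives the regular part the nonvanishing that transversality requires.\<close>

lemma local_form:
 assumes p: "p : divisor bq"
  and G_def: "G = (if p : Si Un Sd then g p else 1)" and r_def: "r = (if p : Si Un Sd then ws p else 0)"
  and D_def: "D = (\<Prod>i\<in>act. pull p (pol i))"
 obtains h1 h2 where
  "gX * gY * G * fst (plf p L) =
   D * (cst (eo (compX p)) * (gY * G) + gX * gY * (cst r * Dx G) + gX * gY * G * h1)"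
  "gX * gY * G * snd (plf p L) =
   D * (cst (eo (compY p)) * (gX * G) + gX * gY * (cst r * Dy G) + gX * gY * G * h2)"
  "!!q c. q : dc ==> p = q @ [Sl c] ==> p ~: Si Un Sd ==> ~ corner p ==> gc h2 0 0 ~= 0"
proof -
 define H where "H i = (if i = (0, p) then G else 1)" for i :: "nat \<times> point"
 define k where "k D i = (if i = (0, p) then D G else 0)" for D :: "germ => germ" and i :: "nat \<times> point"
 have S: "p : Si Un Sd" if "(0, p) : idx" using that by (auto simp: idx_def)
 \<comment> \<open>The triple t packs, for each pole, its unit at p and the two logarithmic
   derivatives of that unit.\<close>
 have "\<forall>i\<in>idx. \<exists>t. is_unit (fst t) & pull p (pol i) = gX ^ mX p (pol i) * gY ^ mY p (pol i) * fst t * H i &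
   Dx (fst t) = fst t * fst (snd t) & Dy (fst t) = fst t * snd (snd t) & gc (snd (snd t)) 0 0 = dl (fst t)"
 proof
  fix i assume i: "i : idx"
  obtain u where u: "is_unit u" "pull p (pol i) = gX ^ mX p (pol i) * gY ^ mY p (pol i) * u * st p (pol i)"
   using pull_structure[OF pol_neq_0[OF i]] by blast
  obtain U where U: "is_unit U" "pull p (pol i) = gX ^ mX p (pol i) * gY ^ mY p (pol i) * U * H i"
  proof (cases "i = (0, p)")
   case True
   hence "st p (pol i) = G" using pushes_st_eq[OF push] S i by (simp add: pol_def G_def)
   thus ?thesis using that u True by (simp add: H_def)
  next
   case False
   hence "is_unit (st p (pol i))" using pol_final[OF i p] by blast
   thus ?thesis using that[of "u * st p (pol i)"] u False by (simp add: H_def is_unit_mult_iff)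
  qed
  obtain h1 h2 where "Dx U = U * h1" "Dy U = U * h2" "gc h2 0 0 = dl U" using log_derivative[OF U(1)] .
  thus "\<exists>t. is_unit (fst t) & pull p (pol i) = gX ^ mX p (pol i) * gY ^ mY p (pol i) * fst t * H i &
   Dx (fst t) = fst t * fst (snd t) & Dy (fst t) = fst t * snd (snd t) & gc (snd (snd t)) 0 0 = dl (fst t)"
   using U by auto
 qed
 from bchoice[OF this] obtain t where t: "\<forall>i\<in>idx. is_unit (fst (t i)) & pull p (pol i) = gX ^ mX p (pol i) * gY ^ mY p (pol i) * fst (t i) * H i &
   Dx (fst (t i)) = fst (t i) * fst (snd (t i)) & Dy (fst (t i)) = fst (t i) * snd (snd (t i)) & gc (snd (snd (t i))) 0 0 = dl (fst (t i))" ..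
 define U hx hy where "U i = fst (t i)" and "hx i = fst (snd (t i))" and "hy i = snd (snd (t i))" for i
 have U: "!!i. i : idx ==> is_unit (U i)"
  "!!i. i : idx ==> pull p (pol i) = gX ^ mX p (pol i) * gY ^ mY p (pol i) * U i * H i"
  "!!i. i : idx ==> Dx (U i) = U i * hx i" "!!i. i : idx ==> Dy (U i) = U i * hy i"
  "!!i. i : idx ==> gc (hy i) 0 0 = dl (U i)"
  using t unfolding U_def hx_def hy_def by blast+
 define h1 h2 where "h1 = (\<Sum>i\<in>act. cst (wt i) * hx i)" and "h2 = (\<Sum>i\<in>act. cst (wt i) * hy i)"
 have k: "(\<Sum>i\<in>act. cst (wt i) * k D i) = cst r * D G" for D
 proof (cases "p : Si Un Sd")
  case True
  hence "(0, p) : act" using ws_neq_0 by (auto simp: act_def idx_def wt_simps)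
  have "(\<Sum>i\<in>act. cst (wt i) * k D i) = (\<Sum>i\<in>act. if i = (0, p) then cst (wt (0, p)) * D G else 0)"
   by (intro sum.cong) (auto simp: k_def)
  also have "\<dots> = cst r * D G" using \<open>(0, p) : act\<close> act(1) True by (simp add: wt_simps r_def)
  finally show ?thesis .
 next
  case False
  hence "k D i = 0" if "i : act" for i using that S act(2) by (auto simp: k_def)
  thus ?thesis using False by (simp add: r_def)
 qed
 have comb: "(\<Sum>i\<in>act. cst (wt i) * (cst (real (a i)) * Z * G + gX * gY * k D i + gX * gY * G * hh i)) =
   cst (\<Sum>i\<in>idx. wt i * real (a i)) * (Z * G) + gX * gY * (cst r * D G) + gX * gY * G * (\<Sum>i\<in>act. cst (wt i) * hh i)"
  for a :: "nat \<times> point => nat" and Z D hh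
 proof -
  have "(\<Sum>i\<in>act. cst (wt i) * (cst (real (a i)) * Z * G + gX * gY * k D i + gX * gY * G * hh i)) =
   (\<Sum>i\<in>act. cst (wt i * real (a i)) * (Z * G) + gX * gY * (cst (wt i) * k D i) + gX * gY * G * (cst (wt i) * hh i))"
   by (intro sum.cong) (auto simp: germ_const_mult alg)
  also have "\<dots> = cst (\<Sum>i\<in>act. wt i * real (a i)) * (Z * G) + gX * gY * (\<Sum>i\<in>act. cst (wt i) * k D i)
    + gX * gY * G * (\<Sum>i\<in>act. cst (wt i) * hh i)"
   by (simp add: sum.distrib sum_distrib_left sum_distrib_right germ_const_sum)
  finally show ?thesis unfolding k sum_act .
 qed
 have HG: "G * Dx (H i) = H i * k Dx i" "G * Dy (H i) = H i * k Dy i" for i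
  by (simp_all add: H_def k_def)
 have pn: "p : set bq Un divisor bq" using p by simp
 have pL: "plf p L = lnum act wt (%i. pull p (pol i))" unfolding L_def by (rule pull_lnum)
 show ?thesis
 proof (rule that[of h1 h2])
  have "gX * gY * G * fst (plf p L) = D * (\<Sum>i\<in>act. cst (wt i) *
    (cst (real (mX p (pol i))) * gY * G + gX * gY * k Dx i + gX * gY * G * hx i))"
   unfolding pL lnum_def fst_conv D_def
   by (rule lnum_clear[OF act(1)]) (rule clear_dx[OF U(2,3) HG(1)], use act(2) in auto)
  thus "gX * gY * G * fst (plf p L) =
   D * (cst (eo (compX p)) * (gY * G) + gX * gY * (cst r * Dx G) + gX * gY * G * h1)"
   unfolding comb component_sum(1)[OF pn] h1_def .
  have "gX * gY * G * snd (plf p L) = D * (\<Sum>i\<in>act. cst (wt i) *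
    (cst (real (mY p (pol i))) * gX * G + gX * gY * k Dy i + gX * gY * G * hy i))"
   unfolding pL lnum_def snd_conv D_def
   by (rule lnum_clear[OF act(1)]) (rule clear_dy[OF U(2,4) HG(2)], use act(2) in auto)
  thus "gX * gY * G * snd (plf p L) =
   D * (cst (eo (compY p)) * (gX * G) + gX * gY * (cst r * Dy G) + gX * gY * G * h2)"
   unfolding comb component_sum(2)[OF pn] h2_def .
  show "gc h2 0 0 ~= 0" if q: "q : dc" "p = q @ [Sl c]" "p ~: Si Un Sd" "~ corner p" for q c
  proof -
   have H1: "H i = 1" if "i : idx" for i using that S q(3) by (auto simp: H_def)
   have "gc h2 0 0 = (\<Sum>i\<in>act. wt i * gc (hy i) 0 0)" by (simp add: h2_def)
   also have "\<dots> = (\<Sum>i\<in>act. wt i * dl (U i))" using U(5) act(2) by (intro sum.cong) auto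
   also have "\<dots> = (\<Sum>i\<in>idx. wt i * dl (U i))" by (rule sum_act)
   also have "\<dots> ~= 0" by (rule transverse_restriction[OF q(1,2) p q(3,4)]) (use U(1,2) H1 in auto)
   finally show ?thesis .
  qed
 qed
qed

text \<open>The conditions of \<open>adapted\<close> at one point, with the index at an isolated
  separatrix, for an explicit representative; \<open>good_scale\<close> carries them over to the
  strict transform.\<close>

definition good :: "point => form => bool" where
 "good p Om <-> coprime (fst Om) (snd Om) &
  (\<forall>q. compX p = Some q --> (q ~: dc --> gX dvd wdg Om gX) & (q : dc --> gc (wdg Om gX) 0 0 ~= 0)) &
  (\<forall>q. compY p = Some q --> (q ~: dc --> gY dvd wdg Om gY) & (q : dc --> gc (wdg Om gY) 0 0 ~= 0)) &
  (sng Om --> smp Om & ~ saddle_node Om & (corner p \<or> p : Si)) &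
  (p : Si Un Sd --> g p dvd wdg Om (g p)) &
  (p : Si --> sng Om & csi Om (crv (g p)) = - 1 / ws p)"

lemma good_scale:
 assumes "good p Om" "is_unit u" shows "good p (scl u Om)"
proof -
 have co: "coprime (fst Om) (snd Om)" using assms(1) by (simp add: good_def)
 have u0: "gc u 0 0 ~= 0" using assms(2) by (simp add: is_unit_iff)
 have "csi (scl u Om) (crv (g p)) = csi Om (crv (g p))" if p: "p : Si"
 proof -
  have S: "p : Si Un Sd" using p by simp
  obtain U V where "gp (g p) U V" using sep_props(2)[OF S] by blast
  thus ?thesis using cs_index_scale[OF sep_props(1)[OF S] _ co _ assms(2)] assms(1) p by (auto simp: good_def)
 qed
 thus ?thesis
  using assms u0 unfolding good_def
  by (simp add: coprime_scale[OF assms(2)] inv_scale[OF assms(2)] singular_scale[OF assms(2)] simple_sing_scale[OF assms(2)]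
    saddle_node_scale[OF assms(2)] wedge_scale del: scale_form_simps)
qed

text \<open>The axes and the curve G that are not poles cancel from the multiplier x y G in
  \<open>local_form\<close>; what remains is in each case a normal form or a regular form.\<close>

lemma good_form:
 assumes p: "p : divisor bq"
 shows "\<exists>Om k k'. good p Om & k ~= 0 & k' ~= 0 & scl k (plf p L) = scl k' Om"
proof -
 define D where "D = (\<Prod>i\<in>act. pull p (pol i))"
 have D: "D ~= 0" using act pol_neq_0 by (auto simp: D_def)
 have XY: "gX * gY ~= 0" by simp
 define G where "G = (if p : Si Un Sd then g p else 1)"
 define r where "r = (if p : Si Un Sd then ws p else 0)"
 obtain h1 h2 where
  h1: "gX * gY * G * fst (plf p L) =
   D * (cst (eo (compX p)) * (gY * G) + gX * gY * (cst r * Dx G) + gX * gY * G * h1)"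
  and h2: "gX * gY * G * snd (plf p L) =
   D * (cst (eo (compY p)) * (gX * G) + gX * gY * (cst r * Dy G) + gX * gY * G * h2)"
  and tr: "!!q c. q : dc ==> p = q @ [Sl c] ==> p ~: Si Un Sd ==> ~ corner p ==> gc h2 0 0 ~= 0"
  by (rule local_form[OF p G_def r_def D_def], rule that, assumption, assumption, blast)
 have p0: "p ~= []" using p divisor_iff[OF bs] by auto
 show ?thesis
 proof (cases "p : Si Un Sd")
  case S: True
  obtain q e u where u: "lone p q e" "q : dc <-> p : Sd" "is_unit u" "graph e (u * g p)" using sep[OF S] by blast
  note gd = graph_derivative[OF u(4,3)]
  note l = lone_cases[OF u(1)]
  have G0: "g p ~= 0" using sep_props(5)[OF S] .
  have Gg: "G = g p" and rw: "r = ws p" using S by (simp_all add: G_def r_def)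
  have r0: "r ~= 0" using ws_neq_0[OF S] by (simp add: rw)
  note e1 = h1[unfolded Gg] and e2 = h2[unfolded Gg]
  show ?thesis
  proof (cases "p : Si")
   case True
   hence q: "q ~: dc" using u(2) disj by blast
   have rr: "~ pos_rat (- 1 / r)" using wi[OF True] by (simp add: rw)
   show ?thesis
   proof (cases "e = gX")
    case eX: True
    have c: "compX p = Some q" "compY p = None" using l eX by auto
    define Om where "Om = (g p + gX * (cst r * Dx (g p) + g p * h1), gX * (cst r * Dy (g p) + g p * h2))"
    have Om: "fst Om = g p + gX * (cst r * Dx (g p) + g p * h1)" "snd Om = gX * (cst r * Dy (g p) + g p * h2)"
     by (simp_all add: Om_def)
    note n = normal_isolated[OF u(4)[unfolded eX] u(3) r0 rr Om]
    have "good p Om" unfolding good_def using n c q True by (auto simp: simple_sing_def rw)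
    moreover have "scl (gX * gY * g p) (plf p L) = scl (D * gY) Om"
     unfolding scale_form_def e1 e2 Om by (simp add: c eo_simps q alg)
    ultimately show ?thesis using D G0 by (intro exI[of _ Om] exI[of _ "gX * gY * g p"] exI[of _ "D * gY"]) simp
   next
    case False
    hence eY: "e = gY" and c: "compY p = Some q" "compX p = None" using l by auto
    define Om where "Om = (gY * (cst r * Dx (g p) + g p * h1), g p + gY * (cst r * Dy (g p) + g p * h2))"
    have Om: "fst Om = gY * (cst r * Dx (g p) + g p * h1)" "snd Om = g p + gY * (cst r * Dy (g p) + g p * h2)"
     by (simp_all add: Om_def)
    note n = normal_isolated_Y[OF u(4)[unfolded eY] u(3) r0 rr Om]
    have "good p Om" unfolding good_def using n c q True by (auto simp: simple_sing_def rw)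
    moreover have "scl (gX * gY * g p) (plf p L) = scl (D * gX) Om"
     unfolding scale_form_def e1 e2 Om by (simp add: c eo_simps q alg)
    ultimately show ?thesis using D G0 by (intro exI[of _ Om] exI[of _ "gX * gY * g p"] exI[of _ "D * gX"]) simp
   qed
  next
   case False
   hence q: "q : dc" "p : Sd" using u(2) S by auto
   have c: "eo (compX p) = 0" "eo (compY p) = 0" using l q by (auto simp: eo_simps)
   \<comment> \<open>Neither axis is a pole here, so x y cancels completely, and r dg plus a
     multiple of g is a regular form whose leaf g is transverse to the component.\<close>
   define Om where "Om = (cst r * Dx (g p) + g p * h1, cst r * Dy (g p) + g p * h2)"
   have d0: "gc (fst Om) 0 0 = r * gc (g p) 1 0" "gc (snd Om) 0 0 = r * gc (g p) 0 1" using gd(1) by (simp_all add: Om_def gc_dx gc_dy)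
   have t: "gc (wdg Om e) 0 0 ~= 0" using l d0 gd(2,3) r0 by (auto simp: wedge_d_def)
   have ns: "~ sng Om" using t by (auto simp: singular_form_def wedge_d_def)
   hence "is_unit (fst Om) \<or> is_unit (snd Om)" by (auto simp: singular_form_def is_unit_iff)
   hence co: "coprime (fst Om) (snd Om)" by (auto simp: is_unit_left_imp_coprime is_unit_right_imp_coprime)
   have "wdg Om (g p) = g p * (h1 * Dy (g p) - h2 * Dx (g p))" by (simp add: wedge_d_def Om_def alg)
   hence "good p Om" unfolding good_def using co ns t l q(1) False by auto
   moreover have "scl (gX * gY * g p) (plf p L) = scl (D * (gX * gY)) Om"
    unfolding scale_form_def e1 e2 Om_def by (simp add: c alg)
   ultimately show ?thesis using D G0 by (intro exI[of _ Om] exI[of _ "gX * gY * g p"] exI[of _ "D * (gX * gY)"]) simp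
  qed
 next
  case nS: False
  have G1: "G = 1" "r = 0" using nS by (simp_all add: G_def r_def)
  have e1: "gX * gY * fst (plf p L) = D * (cst (eo (compX p)) * gY + gX * gY * h1)"
   and e2: "gX * gY * snd (plf p L) = D * (cst (eo (compY p)) * gX + gX * gY * h2)"
   using h1 h2 unfolding G1 by auto
  have sX: "\<exists>Om k k'. good p Om & k ~= 0 & k' ~= 0 & scl k (plf p L) = scl k' Om"
   if c: "compX p = Some q" "q ~: dc" "eo (compY p) = 0" for q
  proof -
   define Om where "Om = (1 + gX * h1, gX * h2)"
   have co: "coprime (fst Om) (snd Om)" by (rule is_unit_left_imp_coprime) (simp add: Om_def is_unit_iff)
   have "good p Om" unfolding good_def using co c nS by (auto simp: Om_def wedge_d_def singular_form_def eo_def)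
   moreover have "scl (gX * gY) (plf p L) = scl (D * gY) Om"
    unfolding scale_form_def e1 e2 Om_def by (simp add: c eo_simps alg)
   ultimately show ?thesis using D by (intro exI[of _ Om] exI[of _ "gX * gY"] exI[of _ "D * gY"]) simp
  qed
  have sY: "\<exists>Om k k'. good p Om & k ~= 0 & k' ~= 0 & scl k (plf p L) = scl k' Om"
   if c: "compY p = Some q" "q ~: dc" "eo (compX p) = 0" for q
  proof -
   define Om where "Om = (gY * h1, 1 + gY * h2)"
   have co: "coprime (fst Om) (snd Om)" by (rule is_unit_right_imp_coprime) (simp add: Om_def is_unit_iff)
   have "good p Om" unfolding good_def using co c nS by (auto simp: Om_def wedge_d_def singular_form_def eo_def)
   moreover have "scl (gX * gY) (plf p L) = scl (D * gX) Om"
    unfolding scale_form_def e1 e2 Om_def by (simp add: c eo_simps alg)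
   ultimately show ?thesis using D by (intro exI[of _ Om] exI[of _ "gX * gY"] exI[of _ "D * gX"]) simp
  qed
  show ?thesis
  proof (cases "corner p")
   case True
   then obtain q q' where q: "compX p = Some q" "compY p = Some q'" by (auto simp: corner_def)
   hence "q ~= q'" using comp_distinct[of p q] by auto
   hence nd: "q ~: dc \<or> q' ~: dc" using dc(2) p q unfolding no_two_meet_def component_at_iff by metis
   show ?thesis
   proof (cases "q : dc \<or> q' : dc")
    case True
    thus ?thesis using nd sX[OF q(1)] sY[OF q(2)] q by (auto simp: eo_simps)
   next
    case False
    define Om where "Om = (gY * (1 + gX * h1), gX * (1 + gY * h2))"
    have "good p Om" unfolding good_def Om_def using normal_corner[of h1 h2] q False \<open>corner p\<close> nS by auto
    moreover have "scl (gX * gY) (plf p L) = scl D Om"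
     unfolding scale_form_def e1 e2 Om_def using False by (simp add: q eo_simps alg)
    ultimately show ?thesis using D XY by blast
   qed
  next
   case nc: False
   then obtain q e where qe: "lone p q e" using lone_or_corner[OF p0] by blast
   note l = lone_cases[OF qe]
   show ?thesis
   proof (cases "q : dc")
    case False
    thus ?thesis using l sX[of q] sY[of q] by (auto simp: eo_simps)
   next
    case True
    obtain p' d where p': "p = p' @ [d]" "p' : set bq" using p divisor_iff[OF bs] by blast
    hence q: "q = p'" "e = ex d" using lone_snoc[of p' d q e] qe by auto
    \<comment> \<open>A vertical point that is neither a centre nor a corner belongs to Sd, so only
      affine slopes remain.\<close>
    have "d ~= Vt"
    proof
     assume "d = Vt"
     hence "p : Sd" unfolding Sd_eq using True q p' nc p divisor_iff[OF bs] by auto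
     thus False using nS by blast
    qed
    then obtain c where d: "d = Sl c" by (cases d) auto
    have cX: "compX p = Some q" "compY p = None" using l q d by auto
    have t: "gc h2 0 0 ~= 0" using tr[of q c] True p' q d nS nc by simp
    define Om where "Om = (h1, h2)"
    have co: "coprime (fst Om) (snd Om)" by (rule is_unit_right_imp_coprime) (use t in \<open>simp add: Om_def is_unit_iff\<close>)
    have "good p Om" unfolding good_def using co t cX True nS by (auto simp: Om_def wedge_d_def singular_form_def)
    moreover have "scl (gX * gY) (plf p L) = scl (D * (gX * gY)) Om"
     unfolding scale_form_def e1 e2 Om_def using True by (simp add: cX eo_simps)
    ultimately show ?thesis using D by (intro exI[of _ Om] exI[of _ "gX * gY"] exI[of _ "D * (gX * gY)"]) simp
   qed
  qed
 qed
qed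

end

text \<open>The predecessor of a missing centre of least length is a centre of \<rho>, so the
  missing centre lies on the divisor of \<rho>.\<close>

lemma first_missing_centre:
 assumes "blowup_seq \<rho>" "blowup_seq bq" "set \<rho> \<subset> set bq"
 obtains q where "q : set bq" "q : divisor \<rho>"
proof -
 have "\<exists>q. q : set bq - set \<rho>" using assms(3) by blast
 then obtain q where q: "q : set bq - set \<rho>" "!!q'. q' : set bq - set \<rho> ==> length q \<le> length q'"
  using ex_has_least_nat[of "%q. q : set bq - set \<rho>" _ length] by blast
 hence "q ~= []" using blowup_seq_Nil[OF assms(1)] by auto
 then obtain p d where p: "q = p @ [d]" by (metis rev_exhaust)
 hence "p : set bq" using q(1) blowup_seq_butlast[OF assms(2)] by blast
 hence "p : set \<rho>" using q(2)[of p] p by force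
 thus ?thesis using that[of q] q(1) p divisor_iff[OF assms(1)] by blast
qed

context model
begin

section \<open>The foliation defined by the model\<close>

lemma L_nonzero: "fst L ~= 0 \<or> snd L ~= 0"
proof (rule ccontr)
 assume "~ ?thesis"
 hence L0: "fst L = 0" "snd L = 0" by auto
 obtain c where "[] @ [Sl c] : divisor bq"
  using generic_slope[OF bs blowup_seq_Nil[OF bs] finite.emptyI] by metis
 from good_form[OF this] obtain Om k k' where Om: "good ([] @ [Sl c]) Om" "k' ~= 0"
  "scl k (plf ([] @ [Sl c]) L) = scl k' Om" by blast
 have "fst Om = 0" "snd Om = 0" using Om(2,3) L0 by (auto simp: pull_form_def prod_eq_iff)
 thus False using Om(1) by (simp add: good_def)
qed

text \<open>By \<open>pol_off\<close> the base points of equal curves are prefixes of each other,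
  hence equal. Separatrices are based at final points and pairs at centres, and the two pairs of a
  centre differ in their quadratic coefficient.\<close>

lemma pol_distinct:
 assumes ij: "i : idx" "j : idx" and d: "pol i dvd pol j" shows "i = j"
proof -
 have d': "pol j dvd pol i" by (rule prime_dvd_imp_dvd[OF prime_pol[OF ij(1)] prime_pol[OF ij(2)] d])
 have c: "crv (pol i) = crv (pol j)" using d d' by (simp add: curve_of_eq_iff)
 have u: "is_unit (st p (pol i)) <-> is_unit (st p (pol j))" for p
  by (rule same_curve_st_unit[OF c pol_neq_0[OF ij(1)] pol_neq_0[OF ij(2)]])
 obtain r where r: "snd j = snd i @ r" using u pol_base[OF ij(1)] pol_off[OF ij(2) base_near[OF ij(1)]] by blast
 obtain r' where r': "snd i = snd j @ r'" using u pol_base[OF ij(2)] pol_off[OF ij(1) base_near[OF ij(2)]] by blast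
 have s: "snd i = snd j" using r r' by simp
 have z: "fst i = 0 <-> fst j = 0" using ij s final divisor_iff[OF bs] by (auto simp: idx_def)
 show ?thesis
 proof (cases "fst i = 0")
  case True
  thus ?thesis using z s by (simp add: prod_eq_iff)
 next
  case False
  obtain u where u: "is_unit u" "pushes (snd i) (u * qd (real (fst i))) (pol i)" using pair_pushes[OF ij(1) False] by metis
  obtain v where v: "is_unit v" "pushes (snd j) (v * qd (real (fst j))) (pol j)" using pair_pushes[OF ij(2)] z False by metis
  obtain w where w: "is_unit w" "pol j = w * pol i" using dvd_antisym_unit[OF d d'] .
  have "st (snd i) (pol j) = pull (snd i) w * st (snd i) (pol i)"
   using w pol_neq_0[OF ij(1)] by (simp add: st_mult st_unit)
  hence e: "v * qd (real (fst j)) = (pull (snd i) w * u) * qd (real (fst i))"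
   using pushes_st_eq[OF u(2)] pushes_st_eq[OF v(2)] s by simp
  obtain v' where v': "v' * v = 1" using v(1) by (metis dvdE mult.commute)
  have vu: "is_unit v'" using v' by (metis dvd_triv_left)
  have "qd (real (fst j)) = (v' * (pull (snd i) w * u)) * qd (real (fst i))"
   using arg_cong[OF e, of "(*) v'"] v' by (simp flip: mult.assoc)
  moreover have "is_unit (v' * (pull (snd i) w * u))" using vu w(1) u(1) by (simp add: is_unit_mult_iff)
  ultimately have "real (fst j) = real (fst i)" by (intro qd_unit_multiple)
  thus ?thesis using s by (simp add: prod_eq_iff)
 qed
qed

context
 fixes th h assumes h: "h ~= 0" "L = scl h th" and co: "coprime (fst th) (snd th)"
begin

lemma model_good: assumes p: "p : divisor bq" shows "good p (stf th p)"
proof -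
 obtain Om k k' where Om: "good p Om" "k ~= 0" "k' ~= 0" "scl k (plf p L) = scl k' Om"
  using good_form[OF p] by blast
 have c: "coprime (fst Om) (snd Om)" using Om(1) by (simp add: good_def)
 have k0: "k * pull p h ~= 0" using Om(2) h(1) by simp
 have e: "scl (k * pull p h) (plf p th) = scl k' Om"
  unfolding Om(4)[symmetric] h(2) pull_form_scale by (simp add: scale_form_def)
 obtain u where "is_unit u" "stf th p = scl u Om"
  by (rule strict_form_unique[OF co c k0 Om(3) e])
 thus ?thesis using good_scale[OF Om(1)] by simp
qed

lemma model_adapted: "adapted th"
 unfolding adapted_def
using final model_good co good_def component_at_iff by auto

lemma model_pole_invariant: assumes i: "i : act" shows "pol i dvd wdg th (pol i)"
proof -
 have ii: "i : idx" using i act by blast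
 have e: "lnum act wt pol = scl h th" using h(2) by (simp add: L_def)
 have "~ pol i dvd h"
 proof (rule lnum_pole_not_dvd[OF act(1) i _ _ _ e])
  show "prm (pol j)" if "j : act" for j using that act prime_pol by blast
  show "j = i" if "j : act" "pol i dvd pol j" for j using pol_distinct[OF ii, of j] that act by blast
  show "wt i ~= 0" using i by (simp add: act_def)
 qed
 moreover have "pol i dvd h * wdg th (pol i)"
  using lnum_invariant[OF act(1) i, of pol wt] unfolding e wedge_scale .
 ultimately show ?thesis using prime_pol[OF ii] by (simp add: prime_elem_dvd_mult_iff)
qed

text \<open>A dicritical centre carries no pair; for it the non-invariance of the component it
  creates plays the role of the pair of tag 2.\<close>

lemma model_bad:
 assumes q: "q : set bq" shows "sng (stf th q)" "~ smp (stf th q)"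
proof -
 have "sng (stf th q) & ~ smp (stf th q)"
 proof (cases "q : dc")
  case False
  hence i: "(2, q) : idx" "(2, q) : act" using q by (auto simp: idx_def act_def wt_simps)
  have n: "fst (2 :: nat, q) ~= 0" by simp
  obtain u where u: "is_unit u" "pushes (snd (2 :: nat, q)) (u * qd (real (fst (2 :: nat, q)))) (pol (2, q))"
   by (rule pair_pushes[OF i(1) n])
  hence "pushes q (u * qd 2) (pol (2, q))" by simp
  from pair_bad[OF _ co u(1) this model_pole_invariant[OF i(2)]] show ?thesis by simp
 next
  case True
  obtain c where c: "q @ [Sl c] : divisor bq" using generic_slope[OF bs q finite.emptyI] by blast
  have "cpt q (q @ [Sl c]) gX" by (rule component_at.intros)
  hence "gc (wdg (stf th (q @ [Sl c])) gX) 0 0 ~= 0"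
   using ad_comp(2)[OF model_adapted c _ True] by blast
  hence "~ gX dvd wdg (stf th (q @ [Sl c])) gX" by auto
  from dicritical_bad[OF co this] show ?thesis .
 qed
 thus "sng (stf th q)" "~ smp (stf th q)" by blast+
qed

lemma model_foliation: "foliation th"
proof -
 obtain u where u: "is_unit u" "stf th [] = scl u th" using strict_form_Nil[OF co] .
 hence "sng th" using model_bad(1)[OF blowup_seq_Nil[OF bs]] singular_scale[OF u(1)] by simp
 thus ?thesis using co by (simp add: foliation_def singular_form_def is_unit_iff)
qed

lemma model_reduction: "real_reduction th bq"
 unfolding real_reduction_def minimal_seq_def
proof (intro conjI bs ad_reduces[OF model_adapted] notI)
 assume "\<exists>\<rho>. blowup_seq \<rho> & reduces th \<rho> & set \<rho> \<subset> set bq"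
 then obtain \<rho> where \<rho>: "blowup_seq \<rho>" "reduces th \<rho>" "set \<rho> \<subset> set bq" by blast
 obtain q where "q : set bq" "q : divisor \<rho>" using first_missing_centre[OF \<rho>(1) bs \<rho>(3)] .
 thus False using model_bad[of q] \<rho>(2) by (auto simp: reduces_def)
qed

text \<open>At isolated separatrices the weight gives the right index at the final point; at
  dicritical ones both foliations are regular there and the index is 0. \<open>cs_difference\<close>
  brings the equality down to the origin.\<close>

lemma model_index:
 assumes ad: "adapted om" and w: "!!p. p : Si ==> ws p = - 1 / csi (stf om p) (crv (g p))"
  and p: "p : Si Un Sd"
 shows "csi om (crv (f p)) = csi th (crv (f p))"
proof -
 obtain U V where gpg: "gp (g p) U V" using sep_props(2)[OF p] by blast
 note pg = sep_props(1)[OF p] and fp = final[OF p]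
 have inv: "f p dvd wdg \<tau> (f p)" if "adapted \<tau>" for \<tau>
  using invariant_along[OF ad_co(1)[OF that] pg push[OF p]] ad_sep(1)[OF that p] by simp
 have "csi (stf om p) (crv (g p)) = csi (stf th p) (crv (g p))"
 proof (cases "p : Si")
  case True
  have "csi (stf th p) (crv (g p)) = - 1 / ws p" using model_good[OF fp] True by (simp add: good_def)
  thus ?thesis using w[OF True] by simp
 next
  case False
  hence pd: "p : Sd" using p by blast
  have "csi (stf \<tau> p) (crv (g p)) = 0" if t: "adapted \<tau>" for \<tau>
  proof -
   obtain q e where "lone p q e" "q : dc" using sep[OF p] pd by blast
   hence "~ sng (stf \<tau> p)"
    using ad_comp(2)[OF t fp, of q e] wedge_nonsingular[OF t] by (auto simp: lone_def)
   from cs_regular[OF this pg gpg ad_sep(1)[OF t p]] show ?thesis .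
  qed
  thus ?thesis using ad model_adapted by simp
 qed
 thus ?thesis
  using cs_difference[OF pg gpg push[OF p] ad_co(1)[OF ad] co inv[OF ad] inv[OF model_adapted]] by simp
qed

text \<open>At a generic slope over p no axis but the new component can be a pole. Either its
  residue is 1 or it is dicritical and the restriction is nonzero there, which is the alternative
  required by \<open>ford_faithful\<close>.\<close>

lemma model_faithful:
 assumes p: "p : set bq"
 shows "ford (plf p L) + 1 = enat (vord (pull p (\<Prod>i\<in>act. pol i)))"
proof -
 define D where "D = (\<Prod>i\<in>act. pull p (pol i))"
 have D: "pull p (\<Prod>i\<in>act. pol i) = D" by (simp add: D_def pull_prod)
 have n0: "pull p (pol i) ~= 0" if "i : act" for i
  using pol_neq_0[of i] act(2) that by auto
 have D0: "D ~= 0" using n0 act(1) by (simp add: D_def)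
 have fs: "finite {c. p @ [Sl c] : Si Un Sd}"
  using finite_vimageI[of "Si Un Sd" "%c. p @ [Sl c]"] fin by (auto simp: inj_on_def vimage_def)
 obtain c where c': "c ~: {c. p @ [Sl c] : Si Un Sd}" and c0: "c ~= 0" "p @ [Sl c] : divisor bq"
  by (rule generic_slope[OF bs p fs])
 from c' have c1: "p @ [Sl c] ~: Si Un Sd" by simp
 note c = c1 c0
 have nc: "~ corner (p @ [Sl c])" using c(2) by (simp add: corner_def)
 obtain h1 h2 where
  h1: "gX * gY * 1 * fst (plf (p @ [Sl c]) L) =
   (\<Prod>i\<in>act. pull (p @ [Sl c]) (pol i)) * (cst (eo (compX (p @ [Sl c]))) * (gY * 1) + gX * gY * (cst 0 * Dx 1) + gX * gY * 1 * h1)"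
  and h2: "gX * gY * 1 * snd (plf (p @ [Sl c]) L) =
   (\<Prod>i\<in>act. pull (p @ [Sl c]) (pol i)) * (cst (eo (compY (p @ [Sl c]))) * (gX * 1) + gX * gY * (cst 0 * Dy 1) + gX * gY * 1 * h2)"
  and tr: "!!q b. q : dc ==> p @ [Sl c] = q @ [Sl b] ==> p @ [Sl c] ~: Si Un Sd ==> ~ corner (p @ [Sl c]) ==> gc h2 0 0 ~= 0"
  by (rule local_form[OF c(3), of 1 0], use c(1) in simp, use c(1) in simp, rule refl, rule that, assumption, assumption, blast)
 have pD: "(\<Prod>i\<in>act. pull (p @ [Sl c]) (pol i)) = pull [Sl c] D" by (simp add: D_def pull_prod pull_append)
 have pL: "plf (p @ [Sl c]) L = plf [Sl c] (plf p L)" by (rule pull_form_append)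
 have "gY * (gX * fst (plf [Sl c] (plf p L))) = gY * (pull [Sl c] D * (cst (eo (Some p)) + gX * h1))"
  using h1 unfolding pD pL by (simp add: alg)
 hence e1: "gX * fst (plf [Sl c] (plf p L)) = pull [Sl c] D * (cst (eo (Some p)) + gX * h1)"
  by simp
 have "(gX * gY) * snd (plf [Sl c] (plf p L)) = (gX * gY) * (pull [Sl c] D * h2)"
  using h2 c(2) unfolding pD pL by (simp add: eo_simps)
 moreover have "gX * gY ~= 0" by simp
 ultimately have e2: "snd (plf [Sl c] (plf p L)) = pull [Sl c] D * h2"
  by simp
 have ne: "eo (Some p) ~= 0 \<or> gc h2 0 0 ~= 0" using tr[of p c] c(1) nc by (cases "p : dc") (auto simp: eo_simps)
 have bd: "enat (vord D) \<le> ford (plf p L) + 1"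
  unfolding L_def pull_lnum D_def by (rule ford_lnum[OF act(1) n0])
 show ?thesis unfolding D by (rule ford_faithful[OF D0 bd e1 e2 ne])
qed

lemma act_sep: "p : Si Un Sd ==> (0, p) : act"
 using ws_neq_0 by (simp add: act_def idx_def wt_simps)

text \<open>The origin always provides a pole: a separatrix of weight -1 if its component is
  dicritical, and the pair of tag 2 otherwise.\<close>

lemma act_nonempty: "act ~= {}"
proof (cases "[] : dc")
 case True
 then obtain b where "b : B []" using AB(3)[OF True] by (metis card.empty equals0I nat.distinct(1))
 hence "[] @ [Sl b] : Sd" unfolding Sd_eq using True by blast
 thus ?thesis using act_sep by blast
next
 case False
 hence "(2, []) : act" using blowup_seq_Nil[OF bs] by (simp add: act_def idx_def wt_simps)
 thus ?thesis by blast
qed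

lemma model_one_dim: assumes i: "i : idx" shows "one_dimensional (pol i) <-> fst i = 0"
proof (cases "fst i = 0")
 case True
 hence S: "snd i : Si Un Sd" "pol i = f (snd i)" using i by (auto simp: idx_def pol_def)
 thus ?thesis using pushes_one_dim_iff[OF push[OF S(1)]] sep_props(4)[OF S(1)] True by simp
next
 case False
 obtain u where u: "is_unit u" "pushes (snd i) (u * qd (real (fst i))) (pol i)" "0 < real (fst i)" using pair_pushes[OF i False] .
 thus ?thesis using pushes_one_dim_iff[OF u(2)] one_dim_unit[OF u(1)] definite_not_one_dim[OF u(3)] by (simp add: qd_def)
qed

lemma model_strict:
 assumes ad: "adapted om" and w: "!!p. p : Si ==> ws p = - 1 / csi (stf om p) (crv (g p))"
 shows "\<exists>\<eta>. strict_log_model \<eta> (trip om)"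
proof -
 obtain b where b: "bij_betw b {..<card act} act" using ex_bij_betw_nat_finite[OF act(1)] by (metis atLeast0LessThan)
 define \<eta> where "\<eta> = fam_log act wt pol b"
 have bi: "b i : act" if "i < card act" for i using b that by (auto simp: bij_betw_def)
 note num = fam_log_num[OF b, of wt pol, folded \<eta>_def L_def]
 have fl: "npoles \<eta> = card act" "res \<eta> i = wt (b i)" "pole \<eta> i = pol (b i)" "reg \<eta> = (0, 0)" for i
  by (simp_all add: \<eta>_def fam_log_def)
 have r: "real_log_form \<eta>" unfolding real_log_form_def fl
 proof (intro conjI allI impI)
  show "1 \<le> card act" using act_nonempty act(1) by (simp add: Suc_le_eq card_gt_0_iff)
  show "wt (b i) ~= 0" if "i < card act" for i using bi[OF that] by (simp add: act_def)
  show "irreducible (pol (b i))" if "i < card act" for i using bi[OF that] act(2) prime_pol prime_elem_imp_irreducible by blast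
  show "~ pol (b i) dvd pol (b j)" if "i < card act" "j < card act" "i ~= j" for i j
  proof
   assume "pol (b i) dvd pol (b j)"
   hence "b i = b j" using pol_distinct bi that act(2) by blast
   thus False using b that by (auto simp: bij_betw_def inj_on_def)
  qed
  show "Dy (fst (0, 0)) = Dx (snd (0, 0))" by simp
 qed
 have poles: "real_poles \<eta> = (%p. crv (f p)) ` (Si Un Sd)"
 proof
  show "real_poles \<eta> \<subseteq> (%p. crv (f p)) ` (Si Un Sd)"
  proof
   fix S assume "S : real_poles \<eta>"
   then obtain i where i: "i < card act" "one_dimensional (pol (b i))" "S = crv (pol (b i))" by (auto simp: real_poles_def fl)
   have "b i : idx" using bi[OF i(1)] act(2) by blast
   thus "S : (%p. crv (f p)) ` (Si Un Sd)" using i model_one_dim by (auto simp: idx_def pol_def)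
  qed
  show "(%p. crv (f p)) ` (Si Un Sd) \<subseteq> real_poles \<eta>"
  proof
   fix S assume "S : (%p. crv (f p)) ` (Si Un Sd)"
   then obtain p where p: "p : Si Un Sd" "S = crv (f p)" by blast
   have "(0, p) : b ` {..<card act}" using act_sep[OF p(1)] b by (simp add: bij_betw_def)
   then obtain i where i: "i < card act" "b i = (0, p)" by auto
   have "one_dimensional (pol (0, p))" using model_one_dim[of "(0, p)"] act_sep[OF p(1)] act(2) by auto
   thus "S : real_poles \<eta>" unfolding real_poles_def fl using i p(2) by (auto simp: pol_def intro!: exI[of _ i])
  qed
 qed
 have fol: "log_foliation \<eta> th" unfolding log_foliation_def num(1) using model_foliation h by blast
 have sd: "S : (%p. crv (f p)) ` Sd <-> (\<exists>q\<in>dc. meets_component bq S q)" if S: "S : (%p. crv (f p)) ` (Si Un Sd)" for S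
 proof -
  obtain p where p: "p : Si Un Sd" "S = crv (f p)" using S by blast
  have "S : (%p. crv (f p)) ` Sd <-> p : Sd" using p sep_inj by (auto simp: inj_on_def)
  moreover obtain q e where "lone p q e" "q : dc <-> p : Sd" using sep[OF p(1)] by blast
  ultimately show ?thesis using meets_iff[OF p(1)] p(2) by (auto simp: lone_def)
 qed
 have nd: "S ~: (%p. crv (f p)) ` Sd" if "S : (%p. crv (f p)) ` Si" for S
  using that sep_inj disj by (auto simp: inj_on_def)
 have dup: "log_duplet \<eta> th bq dc ((%p. crv (f p)) ` Sd) ((%p. crv (f p)) ` Si)"
  unfolding log_duplet_def ad_noninvariant[OF model_adapted] ad_isolated[OF model_adapted] poles
  using model_reduction sd nd by auto
 have faith: "faithful_along \<eta> bq"
  unfolding faithful_along_def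
 proof (intro ballI allI impI)
  fix p \<eta>' assume p: "p : set bq" and "real_log_form \<eta>' & log_transform p \<eta> \<eta>'"
  hence t: "real_log_form \<eta>'" "log_transform p \<eta> \<eta>'" by auto
  have "log_den \<eta> ~= 0" unfolding num(2) using act pol_neq_0 by auto
  thus "one_faithful \<eta>'"
   by (rule one_faithful_transform[OF t(2) _ t(1)]) (unfold num, rule model_faithful[OF p])
 qed
 have ind: "csi (stf om []) S = csi th S" if S: "S : (%p. crv (f p)) ` (Si Un Sd)" for S
 proof -
  obtain p where p: "p : Si Un Sd" "S = crv (f p)" using S by blast
  obtain u where u: "is_unit u" "stf om [] = scl u om" using strict_form_Nil[OF ad_co(1)[OF ad]] .
  obtain U V where gpg: "gp (g p) U V" using sep_props(2)[OF p(1)] by blast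
  have inv: "f p dvd wdg om (f p)"
   using invariant_along[OF ad_co(1)[OF ad] sep_props(1)[OF p(1)] push[OF p(1)]] ad_sep(1)[OF ad p(1)] by simp
  have "csi (stf om []) S = csi om S"
   unfolding u(2) p(2) by (rule cs_index_scale[OF sep_branch(1)[OF p(1)] gp_pushes[OF sep_props(1)[OF p(1)] gpg push[OF p(1)]] ad_co(1)[OF ad] inv u(1)])
  thus ?thesis using model_index[OF ad w p(1)] p(2) by simp
 qed
 have tr: "centres (trip om) = bq" "dic (trip om) = dc" "sep_dic (trip om) = (%p. crv (f p)) ` Sd"
  "sep_iso (trip om) = (%p. crv (f p)) ` Si" "ind (trip om) 0 [] S = csi (stf om []) S" for S
  by (simp_all add: trip_def[OF ad])
 show ?thesis
  unfolding strict_log_model_def tr seps_trip[OF ad] using r poles fol dup faith ind by blast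
qed

end

lemma model_exists:
 assumes "adapted om" "!!p. p : Si ==> ws p = - 1 / csi (stf om p) (crv (g p))"
 shows "\<exists>\<eta>. strict_log_model \<eta> (trip om)"
proof -
 obtain h P Q where h: "h ~= 0" "fst L = h * P" "snd L = h * Q" "coprime P Q" using coprime_reduction[OF L_nonzero] .
 have "L = scl h (P, Q)" using h by (simp add: prod_eq_iff)
 from model_strict[OF h(1) this _ assms] h(4) show ?thesis by simp
qed

end

text \<open>A graph transverse to the only component at p is not exceptional, so it can be pushed
  down to the origin; this changes its equation by a unit.\<close>

lemma curve_at_final_point:
 assumes l: "lone p q e" "p ~= []" and g0: "graph e g0" "g0 dvd wdg th g0"
 obtains g f u where "is_unit u" "graph e (u * g)" "pushes p g f" "g dvd wdg th g" "crv g = crv g0"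
proof -
 note pr = graph_props[OF g0(1)]
 have "nonexc p g0"
  by (rule nonexc_comp[OF _ _ pr(1) l(2)]) (use lone_cases[OF l(1)] pr(4) in auto)
 then obtain v f where v: "is_unit v" "pushes p (v * g0) f" using pushes_exists[OF pr(1)] by blast
 obtain w where w: "w * v = 1" using v(1) by (metis dvdE mult.commute)
 have wu: "is_unit w" using w by (metis dvd_triv_left)
 have "w * (v * g0) = g0" using w by simp
 hence gr: "graph e (w * (v * g0))" using g0(1) by metis
 have "v * g0 dvd wdg th (v * g0)" using g0(2) wedge_unit_dvd[OF v(1)] by metis
 thus ?thesis by (rule that[OF wu gr v(2) _ curve_of_unit[OF v(1)]])
qed

theorem theorem4:
 fixes \<omega> :: form
 assumes "foliation \<omega>"
  and "real_generalized_curve \<omega>"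
 shows "\<exists>\<eta>. strict_log_model_of_foliation \<eta> \<omega>"
proof -
 obtain bq where red: "real_reduction \<omega> bq" and nsn: "!!p. p : divisor bq ==> ~ saddle_node (stf \<omega> p)"
  using assms(2) unfolding real_generalized_curve_def by blast
 have bs: "blowup_seq bq" and rd: "reduces \<omega> bq" using red by (auto simp: real_reduction_def minimal_seq_def)
 have co: "coprime (fst \<omega>) (snd \<omega>)" using assms(1) by (simp add: foliation_def)
 define st where "st p = stf \<omega> p" for p
 have cs: "coprime (fst (st p)) (snd (st p))" for p unfolding st_def by (rule strict_form_props(1)[OF co])
 define dc where "dc = noninvariant_components \<omega> bq"
 have dcN: "dc \<subseteq> set bq" by (auto simp: dc_def noninvariant_components_def)
 have nm: "no_two_meet bq dc" using rd by (simp add: reduces_def dc_def)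
 have tr: "gc (wdg (st p) e) 0 0 ~= 0" if "p : divisor bq" "cpt q p e" "q : dc" for p q e
  using rd that unfolding reduces_def dc_def st_def by blast
 have inv: "e dvd wdg (st p) e" if "p : divisor bq" "cpt q p e" "q ~: dc" for p q e
 proof -
  have "q : set bq" using comp_centre[OF bs, of p q] that by (auto simp: component_at_iff)
  hence "invariant_curve (st p) (crv e)"
   using that unfolding dc_def noninvariant_components_def invariant_component_def st_def by blast
  thus ?thesis by (simp add: invariant_curve_iff)
 qed
 have simple: "smp (st p)" if "p : divisor bq" "sng (st p)" for p
  using rd that unfolding reduces_def st_def by blast
 have regular: "~ sng (st p)" if "p : divisor bq" "cpt q p e" "q : dc" for p q e
  using tr[OF that] by (auto simp: singular_form_def wedge_d_def)
 have p0: "p ~= []" if "p : divisor bq" for p using that divisor_iff[OF bs] by auto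
 define AA where "AA q = {c. q @ [Sl c] : set bq \<or> corner (q @ [Sl c])}" for q
 have fA: "finite (AA q)" for q
 proof -
  have "finite ((%c. q @ [Sl c]) -` set bq)" by (rule finite_vimageI) (auto simp: inj_on_def)
  hence "finite (insert 0 ((%c. q @ [Sl c]) -` set bq))" by simp
  thus ?thesis by (rule finite_subset[rotated]) (auto simp: AA_def corner_def split: if_splits)
 qed
 have "\<exists>B. finite B & card B = Suc (card (AA q)) & AA q \<inter> B = {} &
   (\<forall>c. c ~: AA q --> c ~: B --> (\<Sum>a\<in>AA q. 1 / (c - a)) - (\<Sum>b\<in>B. 1 / (c - b)) ~= 0)" for q
  by (rule interlace[OF fA[of q]]) blast
 then obtain B where B: "!!q. finite (B q) & card (B q) = Suc (card (AA q)) & AA q \<inter> B q = {} &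
   (\<forall>c. c ~: AA q --> c ~: B q --> (\<Sum>a\<in>AA q. 1 / (c - a)) - (\<Sum>b\<in>B q. 1 / (c - b)) ~= 0)" by metis
 \<comment> \<open>Corners are excluded: at a singular corner both components are invariant, and
   they are the only invariant curves.\<close>
 define Si where "Si = {p \<in> divisor bq. sng (st p) & ~ corner p}"
 define Sd where "Sd = {q @ [Sl b] |q b. q : dc & b : B q} Un
   {q @ [Vt] |q. q : dc & q @ [Vt] ~: set bq & ~ corner (q @ [Vt])}"
 have Sd: "p : divisor bq & ~ corner p & (\<exists>q d. p = q @ [d] & q : dc)" if "p : Sd" for p
  using that dcN B by (auto simp: Sd_def AA_def divisor_iff[OF bs])
 have finS: "finite Si" "finite Sd"
 proof -
  show "finite Si" using rd by (rule_tac finite_subset[of _ "{p \<in> divisor bq. sng (stf \<omega> p)}"]) (auto simp: Si_def st_def reduces_def)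
  have "finite dc" using dcN finite_subset by blast
  hence "finite ((\<Union>q\<in>dc. (%b. q @ [Sl b]) ` B q) Un (%q. q @ [Vt]) ` dc)" using B by auto
  thus "finite Sd" by (rule finite_subset[rotated]) (auto simp: Sd_def)
 qed
 have SS: "p : divisor bq & (\<exists>q e. lone p q e & (q : dc <-> p : Sd))" if p: "p : Si Un Sd" for p
 proof -
  have d: "p : divisor bq" "~ corner p" using p Sd by (auto simp: Si_def)
  obtain q e where l: "lone p q e" using lone_or_corner[OF p0[OF d(1)]] d(2) by blast
  have "q : dc" if "p : Sd"
  proof -
   obtain q' d' where "p = q' @ [d']" "q' : dc" using Sd[OF \<open>p : Sd\<close>] by blast
   thus ?thesis using lone_snoc[of q' d' q e] l by simp
  qed
  moreover have "q ~: dc" if "p ~: Sd"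
  proof -
   have "sng (st p)" using p that by (auto simp: Si_def)
   thus ?thesis using regular[OF d(1), of q e] l by (auto simp: lone_def)
  qed
  ultimately show ?thesis using d(1) l by blast
 qed
 have disj: "Si \<inter> Sd = {}"
 proof (rule ccontr)
  assume "Si \<inter> Sd ~= {}"
  then obtain p where p: "p : Si" "p : Sd" by blast
  then obtain q e where "lone p q e" "q : dc" using SS[of p] by blast
  thus False using regular[of p q e] p(1) by (auto simp: Si_def lone_def)
 qed
 have "\<forall>p\<in>Si Un Sd. \<exists>t. (\<exists>q e u. lone p q e & (q : dc <-> p : Sd) & is_unit u & graph e (u * fst t)) &
   pushes p (fst t) (snd t) & fst t dvd wdg (st p) (fst t) &
   (p : Si --> csi (st p) (crv (fst t)) ~= 0 & ~ pos_rat (csi (st p) (crv (fst t))))"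
 proof
  fix p assume p: "p : Si Un Sd"
  obtain q e where l: "lone p q e" "q : dc <-> p : Sd" and d: "p : divisor bq" using SS[OF p] by blast
  have c: "cpt q p e" using l(1) by (simp add: lone_def)
  obtain g0 where g0: "graph e g0" "g0 dvd wdg (st p) g0"
   "p : Si --> csi (st p) (crv g0) ~= 0 & ~ pos_rat (csi (st p) (crv g0))"
  proof (cases "p : Si")
   case True
   hence s: "sng (st p)" and nd: "q ~: dc" using l(2) disj by (auto simp: Si_def)
   show ?thesis
    using simple_structure[OF cs simple[OF d s] nsn[OF d, folded st_def] component_XY[OF c] inv[OF d c nd]] that by blast
  next
   case False
   hence "q : dc" using l(2) p by blast
   thus ?thesis using leaf_structure[OF cs component_XY[OF c] tr[OF d c]] that False by blast
  qed
  obtain g f u where "is_unit u" "graph e (u * g)" "pushes p g f" "g dvd wdg (st p) g" "crv g = crv g0"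
   using curve_at_final_point[OF l(1) p0[OF d] g0(1,2)] .
  thus "\<exists>t. (\<exists>q e u. lone p q e & (q : dc <-> p : Sd) & is_unit u & graph e (u * fst t)) &
   pushes p (fst t) (snd t) & fst t dvd wdg (st p) (fst t) &
   (p : Si --> csi (st p) (crv (fst t)) ~= 0 & ~ pos_rat (csi (st p) (crv (fst t))))"
   using l g0(3) by (intro exI[of _ "(g, f)"]) auto
 qed
 from bchoice[OF this] obtain t where t: "\<forall>p\<in>Si Un Sd. (\<exists>q e u. lone p q e & (q : dc <-> p : Sd) & is_unit u & graph e (u * fst (t p))) &
   pushes p (fst (t p)) (snd (t p)) & fst (t p) dvd wdg (st p) (fst (t p)) &
   (p : Si --> csi (st p) (crv (fst (t p))) ~= 0 & ~ pos_rat (csi (st p) (crv (fst (t p)))))" ..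
 define g f where "g p = fst (t p)" and "f p = snd (t p)" for p
 have gf: "\<exists>q e u. lone p q e & (q : dc <-> p : Sd) & is_unit u & graph e (u * g p)" "pushes p (g p) (f p)"
  "g p dvd wdg (st p) (g p)" if "p : Si Un Sd" for p
  using bspec[OF t that] unfolding g_def f_def by auto
 have ci: "csi (st p) (crv (g p)) ~= 0" "~ pos_rat (csi (st p) (crv (g p)))" if p: "p : Si" for p
 proof -
  have "p : Si Un Sd" using p by simp
  from bspec[OF t this] p show "csi (st p) (crv (g p)) ~= 0" "~ pos_rat (csi (st p) (crv (g p)))"
   unfolding g_def by auto
 qed
 define ws where "ws p = (if p : Sd then if last p = Vt then 1 else - 1 else - 1 / csi (st p) (crv (g p)))" for p
 have ws: "ws p = - 1 / csi (stf \<omega> p) (crv (g p))" if "p : Si" for p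
  using that disj by (auto simp: ws_def st_def)
 interpret model bq dc Si Sd g f B ws
 proof unfold_locales
  show "blowup_seq bq" "dc \<subseteq> set bq" "no_two_meet bq dc" "finite Si" "finite Sd" "Si \<inter> Sd = {}" by fact+
  show "p : divisor bq" if "p : Si Un Sd" for p using SS[OF that] by blast
  show "\<exists>q e u. lone p q e & (q : dc <-> p : Sd) & is_unit u & graph e (u * g p)" "pushes p (g p) (f p)"
   if "p : Si Un Sd" for p by (fact gf[OF that])+
  show "ws p ~= 0 & ~ pos_rat (- 1 / ws p)" if "p : Si" for p
   using ws[OF that] ci[OF that] by (simp add: st_def)
  show "ws p = (if last p = Vt then 1 else - 1)" if "p : Sd" for p using that by (simp add: ws_def)
 qed (use B in \<open>simp_all add: AA_def Sd_def\<close>)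
 \<comment> \<open>The given foliation is itself adapted to these data, so its triplet
   \<open>trip\<close> is associated with it, and the model is compared with it as a second adapted
   form.\<close>
 have ad: "adapted \<omega>"
  unfolding adapted_def st_def[symmetric]
 proof (intro conjI ballI allI impI co)
  fix p assume p: "p : divisor bq"
  { fix q e assume c: "cpt q p e"
   show "q ~: dc ==> e dvd wdg (st p) e" "q : dc ==> gc (wdg (st p) e) 0 0 ~= 0"
    by (rule inv[OF p c] tr[OF p c]; assumption)+ }
  assume s: "sng (st p)"
  show "smp (st p)" "~ saddle_node (st p)" "corner p \<or> p : Si"
   using simple[OF p s] nsn[OF p] s p by (auto simp: st_def Si_def)
 qed (use gf(3) in \<open>auto simp: Si_def\<close>)
 obtain \<eta> where "strict_log_model \<eta> (trip \<omega>)" using model_exists[OF ad ws] by blast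
 thus ?thesis
  unfolding strict_log_model_of_foliation_def using trip_associated[OF ad red] by blast
qed

end
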